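(* Let $\Omega\subset\mathbb{R}^n$ be a bounded smooth domain, $\sigma>1$, $f$ satisfying (F1)–(F8), and let $\Sigma=\{(x,u(x)):x\in\Omega\}$ be a smooth strictly locally convex spacelike graph in $\mathcal{H}^{n+1}$ ($u$ smooth up to $\partial\Omega$) satisfying $f(\kappa[\Sigma])=\sigma$. Then, with $\nu^{n+1}=1/\sqrt{1-|Du|^2}$, $$F^{ij}\nabla_{ij}\frac{\sigma-\nu^{n+1}}{u}=\frac{\sigma}{u}\Big(1-\sum f_i\Big)+\frac{\nu^{n+1}}{u}\Big(\sigma^2-\sum f_i\kappa_i^2\Big)\le0,$$ and consequently $\frac{\sigma-\nu^{n+1}}{u}\ge\inf_{\partial\Sigma}\frac{\sigma-\nu^{n+1}}{u}$ on $\Sigma$. Moreover, if $u=\epsilon>0$ on $\partial\Omega$, there exists $\epsilon_0>0$ depending only on $\partial\Omega$ such that for all $\epsilon\le\epsilon_0$, $$\frac{r_1\sqrt{\sigma^2-1}}{r_1^2-\epsilon^2}+\frac{\epsilon(\sigma-1)}{r_1^2-\epsilon^2}>\frac{\sigma-\nu^{n+1}}{u}>-\frac{r_2\sqrt{\sigma^2-1}}{r_2^2-\epsilon^2}-\frac{\epsilon(1+\sigma)}{r_2^2-\epsilon^2}\quad\text{on }\partial\Sigma,$$ where $r_1$ and $r_2$ are the maximal radii of interior and exterior spheres to $\partial\Omega$ (if $r_2=\infty$ the lower bound is read as its limit $0$). In particular $\nu^{n+1}\to\sigma$ on $\partial\Sigma$ as $\epsilon\to0$.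
   Context: $\mathcal{H}^{n+1}=\{(x,x_{n+1}):x_{n+1}>0\}$ with Lorentz metric $x_{n+1}^{-2}(dx^2-dx_{n+1}^2)$. $\partial\Sigma=\{(x,u(x)):x\in\partial\Omega\}$. The unit normal is upward: de Sitter normal $\mathbf n=u(Du,1)/\sqrt{1-|Du|^2}$, Minkowski normal $\nu=\mathbf n/u$, $\nu^{n+1}$ its last component. $\nabla$ is the Levi-Civita connection of the induced de Sitter metric $g$, computed in a local $g$-orthonormal frame; $\kappa$ are the eigenvalues of $A[\Sigma]=\{g^{ik}h_{kj}\}$ with $h_{ij}$ the de Sitter second fundamental form; $F(A)=f(\lambda(A))$, $F^{ij}=\partial F/\partial a_{ij}(A[\Sigma])$, $f_i=\partial f/\partial\lambda_i(\kappa)$. $K=K_n^+=\{\lambda_i>0\}$; conditions: (F1) $f$ symmetric; (F2) $f_i>0$; (F3) concave; (F4) $(f(1/\lambda_1,\dots,1/\lambda_n))^{-1}$ concave; (F5) $f>0$ in $K$, $f=0$ on $\partial K$; (F6) $f(1,\dots,1)=1$; (F7) homogeneous of degree one; (F8) $\lim_{R\to\infty}f(\lambda_1,\dots,\lambda_n+R)\ge1+\varepsilon_0$ uniformly on $B_{\delta_0}(1,\dots,1)$ for some $\varepsilon_0,\delta_0>0$. *)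

theory Defs
  imports "HOL-Analysis.Analysis"
begin

definition pd :: "'n::finite \<Rightarrow> (real^'n \<Rightarrow> real) \<Rightarrow> real^'n \<Rightarrow> real" where
  "pd i \<phi> x = deriv (\<lambda>t. \<phi> (x + t *\<^sub>R axis i 1)) 0"

fun pds :: "'n::finite list \<Rightarrow> (real^'n \<Rightarrow> real) \<Rightarrow> real^'n \<Rightarrow> real" where
  "pds [] \<phi> = \<phi>"
| "pds (i # is) \<phi> = pd i (pds is \<phi>)"

definition smooth_on :: "(real^'n::finite) set \<Rightarrow> (real^'n \<Rightarrow> real) \<Rightarrow> bool" where
  "smooth_on U \<phi> \<longleftrightarrow> open U \<and> (\<forall>is. pds is \<phi> differentiable_on U)"

definition smooth_domain :: "(real^'n::finite) set \<Rightarrow> bool" where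
  "smooth_domain \<Omega> \<longleftrightarrow> bounded \<Omega> \<and> open \<Omega> \<and> connected \<Omega> \<and> \<Omega> \<noteq> {} \<and>
     (\<forall>p\<in>frontier \<Omega>. \<exists>U \<psi>. p \<in> U \<and> smooth_on U \<psi> \<and>
        (\<forall>x\<in>U. \<exists>i. pd i \<psi> x \<noteq> 0) \<and> \<Omega> \<inter> U = {x\<in>U. \<psi> x < 0})"

definition int_sphere_radii :: "(real^'n::finite) set \<Rightarrow> real set" where
  "int_sphere_radii \<Omega> = {r. r > 0 \<and> (\<forall>p\<in>frontier \<Omega>. \<exists>c. ball c r \<subseteq> \<Omega> \<and> p \<in> frontier (ball c r))}"

definition ext_sphere_radii :: "(real^'n::finite) set \<Rightarrow> real set" where
  "ext_sphere_radii \<Omega> = {r. r > 0 \<and> (\<forall>p\<in>frontier \<Omega>. \<exists>c. ball c r \<inter> \<Omega> = {} \<and> p \<in> frontier (ball c r))}"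

definition posK :: "(real^'n::finite) set" where
  "posK = {q. \<forall>i. q$i > 0}"

definition onevec :: "real^'n::finite" where
  "onevec = (\<chi> i. 1)"

definition f_conditions :: "(real^'n::finite \<Rightarrow> real) \<Rightarrow> bool" where
  "f_conditions f \<longleftrightarrow>
     smooth_on posK f \<and>
     \<comment> \<open>(F1) symmetric\<close>
     (\<forall>p q. p permutes (UNIV::'n set) \<longrightarrow> q \<in> posK \<longrightarrow> f (\<chi> i. q$(p i)) = f q) \<and>
     \<comment> \<open>(F2) f_i > 0\<close>
     (\<forall>q\<in>posK. \<forall>i. pd i f q > 0) \<and>
     \<comment> \<open>(F3) concave\<close>
     concave_on posK f \<and>
     \<comment> \<open>(F4) (f(1/lambda))^{-1} concave\<close>
     concave_on posK (\<lambda>q. 1 / f (\<chi> i. 1 / q$i)) \<and>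
     \<comment> \<open>(F5) f > 0 in K, f = 0 on the boundary of K (f continuous up to the boundary)\<close>
     (\<forall>q\<in>posK. f q > 0) \<and> continuous_on (closure posK) f \<and>
     (\<forall>q\<in>frontier posK. f q = 0) \<and>
     \<comment> \<open>(F6)\<close>
     f onevec = 1 \<and>
     \<comment> \<open>(F7) homogeneous of degree one\<close>
     (\<forall>q\<in>posK. \<forall>t>0. f (t *\<^sub>R q) = t * f q) \<and>
     \<comment> \<open>(F8) lim_{R\<rightarrow>\<infinity>} f(\<lambda>_1,..,\<lambda>_n + R) \<ge> 1 + e0 uniformly on B_d0(1,..,1)\<close>
     (\<exists>e0>0. \<exists>d0>0. \<exists>k. \<forall>\<eta>>0. \<exists>R0. \<forall>R\<ge>R0. \<forall>q\<in>ball onevec d0.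
         f (q + R *\<^sub>R axis k 1) \<ge> 1 + e0 - \<eta>)"

definition diagm :: "real^'n::finite \<Rightarrow> real^'n^'n" where
  "diagm \<kappa> = (\<chi> i j. if i = j then \<kappa>$i else 0)"

definition eigvals :: "real^'n^'n::finite \<Rightarrow> real^'n \<Rightarrow> bool" where
  "eigvals M \<kappa> \<longleftrightarrow> (\<exists>P. invertible P \<and> M ** P = P ** diagm \<kappa>)"

definition eigs :: "real^'n^'n::finite \<Rightarrow> real^'n" where
  "eigs M = (SOME \<kappa>. eigvals M \<kappa>)"

definition Fmat :: "(real^'n::finite \<Rightarrow> real) \<Rightarrow> real^'n^'n \<Rightarrow> real" where
  "Fmat f M = f (eigs M)"

section \<open>Geometry of the graph x_{n+1} = u(x) in de Sitter space (upper half-space model)\<close>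

definition Du :: "(real^'n::finite \<Rightarrow> real) \<Rightarrow> real^'n \<Rightarrow> real^'n" where
  "Du u x = (\<chi> i. pd i u x)"

definition D2u :: "(real^'n::finite \<Rightarrow> real) \<Rightarrow> real^'n \<Rightarrow> real^'n^'n" where
  "D2u u x = (\<chi> i j. pd i (pd j u) x)"

definition wfun :: "(real^'n::finite \<Rightarrow> real) \<Rightarrow> real^'n \<Rightarrow> real" where
  "wfun u x = sqrt (1 - (norm (Du u x))\<^sup>2)"

text \<open>nu^{n+1}: last component of the (upward) Minkowski unit normal.\<close>
definition nu_last :: "(real^'n::finite \<Rightarrow> real) \<Rightarrow> real^'n \<Rightarrow> real" where
  "nu_last u x = 1 / wfun u x"

text \<open>Induced Minkowski metric delta_ij - u_i u_j.\<close>
definition gM :: "(real^'n::finite \<Rightarrow> real) \<Rightarrow> real^'n \<Rightarrow> real^'n^'n" where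
  "gM u x = (\<chi> i j. (if i = j then 1 else 0) - pd i u x * pd j u x)"

text \<open>Induced de Sitter metric g_ij = (delta_ij - u_i u_j)/u^2.\<close>
definition gdS :: "(real^'n::finite \<Rightarrow> real) \<Rightarrow> real^'n \<Rightarrow> real^'n^'n" where
  "gdS u x = (1 / (u x)\<^sup>2) *\<^sub>R gM u x"

text \<open>de Sitter second fundamental form w.r.t. the upward normal n = u (Du,1)/w,
  obtained from the conformal change of the Minkowski metric; sign convention
  such that the slices x_{n+1} = const have principal curvatures 1:
  h_ij = nu^{n+1} g^M_ij / u^2 - u_ij / (u w), i.e. kappa_i = nu^{n+1} - u kappa^M_i.\<close>
definition hdS :: "(real^'n::finite \<Rightarrow> real) \<Rightarrow> real^'n \<Rightarrow> real^'n^'n" where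
  "hdS u x = (nu_last u x / (u x)\<^sup>2) *\<^sub>R gM u x - (1 / (u x * wfun u x)) *\<^sub>R D2u u x"

definition Amat :: "(real^'n::finite \<Rightarrow> real) \<Rightarrow> real^'n \<Rightarrow> real^'n^'n" where
  "Amat u x = matrix_inv (gdS u x) ** hdS u x"

definition kappa :: "(real^'n::finite \<Rightarrow> real) \<Rightarrow> real^'n \<Rightarrow> real^'n" where
  "kappa u x = eigs (Amat u x)"

definition Gam :: "(real^'n::finite \<Rightarrow> real) \<Rightarrow> 'n \<Rightarrow> 'n \<Rightarrow> 'n \<Rightarrow> real^'n \<Rightarrow> real" where
  "Gam u k i j x = (1/2) * (\<Sum>l\<in>UNIV. matrix_inv (gdS u x) $ k $ l *
      (pd i (\<lambda>y. gdS u y $ j $ l) x + pd j (\<lambda>y. gdS u y $ i $ l) x - pd l (\<lambda>y. gdS u y $ i $ j) x))"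

definition covHess :: "(real^'n::finite \<Rightarrow> real) \<Rightarrow> (real^'n \<Rightarrow> real) \<Rightarrow> real^'n \<Rightarrow> real^'n^'n" where
  "covHess u \<phi> x = (\<chi> i j. pd i (pd j \<phi>) x - (\<Sum>k\<in>UNIV. Gam u k i j x * pd k \<phi> x))"

text \<open>F^{ij} nabla_ij phi: derivative of F at A[Sigma] in the direction of the
  Hessian endomorphism g^{-1} nabla^2 phi (independent of the frame).\<close>
definition Fop :: "(real^'n::finite \<Rightarrow> real) \<Rightarrow> (real^'n \<Rightarrow> real) \<Rightarrow> (real^'n \<Rightarrow> real) \<Rightarrow> real^'n \<Rightarrow> real" where
  "Fop f u \<phi> x = deriv (\<lambda>t. Fmat f (Amat u x + t *\<^sub>R (matrix_inv (gdS u x) ** covHess u \<phi> x))) 0"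

definition admissible_graph ::
  "(real^'n::finite) set \<Rightarrow> real \<Rightarrow> (real^'n \<Rightarrow> real) \<Rightarrow> (real^'n \<Rightarrow> real) \<Rightarrow> bool" where
  "admissible_graph \<Omega> \<sigma> f u \<longleftrightarrow>
     (\<exists>U. closure \<Omega> \<subseteq> U \<and> smooth_on U u) \<and>
     (\<forall>x\<in>closure \<Omega>. u x > 0) \<and>
     (\<forall>x\<in>closure \<Omega>. norm (Du u x) < 1) \<and>
     (\<forall>x\<in>\<Omega>. kappa u x \<in> posK) \<and>
     (\<forall>x\<in>\<Omega>. f (kappa u x) = \<sigma>)"

end

theory Submission
  imports Defs
begin

text \<open>
  The curvatures \<open>\<kappa>\<close> are the eigenvalues of the pair \<open>(h, g)\<close>. Perturbing such a pair changes \<open>f(\<kappa>)\<close> to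
  first order by \<open>\<Sum> f\<^sub>i\<close> times the diagonal entries in an eigenframe, even at multiple eigenvalues, because
  \<open>f\<close> is symmetric. Differentiating \<open>f(\<kappa>) = \<sigma>\<close> along \<open>p = Du\<close> therefore yields exactly the third-order
  term of \<open>F\<^sup>i\<^sup>j \<nabla>\<^sub>i\<^sub>j ((\<sigma> - \<nu>) / u)\<close>, and what remains is an algebraic identity in each principal direction.
  Concavity of \<open>f\<close> gives \<open>\<Sum> f\<^sub>i \<ge> 1\<close>, concavity of \<open>1 / f(1/\<lambda>)\<close> gives \<open>\<Sum> f\<^sub>i \<kappa>\<^sub>i\<^sup>2 \<ge> \<sigma>\<^sup>2\<close>, and the minimum
  principle applies.

  At the boundary the graph is compared with umbilic hyperboloids meeting the level \<open>\<epsilon>\<close> in an interior or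
  exterior touching sphere: an interior cap of curvature \<open>\<sigma>\<close>, and a homothetic family of exterior hyperboloids
  of curvature slightly above \<open>\<sigma>\<close>. The resulting bounds involve \<open>sqrt ((\<sigma>\<^sup>2 - 1) r\<^sup>2 + \<epsilon>\<^sup>2)\<close>, which lies strictly
  between \<open>r sqrt (\<sigma>\<^sup>2 - 1)\<close> and \<open>r sqrt (\<sigma>\<^sup>2 - 1) + \<epsilon>\<close>; hence the strict inequalities. If \<open>r\<^sub>2 = \<infinity>\<close>,
  tilted planes replace the exterior hyperboloids, and strictness comes from the Hopf lemma.
\<close>

section \<open>Simultaneous diagonalization\<close>

text \<open>\<open>eigs\<close> picks an arbitrary eigenvalue vector, so no continuous ordering of
  the eigenvalues is at hand, let alone a derivative. \<open>Fmat\<close> is therefore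
  differentiated through diagonalizing matrices that merely stay bounded, and eigenvalues are
  matched across a perturbation by a large term of a determinant. Eigenframes, too, are chosen point
  by point; hence the elliptic theory works with bounds on the coefficients. These hold up to the
  boundary since u is smooth there and the level set f = \<sigma> stays away from the boundary of
  the cone.

  The interior and exterior barriers differ because contact yields inequalities in one direction. A
  minimum of u plus a hyperboloid gets a lower bound, which is the estimate sought. A maximum of u
  minus a hyperboloid gets a lower bound as well, which is no help for an upper estimate. So the
  exterior barriers sweep through homotheties, isometries of the half-space model that preserve the
  curvature a, and an interior first contact contradicts a > \<sigma>.\<close>

lemma matrix_inv_mult:
  assumes "invertible A"
  shows "A ** matrix_inv A = mat 1" "matrix_inv A ** A = mat 1"
proof -
  have "A ** matrix_inv A = mat 1 \<and> matrix_inv A ** A = mat 1"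
    using assms unfolding invertible_def matrix_inv_def by (rule someI_ex)
  then show "A ** matrix_inv A = mat 1" "matrix_inv A ** A = mat 1" by auto
qed

text \<open>Some term of the Leibniz expansion of the determinant of the transition matrix is nonzero.\<close>
lemma eigvals_unique:
  assumes "eigvals M \<kappa>" "eigvals M \<rho>"
  obtains p where "p permutes (UNIV :: 'n::finite set)" "\<rho> = (\<chi> i. \<kappa> $ p i)"
proof -
  obtain P Q where P: "invertible P" "M ** P = P ** diagm \<kappa>" and Q: "invertible Q" "M ** Q = Q ** diagm \<rho>"
    using assms by (auto simp: eigvals_def)
  define T where "T = matrix_inv Q ** P"
  have QI: "matrix_inv Q ** Q = mat 1" "Q ** matrix_inv Q = mat 1"
    using Q(1) by (simp_all add: matrix_inv_mult)
  have "invertible T" unfolding T_def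
    using P Q by (metis QI invertible_def invertible_mult)
  have "matrix_inv Q ** M = diagm \<rho> ** matrix_inv Q"
  proof -
    have "matrix_inv Q ** (M ** Q) ** matrix_inv Q = matrix_inv Q ** (Q ** diagm \<rho>) ** matrix_inv Q"
      using Q by simp
    then show ?thesis
      by (metis QI matrix_mul_assoc matrix_mul_lid matrix_mul_rid)
  qed
  then have T: "diagm \<rho> ** T = T ** diagm \<kappa>"
    unfolding T_def using P(2) by (metis matrix_mul_assoc)
  \<comment> \<open>T intertwines the two diagonal matrices, so a nonzero entry forces the two
    eigenvalues it links to agree.\<close>
  have entry: "\<rho> $ i * T $ i $ j = T $ i $ j * \<kappa> $ j" for i j
  proof -
    have "(diagm \<rho> ** T) $ i $ j = (T ** diagm \<kappa>) $ i $ j" using T by simp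
    then show ?thesis
      by (simp add: matrix_matrix_mult_def diagm_def if_distrib[where f="\<lambda>x. _ * x"] if_distrib[where f="\<lambda>x. x * _"] cong: if_cong)
  qed
  have "det T \<noteq> 0" using \<open>invertible T\<close> invertible_det_nz by blast
  then obtain p where p: "p permutes UNIV" "(\<Prod>i\<in>UNIV. T $ i $ p i) \<noteq> 0"
    unfolding det_def by (metis (mono_tags, lifting) mem_Collect_eq mult_zero_right sum.neutral)
  then have "T $ i $ p i \<noteq> 0" for i by simp
  with entry[of _ "p _"] have "\<rho> $ i = \<kappa> $ p i" for i
    by (metis mult.commute mult_cancel_left)
  then show ?thesis using that[OF p(1)] by (simp add: vec_eq_iff)
qed

text \<open>Whatever vector \<open>eigs\<close> selects, it differs from \<kappa> by a permutation,
  which the symmetry of f absorbs.\<close>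

lemma Fmat_eq:
  fixes f :: "real^'n::finite \<Rightarrow> real"
  assumes sym: "\<forall>p q. p permutes (UNIV::'n set) \<longrightarrow> q \<in> posK \<longrightarrow> f (\<chi> i. q$(p i)) = f q"
    and "eigvals M \<kappa>" "\<kappa> \<in> posK"
  shows "Fmat f M = f \<kappa>"
proof -
  have "eigvals M (eigs M)" unfolding eigs_def using assms(2) by (rule someI)
  then obtain p where "p permutes UNIV" "eigs M = (\<chi> i. \<kappa> $ p i)"
    using eigvals_unique assms(2) by blast
  then show ?thesis unfolding Fmat_def using sym assms(3) by simp
qed

lemma inner_symmetric_matrix:
  fixes S :: "real^'n::finite^'n"
  assumes "transpose S = S"
  shows "x \<bullet> (S *v y) = (S *v x) \<bullet> y"
  using assms by (metis dot_lmul_matrix transpose_matrix_vector)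

text \<open>A linear term dominated by a quadratic one near t = 0 has to vanish: the Lagrange
  condition at the maximizer in the diagonalization below.\<close>

lemma quadratic_form_le_imp_critical:
  fixes b c :: real
  assumes "\<And>t. 2 * t * b \<le> t\<^sup>2 * c"
  shows "b = 0"
proof (rule ccontr)
  assume "b \<noteq> 0"
  define k where "k = \<bar>c\<bar> + 1"
  have k: "k > 0" "c \<le> k" by (auto simp: k_def)
  have "2 * (b / k) * b \<le> (b / k)\<^sup>2 * c" using assms by blast
  also have "\<dots> \<le> (b/k)\<^sup>2 * k" using k by (intro mult_left_mono) auto
  also have "\<dots> = b\<^sup>2 / k" using k by (simp add: power2_eq_square)
  finally have "2 * b\<^sup>2 / k \<le> b\<^sup>2 / k" by (simp add: power2_eq_square)
  moreover have "b\<^sup>2 / k > 0" using k \<open>b \<noteq> 0\<close> by simp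
  ultimately show False by simp
qed

text \<open>The spectral theorem for a pair of quadratic forms: extend a maximal \<open>g\<close>-orthonormal set of
  eigenvectors by a maximizer of \<open>h\<close> on the \<open>g\<close>-unit sphere of its \<open>g\<close>-orthogonal complement.\<close>
lemma simultaneous_diagonalization:
  fixes g h :: "real^'n::finite^'n"
  assumes g: "transpose g = g" and h: "transpose h = h"
    and pd: "\<And>x. x \<noteq> 0 \<Longrightarrow> x \<bullet> (g *v x) > 0"
  obtains P :: "'n \<Rightarrow> real^'n" and \<kappa> where
    "\<And>a b. P a \<bullet> (g *v P b) = (if a = b then 1 else 0)"
    "\<And>a. h *v P a = \<kappa> $ a *\<^sub>R (g *v P a)"
proof -
  define eig where "eig v \<longleftrightarrow> (\<exists>\<mu>. h *v v = \<mu> *\<^sub>R (g *v v))" for v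
  define ON where "ON E \<longleftrightarrow> (\<forall>v\<in>E. \<forall>w\<in>E. v \<bullet> (g *v w) = (if v = w then 1 else 0)) \<and> (\<forall>v\<in>E. eig v)" for E
  note gs = inner_symmetric_matrix[OF g] and hs = inner_symmetric_matrix[OF h]
  have gcom: "x \<bullet> (g *v y) = y \<bullet> (g *v x)" for x y by (metis gs inner_commute)
  have indep: "independent E" if "ON E" for E
    unfolding independent_explicit_module
  proof (intro allI impI)
    fix T u v assume *: "finite T" "T \<subseteq> E" "(\<Sum>v\<in>T. u v *\<^sub>R v) = 0" "v \<in> T"
    have vg: "w \<bullet> (g *v v) = (if w = v then 1 else 0)" if "w \<in> T" for w
      using * \<open>ON E\<close> that unfolding ON_def by blast
    have "0 = (\<Sum>w\<in>T. u w *\<^sub>R w) \<bullet> (g *v v)" using * by simp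
    also have "\<dots> = (\<Sum>w\<in>T. u w * (if w = v then 1 else 0))"
      unfolding inner_sum_left using vg by (intro sum.cong) auto
    also have "\<dots> = u v" using * by (simp add: if_distrib[where f="\<lambda>x. _ * x"] cong: if_cong)
    finally show "u v = 0" by simp
  qed
  have bound: "finite E \<and> card E \<le> CARD('n)" if "ON E" for E
    using independent_bound[OF indep[OF that]] by simp
  have "ON {}" by (simp add: ON_def)
  then obtain E where E: "ON E" and max: "\<And>E'. ON E' \<Longrightarrow> card E' \<le> card E"
    using ex_has_greatest_nat[of ON "{}" card "Suc (CARD('n))"] bound by (metis less_Suc_eq_le)
  have fin: "finite E" using bound E by blast
  define W where "W = {y. \<forall>v\<in>E. y \<bullet> (g *v v) = 0}"
  define proj where "proj x = x - (\<Sum>v\<in>E. (x \<bullet> (g *v v)) *\<^sub>R v)" for x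
  have projW: "proj x \<in> W" for x
  proof -
    have "(\<Sum>v\<in>E. (x \<bullet> (g *v v)) *\<^sub>R v) \<bullet> (g *v w) = x \<bullet> (g *v w)" if "w \<in> E" for w
    proof -
      have "(\<Sum>v\<in>E. (x \<bullet> (g *v v)) *\<^sub>R v) \<bullet> (g *v w) = (\<Sum>v\<in>E. (x \<bullet> (g *v v)) * (if v = w then 1 else 0))"
        unfolding inner_sum_left using E that by (intro sum.cong) (auto simp: ON_def)
      also have "\<dots> = x \<bullet> (g *v w)" using that fin by (simp add: if_distrib[where f="\<lambda>x. _ * x"] cong: if_cong)
      finally show ?thesis .
    qed
    then show ?thesis by (simp add: W_def proj_def inner_diff_left)
  qed
  have "span E = UNIV"
  proof (rule ccontr)
    assume "span E \<noteq> UNIV"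
    then obtain x0 where x0: "x0 \<notin> span E" by auto
    have "(\<Sum>v\<in>E. (x0 \<bullet> (g *v v)) *\<^sub>R v) \<in> span E" by (intro span_sum span_scale span_base)
    then have nz: "proj x0 \<noteq> 0" using x0 by (auto simp: proj_def)
    \<comment> \<open>Coercivity of g, with c its minimum on the Euclidean unit sphere. It bounds
      the g-unit sphere and so makes S compact.\<close>
    obtain c where c: "c > 0" "\<And>x. c * (norm x)\<^sup>2 \<le> x \<bullet> (g *v x)"
    proof -
      have "continuous_on (sphere 0 1) (\<lambda>x. x \<bullet> (g *v x))"
        by (intro continuous_intros)
      moreover have "sphere (0::real^'n) 1 \<noteq> {}" by simp
      ultimately obtain m where m: "m \<in> sphere 0 1" "\<And>x. x \<in> sphere 0 1 \<Longrightarrow> m \<bullet> (g *v m) \<le> x \<bullet> (g *v x)"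
        using continuous_attains_inf[of "sphere 0 1" "\<lambda>x::real^'n. x \<bullet> (g *v x)"] compact_sphere by metis
      have "m \<noteq> 0" using m by auto
      then have "m \<bullet> (g *v m) > 0" by (rule pd)
      moreover have "(m \<bullet> (g *v m)) * (norm x)\<^sup>2 \<le> x \<bullet> (g *v x)" for x
      proof (cases "x = 0")
        case False
        have "m \<bullet> (g *v m) \<le> (x /\<^sub>R norm x) \<bullet> (g *v (x /\<^sub>R norm x))" using False by (intro m) auto
        also have "\<dots> = (x \<bullet> (g *v x)) / (norm x)\<^sup>2"
          by (simp add: matrix_vector_mult_scaleR power2_eq_square divide_inverse)
        finally show ?thesis using False by (simp add: field_simps)
      qed simp
      ultimately show ?thesis using that by blast
    qed
    define S where "S = W \<inter> {x. x \<bullet> (g *v x) = 1}"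
    have quad: "(t *\<^sub>R y) \<bullet> (M *v (t *\<^sub>R y)) = t\<^sup>2 * (y \<bullet> (M *v y))" for t y and M :: "real^'n^'n"
      by (simp add: matrix_vector_mult_scaleR power2_eq_square)
    have nrmS: "(1 / sqrt (y \<bullet> (g *v y))) *\<^sub>R y \<in> S" if "y \<in> W" "y \<noteq> 0" for y
      using that pd[OF that(2)] unfolding S_def mem_Collect_eq Int_iff quad
      by (simp add: W_def power_divide)
    have "closed S"
    proof -
      have "W = (\<Inter>v\<in>E. {y. y \<bullet> (g *v v) = 0})" by (auto simp: W_def)
      moreover have "closed {y. y \<bullet> (g *v v) = 0}" for v
        by (intro closed_Collect_eq continuous_intros)
      moreover have "closed {x. x \<bullet> (g *v x) = 1}"
        by (intro closed_Collect_eq continuous_intros)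
      ultimately show ?thesis unfolding S_def by auto
    qed
    moreover have "bounded S"
    proof -
      have "norm x \<le> sqrt (1 / c)" if "x \<in> S" for x
      proof -
        have "c * (norm x)\<^sup>2 \<le> 1" using c(2)[of x] that by (auto simp: S_def)
        then have "(norm x)\<^sup>2 \<le> 1 / c" using c(1) by (simp add: field_simps)
        then show ?thesis by (rule real_le_rsqrt)
      qed
      then show ?thesis unfolding bounded_iff by blast
    qed
    ultimately have "compact S" by (simp add: compact_eq_bounded_closed)
    moreover have "S \<noteq> {}" using nrmS[OF projW nz] by auto
    moreover have "continuous_on S (\<lambda>x. x \<bullet> (h *v x))"
      by (intro continuous_intros)
    ultimately obtain x where x: "x \<in> S" "\<And>y. y \<in> S \<Longrightarrow> y \<bullet> (h *v y) \<le> x \<bullet> (h *v x)"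
      using continuous_attains_sup[of S "\<lambda>x. x \<bullet> (h *v x)"] by metis
    define \<mu> where "\<mu> = x \<bullet> (h *v x)"
    have xg: "x \<bullet> (g *v x) = 1" "x \<in> W" using x by (auto simp: S_def)
    have le: "y \<bullet> (h *v y) \<le> \<mu> * (y \<bullet> (g *v y))" if "y \<in> W" for y
    proof (cases "y = 0")
      case False
      define q where "q = y \<bullet> (g *v y)"
      have q: "q > 0" using pd[OF False] by (simp add: q_def)
      from x(2)[OF nrmS[OF that False]] have "(y \<bullet> (h *v y)) / q \<le> \<mu>"
        using q unfolding quad by (simp add: power_divide \<mu>_def q_def[symmetric])
      then show ?thesis using q by (simp add: field_simps q_def)
    qed simp
    \<comment> \<open>Lagrange residual of the maximizer x. It is orthogonal to W by maximality and
      to E because E consists of eigenvectors; hence it vanishes, and x enlarges E.\<close>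
    define z where "z = h *v x - \<mu> *\<^sub>R (g *v x)"
    have zW: "z \<bullet> y = 0" if "y \<in> W" for y
    proof (rule quadratic_form_le_imp_critical[where c = "\<mu> * (y \<bullet> (g *v y)) - y \<bullet> (h *v y)"])
      fix t :: real
      have "x + t *\<^sub>R y \<in> W" using that xg by (auto simp: W_def inner_add_left)
      note le1 = le[OF this]
      have e1: "(x + t *\<^sub>R y) \<bullet> (h *v (x + t *\<^sub>R y)) = \<mu> + 2 * t * (y \<bullet> (h *v x)) + t\<^sup>2 * (y \<bullet> (h *v y))"
        using hs[of x y] by (simp add: inner_add_left inner_add_right matrix_vector_right_distrib
            matrix_vector_mult_scaleR \<mu>_def[symmetric] power2_eq_square inner_commute[of "h *v x"] algebra_simps)
      have e2: "(x + t *\<^sub>R y) \<bullet> (g *v (x + t *\<^sub>R y)) = 1 + 2 * t * (y \<bullet> (g *v x)) + t\<^sup>2 * (y \<bullet> (g *v y))"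
        using gcom[of x y] xg by (simp add: inner_add_left inner_add_right matrix_vector_right_distrib
            matrix_vector_mult_scaleR power2_eq_square algebra_simps)
      have e3: "z \<bullet> y = y \<bullet> (h *v x) - \<mu> * (y \<bullet> (g *v x))"
        unfolding z_def inner_diff_left inner_scaleR_left by (simp add: inner_commute)
      show "2 * t * (z \<bullet> y) \<le> t\<^sup>2 * (\<mu> * (y \<bullet> (g *v y)) - y \<bullet> (h *v y))"
        using le1 unfolding e1 e2 e3 by (simp add: algebra_simps)
    qed
    have zE: "z \<bullet> v = 0" if "v \<in> E" for v
    proof -
      have "eig v" using E that unfolding ON_def by blast
      then obtain m where m: "h *v v = m *\<^sub>R (g *v v)" unfolding eig_def ..
      have "x \<bullet> (g *v v) = 0" using xg that by (auto simp: W_def)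
      then show ?thesis
        by (simp add: z_def inner_diff_left gs[symmetric] hs[symmetric] m)
    qed
    have "z \<bullet> y = 0" for y
    proof -
      have "y = proj y + (\<Sum>v\<in>E. (y \<bullet> (g *v v)) *\<^sub>R v)" by (simp add: proj_def)
      then have "z \<bullet> y = z \<bullet> (proj y + (\<Sum>v\<in>E. (y \<bullet> (g *v v)) *\<^sub>R v))" by (rule arg_cong)
      also have "\<dots> = z \<bullet> proj y + (\<Sum>v\<in>E. (y \<bullet> (g *v v)) * (z \<bullet> v))"
        by (simp only: inner_add_right inner_sum_right inner_scaleR_right)
      finally show ?thesis using zE zW[OF projW] by simp
    qed
    then have "z = 0" using inner_eq_zero_iff by blast
    then have "eig x" by (auto simp: eig_def z_def)
    moreover have xE: "x \<notin> E" using xg by (auto simp: W_def)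
    ultimately have "ON (insert x E)"
      using E xg gcom unfolding ON_def W_def by auto
    from max[OF this] show False using xE fin by simp
  qed
  then have "card E = CARD('n)"
    using dim_eq_card_independent[OF indep[OF E]] dim_span[of E] dim_UNIV[where 'a="real^'n"] by simp
  then have "\<exists>P. bij_betw P (UNIV::'n set) E"
    using bij_betw_iff_card[OF finite_class.finite_UNIV[where 'a='n] fin] by simp
  then obtain P where P: "bij_betw P (UNIV::'n set) E" ..
  have PE: "P a \<in> E" for a using P by (auto simp: bij_betw_def)
  have Pinj: "P a = P b \<longleftrightarrow> a = b" for a b using P by (auto simp: bij_betw_def inj_on_def)
  have "\<exists>\<mu>. h *v P a = \<mu> *\<^sub>R (g *v P a)" for a
    using E PE[of a] unfolding ON_def eig_def[symmetric] by blast
  then obtain k where "\<And>a. h *v P a = k a *\<^sub>R (g *v P a)" by metis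
  then show ?thesis
    using E PE Pinj by (intro that[of P "\<chi> a. k a"]) (auto simp: ON_def)
qed

section \<open>Differentiability of symmetric functions of the eigenvalues\<close>

lemma matrix_add_rdistrib': "(A + B) ** C = A ** C + B ** (C :: real^'n::finite^'n)"
  by (simp add: vec_eq_iff matrix_matrix_mult_def sum.distrib algebra_simps)

lemma matrix_diff_rdistrib': "(A - B) ** C = A ** C - B ** (C :: real^'n::finite^'n)"
  by (simp add: vec_eq_iff matrix_matrix_mult_def sum_subtractf algebra_simps)

lemma matrix_diff_ldistrib': "C ** (A - B) = C ** A - C ** (B :: real^'n::finite^'n)"
  by (simp add: vec_eq_iff matrix_matrix_mult_def sum_subtractf algebra_simps)

lemma abs_det_le:
  fixes A :: "real^'n::finite^'n"
  assumes "\<And>i j. \<bar>A $ i $ j\<bar> \<le> C"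
  shows "\<bar>det A\<bar> \<le> fact CARD('n) * C ^ CARD('n)"
proof -
  have "\<bar>det A\<bar> \<le> (\<Sum>p | p permutes (UNIV::'n set). \<bar>of_int (sign p) * (\<Prod>i\<in>UNIV. A $ i $ p i)\<bar>)"
    unfolding det_def by (rule sum_abs)
  also have "\<dots> \<le> (\<Sum>p | p permutes (UNIV::'n set). C ^ CARD('n))"
  proof (rule sum_mono)
    fix p :: "'n \<Rightarrow> 'n"
    have "(\<Prod>i\<in>UNIV. \<bar>A $ i $ p i\<bar>) \<le> (\<Prod>i\<in>(UNIV::'n set). C)" using assms by (intro prod_mono) auto
    then show "\<bar>of_int (sign p) * (\<Prod>i\<in>UNIV. A $ i $ p i)\<bar> \<le> C ^ CARD('n)"
      by (simp add: abs_mult abs_prod sign_def)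
  qed
  finally show ?thesis by (simp add: card_permutations)
qed

text \<open>P and its inverse have entries at most C, so |det P| is at least 1/(n! C^n). Some
  Leibniz term carries at least the fraction 1/n! of it, and estimating all its factors but one by C
  leaves that one at least (n! C^n)^-2. The permutation pairs perturbed with unperturbed eigenvalues
  without any appeal to continuity.\<close>

lemma large_transversal:
  fixes P R :: "real^'n::finite^'n"
  assumes P: "\<And>i j. \<bar>P $ i $ j\<bar> \<le> C" and R: "\<And>i j. \<bar>R $ i $ j\<bar> \<le> C"
    and PR: "P ** R = mat 1" and C: "C \<ge> 1"
  obtains p where "p permutes (UNIV::'n set)"
    "\<And>i. 1 \<le> (fact CARD('n) * C ^ CARD('n))\<^sup>2 * \<bar>P $ i $ p i\<bar>"
proof -
  define K where "K = fact CARD('n) * C ^ CARD('n)"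
  have Kpos: "K > 0" using C by (simp add: K_def)
  have "det P * det R = 1" using PR by (metis det_I det_mul)
  then have "1 = \<bar>det P\<bar> * \<bar>det R\<bar>" by (metis abs_mult abs_one)
  also have "\<dots> \<le> \<bar>det P\<bar> * K" unfolding K_def using abs_det_le[of R C] R by (intro mult_left_mono) auto
  finally have d: "1 \<le> \<bar>det P\<bar> * K" .
  have "\<exists>p. p permutes (UNIV::'n set) \<and> \<bar>det P\<bar> \<le> fact CARD('n) * \<bar>\<Prod>i\<in>UNIV. P $ i $ p i\<bar>"
  proof (rule ccontr)
    assume neg: "\<not> ?thesis"
    have "\<bar>det P\<bar> \<le> (\<Sum>p | p permutes (UNIV::'n set). \<bar>of_int (sign p) * (\<Prod>i\<in>UNIV. P $ i $ p i)\<bar>)"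
      unfolding det_def by (rule sum_abs)
    also have "\<dots> < (\<Sum>p | p permutes (UNIV::'n set). \<bar>det P\<bar> / fact CARD('n))"
    proof (rule sum_strict_mono)
      have "id \<in> {p. p permutes (UNIV::'n set)}" by (simp add: permutes_id)
      then show "{p. p permutes (UNIV::'n set)} \<noteq> {}" by blast
      fix p assume "p \<in> {p. p permutes (UNIV::'n set)}"
      with neg have "fact CARD('n) * \<bar>\<Prod>i\<in>UNIV. P $ i $ p i\<bar> < \<bar>det P\<bar>" by force
      then show "\<bar>of_int (sign p) * (\<Prod>i\<in>UNIV. P $ i $ p i)\<bar> < \<bar>det P\<bar> / fact CARD('n)"
        by (simp add: abs_mult sign_def field_simps)
    qed (simp add: finite_permutations)
    finally show False by (simp add: card_permutations)
  qed
  then obtain p where p: "p permutes (UNIV::'n set)" "\<bar>det P\<bar> \<le> fact CARD('n) * \<bar>\<Prod>i\<in>UNIV. P $ i $ p i\<bar>"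
    by blast
  have "1 \<le> K\<^sup>2 * \<bar>P $ i $ p i\<bar>" for i
  proof -
    have "(\<Prod>j\<in>UNIV. \<bar>P $ j $ p j\<bar>) = \<bar>P $ i $ p i\<bar> * (\<Prod>j\<in>UNIV-{i}. \<bar>P $ j $ p j\<bar>)"
      by (rule prod.remove) auto
    also have "\<dots> \<le> \<bar>P $ i $ p i\<bar> * (\<Prod>j\<in>UNIV-{i}. C)"
      using P by (intro mult_left_mono prod_mono) auto
    also have "\<dots> \<le> \<bar>P $ i $ p i\<bar> * C ^ CARD('n)"
      using C by (intro mult_left_mono) (auto intro!: power_increasing simp: card_Diff_singleton)
    finally have "fact CARD('n) * \<bar>\<Prod>j\<in>UNIV. P $ j $ p j\<bar> \<le> fact CARD('n) * (\<bar>P $ i $ p i\<bar> * C ^ CARD('n))"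
      by (simp add: abs_prod)
    from order_trans[OF p(2) this] have "\<bar>det P\<bar> \<le> \<bar>P $ i $ p i\<bar> * K" by (simp add: K_def mult_ac)
    then have "\<bar>det P\<bar> * K \<le> \<bar>P $ i $ p i\<bar> * K * K" using Kpos by (intro mult_right_mono) auto
    with d show ?thesis by (simp add: power2_eq_square mult_ac)
  qed
  then show ?thesis using that p(1) unfolding K_def by blast
qed

text \<open>Matrix entries linking an eigenvalue of the perturbed matrix to a different unperturbed
  eigenvalue are of first order, so they enter the weighted trace only quadratically.\<close>
lemma eigenvalue_perturbation:
  fixes \<kappa> c :: "real^'n::finite" and C :: real
  assumes C: "C \<ge> 1" and c: "\<And>a b. \<kappa> $ a = \<kappa> $ b \<Longrightarrow> c $ a = c $ b"
  obtains B \<eta>0 where "B \<ge> 0" "\<eta>0 > 0"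
    "\<And>E P R \<mu> \<eta>. \<lbrakk>\<eta> \<le> \<eta>0; (diagm \<kappa> + E) ** P = P ** diagm \<mu>; P ** R = mat 1;
       \<And>i j. \<bar>P $ i $ j\<bar> \<le> C; \<And>i j. \<bar>R $ i $ j\<bar> \<le> C; \<And>i j. \<bar>E $ i $ j\<bar> \<le> \<eta>\<rbrakk> \<Longrightarrow>
       \<exists>p. p permutes (UNIV::'n set) \<and> (\<forall>i. \<bar>\<mu> $ p i - \<kappa> $ i\<bar> \<le> B * \<eta>) \<and>
         \<bar>(\<Sum>i\<in>UNIV. c $ i * (\<mu> $ p i - \<kappa> $ i)) - (\<Sum>i\<in>UNIV. c $ i * E $ i $ i)\<bar> \<le> B * \<eta>\<^sup>2"
proof -
  define n where "n = real CARD('n)"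
  define K where "K = (fact CARD('n) * C ^ CARD('n))\<^sup>2"
  \<comment> \<open>\<gamma> becomes the least gap between distinct eigenvalues; the inserted 1
    serves the case where all of them coincide.\<close>
  define G where "G = insert 1 ((\<lambda>(a,b). \<bar>\<kappa> $ a - \<kappa> $ b\<bar>) ` {(a,b). \<kappa> $ a \<noteq> \<kappa> $ b})"
  define \<gamma> where "\<gamma> = Min G"
  have finG: "finite G" unfolding G_def by simp
  have \<gamma>: "\<gamma> > 0" unfolding \<gamma>_def using finG by (subst Min_gr_iff) (auto simp: G_def)
  have gap: "\<gamma> \<le> \<bar>\<kappa> $ a - \<kappa> $ b\<bar>" if "\<kappa> $ a \<noteq> \<kappa> $ b" for a b
    unfolding \<gamma>_def using finG that by (intro Min_le) (force simp: G_def)+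
  define B1 where "B1 = K * (n * C)"
  \<comment> \<open>Ensures B1 * \<eta> \<le> \<gamma> / 2, so that a perturbed eigenvalue keeps
    half the gap away from every foreign one. The bound by 1 keeps the perturbed eigenvalues below
    M.\<close>
  define \<eta>0 where "\<eta>0 = min 1 (\<gamma> / (2 * B1 + 1))"
  have pos: "n \<ge> 1" "K > 0" using C by (auto simp: n_def K_def Suc_le_eq)
  then have B1: "B1 \<ge> 0" using C by (simp add: B1_def)
  have \<eta>0: "\<eta>0 > 0" using \<gamma> B1 by (simp add: \<eta>0_def)
  define D where "D = 2 * n * C / \<gamma>"
  define M where "M = (\<Sum>i\<in>UNIV. \<bar>\<kappa> $ i\<bar>) + B1"
  define N where "N = 2 * (\<Sum>i\<in>UNIV. \<bar>c $ i\<bar>)"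
  define B2 where "B2 = n * (n * (M * N * D\<^sup>2))"
  have M: "M \<ge> 0" unfolding M_def using B1 by (simp add: sum_nonneg)
  have N: "N \<ge> 0" unfolding N_def by (simp add: sum_nonneg)
  have D: "D \<ge> 0" unfolding D_def using pos C \<gamma> by simp
  have B2: "B2 \<ge> 0" unfolding B2_def using pos M N by simp
  show ?thesis
  proof (rule that[of "max B1 B2" \<eta>0])
    show "max B1 B2 \<ge> 0" using B1 by simp
    show "\<eta>0 > 0" by fact
    fix E P R and \<mu> :: "real^'n" and \<eta>
    assume \<eta>: "\<eta> \<le> \<eta>0" and MP: "(diagm \<kappa> + E) ** P = P ** diagm \<mu>" and PR: "P ** R = mat 1"
      and Pb: "\<And>i j. \<bar>P $ i $ j\<bar> \<le> C" and Rb: "\<And>i j. \<bar>R $ i $ j\<bar> \<le> C"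
      and Eb: "\<And>i j. \<bar>E $ i $ j\<bar> \<le> \<eta>"
    have \<eta>nn: "\<eta> \<ge> 0" using Eb[of undefined undefined] by linarith
    have RP: "R ** P = mat 1" using PR matrix_left_right_inverse by blast
    have RM: "R ** (diagm \<kappa> + E) = diagm \<mu> ** R"
    proof -
      have "R ** ((diagm \<kappa> + E) ** P) ** R = R ** (P ** diagm \<mu>) ** R" using MP by simp
      then show ?thesis
        by (metis PR RP matrix_mul_assoc matrix_mul_lid matrix_mul_rid)
    qed
    have diagl: "(diagm v ** X) $ i $ j = v $ i * X $ i $ j" for v i j and X :: "real^'n^'n"
      by (simp add: matrix_matrix_mult_def diagm_def if_distrib[where f="\<lambda>x. x * _"] cong: if_cong)
    have diagr: "(X ** diagm v) $ i $ j = X $ i $ j * v $ j" for v i j and X :: "real^'n^'n"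
      by (simp add: matrix_matrix_mult_def diagm_def if_distrib[where f="\<lambda>x. _ * x"] cong: if_cong)
    have prodb: "\<bar>(X ** Y) $ i $ j\<bar> \<le> n * C * \<eta>"
      if "\<And>k. \<bar>X $ i $ k\<bar> * \<bar>Y $ k $ j\<bar> \<le> C * \<eta>" for X Y :: "real^'n^'n" and i j
    proof -
      have "\<bar>(X ** Y) $ i $ j\<bar> \<le> (\<Sum>k\<in>UNIV. \<bar>X $ i $ k * Y $ k $ j\<bar>)"
        unfolding matrix_matrix_mult_def by (simp add: sum_abs)
      also have "\<dots> \<le> (\<Sum>k\<in>(UNIV::'n set). C * \<eta>)" using that by (intro sum_mono) (simp add: abs_mult)
      finally show ?thesis by (simp add: n_def mult.assoc)
    qed
    \<comment> \<open>Entry (a, i) of the eigenvalue equation: an eigenvalue difference times an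
      entry of P is, up to sign, an entry of E P.\<close>
    have offP: "\<bar>\<kappa> $ a - \<mu> $ i\<bar> * \<bar>P $ a $ i\<bar> \<le> n * C * \<eta>" for a i
    proof -
      have "((diagm \<kappa> + E) ** P) $ a $ i = (P ** diagm \<mu>) $ a $ i" using MP by simp
      then have "(\<kappa> $ a - \<mu> $ i) * P $ a $ i = - (E ** P) $ a $ i"
        by (simp add: matrix_add_rdistrib' diagl diagr algebra_simps)
      moreover have "\<bar>(E ** P) $ a $ i\<bar> \<le> n * C * \<eta>"
        using Eb Pb \<eta>nn C by (intro prodb) (auto simp: mult.commute[of C] intro!: mult_mono)
      ultimately show ?thesis by (metis abs_minus_cancel abs_mult)
    qed
    have offR: "\<bar>\<kappa> $ a - \<mu> $ i\<bar> * \<bar>R $ i $ a\<bar> \<le> n * C * \<eta>" for a i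
    proof -
      have "(R ** (diagm \<kappa> + E)) $ i $ a = (diagm \<mu> ** R) $ i $ a" using RM by simp
      then have "(\<kappa> $ a - \<mu> $ i) * R $ i $ a = - (R ** E) $ i $ a"
        by (simp add: matrix_add_ldistrib diagl diagr algebra_simps)
      moreover have "\<bar>(R ** E) $ i $ a\<bar> \<le> n * C * \<eta>"
        using Eb Rb \<eta>nn C by (intro prodb) (auto intro!: mult_mono)
      ultimately show ?thesis by (metis abs_minus_cancel abs_mult)
    qed
    obtain p where p: "p permutes (UNIV::'n set)" and pK: "\<And>i. 1 \<le> K * \<bar>P $ i $ p i\<bar>"
      using large_transversal[OF Pb Rb PR C] unfolding K_def by metis
    have close: "\<bar>\<mu> $ p i - \<kappa> $ i\<bar> \<le> B1 * \<eta>" for i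
    proof -
      have "\<bar>\<kappa> $ i - \<mu> $ p i\<bar> \<le> \<bar>\<kappa> $ i - \<mu> $ p i\<bar> * (K * \<bar>P $ i $ p i\<bar>)"
        using pK[of i] by (simp add: mult_le_cancel_left1)
      also have "\<dots> \<le> K * (n * C * \<eta>)" using offP[of i "p i"] pos by (simp add: mult.left_commute mult_left_mono)
      finally show ?thesis by (simp add: B1_def abs_minus_commute mult_ac)
    qed
    have far: "\<bar>\<kappa> $ a - \<mu> $ p i\<bar> \<ge> \<gamma> / 2" if "\<kappa> $ a \<noteq> \<kappa> $ i" for a i
    proof -
      have "B1 * \<eta> \<le> B1 * (\<gamma> / (2 * B1 + 1))" using \<eta> B1 by (intro mult_left_mono) (auto simp: \<eta>0_def)
      also have "\<dots> \<le> \<gamma> / 2" using B1 \<gamma> by (simp add: field_simps)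
      finally show ?thesis using gap[OF that] close[of i] by linarith
    qed
    have small: "\<bar>x\<bar> \<le> D * \<eta>" if "\<bar>d\<bar> * \<bar>x\<bar> \<le> n * C * \<eta>" "\<bar>d\<bar> \<ge> \<gamma> / 2" for d x
    proof -
      have "\<gamma> / 2 * \<bar>x\<bar> \<le> \<bar>d\<bar> * \<bar>x\<bar>" using that by (intro mult_right_mono) auto
      with that(1) have "\<gamma> / 2 * \<bar>x\<bar> \<le> n * C * \<eta>" by linarith
      then show ?thesis using \<gamma> by (simp add: D_def field_simps)
    qed
    \<comment> \<open>The weights Q a i sum to 1 over a and express the perturbed diagonal through
      \<mu>. The defect in the weighted trace is then a sum with factors c a - c i, which are zero
      within an eigenvalue block; across blocks Q itself is of second order, being a product of two
      small entries.\<close>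
    define Q where "Q a i = P $ a $ p i * R $ p i $ a" for a i
    have Qsmall: "\<bar>Q a i\<bar> \<le> D\<^sup>2 * \<eta>\<^sup>2" if "\<kappa> $ a \<noteq> \<kappa> $ i" for a i
    proof -
      have "\<bar>P $ a $ p i\<bar> \<le> D * \<eta>" "\<bar>R $ p i $ a\<bar> \<le> D * \<eta>"
        using small[OF offP far[OF that]] small[OF offR far[OF that]] by auto
      then have "\<bar>P $ a $ p i\<bar> * \<bar>R $ p i $ a\<bar> \<le> (D * \<eta>) * (D * \<eta>)"
        using D \<eta>nn by (intro mult_mono) auto
      then show ?thesis by (simp add: Q_def abs_mult power2_eq_square mult_ac)
    qed
    have colsum: "(\<Sum>a\<in>UNIV. Q a i) = 1" for i
    proof -
      have "(R ** P) $ p i $ p i = 1" using RP by (simp add: mat_def)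
      then show ?thesis by (simp add: matrix_matrix_mult_def Q_def mult.commute)
    qed
    have diag: "\<kappa> $ a + E $ a $ a = (\<Sum>i\<in>UNIV. Q a i * \<mu> $ p i)" for a
    proof -
      have "diagm \<kappa> + E = (P ** diagm \<mu>) ** R" using MP PR
        by (metis matrix_mul_assoc matrix_mul_rid)
      then have "(diagm \<kappa> + E) $ a $ a = ((P ** diagm \<mu>) ** R) $ a $ a" by simp
      also have "\<dots> = (\<Sum>i\<in>UNIV. P $ a $ i * \<mu> $ i * R $ i $ a)"
        by (simp add: matrix_matrix_mult_def[of _ R] diagr)
      also have "\<dots> = (\<Sum>i\<in>UNIV. P $ a $ p i * \<mu> $ p i * R $ p i $ a)"
        by (rule sum.permute[OF p, unfolded o_def])
      finally show ?thesis by (simp add: diagm_def Q_def mult_ac)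
    qed
    have \<mu>b: "\<bar>\<mu> $ p i\<bar> \<le> M" for i
    proof -
      have "\<bar>\<kappa> $ i\<bar> \<le> (\<Sum>i\<in>UNIV. \<bar>\<kappa> $ i\<bar>)" by (rule member_le_sum) auto
      moreover have "B1 * \<eta> \<le> B1 * 1" using \<eta> B1 by (intro mult_left_mono) (auto simp: \<eta>0_def)
      ultimately show ?thesis using close[of i] unfolding M_def by linarith
    qed
    have cN: "\<bar>c $ a - c $ i\<bar> \<le> N" for a i
    proof -
      have "\<bar>c $ i\<bar> \<le> (\<Sum>i\<in>UNIV. \<bar>c $ i\<bar>)" for i by (rule member_le_sum) auto
      from this[of i] this[of a] show ?thesis unfolding N_def by linarith
    qed
    have "(\<Sum>i\<in>UNIV. c $ i * E $ i $ i) = (\<Sum>a\<in>UNIV. c $ a * (\<Sum>i\<in>UNIV. Q a i * \<mu> $ p i)) - (\<Sum>i\<in>UNIV. c $ i * \<kappa> $ i)"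
      unfolding diag[symmetric] by (simp add: algebra_simps sum.distrib)
    also have "(\<Sum>a\<in>UNIV. c $ a * (\<Sum>i\<in>UNIV. Q a i * \<mu> $ p i)) = (\<Sum>i\<in>UNIV. \<Sum>a\<in>UNIV. c $ a * (Q a i * \<mu> $ p i))"
      unfolding sum_distrib_left by (rule sum.swap)
    also have "\<dots> = (\<Sum>i\<in>UNIV. c $ i * \<mu> $ p i) + (\<Sum>i\<in>UNIV. \<Sum>a\<in>UNIV. (c $ a - c $ i) * Q a i * \<mu> $ p i)"
    proof -
      have "c $ i * \<mu> $ p i = (\<Sum>a\<in>UNIV. c $ i * (Q a i * \<mu> $ p i))" for i
        using colsum[of i] by (simp flip: sum_distrib_left sum_distrib_right)
      then show ?thesis by (simp add: sum.distrib[symmetric] algebra_simps)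
    qed
    finally have "(\<Sum>i\<in>UNIV. c $ i * (\<mu> $ p i - \<kappa> $ i)) - (\<Sum>i\<in>UNIV. c $ i * E $ i $ i)
        = - (\<Sum>i\<in>UNIV. \<Sum>a\<in>UNIV. (c $ a - c $ i) * Q a i * \<mu> $ p i)"
      by (simp add: algebra_simps sum_subtractf)
    also have "\<bar>\<dots>\<bar> \<le> (\<Sum>i\<in>UNIV. \<Sum>a\<in>UNIV. \<bar>(c $ a - c $ i) * Q a i * \<mu> $ p i\<bar>)"
      unfolding abs_minus_cancel by (intro order_trans[OF sum_abs] sum_mono sum_abs)
    also have "\<dots> \<le> (\<Sum>i\<in>(UNIV::'n set). \<Sum>a\<in>(UNIV::'n set). N * (D\<^sup>2 * \<eta>\<^sup>2) * M)"
    proof (intro sum_mono)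
      fix i a
      show "\<bar>(c $ a - c $ i) * Q a i * \<mu> $ p i\<bar> \<le> N * (D\<^sup>2 * \<eta>\<^sup>2) * M"
      proof (cases "\<kappa> $ a = \<kappa> $ i")
        case True
        then show ?thesis using c[OF True] N M by simp
      next
        case False
        show ?thesis unfolding abs_mult using Qsmall[OF False] cN \<mu>b N M
          by (intro mult_mono) auto
      qed
    qed
    also have "\<dots> = B2 * \<eta>\<^sup>2" by (simp add: B2_def n_def mult_ac)
    finally have second: "\<bar>(\<Sum>i\<in>UNIV. c $ i * (\<mu> $ p i - \<kappa> $ i)) - (\<Sum>i\<in>UNIV. c $ i * E $ i $ i)\<bar> \<le> B2 * \<eta>\<^sup>2" .
    show "\<exists>p. p permutes (UNIV::'n set) \<and> (\<forall>i. \<bar>\<mu> $ p i - \<kappa> $ i\<bar> \<le> max B1 B2 * \<eta>) \<and>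
         \<bar>(\<Sum>i\<in>UNIV. c $ i * (\<mu> $ p i - \<kappa> $ i)) - (\<Sum>i\<in>UNIV. c $ i * E $ i $ i)\<bar> \<le> max B1 B2 * \<eta>\<^sup>2"
    proof (intro exI[of _ p] conjI allI)
      show "\<bar>\<mu> $ p i - \<kappa> $ i\<bar> \<le> max B1 B2 * \<eta>" for i
        using close[of i] \<eta>nn by (meson max.cobounded1 mult_right_mono order_trans)
      show "\<bar>(\<Sum>i\<in>UNIV. c $ i * (\<mu> $ p i - \<kappa> $ i)) - (\<Sum>i\<in>UNIV. c $ i * E $ i $ i)\<bar> \<le> max B1 B2 * \<eta>\<^sup>2"
        using second by (meson max.cobounded2 mult_right_mono order_trans zero_le_power2)
    qed (fact p)
  qed
qed

section \<open>Partial derivatives and the total derivative\<close>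

lemma pd_eqI:
  assumes "(\<phi> has_derivative D) (at x)"
  shows "pd i \<phi> x = D (axis i 1)"
proof -
  have "((\<lambda>t. x + t *\<^sub>R axis i 1) has_derivative (\<lambda>t. t *\<^sub>R axis i 1)) (at (0::real))"
    by (auto intro!: derivative_eq_intros)
  moreover have "(\<phi> has_derivative D) (at (x + 0 *\<^sub>R axis i 1))" using assms by simp
  ultimately have "((\<lambda>t. \<phi> (x + t *\<^sub>R axis i 1)) has_derivative (\<lambda>t. D (t *\<^sub>R axis i 1))) (at (0::real))"
    by (rule has_derivative_compose[where g = \<phi> and g' = D])
  moreover have "D (t *\<^sub>R axis i 1) = D (axis i 1) * t" for t :: real
    using linear_scale[OF has_derivative_linear[OF assms]] by (simp add: mult.commute)
  ultimately show ?thesis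
    unfolding pd_def by (intro DERIV_imp_deriv) (simp add: has_field_derivative_def)
qed

lemma has_derivative_Du:
  assumes "\<phi> differentiable (at x)"
  shows "(\<phi> has_derivative (\<lambda>v. Du \<phi> x \<bullet> v)) (at x)"
proof -
  obtain D where D: "(\<phi> has_derivative D) (at x)" using assms unfolding differentiable_def ..
  note lin = has_derivative_linear[OF D]
  have "D v = Du \<phi> x \<bullet> v" for v
  proof -
    have "D v = D (\<Sum>i\<in>UNIV. (v $ i) *\<^sub>R axis i 1)"
      using basis_expansion[of v] unfolding scalar_mult_eq_scaleR by simp
    also have "\<dots> = (\<Sum>i\<in>UNIV. v $ i * D (axis i 1))"
      by (simp add: linear_sum[OF lin] linear_scale[OF lin])
    finally show ?thesis by (simp add: inner_vec_def Du_def pd_eqI[OF D] mult.commute)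
  qed
  then have "D = (\<lambda>v. Du \<phi> x \<bullet> v)" by auto
  with D show ?thesis by simp
qed

text \<open>Swapping the coordinates a and b fixes \<kappa> and exchanges the two test lines. The
  weights f_i are thus constant on eigenvalue blocks, as \<open>eigenvalue_perturbation\<close>
  demands of \<open>c\<close>.\<close>

lemma symmetric_pd_eq:
  fixes f :: "real^'n::finite \<Rightarrow> real"
  assumes sym: "\<forall>p q. p permutes (UNIV::'n set) \<longrightarrow> q \<in> posK \<longrightarrow> f (\<chi> i. q$(p i)) = f q"
    and \<kappa>: "\<kappa> \<in> posK" "\<kappa> $ a = \<kappa> $ b"
  shows "pd a f \<kappa> = pd b f \<kappa>"
proof -
  have "\<forall>\<^sub>F t in nhds 0. f (\<kappa> + t *\<^sub>R axis a 1) = f (\<kappa> + t *\<^sub>R axis b 1)"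
  proof -
    have "((\<lambda>t. (\<kappa> + t *\<^sub>R axis a 1) $ a) \<longlongrightarrow> (\<kappa> + 0 *\<^sub>R axis a 1) $ a) (nhds (0::real))"
      by (intro tendsto_intros filterlim_ident)
    then have "\<forall>\<^sub>F t in nhds (0::real). (\<kappa> + t *\<^sub>R axis a 1) $ a > 0"
      using \<kappa> by (intro order_tendstoD(1)) (auto simp: posK_def)
    then show ?thesis
    proof eventually_elim
      case (elim t)
      have "\<kappa> + t *\<^sub>R axis a 1 \<in> posK"
        using elim \<kappa> by (auto simp: posK_def axis_def)
      from sym[rule_format, OF permutes_swap_id this, of a b]
      have "f (\<chi> i. (\<kappa> + t *\<^sub>R axis a 1) $ (Transposition.transpose a b i)) = f (\<kappa> + t *\<^sub>R axis a 1)" by simp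
      moreover have "(\<kappa> + t *\<^sub>R axis a 1) $ (Transposition.transpose a b i) = (\<kappa> + t *\<^sub>R axis b 1) $ i" for i
        using \<kappa>(2) by (cases "i = a"; cases "i = b") (simp_all add: axis_def Transposition.transpose_def)
      then have "(\<chi> i. (\<kappa> + t *\<^sub>R axis a 1) $ (Transposition.transpose a b i)) = \<kappa> + t *\<^sub>R axis b 1"
        by (simp only: vec_eq_iff vec_lambda_beta) simp
      ultimately show ?case by (simp only:)
    qed
  qed
  then show ?thesis unfolding pd_def by (intro deriv_cong_ev) auto
qed

text \<open>Conjugation by the eigenbasis turns A t into \<open>diagm \<kappa>\<close> + E t with E
  t = O(t). The perturbation lemma with weights f_i then gives f at the new eigenvalues as f
  \<kappa> + \<Sum> f_i (E t)_ii + o(t), whatever their order. The constant C bounds the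
  diagonalizers near t = 0 jointly with their inverses.\<close>

lemma Fmat_has_derivative:
  fixes f :: "real^'n::finite \<Rightarrow> real" and A :: "real \<Rightarrow> real^'n^'n" and P R :: "real^'n^'n"
  assumes sym: "\<forall>p q. p permutes (UNIV::'n set) \<longrightarrow> q \<in> posK \<longrightarrow> f (\<chi> i. q$(p i)) = f q"
    and \<kappa>: "\<kappa> \<in> posK" and f: "f differentiable (at \<kappa>)"
    and AP: "A 0 ** P = P ** diagm \<kappa>" and PR: "P ** R = mat 1"
    and dA: "\<And>i j. ((\<lambda>t. A t $ i $ j) has_real_derivative B $ i $ j) (at 0)"
    and diag: "\<forall>\<^sub>F t in at 0. \<exists>(Q::real^'n^'n) (S::real^'n^'n) \<mu>. A t ** Q = Q ** diagm \<mu> \<and> Q ** S = mat 1 \<and>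
        (\<forall>i j. \<bar>Q $ i $ j\<bar> \<le> C) \<and> (\<forall>i j. \<bar>S $ i $ j\<bar> \<le> C)"
  shows "((\<lambda>t. Fmat f (A t)) has_real_derivative (\<Sum>a\<in>UNIV. pd a f \<kappa> * (R ** B ** P) $ a $ a)) (at 0)"
proof -
  define n where "n = real CARD('n)"
  define E where "E t = R ** (A t - A 0) ** P" for t
  define D where "D = R ** B ** P"
  define c where "c = Du f \<kappa>"
  define m where "m = (\<Sum>i\<in>UNIV. \<Sum>j\<in>UNIV. \<bar>P $ i $ j\<bar> + \<bar>R $ i $ j\<bar>)"
  \<comment> \<open>Entry bound for the conjugated diagonalizers R ** Q and T ** P: n products, each
    at most m * |C|.\<close>
  define C' where "C' = max 1 (n * (m * \<bar>C\<bar>))"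
  \<comment> \<open>Strictly above all entries of the derivative D, so that |E t| \<le> L * |t|
    holds near 0.\<close>
  define L where "L = 1 + (\<Sum>i\<in>UNIV. \<Sum>j\<in>UNIV. \<bar>D $ i $ j\<bar>)"
  have RP: "R ** P = mat 1" using PR matrix_left_right_inverse by blast
  have mb: "\<bar>P $ i $ j\<bar> \<le> m" "\<bar>R $ i $ j\<bar> \<le> m" for i j
  proof -
    have "\<bar>P $ i $ j\<bar> + \<bar>R $ i $ j\<bar> \<le> (\<Sum>j\<in>UNIV. \<bar>P $ i $ j\<bar> + \<bar>R $ i $ j\<bar>)"
      by (rule member_le_sum) auto
    also have "\<dots> \<le> m" unfolding m_def by (rule member_le_sum) (auto intro: sum_nonneg)
    finally show "\<bar>P $ i $ j\<bar> \<le> m" "\<bar>R $ i $ j\<bar> \<le> m" by auto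
  qed
  have L: "\<bar>D $ i $ j\<bar> < L" for i j
  proof -
    have "\<bar>D $ i $ j\<bar> \<le> (\<Sum>j\<in>UNIV. \<bar>D $ i $ j\<bar>)"
      by (rule member_le_sum) auto
    also have "\<dots> \<le> (\<Sum>i\<in>UNIV. \<Sum>j\<in>UNIV. \<bar>D $ i $ j\<bar>)" by (rule member_le_sum) (auto intro: sum_nonneg)
    finally show ?thesis by (simp add: L_def)
  qed
  then have Lpos: "L > 0" by (meson abs_ge_zero le_less_trans)
  have C': "C' \<ge> 1" by (simp add: C'_def)
  have dE: "((\<lambda>t. E t $ i $ j) has_real_derivative D $ i $ j) (at 0)" for i j
    unfolding E_def D_def matrix_matrix_mult_def
    by (auto intro!: derivative_eq_intros dA sum.cong simp: mult.commute)
  have cblock: "c $ a = c $ b" if "\<kappa> $ a = \<kappa> $ b" for a b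
    using symmetric_pd_eq[OF sym \<kappa> that] by (simp add: c_def Du_def)
  obtain K \<eta>0 where K: "K \<ge> 0" "\<eta>0 > 0" and pert:
    "\<And>E P R \<mu> \<eta>. \<lbrakk>\<eta> \<le> \<eta>0; (diagm \<kappa> + E) ** P = P ** diagm \<mu>; P ** R = mat 1;
       \<And>i j. \<bar>P $ i $ j\<bar> \<le> C'; \<And>i j. \<bar>R $ i $ j\<bar> \<le> C'; \<And>i j. \<bar>E $ i $ j\<bar> \<le> \<eta>\<rbrakk> \<Longrightarrow>
       \<exists>p. p permutes (UNIV::'n set) \<and> (\<forall>i. \<bar>\<mu> $ p i - \<kappa> $ i\<bar> \<le> K * \<eta>) \<and>
         \<bar>(\<Sum>i\<in>UNIV. c $ i * (\<mu> $ p i - \<kappa> $ i)) - (\<Sum>i\<in>UNIV. c $ i * E $ i $ i)\<bar> \<le> K * \<eta>\<^sup>2"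
    using eigenvalue_perturbation[OF C' cblock] by blast
  have inv: "invertible P" using PR RP by (auto simp: invertible_def)
  have F0: "Fmat f (A 0) = f \<kappa>"
    by (rule Fmat_eq[OF sym]) (use \<kappa> AP inv in \<open>auto simp: eigvals_def\<close>)
  define S where "S t = (\<Sum>i\<in>UNIV. c $ i * E t $ i $ i)" for t
  have S0: "S 0 = 0" by (simp add: S_def E_def matrix_matrix_mult_def)
  have dS: "(S has_real_derivative (\<Sum>a\<in>UNIV. pd a f \<kappa> * D $ a $ a)) (at 0)"
    unfolding S_def by (auto intro!: derivative_eq_intros dE sum.cong simp: c_def Du_def)
  have ev1: "\<forall>\<^sub>F t in at 0. \<bar>E t $ i $ j\<bar> \<le> L * \<bar>t\<bar>" for i j
  proof -
    have "((\<lambda>t. \<bar>(E t $ i $ j - E 0 $ i $ j) / (t - 0)\<bar>) \<longlongrightarrow> \<bar>D $ i $ j\<bar>) (at 0)"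
      using dE[of i j] unfolding has_field_derivative_iff by (intro tendsto_rabs) simp
    then have "\<forall>\<^sub>F t in at 0. \<bar>(E t $ i $ j - E 0 $ i $ j) / (t - 0)\<bar> < L"
      by (rule order_tendstoD) (rule L)
    moreover have "\<forall>\<^sub>F t in at (0::real). t \<noteq> 0" by (simp add: eventually_at_filter)
    ultimately show ?thesis
    proof eventually_elim
      case (elim t)
      have "E 0 $ i $ j = 0" by (simp add: E_def matrix_matrix_mult_def)
      with elim show ?case by (simp add: field_simps)
    qed
  qed
  have ev: "\<forall>\<^sub>F t in at 0. \<forall>i j. \<bar>E t $ i $ j\<bar> \<le> L * \<bar>t\<bar>"
    using ev1 by (simp add: eventually_all_finite)
  have posev: "\<exists>d>0. \<forall>v. (\<forall>i. \<bar>v $ i - \<kappa> $ i\<bar> < d) \<longrightarrow> v \<in> posK"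
  proof -
    define d where "d = Min (range (\<lambda>i. \<kappa> $ i))"
    have "d > 0" unfolding d_def using \<kappa> by (subst Min_gr_iff) (auto simp: posK_def)
    moreover have "v \<in> posK" if v: "\<forall>i. \<bar>v $ i - \<kappa> $ i\<bar> < d" for v
    proof -
      have "d \<le> \<kappa> $ i" for i unfolding d_def by (rule Min_le) auto
      then have "v $ i > 0" for i using v[rule_format, of i] by (smt (verit))
      then show ?thesis by (simp add: posK_def)
    qed
    ultimately show ?thesis by blast
  qed
  then obtain d1 where d1: "d1 > 0" "\<And>v. (\<forall>i. \<bar>v $ i - \<kappa> $ i\<bar> < d1) \<Longrightarrow> v \<in> posK" by blast
  have fder: "(f has_derivative (\<lambda>v. c \<bullet> v)) (at \<kappa>)" unfolding c_def by (rule has_derivative_Du[OF f])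
  \<comment> \<open>With the trace term S split off, the rest must have derivative zero. The error
    of linearizing f and the quadratic error of the eigenvalues get e / 2 each.\<close>
  have "((\<lambda>t. Fmat f (A t) - S t) has_derivative (\<lambda>t. 0)) (at 0)"
    unfolding has_derivative_at_alt
  proof (intro conjI allI impI)
    show "bounded_linear (\<lambda>t::real. 0::real)" by simp
    fix e :: real assume e: "e > 0"
    define e1 where "e1 = e / (2 * (n * K * L + 1))"
    have n: "n \<ge> 1" by (simp add: n_def Suc_le_eq)
    have nKL: "n * K * L \<ge> 0" using n K Lpos by simp
    have e1: "e1 > 0" using e nKL by (simp add: e1_def)
    obtain d2 where d2: "d2 > 0" "\<And>y. norm (y - \<kappa>) < d2 \<Longrightarrow> norm (f y - f \<kappa> - c \<bullet> (y - \<kappa>)) \<le> e1 * norm (y - \<kappa>)"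
      using fder e1 unfolding has_derivative_at_alt by blast
    define good where "good t \<longleftrightarrow> (\<forall>i j. \<bar>E t $ i $ j\<bar> \<le> L * \<bar>t\<bar>) \<and>
       (\<exists>(Q::real^'n^'n) (S::real^'n^'n) \<mu>. A t ** Q = Q ** diagm \<mu> \<and> Q ** S = mat 1 \<and>
        (\<forall>i j. \<bar>Q $ i $ j\<bar> \<le> C) \<and> (\<forall>i j. \<bar>S $ i $ j\<bar> \<le> C))" for t
    have "\<forall>\<^sub>F t in at 0. good t" using ev diag unfolding good_def by (rule eventually_conj)
    then obtain d3 where d3: "d3 > 0" "\<And>t. t \<noteq> 0 \<Longrightarrow> \<bar>t\<bar> < d3 \<Longrightarrow> good t"
      unfolding eventually_at dist_real_def by auto
    \<comment> \<open>In order: the hypotheses hold at t, \<eta> is admissible, the eigenvalues stay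
      in the cone, f is close to its linearization, and the quadratic error is absorbed.\<close>
    define d where "d = Min {d3, \<eta>0 / L, d1 / (K * L + 1), d2 / (n * K * L + 1), e / (2 * (K * L\<^sup>2 + 1))}"
    have KL: "K * L \<ge> 0" "K * L\<^sup>2 \<ge> 0" using K Lpos by auto
    have "d > 0" unfolding d_def using d1 d2 d3 K Lpos KL nKL e by (simp add: add_nonneg_pos)
    moreover have "norm (Fmat f (A t) - S t - (Fmat f (A 0) - S 0) - 0) \<le> e * norm (t - 0)"
      if "norm (t - 0) < d" for t
    proof (cases "t = 0")
      case False
      have td: "\<bar>t\<bar> < d3" "\<bar>t\<bar> < \<eta>0 / L" "\<bar>t\<bar> < d1 / (K * L + 1)" "\<bar>t\<bar> < d2 / (n * K * L + 1)"
        "\<bar>t\<bar> < e / (2 * (K * L\<^sup>2 + 1))" using that by (auto simp: d_def)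
      obtain Q T :: "real^'n^'n" and \<mu> where Q: "A t ** Q = Q ** diagm \<mu>" "Q ** T = mat 1"
        "\<And>i j. \<bar>Q $ i $ j\<bar> \<le> C" "\<And>i j. \<bar>T $ i $ j\<bar> \<le> C" using d3(2)[OF False td(1)] unfolding good_def by blast
      have Et: "\<And>i j. \<bar>E t $ i $ j\<bar> \<le> L * \<bar>t\<bar>" using d3(2)[OF False td(1)] unfolding good_def by blast
      have TQ: "T ** Q = mat 1" using Q matrix_left_right_inverse by blast
      have "diagm \<kappa> + E t = R ** A t ** P"
      proof -
        have "diagm \<kappa> = R ** A 0 ** P"
          by (metis AP RP matrix_mul_assoc matrix_mul_lid)
        moreover have "R ** (A t - A 0) ** P = R ** A t ** P - R ** A 0 ** P"
          by (simp add: matrix_diff_ldistrib' matrix_diff_rdistrib')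
        ultimately show ?thesis by (simp add: E_def)
      qed
      then have "(diagm \<kappa> + E t) ** (R ** Q) = R ** (A t ** (P ** R) ** Q)"
        by (simp add: matrix_mul_assoc)
      also have "\<dots> = (R ** Q) ** diagm \<mu>" by (simp add: PR Q matrix_mul_assoc[symmetric])
      finally have 1: "(diagm \<kappa> + E t) ** (R ** Q) = (R ** Q) ** diagm \<mu>" .
      have "(R ** Q) ** (T ** P) = R ** (Q ** T) ** P" by (simp add: matrix_mul_assoc)
      then have 2: "(R ** Q) ** (T ** P) = mat 1" by (simp add: Q RP)
      have bd: "\<bar>(X ** Y) $ i $ j\<bar> \<le> C'"
        if "\<And>k. \<bar>X $ i $ k\<bar> * \<bar>Y $ k $ j\<bar> \<le> m * \<bar>C\<bar>" for X Y :: "real^'n^'n" and i j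
      proof -
        have "\<bar>(X ** Y) $ i $ j\<bar> \<le> (\<Sum>k\<in>UNIV. \<bar>X $ i $ k * Y $ k $ j\<bar>)"
          unfolding matrix_matrix_mult_def by (simp add: sum_abs)
        also have "\<dots> \<le> (\<Sum>k\<in>(UNIV::'n set). m * \<bar>C\<bar>)" using that by (intro sum_mono) (simp add: abs_mult)
        finally show ?thesis by (simp add: n_def C'_def)
      qed
      have Cb: "\<bar>Q $ i $ j\<bar> \<le> \<bar>C\<bar>" "\<bar>T $ i $ j\<bar> \<le> \<bar>C\<bar>" for i j
        using Q(3)[of i j] Q(4)[of i j] by linarith+
      have m0: "m \<ge> 0" using mb(1)[of undefined undefined] by linarith
      have 3: "\<bar>(R ** Q) $ i $ j\<bar> \<le> C'" for i j using mb Cb m0 by (intro bd mult_mono) auto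
      have 4: "\<bar>(T ** P) $ i $ j\<bar> \<le> C'" for i j
        using mb Cb m0 by (intro bd) (subst mult.commute, intro mult_mono, auto)
      have small: "L * \<bar>t\<bar> \<le> \<eta>0" using td(2) Lpos by (simp add: field_simps)
      obtain p where p: "p permutes (UNIV::'n set)" "\<And>i. \<bar>\<mu> $ p i - \<kappa> $ i\<bar> \<le> K * (L * \<bar>t\<bar>)"
         "\<bar>(\<Sum>i\<in>UNIV. c $ i * (\<mu> $ p i - \<kappa> $ i)) - (\<Sum>i\<in>UNIV. c $ i * E t $ i $ i)\<bar> \<le> K * (L * \<bar>t\<bar>)\<^sup>2"
        using pert[OF small 1 2 3 4 Et] by blast
      define v where "v = (\<chi> i. \<mu> $ p i)"
      have v: "v $ i = \<mu> $ p i" for i by (simp add: v_def)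
      have "K * (L * \<bar>t\<bar>) < d1"
      proof -
        have "K * L * \<bar>t\<bar> \<le> (K * L + 1) * \<bar>t\<bar>" by (simp add: algebra_simps)
        also have "\<dots> < d1" using td(3) KL by (simp add: field_simps)
        finally show ?thesis by (simp add: mult.assoc)
      qed
      then have "\<bar>v $ i - \<kappa> $ i\<bar> < d1" for i using p(2)[of i] unfolding v by linarith
      then have "\<forall>i. \<bar>v $ i - \<kappa> $ i\<bar> < d1" ..
      from d1(2)[OF this] have vpos: "v \<in> posK" .
      have "\<mu> $ j > 0" for j
      proof -
        obtain i where "j = p i" using permutes_surj[OF p(1)] by (rule surjE)
        moreover have "v $ i > 0" using vpos by (simp add: posK_def)
        ultimately show ?thesis using v[of i] by simp
      qed
      then have \<mu>pos: "\<mu> \<in> posK" by (simp add: posK_def)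
      have "invertible Q" using Q(2) TQ by (auto simp: invertible_def)
      then have "Fmat f (A t) = f \<mu>"
        by (intro Fmat_eq[OF sym _ \<mu>pos]) (use Q in \<open>auto simp: eigvals_def\<close>)
      also have "\<dots> = f v" using sym[rule_format, OF p(1) \<mu>pos] by (simp add: v_def)
      finally have Ft: "Fmat f (A t) = f v" .
      have "norm (v - \<kappa>) \<le> (\<Sum>i\<in>UNIV. \<bar>(v - \<kappa>) $ i\<bar>)" by (rule norm_le_l1_cart)
      also have "\<dots> \<le> (\<Sum>i\<in>(UNIV::'n set). K * (L * \<bar>t\<bar>))" using p(2) by (intro sum_mono) (simp add: v)
      finally have nv: "norm (v - \<kappa>) \<le> n * K * L * \<bar>t\<bar>" by (simp add: n_def mult.assoc)
      also have "\<dots> \<le> (n * K * L + 1) * \<bar>t\<bar>" by (simp add: algebra_simps)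
      also have "\<dots> < d2" using td(4) nKL by (simp add: field_simps)
      finally have "norm (f v - f \<kappa> - c \<bullet> (v - \<kappa>)) \<le> e1 * norm (v - \<kappa>)" by (rule d2(2))
      also have "\<dots> \<le> e1 * ((n * K * L + 1) * \<bar>t\<bar>)"
        using nv e1 by (intro mult_left_mono) (auto simp: algebra_simps)
      also have "\<dots> = e / 2 * \<bar>t\<bar>" using nKL by (simp add: e1_def field_simps)
      finally have b1: "\<bar>f v - f \<kappa> - c \<bullet> (v - \<kappa>)\<bar> \<le> e / 2 * \<bar>t\<bar>" by simp
      have "c \<bullet> (v - \<kappa>) = (\<Sum>i\<in>UNIV. c $ i * (\<mu> $ p i - \<kappa> $ i))" by (simp add: inner_vec_def v)
      then have b2: "\<bar>c \<bullet> (v - \<kappa>) - S t\<bar> \<le> K * (L * \<bar>t\<bar>)\<^sup>2" using p(3) by (simp add: S_def)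
      also have "\<dots> = (K * L\<^sup>2) * \<bar>t\<bar> * \<bar>t\<bar>" by (simp add: power2_eq_square mult_ac)
      also have "\<dots> \<le> e / 2 * \<bar>t\<bar>"
      proof (rule mult_right_mono)
        have "(K * L\<^sup>2) * \<bar>t\<bar> \<le> (K * L\<^sup>2 + 1) * \<bar>t\<bar>" by (simp add: algebra_simps)
        also have "\<dots> \<le> e / 2" using td(5) KL(2) by (simp add: field_simps)
        finally show "(K * L\<^sup>2) * \<bar>t\<bar> \<le> e / 2" .
      qed simp
      finally have "\<bar>c \<bullet> (v - \<kappa>) - S t\<bar> \<le> e / 2 * \<bar>t\<bar>" .
      moreover have "e / 2 * \<bar>t\<bar> + e / 2 * \<bar>t\<bar> = e * \<bar>t\<bar>" by simp
      ultimately have "\<bar>f v - f \<kappa> - S t\<bar> \<le> e * \<bar>t\<bar>" using b1 by linarith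
      then show ?thesis by (simp add: F0 S0 Ft algebra_simps)
    qed (simp add: S0)
    ultimately show "\<exists>d>0. \<forall>t. norm (t - 0) < d \<longrightarrow>
        norm (Fmat f (A t) - S t - (Fmat f (A 0) - S 0) - 0) \<le> e * norm (t - 0)" by blast
  qed
  then have "((\<lambda>t. Fmat f (A t) - S t) has_real_derivative 0) (at 0)"
    by (simp add: has_field_derivative_def mult_zero_left[abs_def])
  from DERIV_add[OF this dS] show ?thesis by (simp add: D_def)
qed

section \<open>Partial derivatives and second-order Taylor expansion\<close>

lemma Du_nth [simp]: "Du \<phi> x $ i = pd i \<phi> x"
  by (simp add: Du_def)

lemma D2u_nth [simp]: "D2u \<phi> x $ i $ j = pd i (pd j \<phi>) x"
  by (simp add: D2u_def)

lemma pds_append: "pds (is @ js) \<phi> = pds is (pds js \<phi>)"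
  by (induction "is") auto

lemma smooth_on_pd: "smooth_on U \<phi> \<Longrightarrow> smooth_on U (pd i \<phi>)"
  unfolding smooth_on_def by (metis pds.simps pds_append)

lemma smooth_on_differentiable:
  assumes "smooth_on U \<phi>" "x \<in> U"
  shows "\<phi> differentiable (at x)"
proof -
  have "pds [] \<phi> differentiable_on U" "open U" using assms unfolding smooth_on_def by blast+
  then show ?thesis using assms(2) by (simp add: differentiable_on_eq_differentiable_at)
qed

lemma smooth_on_continuous_on: "smooth_on U \<phi> \<Longrightarrow> continuous_on U \<phi>"
  by (meson smooth_on_differentiable continuous_at_imp_continuous_on differentiable_imp_continuous_within)

lemma smooth_on_has_derivative:
  "smooth_on U \<phi> \<Longrightarrow> x \<in> U \<Longrightarrow> (\<phi> has_derivative (\<lambda>v. Du \<phi> x \<bullet> v)) (at x)"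
  by (intro has_derivative_Du smooth_on_differentiable)

lemma pd_cong:
  assumes "open U" "x \<in> U" "\<And>y. y \<in> U \<Longrightarrow> \<phi> y = \<psi> y"
  shows "pd i \<phi> x = pd i \<psi> x"
proof -
  have "((\<lambda>t. x + t *\<^sub>R axis i 1) \<longlongrightarrow> x + 0 *\<^sub>R axis i 1) (nhds (0::real))"
    by (intro tendsto_intros filterlim_ident)
  then have "\<forall>\<^sub>F t in nhds (0::real). x + t *\<^sub>R axis i 1 \<in> U"
    by (rule topological_tendstoD) (use assms in auto)
  then have "\<forall>\<^sub>F t in nhds (0::real). \<phi> (x + t *\<^sub>R axis i 1) = \<psi> (x + t *\<^sub>R axis i 1)"
    by eventually_elim (rule assms(3))
  then show ?thesis unfolding pd_def by (intro deriv_cong_ev) auto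
qed

text \<open>Pointwise twice differentiability, the regularity on which symmetry of second
  derivatives and the second-order tests below rest.\<close>

definition C2_on :: "(real^'n::finite) set \<Rightarrow> (real^'n \<Rightarrow> real) \<Rightarrow> bool" where
  "C2_on U \<phi> \<longleftrightarrow> open U \<and> (\<forall>x\<in>U. \<phi> differentiable (at x) \<and> (\<forall>j. pd j \<phi> differentiable (at x)))"

lemma smooth_on_C2_on: "smooth_on U \<phi> \<Longrightarrow> C2_on U \<phi>"
  unfolding C2_on_def using smooth_on_pd[of U \<phi>] smooth_on_differentiable[of U] smooth_on_def[of U \<phi>] by blast

lemma C2_on_subset: "C2_on U \<phi> \<Longrightarrow> V \<subseteq> U \<Longrightarrow> open V \<Longrightarrow> C2_on V \<phi>"
  unfolding C2_on_def by blast

lemma DERIV_along_line: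
  assumes "\<phi> differentiable (at (x + t *\<^sub>R \<xi>))"
  shows "((\<lambda>t. \<phi> (x + t *\<^sub>R \<xi>)) has_real_derivative Du \<phi> (x + t *\<^sub>R \<xi>) \<bullet> \<xi>) (at t)"
proof -
  have "((\<lambda>t. x + t *\<^sub>R \<xi>) has_derivative (\<lambda>s. s *\<^sub>R \<xi>)) (at t)"
    by (auto intro!: derivative_eq_intros)
  then have "((\<lambda>t. \<phi> (x + t *\<^sub>R \<xi>)) has_derivative (\<lambda>s. Du \<phi> (x + t *\<^sub>R \<xi>) \<bullet> (s *\<^sub>R \<xi>))) (at t)"
    by (rule has_derivative_compose[where g = \<phi>]) (rule has_derivative_Du[OF assms])
  then show ?thesis by (rule has_derivative_imp_has_field_derivative) simp
qed

lemma DERIV2_along_line: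
  assumes "\<And>j. pd j \<phi> differentiable (at (x + t *\<^sub>R \<xi>))"
  shows "((\<lambda>t. Du \<phi> (x + t *\<^sub>R \<xi>) \<bullet> \<xi>) has_real_derivative \<xi> \<bullet> (D2u \<phi> (x + t *\<^sub>R \<xi>) *v \<xi>)) (at t)"
proof -
  have "((\<lambda>t. \<Sum>j\<in>UNIV. pd j \<phi> (x + t *\<^sub>R \<xi>) * \<xi> $ j) has_real_derivative
     (\<Sum>j\<in>UNIV. (Du (pd j \<phi>) (x + t *\<^sub>R \<xi>) \<bullet> \<xi>) * \<xi> $ j)) (at t)"
    by (intro DERIV_sum DERIV_cmult_right DERIV_along_line assms)
  moreover have "(\<Sum>j\<in>UNIV. (Du (pd j \<phi>) (x + t *\<^sub>R \<xi>) \<bullet> \<xi>) * \<xi> $ j) = \<xi> \<bullet> (D2u \<phi> (x + t *\<^sub>R \<xi>) *v \<xi>)"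
    unfolding inner_vec_def matrix_vector_mult_def
    by (simp add: sum_distrib_left sum_distrib_right) (subst sum.swap, simp add: mult_ac)
  ultimately show ?thesis by (simp add: inner_vec_def)
qed

text \<open>Mean value theorem in direction i for the increment in direction j, then the
  differential of the i-th partial derivative at x. The second difference is symmetric in i and j,
  whence \<open>pd_commute\<close>.\<close>

lemma mixed_difference_quotient:
  fixes \<phi> :: "real^'n::finite \<Rightarrow> real"
  assumes "open U" "x \<in> U" and d: "\<And>y. y \<in> U \<Longrightarrow> \<phi> differentiable (at y)" and d2: "pd i \<phi> differentiable (at x)"
    and "e > 0"
  obtains \<delta> where "\<delta> > 0" "\<And>t. 0 < t \<Longrightarrow> t < \<delta> \<Longrightarrow>
     \<bar>\<phi> (x + t *\<^sub>R axis i 1 + t *\<^sub>R axis j 1) - \<phi> (x + t *\<^sub>R axis i 1) - \<phi> (x + t *\<^sub>R axis j 1) + \<phi> x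
       - t\<^sup>2 * pd j (pd i \<phi>) x\<bar> \<le> e * t\<^sup>2"
proof -
  define \<psi> where "\<psi> = pd i \<phi>"
  have "(\<psi> has_derivative (\<lambda>v. Du \<psi> x \<bullet> v)) (at x)" unfolding \<psi>_def by (rule has_derivative_Du[OF d2])
  \<comment> \<open>The two evaluation points lie within 2 t and t of x, so the errors add up to e *
    t.\<close>
  moreover have "e / 3 > 0" using \<open>e > 0\<close> by simp
  ultimately obtain \<delta>1 where \<delta>1: "\<delta>1 > 0"
    "\<And>y. norm (y - x) < \<delta>1 \<Longrightarrow> norm (\<psi> y - \<psi> x - Du \<psi> x \<bullet> (y - x)) \<le> e / 3 * norm (y - x)"
    unfolding has_derivative_at_alt by blast
  obtain r where r: "r > 0" "ball x r \<subseteq> U" using assms openE by blast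
  define \<delta> where "\<delta> = min \<delta>1 r / 2"
  have nrm: "norm (s *\<^sub>R axis i 1 + t *\<^sub>R axis j 1 :: real^'n) \<le> \<bar>s\<bar> + \<bar>t\<bar>" for s t :: real
    by (rule norm_triangle_le) simp
  show ?thesis
  proof (rule that[of \<delta>])
    show "\<delta> > 0" using r \<delta>1 by (simp add: \<delta>_def)
    fix t :: real assume t: "0 < t" "t < \<delta>"
    define g where "g s = \<phi> ((x + t *\<^sub>R axis j 1) + s *\<^sub>R axis i 1) - \<phi> (x + s *\<^sub>R axis i 1)" for s
    have inU: "x + s *\<^sub>R axis i 1 \<in> U" "(x + t *\<^sub>R axis j 1) + s *\<^sub>R axis i 1 \<in> U" if "0 \<le> s" "s \<le> t" for s
    proof -
      have "norm (s *\<^sub>R axis i 1 + t *\<^sub>R axis j 1 :: real^'n) < r" "norm (s *\<^sub>R axis i 1 :: real^'n) < r"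
        using that t nrm[of s t] by (auto simp: \<delta>_def)
      moreover have "x + v \<in> U" if "norm v < r" for v
        using r(2) that by (auto simp: subset_iff dist_norm)
      ultimately have "x + s *\<^sub>R axis i 1 \<in> U" "x + (s *\<^sub>R axis i 1 + t *\<^sub>R axis j 1) \<in> U" by blast+
      then show "x + s *\<^sub>R axis i 1 \<in> U" "(x + t *\<^sub>R axis j 1) + s *\<^sub>R axis i 1 \<in> U"
        by (simp_all add: add_ac)
    qed
    have dg: "(g has_real_derivative \<psi> ((x + t *\<^sub>R axis j 1) + s *\<^sub>R axis i 1) - \<psi> (x + s *\<^sub>R axis i 1)) (at s)"
      if "0 \<le> s" "s \<le> t" for s
      unfolding g_def \<psi>_def using inU[OF that] DERIV_along_line[OF d, of _ s "axis i 1"]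
      by (intro DERIV_diff) (simp_all add: inner_axis)
    obtain s where s: "0 < s" "s < t" "g t - g 0 = (t - 0) * (\<psi> ((x + t *\<^sub>R axis j 1) + s *\<^sub>R axis i 1) - \<psi> (x + s *\<^sub>R axis i 1))"
      using MVT2[OF t(1) dg] by blast
    define y z where "y = (x + t *\<^sub>R axis j 1) + s *\<^sub>R axis i 1" and "z = x + s *\<^sub>R axis i 1"
    have yx: "norm (y - x) \<le> 2 * t" and zx: "norm (z - x) \<le> t"
      using nrm[of s t] s by (auto simp: y_def z_def algebra_simps)
    have "norm (\<psi> y - \<psi> x - Du \<psi> x \<bullet> (y - x)) \<le> e / 3 * norm (y - x)"
      by (rule \<delta>1(2)) (use yx t in \<open>auto simp: \<delta>_def\<close>)
    also have "\<dots> \<le> e / 3 * (2 * t)" using yx \<open>e > 0\<close> by (intro mult_left_mono) auto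
    finally have 1: "\<bar>\<psi> y - \<psi> x - Du \<psi> x \<bullet> (y - x)\<bar> \<le> e / 3 * (2 * t)" by simp
    have "norm (\<psi> z - \<psi> x - Du \<psi> x \<bullet> (z - x)) \<le> e / 3 * norm (z - x)"
      by (rule \<delta>1(2)) (use zx t in \<open>auto simp: \<delta>_def\<close>)
    also have "\<dots> \<le> e / 3 * t" using zx \<open>e > 0\<close> by (intro mult_left_mono) auto
    finally have 2: "\<bar>\<psi> z - \<psi> x - Du \<psi> x \<bullet> (z - x)\<bar> \<le> e / 3 * t" by simp
    have "Du \<psi> x \<bullet> (y - x) - Du \<psi> x \<bullet> (z - x) = Du \<psi> x \<bullet> (t *\<^sub>R axis j 1)"
      unfolding y_def z_def by (simp add: inner_add_right inner_diff_right)
    also have "\<dots> = t * pd j \<psi> x" by (simp add: inner_axis)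
    finally have 3: "Du \<psi> x \<bullet> (y - x) - Du \<psi> x \<bullet> (z - x) = t * pd j \<psi> x" .
    have "\<bar>(\<psi> y - \<psi> z) - t * pd j \<psi> x\<bar> \<le> e * t"
    proof -
      have "e / 3 * (2 * t) = 2 / 3 * (e * t)" "e / 3 * t = 1 / 3 * (e * t)" by simp_all
      then show ?thesis using 1 2 3 by linarith
    qed
    then have "\<bar>t\<bar> * \<bar>(\<psi> y - \<psi> z) - t * pd j \<psi> x\<bar> \<le> t * (e * t)" using t by (simp add: mult_left_mono)
    then have "\<bar>g t - g 0 - t\<^sup>2 * pd j \<psi> x\<bar> \<le> e * t\<^sup>2"
      using s(3) by (simp add: y_def z_def power2_eq_square algebra_simps flip: abs_mult)
    then show "\<bar>\<phi> (x + t *\<^sub>R axis i 1 + t *\<^sub>R axis j 1) - \<phi> (x + t *\<^sub>R axis i 1) - \<phi> (x + t *\<^sub>R axis j 1) + \<phi> x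
       - t\<^sup>2 * pd j (pd i \<phi>) x\<bar> \<le> e * t\<^sup>2" by (simp add: g_def \<psi>_def algebra_simps)
  qed
qed

lemma pd_commute:
  assumes "C2_on U \<phi>" "x \<in> U"
  shows "pd i (pd j \<phi>) x = pd j (pd i \<phi>) x"
proof -
  have U: "open U" "\<And>y. y \<in> U \<Longrightarrow> \<phi> differentiable (at y)" "\<And>j. pd j \<phi> differentiable (at x)"
    using assms by (auto simp: C2_on_def)
  have "\<bar>pd i (pd j \<phi>) x - pd j (pd i \<phi>) x\<bar> \<le> e" if "e > 0" for e
  proof -
    have e2: "e / 2 > 0" using that by simp
    define \<Delta> where "\<Delta> t = \<phi> (x + t *\<^sub>R axis i 1 + t *\<^sub>R axis j 1) - \<phi> (x + t *\<^sub>R axis i 1) - \<phi> (x + t *\<^sub>R axis j 1) + \<phi> x" for t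
    obtain \<delta>1 where 1: "\<delta>1 > 0" "\<And>t. 0 < t \<Longrightarrow> t < \<delta>1 \<Longrightarrow> \<bar>\<Delta> t - t\<^sup>2 * pd j (pd i \<phi>) x\<bar> \<le> e / 2 * t\<^sup>2"
      using mixed_difference_quotient[OF U(1) assms(2) U(2,3) e2, of i j] unfolding \<Delta>_def by metis
    obtain \<delta>2 where 2: "\<delta>2 > 0" "\<And>t. 0 < t \<Longrightarrow> t < \<delta>2 \<Longrightarrow> \<bar>\<phi> (x + t *\<^sub>R axis j 1 + t *\<^sub>R axis i 1) - \<phi> (x + t *\<^sub>R axis j 1) - \<phi> (x + t *\<^sub>R axis i 1) + \<phi> x - t\<^sup>2 * pd i (pd j \<phi>) x\<bar> \<le> e / 2 * t\<^sup>2"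
      using mixed_difference_quotient[OF U(1) assms(2) U(2,3) e2, of j i] by metis
    define t where "t = min \<delta>1 \<delta>2 / 2"
    have t: "0 < t" "t < \<delta>1" "t < \<delta>2" using 1 2 by (auto simp: t_def)
    have "\<bar>\<Delta> t - t\<^sup>2 * pd i (pd j \<phi>) x\<bar> \<le> e / 2 * t\<^sup>2"
      using 2(2)[OF t(1,3)] by (simp add: \<Delta>_def algebra_simps)
    with 1(2)[OF t(1,2)] have "\<bar>t\<^sup>2 * pd i (pd j \<phi>) x - t\<^sup>2 * pd j (pd i \<phi>) x\<bar> \<le> e / 2 * t\<^sup>2 + e / 2 * t\<^sup>2"
      by linarith
    then have "t\<^sup>2 * \<bar>pd i (pd j \<phi>) x - pd j (pd i \<phi>) x\<bar> \<le> t\<^sup>2 * e"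
      by (simp add: abs_mult right_diff_distrib[symmetric] mult.commute[of "t\<^sup>2" e])
    then show ?thesis using t(1) by simp
  qed
  then show ?thesis by (metis abs_le_zero_iff eq_iff_diff_eq_0 field_le_epsilon add_0)
qed

text \<open>If c were negative, g' would be negative just to the right of 0 and g would drop below g
  0. Comparing with t > 0 only makes the test usable at boundary points.\<close>

lemma second_derivative_nonneg:
  fixes g g' :: "real \<Rightarrow> real"
  assumes "d > 0" and min: "\<And>t. 0 < t \<Longrightarrow> t < d \<Longrightarrow> g 0 \<le> g t"
    and g: "\<And>t. 0 \<le> t \<Longrightarrow> t < d \<Longrightarrow> (g has_real_derivative g' t) (at t)"
    and g': "(g' has_real_derivative c) (at 0)" "g' 0 = 0"
  shows "c \<ge> 0"
proof (rule ccontr)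
  assume "\<not> c \<ge> 0"
  then obtain r where r: "r > 0" "\<And>h. 0 < h \<Longrightarrow> h < r \<Longrightarrow> g' (0 + h) < g' 0"
    using DERIV_neg_dec_right[OF g'(1)] by auto
  define t where "t = min d r / 2"
  have t: "0 < t" "t < d" "t < r" using r \<open>d > 0\<close> by (auto simp: t_def)
  obtain z where z: "0 < z" "z < t" "g t - g 0 = (t - 0) * g' z"
    using MVT2[OF t(1), of g g'] g t by auto
  have "g' z < 0" using r(2)[of z] z t g'(2) by simp
  then have "(t - 0) * g' z < 0" using t by (simp add: mult_less_0_iff)
  then have "g t < g 0" using z(3) by linarith
  with min[OF t(1,2)] show False by simp
qed

text \<open>A second-order test along a single ray, which may start at a boundary point and run
  inward. The barrier enters as a function \<psi> of the ray parameter.\<close>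

lemma C2_on_line_nonneg:
  assumes \<phi>: "C2_on U \<phi>" "x \<in> U" and \<psi>: "\<And>t. (\<psi> has_real_derivative \<psi>' t) (at t)"
    and \<psi>2: "(\<psi>' has_real_derivative c) (at 0)"
    and "d > 0" and min: "\<And>t. 0 < t \<Longrightarrow> t < d \<Longrightarrow> \<phi> x + \<psi> 0 \<le> \<phi> (x + t *\<^sub>R \<xi>) + \<psi> t"
    and crit: "Du \<phi> x \<bullet> \<xi> + \<psi>' 0 = 0"
  shows "\<xi> \<bullet> (D2u \<phi> x *v \<xi>) + c \<ge> 0"
proof -
  have U: "open U" "\<And>y. y \<in> U \<Longrightarrow> \<phi> differentiable (at y)" "\<And>j y. y \<in> U \<Longrightarrow> pd j \<phi> differentiable (at y)"
    using \<phi> by (auto simp: C2_on_def)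
  have "((\<lambda>t. x + t *\<^sub>R \<xi>) \<longlongrightarrow> x + 0 *\<^sub>R \<xi>) (nhds (0::real))"
    by (intro tendsto_intros filterlim_ident)
  then have "\<forall>\<^sub>F t in nhds (0::real). x + t *\<^sub>R \<xi> \<in> U"
    by (rule topological_tendstoD) (use U \<phi> in auto)
  then obtain d1 where d1: "d1 > 0" "\<And>t. \<bar>t\<bar> < d1 \<Longrightarrow> x + t *\<^sub>R \<xi> \<in> U"
    unfolding eventually_nhds_metric dist_real_def by auto
  show ?thesis
  proof (rule second_derivative_nonneg[where d = "min d d1"])
    show "min d d1 > 0" using d1 \<open>d > 0\<close> by simp
    show "\<phi> (x + 0 *\<^sub>R \<xi>) + \<psi> 0 \<le> \<phi> (x + t *\<^sub>R \<xi>) + \<psi> t" if "0 < t" "t < min d d1" for t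
      using min that by simp
    show "((\<lambda>t. \<phi> (x + t *\<^sub>R \<xi>) + \<psi> t) has_real_derivative Du \<phi> (x + t *\<^sub>R \<xi>) \<bullet> \<xi> + \<psi>' t) (at t)"
      if "0 \<le> t" "t < min d d1" for t
      using that by (intro DERIV_add DERIV_along_line U \<psi> d1) auto
    show "((\<lambda>t. Du \<phi> (x + t *\<^sub>R \<xi>) \<bullet> \<xi> + \<psi>' t) has_real_derivative \<xi> \<bullet> (D2u \<phi> x *v \<xi>) + c) (at 0)"
      using DERIV_add[OF DERIV2_along_line[of \<phi> x 0 \<xi>] \<psi>2] U(3) \<phi>(2) by simp
    show "Du \<phi> (x + 0 *\<^sub>R \<xi>) \<bullet> \<xi> + \<psi>' 0 = 0" using crit by simp
  qed
qed

lemma line_min_critical: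
  assumes "open U" "x \<in> U" "\<phi> differentiable (at x)" and \<psi>: "(\<psi> has_real_derivative c) (at 0)"
    and min: "\<And>t. x + t *\<^sub>R \<xi> \<in> U \<Longrightarrow> \<phi> x + \<psi> 0 \<le> \<phi> (x + t *\<^sub>R \<xi>) + \<psi> t"
  shows "Du \<phi> x \<bullet> \<xi> + c = 0"
proof -
  have "((\<lambda>t. x + t *\<^sub>R \<xi>) \<longlongrightarrow> x + 0 *\<^sub>R \<xi>) (nhds (0::real))"
    by (intro tendsto_intros filterlim_ident)
  then have "\<forall>\<^sub>F t in nhds (0::real). x + t *\<^sub>R \<xi> \<in> U"
    by (rule topological_tendstoD) (use assms in auto)
  then obtain d1 where d1: "d1 > 0" "\<And>t. \<bar>t\<bar> < d1 \<Longrightarrow> x + t *\<^sub>R \<xi> \<in> U"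
    unfolding eventually_nhds_metric dist_real_def by auto
  have "((\<lambda>t. \<phi> (x + t *\<^sub>R \<xi>) + \<psi> t) has_real_derivative Du \<phi> (x + 0 *\<^sub>R \<xi>) \<bullet> \<xi> + c) (at 0)"
    by (intro DERIV_add DERIV_along_line \<psi>) (use assms in simp)
  from DERIV_local_min[OF this d1(1)] show ?thesis
    using min d1 by simp
qed

section \<open>The Hopf lemma and the minimum principle\<close>

text \<open>The coefficient matrix is given in factored form, as the sum of P_a P_a^T, so a sign of
  all second directional derivatives passes to the operator term by term.\<close>

definition lin_op :: "(real^'n::finite \<Rightarrow> 'n \<Rightarrow> real^'n) \<Rightarrow> (real^'n \<Rightarrow> real^'n) \<Rightarrow> (real^'n \<Rightarrow> real) \<Rightarrow> real^'n \<Rightarrow> real" where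
  "lin_op P b \<psi> x = (\<Sum>a\<in>UNIV. P x a \<bullet> (D2u \<psi> x *v P x a)) + b x \<bullet> Du \<psi> x"

text \<open>Bounds uniform on the domain for coefficients chosen independently at each point, as
  eigenframes are.\<close>

definition uniformly_elliptic :: "(real^'n::finite) set \<Rightarrow> (real^'n \<Rightarrow> 'n \<Rightarrow> real^'n) \<Rightarrow> (real^'n \<Rightarrow> real^'n) \<Rightarrow> bool" where
  "uniformly_elliptic \<Omega> P b \<longleftrightarrow> (\<exists>\<theta>>0. \<exists>\<Lambda>. \<forall>x\<in>\<Omega>. (\<forall>z. \<theta> * (norm z)\<^sup>2 \<le> (\<Sum>a\<in>UNIV. (P x a \<bullet> z)\<^sup>2)) \<and>
     (\<Sum>a\<in>UNIV. (norm (P x a))\<^sup>2) \<le> \<Lambda> \<and> norm (b x) \<le> \<Lambda>)"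

lemma gaussian_has_derivative:
  fixes y :: "real^'n::finite"
  shows "((\<lambda>x. exp (- \<alpha> * (norm (x - y))\<^sup>2)) has_derivative
     (\<lambda>v. - 2 * \<alpha> * exp (- \<alpha> * (norm (x - y))\<^sup>2) * ((x - y) \<bullet> v))) (at x)"
  unfolding power2_norm_eq_inner
  by (auto intro!: derivative_eq_intros simp: inner_commute algebra_simps)

lemma gaussian_C2:
  fixes y :: "real^'n::finite" and \<alpha> c :: real
  defines "h \<equiv> \<lambda>x. exp (- \<alpha> * (norm (x - y))\<^sup>2) - c"
  shows "C2_on UNIV h"
    and "Du h x \<bullet> v = - 2 * \<alpha> * exp (- \<alpha> * (norm (x - y))\<^sup>2) * ((x - y) \<bullet> v)"
    and "v \<bullet> (D2u h x *v v) = 2 * \<alpha> * exp (- \<alpha> * (norm (x - y))\<^sup>2) * (2 * \<alpha> * ((x - y) \<bullet> v)\<^sup>2 - (norm v)\<^sup>2)"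
proof -
  define e where "e x = exp (- \<alpha> * (norm (x - y))\<^sup>2)" for x
  have e: "(e has_derivative (\<lambda>v. - 2 * \<alpha> * e x * ((x - y) \<bullet> v))) (at x)" for x
    unfolding e_def by (rule gaussian_has_derivative)
  have h: "(h has_derivative (\<lambda>v. - 2 * \<alpha> * e x * ((x - y) \<bullet> v))) (at x)" for x
    using has_derivative_diff[OF e[of x] has_derivative_const[of c]] by (simp add: h_def e_def)
  have pd_h: "pd j h = (\<lambda>x. - 2 * \<alpha> * e x * (x - y) $ j)" for j
    by (rule ext) (simp add: pd_eqI[OF h] inner_axis)
  have h2: "(pd j h has_derivative (\<lambda>v. - 2 * \<alpha> * (e x * v $ j + (- 2 * \<alpha> * e x * ((x - y) \<bullet> v)) * (x - y) $ j))) (at x)" for j x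
    unfolding pd_h
    by (auto intro!: derivative_eq_intros e bounded_linear.has_derivative[OF bounded_linear_vec_nth] simp: algebra_simps)
  show "C2_on UNIV h" unfolding C2_on_def differentiable_def using h h2 by blast
  have "Du h x \<bullet> v = (\<Sum>j\<in>UNIV. - 2 * \<alpha> * e x * ((x - y) $ j * v $ j))"
    unfolding inner_vec_def by (simp add: pd_h algebra_simps)
  also have "\<dots> = - 2 * \<alpha> * e x * ((x - y) \<bullet> v)"
    unfolding inner_vec_def by (simp add: sum_distrib_left)
  finally show "Du h x \<bullet> v = - 2 * \<alpha> * exp (- \<alpha> * (norm (x - y))\<^sup>2) * ((x - y) \<bullet> v)" by (simp add: e_def)
  define z where "z = x - y"
  have D2: "D2u h x $ i $ j = 4 * \<alpha>\<^sup>2 * e x * (z $ i * z $ j) - 2 * \<alpha> * e x * (if i = j then 1 else 0)" for i j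
  proof -
    have "z \<bullet> axis i 1 = z $ i" "axis i (1::real) $ j = (if i = j then 1 else 0)"
      by (simp add: inner_axis) (simp add: axis_def)
    then show ?thesis unfolding D2u_nth pd_eqI[OF h2] z_def[symmetric]
      by (simp only:) (simp add: power2_eq_square algebra_simps)
  qed
  have "v \<bullet> (D2u h x *v v) = (\<Sum>i\<in>UNIV. v $ i * (\<Sum>j\<in>UNIV. D2u h x $ i $ j * v $ j))"
    by (simp add: inner_vec_def matrix_vector_mult_def)
  also have "\<dots> = (\<Sum>i\<in>UNIV. v $ i * (4 * \<alpha>\<^sup>2 * e x * z $ i * (z \<bullet> v) - 2 * \<alpha> * e x * v $ i))"
    unfolding D2 left_diff_distrib sum_subtractf inner_vec_def
    by (simp add: sum_distrib_left mult_ac if_distrib[where f="\<lambda>x. _ * x"] cong: if_cong)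
  also have "\<dots> = 4 * \<alpha>\<^sup>2 * e x * (z \<bullet> v) * (\<Sum>i\<in>UNIV. z $ i * v $ i) - 2 * \<alpha> * e x * (v \<bullet> v)"
    unfolding inner_vec_def[of v] by (simp add: right_diff_distrib sum_subtractf sum_distrib_left mult_ac)
  also have "(\<Sum>i\<in>UNIV. z $ i * v $ i) = z \<bullet> v" by (simp add: inner_vec_def)
  finally show "v \<bullet> (D2u h x *v v) = 2 * \<alpha> * exp (- \<alpha> * (norm (x - y))\<^sup>2) * (2 * \<alpha> * ((x - y) \<bullet> v)\<^sup>2 - (norm v)\<^sup>2)"
    unfolding power2_norm_eq_inner[of v] e_def z_def by (simp add: algebra_simps power2_eq_square)
qed

text \<open>Compare with the barrier \<open>exp (- \<alpha> |x - y|\<^sup>2) - exp (- \<alpha> r\<^sup>2)\<close> on the annulus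
  \<open>r/2 \<le> |x - y| \<le> r\<close>, on which it is a strict subsolution for large \<open>\<alpha>\<close>.\<close>
lemma Hopf_boundary_point:
  fixes \<phi> :: "real^'n::finite \<Rightarrow> real"
  assumes ell: "uniformly_elliptic \<Omega> P b" and \<phi>: "C2_on \<Omega> \<phi>"
    and L: "\<And>x. x \<in> \<Omega> \<Longrightarrow> lin_op P b \<phi> x \<le> 0"
    and r: "r > 0" "ball y r \<subseteq> \<Omega>" and cont: "continuous_on (cball y r) \<phi>"
    and x0: "dist y x0 = r" "\<phi> x0 = m"
    and pos: "\<And>x. x \<in> ball y r \<Longrightarrow> \<phi> x > m" and nn: "\<And>x. x \<in> cball y r \<Longrightarrow> \<phi> x \<ge> m"
    and D: "\<phi> differentiable (at x0)"
  shows "Du \<phi> x0 \<bullet> (y - x0) > 0"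
proof -
  obtain \<theta> \<Lambda> where \<theta>: "\<theta> > 0" and
    el: "\<And>x z. x \<in> \<Omega> \<Longrightarrow> \<theta> * (norm z)\<^sup>2 \<le> (\<Sum>a\<in>UNIV. (P x a \<bullet> z)\<^sup>2)"
      "\<And>x. x \<in> \<Omega> \<Longrightarrow> (\<Sum>a\<in>UNIV. (norm (P x a))\<^sup>2) \<le> \<Lambda>" "\<And>x. x \<in> \<Omega> \<Longrightarrow> norm (b x) \<le> \<Lambda>"
    using ell unfolding uniformly_elliptic_def by blast
  define K where "K = \<bar>\<Lambda>\<bar> * (1 + r)"
  have K: "K \<ge> 0" using r by (simp add: K_def)
  \<comment> \<open>Gives 2 \<alpha> \<theta> (r/2)^2 = K + 1/2, which beats the trace and drift
    terms, together at most K, as long as |x - y| \<ge> r/2.\<close>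
  define \<alpha> where "\<alpha> = (2 * K + 1) / (\<theta> * r\<^sup>2)"
  have \<alpha>: "\<alpha> > 0" using K \<theta> r by (simp add: \<alpha>_def)
  define h where "h = (\<lambda>x. exp (- \<alpha> * (norm (x - y))\<^sup>2) - exp (- \<alpha> * r\<^sup>2))"
  note hC2 = gaussian_C2[where \<alpha> = \<alpha> and y = y and c = "exp (- \<alpha> * r\<^sup>2)", folded h_def]
  have hd: "h differentiable (at x)" "pd j h differentiable (at x)" for x j using hC2(1) by (auto simp: C2_on_def)
  have Lh: "lin_op P b h x > 0" if x: "x \<in> ball y r" "r / 2 \<le> norm (x - y)" for x
  proof -
    define e where "e = exp (- \<alpha> * (norm (x - y))\<^sup>2)"
    have x\<Omega>: "x \<in> \<Omega>" using x r by auto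
    have nz: "norm (x - y) < r" using x by (simp add: dist_norm norm_minus_commute)
    have "lin_op P b h x = 2 * \<alpha> * e * (2 * \<alpha> * (\<Sum>a\<in>UNIV. (P x a \<bullet> (x - y))\<^sup>2) - (\<Sum>a\<in>UNIV. (norm (P x a))\<^sup>2) - (x - y) \<bullet> b x)"
      unfolding lin_op_def hC2(3) inner_commute[of "b x"] hC2(2) e_def[symmetric]
      by (simp add: sum_distrib_left sum_subtractf algebra_simps inner_commute)
    moreover have "2 * \<alpha> * (\<Sum>a\<in>UNIV. (P x a \<bullet> (x - y))\<^sup>2) - (\<Sum>a\<in>UNIV. (norm (P x a))\<^sup>2) - (x - y) \<bullet> b x > 0"
    proof -
      have "\<theta> * (r / 2)\<^sup>2 \<le> \<theta> * (norm (x - y))\<^sup>2"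
        using x(2) r \<theta> by (intro mult_left_mono power_mono) auto
      also have "\<dots> \<le> (\<Sum>a\<in>UNIV. (P x a \<bullet> (x - y))\<^sup>2)" by (rule el(1)[OF x\<Omega>])
      finally have "2 * \<alpha> * (\<theta> * (r / 2)\<^sup>2) \<le> 2 * \<alpha> * (\<Sum>a\<in>UNIV. (P x a \<bullet> (x - y))\<^sup>2)"
        using \<alpha> by (intro mult_left_mono) auto
      moreover have "2 * \<alpha> * (\<theta> * (r / 2)\<^sup>2) = K + 1 / 2" using \<theta> r by (simp add: \<alpha>_def power2_eq_square)
      moreover have "(x - y) \<bullet> b x \<le> r * \<bar>\<Lambda>\<bar>"
      proof -
        have "(x - y) \<bullet> b x \<le> norm (x - y) * norm (b x)" by (rule norm_cauchy_schwarz)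
        also have "\<dots> \<le> r * \<bar>\<Lambda>\<bar>" using nz r el(3)[OF x\<Omega>] by (intro mult_mono) auto
        finally show ?thesis .
      qed
      moreover have "K = \<bar>\<Lambda>\<bar> + r * \<bar>\<Lambda>\<bar>" by (simp add: K_def algebra_simps)
      ultimately show ?thesis using el(2)[OF x\<Omega>] by linarith
    qed
    ultimately show ?thesis using \<alpha> by (simp add: e_def)
  qed
  \<comment> \<open>The inner sphere is a compact subset of the open ball, so \<phi> exceeds m there
    by a fixed amount; as h \<le> 1, subtracting \<delta> * h keeps the value above m.\<close>
  obtain \<delta> where \<delta>: "\<delta> > 0" "\<And>x. norm (x - y) = r / 2 \<Longrightarrow> \<phi> x \<ge> m + \<delta>"
  proof -
    have sub: "sphere y (r / 2) \<subseteq> ball y r" using r by (auto simp: dist_norm)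
    then have "continuous_on (sphere y (r / 2)) \<phi>" using cont by (meson ball_subset_cball continuous_on_subset order_trans)
    moreover have "x0 + (1/2) *\<^sub>R (y - x0) \<in> sphere y (r / 2)"
    proof -
      have "y - (x0 + (1/2) *\<^sub>R (y - x0)) = (1/2) *\<^sub>R (y - x0)" by (simp add: vec_eq_iff field_simps)
      then show ?thesis using x0(1) unfolding mem_sphere dist_norm by (simp only: norm_scaleR)
    qed
    ultimately obtain x1 where x1: "x1 \<in> sphere y (r / 2)" "\<And>x. x \<in> sphere y (r / 2) \<Longrightarrow> \<phi> x1 \<le> \<phi> x"
      using continuous_attains_inf[of "sphere y (r/2)" \<phi>] compact_sphere by blast
    show ?thesis
    proof (rule that[of "\<phi> x1 - m"])
      show "\<phi> x1 - m > 0" using pos[of x1] x1 sub by auto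
      show "m + (\<phi> x1 - m) \<le> \<phi> x" if "norm (x - y) = r / 2" for x
        using x1(2)[of x] that by (simp add: dist_norm norm_minus_commute)
    qed
  qed
  have h1: "h x \<le> 1" for x
  proof -
    have "exp (- \<alpha> * (norm (x - y))\<^sup>2) \<le> 1" using \<alpha> by simp
    moreover have "exp (- \<alpha> * r\<^sup>2) > 0" by simp
    ultimately show ?thesis unfolding h_def by linarith
  qed
  define A where "A = cball y r - ball y (r / 2)"
  have ge: "m \<le> \<phi> x - \<delta> * h x" if "x \<in> A" for x
  proof -
    have Ane: "A \<noteq> {}" using that by auto
    have "compact A" unfolding A_def by (intro compact_diff) auto
    moreover have "continuous_on A (\<lambda>x. \<phi> x - \<delta> * h x)"
      unfolding h_def A_def
      by (intro continuous_intros continuous_on_subset[OF cont]) auto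
    ultimately obtain x1 where x1: "x1 \<in> A" "\<And>x. x \<in> A \<Longrightarrow> \<phi> x1 - \<delta> * h x1 \<le> \<phi> x - \<delta> * h x"
      using continuous_attains_inf[of A "\<lambda>x. \<phi> x - \<delta> * h x"] Ane by blast
    have "m \<le> \<phi> x1 - \<delta> * h x1"
    proof -
      consider "norm (x1 - y) = r / 2" | "norm (x1 - y) = r" | "r / 2 < norm (x1 - y)" "norm (x1 - y) < r"
        using x1(1) by (force simp: A_def dist_norm norm_minus_commute)
      then show ?thesis
      proof cases
        case 1
        have "\<delta> * h x1 \<le> \<delta> * 1" using h1 \<delta> by (intro mult_left_mono) auto
        then show ?thesis using \<delta>(2)[OF 1] by linarith
      next
        case 2
        then have "h x1 = 0" by (simp add: h_def)
        then show ?thesis using nn x1(1) by (simp add: A_def)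
      next
        case 3
        \<comment> \<open>An interior minimum of \<phi> - \<delta> h would give it a nonnegative
          operator value, against L \<phi> \<le> 0 < L h.\<close>
        define U where "U = ball y r - cball y (r / 2)"
        have U: "open U" "x1 \<in> U" "U \<subseteq> A" "U \<subseteq> \<Omega>"
          using 3 r by (auto simp: U_def A_def dist_norm norm_minus_commute)
        have \<phi>U: "C2_on U \<phi>" using C2_on_subset[OF \<phi> U(4,1)] .
        have d\<phi>: "\<phi> differentiable (at x1)" using \<phi>U U by (auto simp: C2_on_def)
        have along: "((\<lambda>t. - \<delta> * h (x1 + t *\<^sub>R \<xi>)) has_real_derivative - \<delta> * (Du h (x1 + t *\<^sub>R \<xi>) \<bullet> \<xi>)) (at t)" for t \<xi>
          by (intro DERIV_cmult DERIV_along_line hd)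
        have crit: "Du \<phi> x1 \<bullet> \<xi> + - \<delta> * (Du h (x1 + 0 *\<^sub>R \<xi>) \<bullet> \<xi>) = 0" for \<xi>
          by (rule line_min_critical[OF U(1,2) d\<phi> along]) (use x1 U in auto)
        have second: "\<xi> \<bullet> (D2u \<phi> x1 *v \<xi>) + - \<delta> * (\<xi> \<bullet> (D2u h x1 *v \<xi>)) \<ge> 0" for \<xi>
        proof -
          have "((\<lambda>t. x1 + t *\<^sub>R \<xi>) \<longlongrightarrow> x1 + 0 *\<^sub>R \<xi>) (nhds (0::real))"
            by (intro tendsto_intros filterlim_ident)
          then have "\<forall>\<^sub>F t in nhds (0::real). x1 + t *\<^sub>R \<xi> \<in> U"
            by (rule topological_tendstoD) (use U in auto)
          then obtain d where d: "d > 0" "\<And>t. \<bar>t\<bar> < d \<Longrightarrow> x1 + t *\<^sub>R \<xi> \<in> U"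
            unfolding eventually_nhds_metric dist_real_def by auto
          show ?thesis
          proof (rule C2_on_line_nonneg[OF \<phi>U U(2) along _ d(1)])
            show "((\<lambda>t. - \<delta> * (Du h (x1 + t *\<^sub>R \<xi>) \<bullet> \<xi>)) has_real_derivative - \<delta> * (\<xi> \<bullet> (D2u h x1 *v \<xi>))) (at 0)"
              using DERIV_cmult[OF DERIV2_along_line[of h x1 0 \<xi>], of "- \<delta>"] hd by simp
            show "\<phi> x1 + - \<delta> * h (x1 + 0 *\<^sub>R \<xi>) \<le> \<phi> (x1 + t *\<^sub>R \<xi>) + - \<delta> * h (x1 + t *\<^sub>R \<xi>)"
              if "0 < t" "t < d" for t
              using x1(2)[of "x1 + t *\<^sub>R \<xi>"] d(2)[of t] that U(3) by auto
          qed (rule crit)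
        qed
        have "0 \<le> (\<Sum>a\<in>UNIV. P x1 a \<bullet> (D2u \<phi> x1 *v P x1 a) + - \<delta> * (P x1 a \<bullet> (D2u h x1 *v P x1 a)))"
          by (intro sum_nonneg second)
        also have "\<dots> = lin_op P b \<phi> x1 - \<delta> * lin_op P b h x1"
          using crit[of "b x1"] unfolding lin_op_def
          by (simp add: sum_subtractf sum_distrib_left algebra_simps inner_commute)
        finally have "\<delta> * lin_op P b h x1 \<le> 0" using L[of x1] U by auto
        moreover have "\<delta> * lin_op P b h x1 > 0"
          using \<delta> Lh[of x1] 3 by (simp add: dist_norm norm_minus_commute)
        ultimately show ?thesis by simp
      qed
    qed
    with x1(2)[OF that] show ?thesis by simp
  qed
  define v where "v = y - x0"
  have nv: "norm v = r" using x0 by (simp add: v_def dist_norm)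
  have hx0: "h x0 = 0" using nv by (simp add: h_def v_def norm_minus_commute)
  have k: "((\<lambda>t. \<phi> (x0 + t *\<^sub>R v) - \<delta> * h (x0 + t *\<^sub>R v)) has_real_derivative
      (Du \<phi> (x0 + 0 *\<^sub>R v) \<bullet> v - \<delta> * (Du h (x0 + 0 *\<^sub>R v) \<bullet> v))) (at 0)"
    by (intro DERIV_diff DERIV_cmult DERIV_along_line hd) (use D in simp)
  \<comment> \<open>The difference \<phi> - \<delta> h attains its minimum over the annulus at x0,
    so its inward derivative is nonnegative there, while that of h is positive.\<close>
  have "Du \<phi> x0 \<bullet> v - \<delta> * (Du h x0 \<bullet> v) \<ge> 0"
  proof (rule ccontr)
    assume "\<not> ?thesis"
    then have neg: "Du \<phi> (x0 + 0 *\<^sub>R v) \<bullet> v - \<delta> * (Du h (x0 + 0 *\<^sub>R v) \<bullet> v) < 0" by simp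
    obtain d where d: "d > 0" "\<And>s. 0 < s \<Longrightarrow> s < d \<Longrightarrow>
       \<phi> (x0 + (0 + s) *\<^sub>R v) - \<delta> * h (x0 + (0 + s) *\<^sub>R v) < \<phi> (x0 + 0 *\<^sub>R v) - \<delta> * h (x0 + 0 *\<^sub>R v)"
      using DERIV_neg_dec_right[OF k neg] by blast
    define s where "s = min d 1 / 2"
    have s: "0 < s" "s < d" "s \<le> 1 / 2" using d by (auto simp: s_def)
    have "y - (x0 + s *\<^sub>R v) = (1 - s) *\<^sub>R v" by (simp add: v_def algebra_simps)
    then have "dist y (x0 + s *\<^sub>R v) = (1 - s) * r" using s nv by (simp add: dist_norm)
    moreover have "(1 - s) * r \<le> 1 * r" "1 / 2 * r \<le> (1 - s) * r" using s r by (intro mult_right_mono; simp)+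
    ultimately have "x0 + s *\<^sub>R v \<in> A" by (simp add: A_def)
    from ge[OF this] d(2)[OF s(1,2)] x0(2) hx0 show False by simp
  qed
  moreover have "Du h x0 \<bullet> v = 2 * \<alpha> * exp (- \<alpha> * r\<^sup>2) * r\<^sup>2"
  proof -
    have "x0 - y = - v" by (simp add: v_def)
    moreover have "v \<bullet> v = r\<^sup>2" using nv by (simp add: power2_norm_eq_inner[symmetric])
    ultimately show ?thesis using hC2(2)[of x0 v] nv by simp
  qed
  moreover have "\<delta> * (2 * \<alpha> * exp (- \<alpha> * r\<^sup>2) * r\<^sup>2) > 0" using \<delta> \<alpha> r by simp
  ultimately have "Du \<phi> x0 \<bullet> v > 0" by (metis diff_ge_0_iff_ge less_le_trans)
  then show ?thesis by (simp add: v_def)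
qed

text \<open>The minimum set is open: otherwise a ball about a nearby point outside it touches it at
  some x0 of the domain, where the Hopf lemma yields a nonzero gradient although x0 is an interior
  minimum.\<close>

lemma strong_minimum_principle:
  fixes \<phi> :: "real^'n::finite \<Rightarrow> real"
  assumes ell: "uniformly_elliptic \<Omega> P b" and \<phi>: "C2_on \<Omega> \<phi>" and conn: "connected \<Omega>"
    and L: "\<And>x. x \<in> \<Omega> \<Longrightarrow> lin_op P b \<phi> x \<le> 0"
    and min: "\<And>x. x \<in> \<Omega> \<Longrightarrow> m \<le> \<phi> x" and z: "z \<in> \<Omega>" "\<phi> z = m"
    and "x \<in> \<Omega>"
  shows "\<phi> x = m"
proof -
  have op: "open \<Omega>" and dif: "\<And>x. x \<in> \<Omega> \<Longrightarrow> \<phi> differentiable (at x)" using \<phi> by (auto simp: C2_on_def)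
  have cont: "continuous_on \<Omega> \<phi>"
    using dif by (meson continuous_at_imp_continuous_on differentiable_imp_continuous_within)
  define Z where "Z = {x\<in>\<Omega>. \<phi> x = m}"
  have "openin (top_of_set \<Omega>) Z"
  proof -
    have "\<exists>e>0. ball x e \<subseteq> Z" if "x \<in> Z" for x
    proof -
      have x: "x \<in> \<Omega>" "\<phi> x = m" using that by (auto simp: Z_def)
      obtain r where r: "r > 0" "cball x r \<subseteq> \<Omega>" using op x open_contains_cball by blast
      \<comment> \<open>Half the radius keeps the ball about y that reaches its nearest point of S
        inside \<open>cball x r\<close>.\<close>
      have "ball x (r / 2) \<subseteq> Z"
      proof
        fix y assume y: "y \<in> ball x (r / 2)"
        have yr: "y \<in> \<Omega>" using y r by (auto simp: subset_iff)
        show "y \<in> Z"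
        proof (rule ccontr)
          assume "y \<notin> Z"
          define S where "S = {w \<in> cball x r. \<phi> w = m}"
          have "closed S" unfolding S_def
            by (intro continuous_closed_preimage_constant continuous_on_subset[OF cont] r) auto
          moreover have "bounded S" by (rule bounded_subset[of "cball x r"]) (auto simp: S_def)
          ultimately have "compact S" by (simp add: compact_eq_bounded_closed)
          moreover have "x \<in> S" using r x by (auto simp: S_def)
          ultimately obtain x0 where x0: "x0 \<in> S" "\<And>w. w \<in> S \<Longrightarrow> dist y x0 \<le> dist y w"
            using distance_attains_inf[of S y] compact_imp_closed by blast
          define \<rho> where "\<rho> = dist y x0"
          have x0': "x0 \<in> \<Omega>" "\<phi> x0 = m" using x0 r by (auto simp: S_def)
          have "\<rho> > 0" using \<open>y \<notin> Z\<close> x0' by (auto simp: \<rho>_def Z_def)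
          have \<rho>r: "\<rho> < r / 2" using x0(2)[OF \<open>x \<in> S\<close>] y by (simp add: \<rho>_def dist_commute)
          have sub: "w \<in> cball x r" if "dist y w \<le> \<rho>" for w
            using that \<rho>r y dist_triangle[of x w y] by simp
          have "Du \<phi> x0 \<bullet> (y - x0) > 0"
          proof (rule Hopf_boundary_point[OF ell \<phi> L \<open>\<rho> > 0\<close>])
            show "ball y \<rho> \<subseteq> \<Omega>" using sub r(2) by (auto simp del: mem_cball intro: less_imp_le)
            show "continuous_on (cball y \<rho>) \<phi>"
            proof (rule continuous_on_subset[OF cont])
              show "cball y \<rho> \<subseteq> \<Omega>" using sub r(2) by (metis mem_cball subsetD subsetI)
            qed
            show "m < \<phi> w" if "w \<in> ball y \<rho>" for w
            proof -
              have "w \<in> cball x r" using that by (intro sub) simp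
              moreover have "w \<notin> S" using x0(2)[of w] that by (auto simp: \<rho>_def)
              ultimately have "\<phi> w \<noteq> m" "w \<in> \<Omega>" using r by (auto simp: S_def)
              then show ?thesis using min[of w] by simp
            qed
            show "m \<le> \<phi> w" if "w \<in> cball y \<rho>" for w
              by (rule min) (use that sub[of w] r(2) in auto)
          qed (use x0' dif in \<open>auto simp: \<rho>_def\<close>)
          moreover have "Du \<phi> x0 \<bullet> (y - x0) + 0 = 0"
            by (rule line_min_critical[OF op x0'(1) dif[OF x0'(1)], of "\<lambda>_. 0"]) (use min x0' in auto)
          ultimately show False by simp
        qed
      qed
      then show ?thesis using r by (intro exI[of _ "r / 2"]) auto
    qed
    then have "open Z" unfolding open_contains_ball by blast
    then show ?thesis by (intro open_subset) (auto simp: Z_def)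
  qed
  moreover have "closedin (top_of_set \<Omega>) Z"
    unfolding Z_def by (rule continuous_closedin_preimage_constant[OF cont])
  moreover have "Z \<noteq> {}" using z by (auto simp: Z_def)
  ultimately have "Z = \<Omega>" using conn unfolding connected_clopen by blast
  then show ?thesis using \<open>x \<in> \<Omega>\<close> by (auto simp: Z_def)
qed

text \<open>An interior minimum makes \<phi> constant, and the constant is also taken on the
  frontier, which is nonempty for a bounded domain.\<close>

lemma minimum_principle:
  fixes \<phi> :: "real^'n::finite \<Rightarrow> real"
  assumes ell: "uniformly_elliptic \<Omega> P b" and \<phi>: "C2_on \<Omega> \<phi>" and conn: "connected \<Omega>" and bd: "bounded \<Omega>"
    and L: "\<And>x. x \<in> \<Omega> \<Longrightarrow> lin_op P b \<phi> x \<le> 0"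
    and cont: "continuous_on (closure \<Omega>) \<phi>" and x: "x \<in> \<Omega>"
  shows "\<exists>z\<in>frontier \<Omega>. \<phi> z \<le> \<phi> x"
proof -
  have op: "open \<Omega>" using \<phi> by (auto simp: C2_on_def)
  have "compact (closure \<Omega>)" using bd by simp
  moreover have "closure \<Omega> \<noteq> {}" using x by auto
  ultimately obtain z where z: "z \<in> closure \<Omega>" "\<And>y. y \<in> closure \<Omega> \<Longrightarrow> \<phi> z \<le> \<phi> y"
    using continuous_attains_inf[OF _ _ cont] by blast
  show ?thesis
  proof (cases "z \<in> \<Omega>")
    case False
    then have "z \<in> frontier \<Omega>" using z op by (simp add: frontier_def interior_open)
    then show ?thesis using z x closure_subset by blast
  next
    case True
    have const: "\<phi> y = \<phi> z" if "y \<in> \<Omega>" for y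
      using strong_minimum_principle[OF ell \<phi> conn L _ True refl that] z closure_subset by blast
    have "frontier \<Omega> \<noteq> {}"
      using frontier_eq_empty[of \<Omega>] x bd not_bounded_UNIV by blast
    then obtain w where w: "w \<in> frontier \<Omega>" by blast
    have "\<phi> w = \<phi> z"
      using continuous_constant_on_closure[OF cont, of "\<phi> z" w] const w by (auto simp: frontier_def)
    then show ?thesis using w const[OF x] by (intro bexI[of _ w]) simp_all
  qed
qed

section \<open>Geometry of spacelike graphs\<close>

text \<open>Generalized eigenvectors of the pair (h, g), orthonormal for g. Working with two
  symmetric forms instead of the nonsymmetric g^-1 h is what gives norm bounds on the frame.\<close>

definition eigen_frame :: "real^'n::finite^'n \<Rightarrow> real^'n^'n \<Rightarrow> ('n \<Rightarrow> real^'n) \<Rightarrow> real^'n \<Rightarrow> bool" where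
  "eigen_frame g h P \<kappa> \<longleftrightarrow> (\<forall>a b. P a \<bullet> (g *v P b) = (if a = b then 1 else 0)) \<and>
     (\<forall>a. h *v P a = \<kappa> $ a *\<^sub>R (g *v P a))"

text \<open>By g-orthonormality the covectors g P_a are the rows of the inverse of Q. The last
  equation turns diagonal entries of a conjugated matrix into values of a quadratic form on the
  frame.\<close>

lemma eigen_frame_matrices:
  fixes g h gi :: "real^'n::finite^'n"
  assumes fr: "eigen_frame g h P \<kappa>" and g: "transpose g = g" and gi: "gi ** g = mat 1"
  defines "Q \<equiv> (\<chi> i a. P a $ i)" and "R \<equiv> (\<chi> a i. (g *v P a) $ i)"
  shows "(gi ** h) ** Q = Q ** diagm \<kappa>" "Q ** R = mat 1" "R ** Q = mat 1"
    "(R ** B ** Q) $ a $ a = P a \<bullet> ((g ** B) *v P a)"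
proof -
  have colQ: "column a Q = P a" for a by (simp add: Q_def column_def vec_eq_iff)
  have "(R ** Q) $ a $ b = (if a = b then 1 else 0)" for a b
  proof -
    have "(R ** Q) $ a $ b = (g *v P a) \<bullet> P b"
      by (simp add: matrix_matrix_mult_def R_def Q_def inner_vec_def)
    then show ?thesis using fr by (auto simp: eigen_frame_def inner_commute)
  qed
  then show RQ: "R ** Q = mat 1" by (simp add: vec_eq_iff mat_def)
  then show QR: "Q ** R = mat 1" using matrix_left_right_inverse by blast
  have "(gi ** h) *v P a = \<kappa> $ a *\<^sub>R P a" for a
  proof -
    have "(gi ** h) *v P a = gi *v (\<kappa> $ a *\<^sub>R (g *v P a))"
      using fr by (simp add: eigen_frame_def matrix_vector_mul_assoc[symmetric])
    also have "\<dots> = \<kappa> $ a *\<^sub>R P a"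
      by (simp add: matrix_vector_mult_scaleR matrix_vector_mul_assoc gi)
    finally show ?thesis .
  qed
  then have "((gi ** h) ** Q) $ i $ a = (Q ** diagm \<kappa>) $ i $ a" for i a
  proof -
    assume *: "\<And>a. (gi ** h) *v P a = \<kappa> $ a *\<^sub>R P a"
    have "((gi ** h) ** Q) $ i $ a = ((gi ** h) *v P a) $ i"
      unfolding matrix_matrix_mult_def[of _ Q] by (simp add: matrix_vector_mult_def Q_def)
    also have "\<dots> = P a $ i * \<kappa> $ a" by (simp add: *)
    also have "\<dots> = (Q ** diagm \<kappa>) $ i $ a"
      by (simp add: matrix_matrix_mult_def diagm_def Q_def if_distrib[where f="\<lambda>x. _ * x"] cong: if_cong)
    finally show ?thesis .
  qed
  then show "(gi ** h) ** Q = Q ** diagm \<kappa>" by (simp add: vec_eq_iff)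
  have "(R ** B ** Q) $ a $ a = (g *v P a) \<bullet> (B *v P a)"
    unfolding matrix_mul_assoc[symmetric]
    by (simp add: matrix_matrix_mult_def[of R] R_def inner_vec_def)
       (simp add: matrix_matrix_mult_def matrix_vector_mult_def Q_def)
  then show "(R ** B ** Q) $ a $ a = P a \<bullet> ((g ** B) *v P a)"
    by (simp add: inner_symmetric_matrix[OF g] matrix_vector_mul_assoc[symmetric])
qed

text \<open>The sum of P_a P_a^T over a g-orthonormal frame is the inverse metric; ellipticity of
  the linearized operator rests on this.\<close>

lemma eigen_frame_complete:
  fixes g h gi :: "real^'n::finite^'n"
  assumes fr: "eigen_frame g h P \<kappa>" and g: "transpose g = g" and gi: "gi ** g = mat 1"
  shows "(\<Sum>a\<in>UNIV. (P a \<bullet> z)\<^sup>2) = z \<bullet> (gi *v z)"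
proof -
  define Q where "Q = (\<chi> i a. P a $ i)"
  define R where "R = (\<chi> a i. (g *v P a) $ i)"
  have QR: "Q ** R = mat 1" using eigen_frame_matrices(2)[OF fr g gi] by (simp add: Q_def R_def)
  have gig: "g ** gi = mat 1" using gi matrix_left_right_inverse by blast
  define y where "y = gi *v z"
  have z: "z = g *v y" by (simp add: y_def matrix_vector_mul_assoc gig)
  have "y = Q *v (R *v y)" by (simp add: matrix_vector_mul_assoc QR)
  moreover have "(R *v y) $ a = P a \<bullet> z" for a
    unfolding z inner_symmetric_matrix[OF g] by (simp add: R_def matrix_vector_mult_def inner_vec_def)
  ultimately have y: "y $ i = (\<Sum>a\<in>UNIV. P a $ i * (P a \<bullet> z))" for i
  proof -
    assume y: "y = Q *v (R *v y)" and R: "\<And>a. (R *v y) $ a = P a \<bullet> z"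
    have "y $ i = (Q *v (R *v y)) $ i" using y by (rule arg_cong)
    also have "\<dots> = (\<Sum>a\<in>UNIV. Q $ i $ a * (R *v y) $ a)" by (simp add: matrix_vector_mult_def[of Q])
    finally show ?thesis by (simp add: R Q_def)
  qed
  have "z \<bullet> y = (\<Sum>i\<in>UNIV. \<Sum>a\<in>UNIV. z $ i * P a $ i * (P a \<bullet> z))"
    unfolding inner_vec_def[of z y] y by (simp add: sum_distrib_left mult.assoc)
  also have "\<dots> = (\<Sum>a\<in>UNIV. \<Sum>i\<in>UNIV. z $ i * P a $ i * (P a \<bullet> z))" by (rule sum.swap)
  also have "\<dots> = (\<Sum>a\<in>UNIV. (P a \<bullet> z)\<^sup>2)"
  proof (intro sum.cong refl)
    fix a
    have "(\<Sum>i\<in>UNIV. z $ i * P a $ i) = P a \<bullet> z" by (simp add: inner_vec_def mult.commute)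
    then show "(\<Sum>i\<in>UNIV. z $ i * P a $ i * (P a \<bullet> z)) = (P a \<bullet> z)\<^sup>2"
      by (simp add: sum_distrib_right[symmetric] power2_eq_square)
  qed
  finally show ?thesis by (simp add: y_def)
qed

section \<open>Metric, inverse metric and eigenframes of a spacelike graph\<close>

locale spacelike_graph =
  fixes u :: "real^'n::finite \<Rightarrow> real" and U :: "(real^'n) set"
  assumes smooth: "smooth_on U u"
    and u_pos: "\<And>x. x \<in> U \<Longrightarrow> u x > 0"
    and spacelike: "\<And>x. x \<in> U \<Longrightarrow> norm (Du u x) < 1"
begin

abbreviation "\<nu> \<equiv> nu_last u"
abbreviation "p \<equiv> Du u"
abbreviation "H \<equiv> D2u u"
abbreviation "q x \<equiv> H x *v p x"

lemma open_U: "open U" using smooth by (simp add: smooth_on_def)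

lemma C2_u: "C2_on U u" by (rule smooth_on_C2_on[OF smooth])

lemma w_pos: "x \<in> U \<Longrightarrow> wfun u x > 0"
  using spacelike[of x] by (simp add: wfun_def power_less_one_iff abs_square_less_1)

lemma nu_pos: "x \<in> U \<Longrightarrow> \<nu> x > 0"
  using w_pos by (simp add: nu_last_def)

lemma nu_norm: "x \<in> U \<Longrightarrow> (\<nu> x)\<^sup>2 * (p x \<bullet> p x) = (\<nu> x)\<^sup>2 - 1"
proof -
  assume x: "x \<in> U"
  have w: "(wfun u x)\<^sup>2 = 1 - p x \<bullet> p x"
    using spacelike[OF x] by (simp add: wfun_def power2_norm_eq_inner[symmetric] power_le_one)
  have "(\<nu> x)\<^sup>2 * (wfun u x)\<^sup>2 = 1" using w_pos[OF x] by (simp add: nu_last_def power_divide)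
  then show ?thesis unfolding w by (simp add: algebra_simps)
qed

lemma H_sym: "x \<in> U \<Longrightarrow> H x $ i $ j = H x $ j $ i"
  using pd_commute[OF C2_u] by simp

lemma H_transpose: "x \<in> U \<Longrightarrow> transpose (H x) = H x"
  using H_sym by (simp add: transpose_def vec_eq_iff del: D2u_nth)

lemma g_nth: "gdS u x $ i $ j = ((if i = j then 1 else 0) - p x $ i * p x $ j) / (u x)\<^sup>2"
  by (simp add: gdS_def gM_def)

lemma h_nth: "hdS u x $ i $ j = \<nu> x / (u x)\<^sup>2 * ((if i = j then 1 else 0) - p x $ i * p x $ j) - \<nu> x / u x * H x $ i $ j"
  by (simp add: hdS_def gM_def nu_last_def)

lemma kronecker_sum: "(\<Sum>j\<in>UNIV. (if i = j then 1 else 0) * c j) = (c i :: real)" for i :: 'n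
  by (simp add: if_distrib[where f="\<lambda>x. x * _"] cong: if_cong)

lemma g_mult: "gdS u x *v \<xi> = (1 / (u x)\<^sup>2) *\<^sub>R (\<xi> - (p x \<bullet> \<xi>) *\<^sub>R p x)"
proof -
  have "(gdS u x *v \<xi>) $ i = (1 / (u x)\<^sup>2) * (\<Sum>j\<in>UNIV. (if i = j then 1 else 0) * \<xi> $ j - p x $ i * (p x $ j * \<xi> $ j))" for i
    by (simp add: matrix_vector_mult_def g_nth sum_distrib_left algebra_simps diff_divide_distrib del: Du_nth)
  then have "(gdS u x *v \<xi>) $ i = (1 / (u x)\<^sup>2) * (\<xi> $ i - p x $ i * (p x \<bullet> \<xi>))" for i
    by (simp only: sum_subtractf kronecker_sum sum_distrib_left[symmetric] inner_vec_def inner_real_def)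
  then show ?thesis by (simp add: vec_eq_iff mult.commute del: Du_nth)
qed

lemma h_mult: "hdS u x *v \<xi> = (\<nu> x / (u x)\<^sup>2) *\<^sub>R (\<xi> - (p x \<bullet> \<xi>) *\<^sub>R p x) - (\<nu> x / u x) *\<^sub>R (H x *v \<xi>)"
proof -
  have "hdS u x = \<nu> x *\<^sub>R gdS u x - (\<nu> x / u x) *\<^sub>R H x"
    by (simp add: hdS_def gdS_def nu_last_def)
  then have "hdS u x *v \<xi> = \<nu> x *\<^sub>R (gdS u x *v \<xi>) - (\<nu> x / u x) *\<^sub>R (H x *v \<xi>)"
    by (simp add: matrix_vector_mult_diff_rdistrib scaleR_matrix_vector_assoc)
  then show ?thesis by (simp add: g_mult)
qed

lemma g_transpose: "transpose (gdS u x) = gdS u x"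
  by (simp add: transpose_def vec_eq_iff g_nth mult.commute)

lemma h_transpose: "x \<in> U \<Longrightarrow> transpose (hdS u x) = hdS u x"
  using H_sym[of x] by (simp add: transpose_def vec_eq_iff h_nth mult.commute del: Du_nth D2u_nth)

lemma g_form: "\<xi> \<bullet> (gdS u x *v \<xi>) = (\<xi> \<bullet> \<xi> - (p x \<bullet> \<xi>)\<^sup>2) / (u x)\<^sup>2"
  by (simp add: g_mult inner_diff_right inner_commute power2_eq_square)

text \<open>Cauchy-Schwarz together with |Du|^2 = 1 - 1/\<nu>^2: the graph metric dominates \<nu>^-2
  times the Euclidean one.\<close>

lemma norm_le_g: "x \<in> U \<Longrightarrow> \<xi> \<bullet> \<xi> \<le> (\<nu> x)\<^sup>2 * (\<xi> \<bullet> \<xi> - (p x \<bullet> \<xi>)\<^sup>2)"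
proof -
  assume x: "x \<in> U"
  have "(p x \<bullet> \<xi>)\<^sup>2 \<le> (p x \<bullet> p x) * (\<xi> \<bullet> \<xi>)" by (rule Cauchy_Schwarz_ineq)
  then have "(\<nu> x)\<^sup>2 * (p x \<bullet> \<xi>)\<^sup>2 \<le> (\<nu> x)\<^sup>2 * ((p x \<bullet> p x) * (\<xi> \<bullet> \<xi>))" by (intro mult_left_mono) auto
  also have "\<dots> = ((\<nu> x)\<^sup>2 - 1) * (\<xi> \<bullet> \<xi>)" using nu_norm[OF x] by (simp add: mult.assoc[symmetric])
  finally show ?thesis by (simp add: algebra_simps)
qed

lemma g_pd: assumes "x \<in> U" "\<xi> \<noteq> 0" shows "\<xi> \<bullet> (gdS u x *v \<xi>) > 0"
proof -
  have "0 < \<xi> \<bullet> \<xi>" using assms by simp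
  also have "\<dots> \<le> (\<nu> x)\<^sup>2 * (\<xi> \<bullet> \<xi> - (p x \<bullet> \<xi>)\<^sup>2)" by (rule norm_le_g[OF assms(1)])
  finally have "\<xi> \<bullet> \<xi> - (p x \<bullet> \<xi>)\<^sup>2 > 0" by (simp add: zero_less_mult_iff)
  then show ?thesis using u_pos[OF assms(1)] by (simp add: g_form)
qed

text \<open>Rank-one update: (I - p p^T)^-1 = I + \<nu>^2 p p^T, because 1 - |p|^2 =
  \<nu>^-2.\<close>

definition ginv :: "real^'n \<Rightarrow> real^'n^'n" where
  "ginv x = (\<chi> i j. (u x)\<^sup>2 * ((if i = j then 1 else 0) + (\<nu> x)\<^sup>2 * p x $ i * p x $ j))"

lemma ginv_mult: "ginv x *v \<xi> = (u x)\<^sup>2 *\<^sub>R (\<xi> + ((\<nu> x)\<^sup>2 * (p x \<bullet> \<xi>)) *\<^sub>R p x)"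
proof -
  have "(ginv x *v \<xi>) $ i = (u x)\<^sup>2 * (\<Sum>j\<in>UNIV. (if i = j then 1 else 0) * \<xi> $ j + (\<nu> x)\<^sup>2 * p x $ i * (p x $ j * \<xi> $ j))" for i
    by (simp add: matrix_vector_mult_def ginv_def sum_distrib_left algebra_simps del: Du_nth)
  then have "(ginv x *v \<xi>) $ i = (u x)\<^sup>2 * (\<xi> $ i + (\<nu> x)\<^sup>2 * p x $ i * (p x \<bullet> \<xi>))" for i
    by (simp only: sum.distrib kronecker_sum sum_distrib_left[symmetric] inner_vec_def inner_real_def)
  then show ?thesis by (simp add: vec_eq_iff mult_ac del: Du_nth)
qed

lemma ginv_g: assumes x: "x \<in> U" shows "ginv x ** gdS u x = mat 1"
proof -
  have "(gdS u x ** ginv x) *v \<xi> = mat 1 *v \<xi>" for \<xi>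
  proof -
    have "p x \<bullet> (\<xi> + ((\<nu> x)\<^sup>2 * (p x \<bullet> \<xi>)) *\<^sub>R p x) = p x \<bullet> \<xi> + (p x \<bullet> \<xi>) * ((\<nu> x)\<^sup>2 * (p x \<bullet> p x))"
      by (simp add: inner_add_right mult_ac)
    also have "\<dots> = (\<nu> x)\<^sup>2 * (p x \<bullet> \<xi>)" unfolding nu_norm[OF x] by (simp add: algebra_simps)
    finally have "gdS u x *v (ginv x *v \<xi>) = \<xi>"
      using u_pos[OF x] by (simp add: ginv_mult g_mult matrix_vector_mult_scaleR)
    then show ?thesis by (simp add: matrix_vector_mul_assoc)
  qed
  then have "gdS u x ** ginv x = mat 1" by (simp add: matrix_eq)
  then show ?thesis using matrix_left_right_inverse by blast
qed

lemma matrix_inv_g: "x \<in> U \<Longrightarrow> matrix_inv (gdS u x) = ginv x"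
  using ginv_g[of x] matrix_left_right_inverse[of "ginv x" "gdS u x"]
  by (metis invertible_def matrix_inv_mult(1) matrix_mul_assoc matrix_mul_lid matrix_mul_rid)

lemma Amat_eq: "x \<in> U \<Longrightarrow> Amat u x = ginv x ** hdS u x"
  by (simp add: Amat_def matrix_inv_g)

abbreviation "frame x \<equiv> eigen_frame (gdS u x) (hdS u x)"

text \<open>The bounds involve u and \<nu> at the point and not the form S that replaces h. They
  supply the uniformly bounded diagonalizers for \<open>Fmat_has_derivative\<close>.\<close>

lemma eigen_frame_bound:
  assumes x: "x \<in> U" and fr: "eigen_frame (gdS u x) S P \<kappa>"
  shows "norm (P a) \<le> u x * \<nu> x" "norm (gdS u x *v P a) \<le> 2 * \<nu> x / u x"
proof -
  have "(P a \<bullet> P a - (p x \<bullet> P a)\<^sup>2) / (u x)\<^sup>2 = 1" using fr unfolding eigen_frame_def g_form[symmetric] by simp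
  then have 1: "P a \<bullet> P a - (p x \<bullet> P a)\<^sup>2 = (u x)\<^sup>2" using u_pos[OF x] by (simp add: divide_eq_eq split: if_splits)
  have "(norm (P a))\<^sup>2 = P a \<bullet> P a" by (rule power2_norm_eq_inner)
  also have "\<dots> \<le> (\<nu> x)\<^sup>2 * (P a \<bullet> P a - (p x \<bullet> P a)\<^sup>2)" by (rule norm_le_g[OF x])
  also have "\<dots> = (u x * \<nu> x)\<^sup>2" by (simp only: 1 power_mult_distrib mult.commute)
  finally have "(norm (P a))\<^sup>2 \<le> (u x * \<nu> x)\<^sup>2" .
  then show 2: "norm (P a) \<le> u x * \<nu> x"
    by (rule power2_le_imp_le) (rule mult_nonneg_nonneg[OF less_imp_le[OF u_pos[OF x]] less_imp_le[OF nu_pos[OF x]]])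
  have "norm (P a - (p x \<bullet> P a) *\<^sub>R p x) \<le> norm (P a) + \<bar>p x \<bullet> P a\<bar> * norm (p x)"
    by (rule order_trans[OF norm_triangle_ineq4]) simp
  also have "\<dots> \<le> norm (P a) + (norm (p x) * norm (P a)) * norm (p x)"
    by (intro add_left_mono mult_right_mono Cauchy_Schwarz_ineq2) auto
  also have "\<dots> \<le> norm (P a) + (1 * norm (P a)) * 1"
    using spacelike[OF x] by (intro add_left_mono mult_mono) auto
  also have "\<dots> \<le> 2 * (u x * \<nu> x)" using 2 by simp
  finally have "norm (P a - (p x \<bullet> P a) *\<^sub>R p x) / (u x)\<^sup>2 \<le> 2 * (u x * \<nu> x) / (u x)\<^sup>2"
    by (rule divide_right_mono) simp
  then show "norm (gdS u x *v P a) \<le> 2 * \<nu> x / u x"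
    using u_pos[OF x] by (simp add: g_mult power2_eq_square)
qed

lemma pair_frame_exists:
  assumes "x \<in> U" "transpose S = S"
  obtains P \<kappa> where "eigen_frame (gdS u x) S P \<kappa>"
  using simultaneous_diagonalization[OF g_transpose assms(2) g_pd[OF assms(1)]]
  unfolding eigen_frame_def by metis

text \<open>Diagonalization delivers the eigenvalues in some order, \<open>kappa\<close> lists them
  in the order picked by \<open>eigs\<close>; the frame is reindexed by the connecting
  permutation.\<close>

lemma frame_exists:
  assumes x: "x \<in> U"
  obtains P where "frame x P (kappa u x)"
proof -
  obtain P \<kappa> where fr: "frame x P \<kappa>" using pair_frame_exists[OF x h_transpose[OF x]] by metis
  define Q where "Q = (\<chi> i a. P a $ i)"
  note m = eigen_frame_matrices(1-3)[OF fr g_transpose ginv_g[OF x], folded Q_def]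
  have "eigvals (Amat u x) \<kappa>"
    unfolding eigvals_def Amat_eq[OF x] using m by (auto simp: invertible_def)
  moreover have "eigvals (Amat u x) (kappa u x)"
    unfolding kappa_def eigs_def using calculation by (rule someI)
  ultimately obtain s where s: "s permutes (UNIV::'n set)" "kappa u x = (\<chi> i. \<kappa> $ s i)"
    using eigvals_unique by blast
  have inj: "s a = s b \<longleftrightarrow> a = b" for a b using permutes_inj[OF s(1)] by (auto dest: injD)
  have "frame x (\<lambda>a. P (s a)) (kappa u x)"
    using fr unfolding eigen_frame_def by (simp add: s(2) inj)
  then show ?thesis by (rule that)
qed

end

lemma matrix_form_sum: "\<xi> \<bullet> (M *v \<zeta>) = (\<Sum>i\<in>UNIV. \<Sum>j\<in>UNIV. \<xi> $ i * M $ i $ j * \<zeta> $ j)" for M :: "real^'n::finite^'n"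
  by (simp add: inner_vec_def matrix_vector_mult_def sum_distrib_left mult.assoc)

lemma has_derivative_line:
  fixes x v :: "real^'n::finite"
  assumes "(\<phi> has_derivative D) (at x)"
  shows "((\<lambda>t. \<phi> (x + t *\<^sub>R v)) has_real_derivative D v) (at 0)"
proof -
  have "\<phi> differentiable (at (x + 0 *\<^sub>R v))" using assms by (auto simp: differentiable_def)
  from DERIV_along_line[where t = 0 and x = x and \<xi> = v, OF this] have "((\<lambda>t. \<phi> (x + t *\<^sub>R v)) has_real_derivative Du \<phi> x \<bullet> v) (at 0)" by simp
  moreover have "D = (\<lambda>v. Du \<phi> x \<bullet> v)"
    by (rule has_derivative_unique[OF assms has_derivative_Du]) (use assms in \<open>auto simp: differentiable_def\<close>)
  ultimately show ?thesis by simp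
qed

lemma Du_inner_eqI:
  assumes "(\<phi> has_derivative D) (at x)"
  shows "Du \<phi> x \<bullet> v = D v"
proof -
  have "(\<lambda>v. Du \<phi> x \<bullet> v) = D"
    by (rule has_derivative_unique[OF has_derivative_Du assms]) (use assms in \<open>auto simp: differentiable_def\<close>)
  then show ?thesis by (rule fun_cong)
qed

lemma D2u_form_eqI:
  assumes "\<And>j. (pd j \<phi> has_derivative E j) (at x)"
  shows "\<xi> \<bullet> (D2u \<phi> x *v \<xi>) = (\<Sum>j\<in>UNIV. \<xi> $ j * E j \<xi>)"
proof -
  have "\<xi> \<bullet> (D2u \<phi> x *v \<xi>) = (\<Sum>i\<in>UNIV. \<Sum>j\<in>UNIV. \<xi> $ i * D2u \<phi> x $ i $ j * \<xi> $ j)" by (rule matrix_form_sum)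
  also have "\<dots> = (\<Sum>j\<in>UNIV. \<Sum>i\<in>UNIV. \<xi> $ i * D2u \<phi> x $ i $ j * \<xi> $ j)" by (rule sum.swap)
  also have "\<dots> = (\<Sum>j\<in>UNIV. \<xi> $ j * (Du (pd j \<phi>) x \<bullet> \<xi>))"
    by (intro sum.cong refl) (simp add: inner_vec_def sum_distrib_left mult_ac)
  finally show ?thesis by (simp add: Du_inner_eqI[OF assms])
qed

section \<open>Derivatives of \<nu>, of the two fundamental forms and of (\<sigma> -
  \<nu>)/u\<close>

context spacelike_graph
begin

lemma du: "x \<in> U \<Longrightarrow> (u has_derivative (\<lambda>v. p x \<bullet> v)) (at x)"
  by (rule smooth_on_has_derivative[OF smooth])

lemma Hv_nth: "x \<in> U \<Longrightarrow> Du (pd k u) x \<bullet> v = (H x *v v) $ k"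
  using H_sym[of x] by (simp add: inner_vec_def matrix_vector_mult_def)

lemma dpk: "x \<in> U \<Longrightarrow> (pd k u has_derivative (\<lambda>v. (H x *v v) $ k)) (at x)"
  using smooth_on_has_derivative[OF smooth_on_pd[OF smooth], of x k] by (simp add: Hv_nth)

lemma dH: "x \<in> U \<Longrightarrow> (pd i (pd j u) has_derivative (\<lambda>v. Du (pd i (pd j u)) x \<bullet> v)) (at x)"
  by (intro smooth_on_has_derivative[of U] smooth_on_pd smooth)

lemma q_inner: "x \<in> U \<Longrightarrow> q x \<bullet> v = p x \<bullet> (H x *v v)"
  by (simp add: inner_symmetric_matrix[OF H_transpose])

text \<open>\<nu> = (1 - |p|^2)^(-1/2), and half the gradient of |p|^2 is \<open>q\<close>, the
  Hessian applied to Du.\<close>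

lemma dnu: assumes x: "x \<in> U" shows "(\<nu> has_derivative (\<lambda>v. (\<nu> x) ^ 3 * (q x \<bullet> v))) (at x)"
proof -
  define N where "N y = (\<Sum>k\<in>UNIV. pd k u y * pd k u y)" for y
  have N: "(norm (p y))\<^sup>2 = N y" for y by (simp add: N_def power2_norm_eq_inner inner_vec_def)
  have "(N has_derivative (\<lambda>v. \<Sum>k\<in>UNIV. pd k u x * (H x *v v) $ k + (H x *v v) $ k * pd k u x)) (at x)"
    unfolding N_def by (intro has_derivative_sum has_derivative_mult dpk x)
  moreover have "(\<Sum>k\<in>UNIV. pd k u x * (H x *v v) $ k + (H x *v v) $ k * pd k u x) = 2 * (q x \<bullet> v)" for v
    by (subst q_inner[OF x]) (simp add: inner_vec_def sum_distrib_left algebra_simps)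
  ultimately have dN: "(N has_derivative (\<lambda>v. 2 * (q x \<bullet> v))) (at x)" by simp
  have w: "wfun u x = sqrt (1 - N x)" "wfun u x > 0" using w_pos[OF x] by (auto simp: wfun_def N)
  then have N1: "1 - N x > 0" by (simp add: real_sqrt_gt_0_iff)
  have "((\<lambda>s. 1 / sqrt (1 - s)) has_real_derivative (\<nu> x) ^ 3 / 2) (at (N x))"
  proof -
    have "((\<lambda>s. 1 / sqrt (1 - s)) has_real_derivative inverse (sqrt (1 - N x)) / (2 * (1 - N x))) (at (N x))"
      using N1 by (auto intro!: derivative_eq_intros)
    moreover have "inverse (sqrt (1 - N x)) / (2 * (1 - N x)) = (\<nu> x) ^ 3 / 2"
    proof -
      define r where "r = sqrt (1 - N x)"
      have rr: "1 - N x = r * r"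
        using real_sqrt_mult_self[of "1 - N x"] unfolding abs_of_pos[OF N1] r_def by (rule sym)
      have "inverse r / (2 * (r * r)) = (1 / r) ^ 3 / 2" by (cases "r = 0") (simp_all add: power3_eq_cube field_simps)
      then show ?thesis unfolding rr[symmetric] unfolding nu_last_def w(1) r_def .
    qed
    ultimately show ?thesis by (simp only:)
  qed
  from DERIV_compose_FDERIV[OF this dN]
  have "((\<lambda>y. 1 / sqrt (1 - N y)) has_derivative (\<lambda>v. 2 * (q x \<bullet> v) * ((\<nu> x) ^ 3 / 2))) (at x)" .
  moreover have "\<nu> = (\<lambda>y. 1 / sqrt (1 - N y))" by (rule ext) (simp add: nu_last_def wfun_def N)
  moreover have "(\<lambda>v. 2 * (q x \<bullet> v) * ((\<nu> x) ^ 3 / 2)) = (\<lambda>v. (\<nu> x) ^ 3 * (q x \<bullet> v))" by (simp add: mult_ac)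
  ultimately show ?thesis by simp
qed

lemma dg: assumes x: "x \<in> U"
  shows "((\<lambda>y. gdS u y $ i $ j) has_derivative (\<lambda>v. - 2 * (p x \<bullet> v) / (u x) ^ 3 * ((if i = j then 1 else 0) - p x $ i * p x $ j)
     - ((H x *v v) $ i * p x $ j + p x $ i * (H x *v v) $ j) / (u x)\<^sup>2)) (at x)"
proof -
  have "((\<lambda>y. ((if i = j then 1 else 0) - pd i u y * pd j u y) / (u y)\<^sup>2) has_derivative
     (\<lambda>v. - 2 * (p x \<bullet> v) / (u x) ^ 3 * ((if i = j then 1 else 0) - pd i u x * pd j u x)
     - ((H x *v v) $ i * pd j u x + pd i u x * (H x *v v) $ j) / (u x)\<^sup>2)) (at x)"
    using u_pos[OF x]
    by (auto intro!: derivative_eq_intros du[OF x] dpk[OF x] simp: field_simps power2_eq_square power3_eq_cube)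
  then show ?thesis by (simp add: g_nth)
qed

lemma dh: assumes x: "x \<in> U"
  shows "((\<lambda>y. hdS u y $ i $ j) has_derivative (\<lambda>v.
     ((\<nu> x) ^ 3 * (q x \<bullet> v) / (u x)\<^sup>2 - 2 * \<nu> x * (p x \<bullet> v) / (u x) ^ 3) * ((if i = j then 1 else 0) - p x $ i * p x $ j)
     - \<nu> x / (u x)\<^sup>2 * ((H x *v v) $ i * p x $ j + p x $ i * (H x *v v) $ j)
     - ((\<nu> x) ^ 3 * (q x \<bullet> v) / u x - \<nu> x * (p x \<bullet> v) / (u x)\<^sup>2) * H x $ i $ j
     - \<nu> x / u x * (Du (pd i (pd j u)) x \<bullet> v))) (at x)"
proof -
  have "((\<lambda>y. \<nu> y / (u y)\<^sup>2 * ((if i = j then 1 else 0) - pd i u y * pd j u y) - \<nu> y / u y * pd i (pd j u) y) has_derivative (\<lambda>v.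
     ((\<nu> x) ^ 3 * (q x \<bullet> v) / (u x)\<^sup>2 - 2 * \<nu> x * (p x \<bullet> v) / (u x) ^ 3) * ((if i = j then 1 else 0) - pd i u x * pd j u x)
     - \<nu> x / (u x)\<^sup>2 * ((H x *v v) $ i * pd j u x + pd i u x * (H x *v v) $ j)
     - ((\<nu> x) ^ 3 * (q x \<bullet> v) / u x - \<nu> x * (p x \<bullet> v) / (u x)\<^sup>2) * pd i (pd j u) x
     - \<nu> x / u x * (Du (pd i (pd j u)) x \<bullet> v))) (at x)"
    using u_pos[OF x]
    by (auto intro!: derivative_eq_intros du[OF x] dpk[OF x] dH[OF x] dnu[OF x] simp: field_simps power2_eq_square power3_eq_cube)
  then show ?thesis by (simp add: h_nth)
qed

lemma pd_g: "x \<in> U \<Longrightarrow> pd l (\<lambda>y. gdS u y $ i $ j) x = - 2 * p x $ l / (u x) ^ 3 * ((if i = j then 1 else 0) - p x $ i * p x $ j)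
     - (H x $ i $ l * p x $ j + p x $ i * H x $ j $ l) / (u x)\<^sup>2"
  by (simp add: pd_eqI[OF dg] inner_axis matrix_vector_mult_basis column_def)

definition phi :: "real \<Rightarrow> real^'n \<Rightarrow> real" where "phi \<sigma> = (\<lambda>x. (\<sigma> - \<nu> x) / u x)"

lemma dphi: assumes x: "x \<in> U"
  shows "(phi \<sigma> has_derivative (\<lambda>v. - ((\<nu> x) ^ 3 * (q x \<bullet> v) / u x) - (\<sigma> - \<nu> x) * (p x \<bullet> v) / (u x)\<^sup>2)) (at x)"
  unfolding phi_def using u_pos[OF x]
  by (auto intro!: derivative_eq_intros du[OF x] dnu[OF x] simp: field_simps power2_eq_square)

lemma Du_phi: "x \<in> U \<Longrightarrow> Du (phi \<sigma>) x \<bullet> v = - ((\<nu> x) ^ 3 * (q x \<bullet> v) / u x) - (\<sigma> - \<nu> x) * (p x \<bullet> v) / (u x)\<^sup>2"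
  by (rule Du_inner_eqI[OF dphi])

lemma pd_phi: "x \<in> U \<Longrightarrow> pd j (phi \<sigma>) x = - ((\<nu> x) ^ 3 * q x $ j / u x) - (\<sigma> - \<nu> x) * pd j u x / (u x)\<^sup>2"
  by (simp add: pd_eqI[OF dphi] inner_axis)

lemma dq: assumes x: "x \<in> U"
  shows "((\<lambda>y. q y $ j) has_derivative (\<lambda>v. (\<Sum>k\<in>UNIV. (Du (pd j (pd k u)) x \<bullet> v) * p x $ k) + (H x *v (H x *v v)) $ j)) (at x)"
proof -
  have "((\<lambda>y. \<Sum>k\<in>UNIV. pd j (pd k u) y * pd k u y) has_derivative (\<lambda>v. \<Sum>k\<in>UNIV. pd j (pd k u) x * (H x *v v) $ k + (Du (pd j (pd k u)) x \<bullet> v) * pd k u x)) (at x)"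
    by (intro has_derivative_sum has_derivative_mult dpk dH x)
  moreover have "(\<lambda>y. q y $ j) = (\<lambda>y. \<Sum>k\<in>UNIV. pd j (pd k u) y * pd k u y)"
    by (simp add: matrix_vector_mult_def)
  moreover have "(\<Sum>k\<in>UNIV. pd j (pd k u) x * (H x *v v) $ k + (Du (pd j (pd k u)) x \<bullet> v) * pd k u x)
      = (\<Sum>k\<in>UNIV. (Du (pd j (pd k u)) x \<bullet> v) * p x $ k) + (H x *v (H x *v v)) $ j" for v
    unfolding matrix_vector_mult_def[of "H x" "H x *v v"] by (simp add: sum.distrib)
  ultimately show ?thesis by simp
qed

lemma dpd_phi: assumes x: "x \<in> U"
  shows "(pd j (phi \<sigma>) has_derivative (\<lambda>v.
      - (3 * (\<nu> x) ^ 5 * (q x \<bullet> v) * q x $ j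
         + (\<nu> x) ^ 3 * ((\<Sum>k\<in>UNIV. (Du (pd j (pd k u)) x \<bullet> v) * p x $ k) + (H x *v (H x *v v)) $ j)) / u x
      + (\<nu> x) ^ 3 * (q x $ j * (p x \<bullet> v) + (q x \<bullet> v) * p x $ j) / (u x)\<^sup>2
      - (\<sigma> - \<nu> x) * (H x *v v) $ j / (u x)\<^sup>2 + 2 * (\<sigma> - \<nu> x) * p x $ j * (p x \<bullet> v) / (u x) ^ 3)) (at x)"
    (is "(_ has_derivative ?E) _")
proof (rule has_derivative_transform_within_open[OF _ open_U x])
  show "((\<lambda>y. - ((\<nu> y) ^ 3 * q y $ j / u y) - (\<sigma> - \<nu> y) * pd j u y / (u y)\<^sup>2) has_derivative ?E) (at x)"
    using u_pos[OF x]
    by (auto intro!: derivative_eq_intros du[OF x] dpk[OF x] dq[OF x] dnu[OF x] simp: field_simps power2_eq_square power3_eq_cube eval_nat_numeral)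
  show "- ((\<nu> y) ^ 3 * q y $ j / u y) - (\<sigma> - \<nu> y) * pd j u y / (u y)\<^sup>2 = pd j (phi \<sigma>) y" if "y \<in> U" for y
    using pd_phi[OF that] by simp
qed

lemma C2_phi: "C2_on U (phi \<sigma>)"
  unfolding C2_on_def differentiable_def using open_U dphi dpd_phi by blast

text \<open>D^3u(\<xi>, \<xi>, Du), the only third-order quantity in the Hessian of
  \<open>phi\<close>.\<close>

definition T3 :: "real^'n \<Rightarrow> real^'n \<Rightarrow> real" where
  "T3 x \<xi> = (\<Sum>i\<in>UNIV. \<Sum>j\<in>UNIV. \<xi> $ i * (Du (pd i (pd j u)) x \<bullet> p x) * \<xi> $ j)"

lemma pd3_commute: assumes x: "x \<in> U" shows "pd k (pd i (pd j u)) x = pd i (pd j (pd k u)) x"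
proof -
  have "pd k (pd i (pd j u)) x = pd i (pd k (pd j u)) x"
    by (rule pd_commute[OF smooth_on_C2_on[OF smooth_on_pd[OF smooth]] x])
  also have "\<dots> = pd i (pd j (pd k u)) x"
    by (rule pd_cong[OF open_U x]) (rule pd_commute[OF C2_u])
  finally show ?thesis .
qed

text \<open>Symmetry of third derivatives moves Du from the outermost derivative to the innermost
  slot. The left form arises when \<open>hdS\<close> is differentiated along Du, the right one when
  \<open>q\<close> is differentiated along \<xi>.\<close>

lemma T3_eq: assumes x: "x \<in> U"
  shows "T3 x \<xi> = (\<Sum>j\<in>UNIV. \<xi> $ j * (\<Sum>k\<in>UNIV. (Du (pd j (pd k u)) x \<bullet> \<xi>) * p x $ k))"
proof -
  have "T3 x \<xi> = (\<Sum>i\<in>UNIV. \<Sum>j\<in>UNIV. \<Sum>k\<in>UNIV. \<xi> $ i * pd k (pd i (pd j u)) x * pd k u x * \<xi> $ j)"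
    unfolding T3_def by (simp add: inner_vec_def sum_distrib_left sum_distrib_right mult_ac)
  also have "\<dots> = (\<Sum>i\<in>UNIV. \<Sum>j\<in>UNIV. \<Sum>k\<in>UNIV. \<xi> $ i * pd i (pd j (pd k u)) x * pd k u x * \<xi> $ j)"
    by (simp add: pd3_commute[OF x])
  also have "\<dots> = (\<Sum>j\<in>UNIV. \<Sum>i\<in>UNIV. \<Sum>k\<in>UNIV. \<xi> $ i * pd i (pd j (pd k u)) x * pd k u x * \<xi> $ j)"
    by (rule sum.swap)
  also have "\<dots> = (\<Sum>j\<in>UNIV. \<Sum>k\<in>UNIV. \<Sum>i\<in>UNIV. \<xi> $ i * pd i (pd j (pd k u)) x * pd k u x * \<xi> $ j)"
    by (intro sum.cong refl sum.swap)
  also have "\<dots> = (\<Sum>j\<in>UNIV. \<xi> $ j * (\<Sum>k\<in>UNIV. (Du (pd j (pd k u)) x \<bullet> \<xi>) * p x $ k))"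
    by (simp add: inner_vec_def sum_distrib_left sum_distrib_right mult_ac)
  finally show ?thesis .
qed

lemma D2_phi_form: assumes x: "x \<in> U"
  shows "\<xi> \<bullet> (D2u (phi \<sigma>) x *v \<xi>) =
      - (3 * (\<nu> x) ^ 5 * (q x \<bullet> \<xi>)\<^sup>2 + (\<nu> x) ^ 3 * (T3 x \<xi> + (H x *v \<xi>) \<bullet> (H x *v \<xi>))) / u x
      + 2 * (\<nu> x) ^ 3 * (q x \<bullet> \<xi>) * (p x \<bullet> \<xi>) / (u x)\<^sup>2
      - (\<sigma> - \<nu> x) * (\<xi> \<bullet> (H x *v \<xi>)) / (u x)\<^sup>2 + 2 * (\<sigma> - \<nu> x) * (p x \<bullet> \<xi>)\<^sup>2 / (u x) ^ 3"
proof -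
  define S where "S j = (\<Sum>k\<in>UNIV. (Du (pd j (pd k u)) x \<bullet> \<xi>) * p x $ k)" for j
  have T: "(\<Sum>j\<in>UNIV. \<xi> $ j * S j) = T3 x \<xi>" unfolding S_def T3_eq[OF x] ..
  have ip: "(\<Sum>j\<in>UNIV. \<xi> $ j * z $ j) = z \<bullet> \<xi>" for z by (simp add: inner_vec_def mult.commute)
  have HH: "(H x *v (H x *v \<xi>)) \<bullet> \<xi> = (H x *v \<xi>) \<bullet> (H x *v \<xi>)"
    by (simp add: inner_symmetric_matrix[OF H_transpose[OF x]])
  have "\<xi> \<bullet> (D2u (phi \<sigma>) x *v \<xi>) = (\<Sum>j\<in>UNIV. \<xi> $ j * (- (3 * (\<nu> x) ^ 5 * (q x \<bullet> \<xi>) * q x $ j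
         + (\<nu> x) ^ 3 * (S j + (H x *v (H x *v \<xi>)) $ j)) / u x
      + (\<nu> x) ^ 3 * (q x $ j * (p x \<bullet> \<xi>) + (q x \<bullet> \<xi>) * p x $ j) / (u x)\<^sup>2
      - (\<sigma> - \<nu> x) * (H x *v \<xi>) $ j / (u x)\<^sup>2 + 2 * (\<sigma> - \<nu> x) * p x $ j * (p x \<bullet> \<xi>) / (u x) ^ 3))"
    unfolding S_def by (rule D2u_form_eqI[OF dpd_phi[OF x]])
  also have "\<dots> = (\<Sum>j\<in>UNIV. - (3 * (\<nu> x) ^ 5 * (q x \<bullet> \<xi>)) / u x * (\<xi> $ j * q x $ j)
       - (\<nu> x) ^ 3 / u x * (\<xi> $ j * S j) - (\<nu> x) ^ 3 / u x * (\<xi> $ j * (H x *v (H x *v \<xi>)) $ j)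
      + (\<nu> x) ^ 3 * (p x \<bullet> \<xi>) / (u x)\<^sup>2 * (\<xi> $ j * q x $ j) + (\<nu> x) ^ 3 * (q x \<bullet> \<xi>) / (u x)\<^sup>2 * (\<xi> $ j * p x $ j)
      - (\<sigma> - \<nu> x) / (u x)\<^sup>2 * (\<xi> $ j * (H x *v \<xi>) $ j) + 2 * (\<sigma> - \<nu> x) * (p x \<bullet> \<xi>) / (u x) ^ 3 * (\<xi> $ j * p x $ j))"
    by (intro sum.cong refl) (simp add: algebra_simps add_divide_distrib diff_divide_distrib del: Du_nth)
  also have "\<dots> = - (3 * (\<nu> x) ^ 5 * (q x \<bullet> \<xi>)) / u x * (q x \<bullet> \<xi>)
       - (\<nu> x) ^ 3 / u x * T3 x \<xi> - (\<nu> x) ^ 3 / u x * ((H x *v \<xi>) \<bullet> (H x *v \<xi>))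
      + (\<nu> x) ^ 3 * (p x \<bullet> \<xi>) / (u x)\<^sup>2 * (q x \<bullet> \<xi>) + (\<nu> x) ^ 3 * (q x \<bullet> \<xi>) / (u x)\<^sup>2 * (p x \<bullet> \<xi>)
      - (\<sigma> - \<nu> x) / (u x)\<^sup>2 * ((H x *v \<xi>) \<bullet> \<xi>) + 2 * (\<sigma> - \<nu> x) * (p x \<bullet> \<xi>) / (u x) ^ 3 * (p x \<bullet> \<xi>)"
    unfolding sum.distrib sum_subtractf sum_distrib_left[symmetric] ip T HH ..
  finally show ?thesis
    by (simp add: algebra_simps add_divide_distrib diff_divide_distrib power2_eq_square inner_commute)
qed

end

section \<open>The linearized curvature operator\<close>

lemma outer_form_sum: "(\<Sum>i\<in>UNIV. \<Sum>j\<in>UNIV. \<xi> $ i * (a $ i * b $ j) * \<xi> $ j) = (a \<bullet> \<xi>) * (b \<bullet> \<xi>)"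
  for \<xi> :: "real^'n::finite"
  by (simp add: inner_vec_def sum_product mult_ac)

lemma kronecker_form_sum: "(\<Sum>i\<in>UNIV. \<Sum>j\<in>UNIV. \<xi> $ i * (if i = j then 1 else 0) * \<xi> $ j) = \<xi> \<bullet> \<xi>"
  for \<xi> :: "real^'n::finite"
  by (simp add: inner_vec_def if_distrib[where f="\<lambda>x. _ * x * _"] cong: if_cong)

text \<open>In a principal direction \<open>\<xi>\<close> all terms of \<open>frame_identity\<close> are rational functions of
  \<open>u, \<nu>, \<tau>, X = p \<bullet> \<xi>\<close>.\<close>
lemma frame_identity_real:
  fixes u \<nu> \<tau> X m s T \<sigma> \<kappa> Y S HH cp cx h' g' :: real
  assumes u: "u > 0" and \<nu>: "\<nu> > 0" and m: "m = 1 - 1 / \<nu>\<^sup>2"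
    and \<kappa>: "\<kappa> = \<nu> - u * \<nu> * \<tau>" and Y: "Y = \<tau> * X / \<nu>\<^sup>2" and HH: "HH = \<tau> * u\<^sup>2"
    and S: "S = \<tau>\<^sup>2 * (u\<^sup>2 - X\<^sup>2 / \<nu>\<^sup>2)"
    and cp: "cp = - (\<nu> ^ 3 * s / u) - (\<sigma> - \<nu>) * m / u\<^sup>2" and cx: "cx = - (\<nu> ^ 3 * Y / u) - (\<sigma> - \<nu>) * X / u\<^sup>2"
    and h': "h' = (\<nu> ^ 3 * s / u\<^sup>2 - 2 * \<nu> * m / u ^ 3) * u\<^sup>2 - \<nu> / u\<^sup>2 * (2 * Y * X) - (\<nu> ^ 3 * s / u - \<nu> * m / u\<^sup>2) * HH - \<nu> / u * T"
    and g': "g' = - 2 * m / u ^ 3 * u\<^sup>2 - 2 * Y * X / u\<^sup>2"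
  shows "- (3 * \<nu> ^ 5 * Y\<^sup>2 + \<nu> ^ 3 * (T + S)) / u + 2 * \<nu> ^ 3 * Y * X / u\<^sup>2 - (\<sigma> - \<nu>) * HH / u\<^sup>2 + 2 * (\<sigma> - \<nu>) * X\<^sup>2 / u ^ 3
      + \<nu>\<^sup>2 * cp * HH + 2 * cx * X / u - u\<^sup>2 * (\<nu>\<^sup>2 * cp / u)
    = \<sigma> / u * (\<nu> * \<kappa> - 1) + (\<kappa> - \<nu> * \<kappa>\<^sup>2) / u + \<nu>\<^sup>2 * (h' - \<kappa> * g')"
  unfolding h' g' cx cp \<kappa> Y HH S m using u \<nu>
  by (simp add: field_simps power2_eq_square power3_eq_cube eval_nat_numeral)

section \<open>Christoffel symbols, covariant Hessian and the differentiated curvature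
  equation\<close>

context spacelike_graph
begin

text \<open>The term with the Hessian is the Christoffel symbol of the Minkowski graph metric; the
  rest is the correction for the conformal factor u^-2.\<close>

lemma Gam_eq: assumes x: "x \<in> U"
  shows "Gam u k i j x = - ((\<nu> x)\<^sup>2 * H x $ i $ j * p x $ k) - (p x $ i * (if j = k then 1 else 0) + p x $ j * (if i = k then 1 else 0)
    - (\<nu> x)\<^sup>2 * p x $ k * ((if i = j then 1 else 0) - p x $ i * p x $ j)) / u x"
proof -
  define c where "c = ((if i = j then 1 else 0) + p x $ i * p x $ j) / (u x) ^ 3 - H x $ i $ j / (u x)\<^sup>2"
  have k1: "(1/2) * (pd i (\<lambda>y. gdS u y $ j $ l) x + pd j (\<lambda>y. gdS u y $ i $ l) x - pd l (\<lambda>y. gdS u y $ i $ j) x)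
     = c * p x $ l - (p x $ i * (if j = l then 1 else 0) + p x $ j * (if i = l then 1 else 0)) / (u x) ^ 3" for l
    unfolding pd_g[OF x] c_def using H_sym[OF x, of j i] H_sym[OF x, of l i] H_sym[OF x, of l j]
    by (simp add: algebra_simps add_divide_distrib diff_divide_distrib del: Du_nth D2u_nth)
  have "Gam u k i j x = (\<Sum>l\<in>UNIV. ginv x $ k $ l * (c * p x $ l - (p x $ i * (if j = l then 1 else 0) + p x $ j * (if i = l then 1 else 0)) / (u x) ^ 3))"
    unfolding Gam_def matrix_inv_g[OF x] sum_distrib_left by (intro sum.cong refl) (simp only: mult.left_commute[of "1/2"] k1)
  also have "\<dots> = c * (ginv x *v p x) $ k - (p x $ i / (u x) ^ 3) * (\<Sum>l\<in>UNIV. (if j = l then 1 else 0) * ginv x $ k $ l)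
       - (p x $ j / (u x) ^ 3) * (\<Sum>l\<in>UNIV. (if i = l then 1 else 0) * ginv x $ k $ l)"
    unfolding matrix_vector_mult_def vec_lambda_beta sum_distrib_left sum_subtractf[symmetric]
    by (intro sum.cong refl) (simp add: algebra_simps diff_divide_distrib add_divide_distrib del: Du_nth)
  also have "\<dots> = c * (ginv x *v p x) $ k - (p x $ i / (u x) ^ 3) * ginv x $ k $ j - (p x $ j / (u x) ^ 3) * ginv x $ k $ i"
    by (simp only: kronecker_sum)
  also have "(ginv x *v p x) $ k = (u x)\<^sup>2 * ((\<nu> x)\<^sup>2 * p x $ k)"
  proof -
    have "(ginv x *v p x) $ k = (u x)\<^sup>2 * (p x $ k + ((\<nu> x)\<^sup>2 * (p x \<bullet> p x)) * p x $ k)" by (simp add: ginv_mult)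
    then show ?thesis unfolding nu_norm[OF x] by (simp add: algebra_simps)
  qed
  finally have "Gam u k i j x = c * ((u x)\<^sup>2 * ((\<nu> x)\<^sup>2 * p x $ k)) - p x $ i / (u x) ^ 3 * ((u x)\<^sup>2 * ((if j = k then 1 else 0) + (\<nu> x)\<^sup>2 * p x $ k * p x $ j))
      - p x $ j / (u x) ^ 3 * ((u x)\<^sup>2 * ((if i = k then 1 else 0) + (\<nu> x)\<^sup>2 * p x $ k * p x $ i))"
    by (simp add: ginv_def eq_commute[of k] del: Du_nth)
  moreover have "a / (u x) ^ 3 * ((u x)\<^sup>2 * b) = a * b / u x" "a / (u x)\<^sup>2 * ((u x)\<^sup>2 * b) = a * b" for a b
    using u_pos[OF x] by (simp_all add: power2_eq_square power3_eq_cube)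
  ultimately show ?thesis unfolding c_def left_diff_distrib
    by (simp only:) (simp add: algebra_simps add_divide_distrib diff_divide_distrib del: Du_nth D2u_nth)
qed

lemma covHess_nth: assumes x: "x \<in> U"
  shows "covHess u \<psi> x $ i $ j = D2u \<psi> x $ i $ j + (\<nu> x)\<^sup>2 * (p x \<bullet> Du \<psi> x) * H x $ i $ j
    + (p x $ i * Du \<psi> x $ j + Du \<psi> x $ i * p x $ j) / u x
    - ((\<nu> x)\<^sup>2 * (p x \<bullet> Du \<psi> x) / u x) * ((if i = j then 1 else 0) - p x $ i * p x $ j)"
proof -
  have "(\<Sum>k\<in>UNIV. Gam u k i j x * pd k \<psi> x) =
    - ((\<nu> x)\<^sup>2 * H x $ i $ j) * (\<Sum>k\<in>UNIV. p x $ k * Du \<psi> x $ k)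
    - (p x $ i / u x) * (\<Sum>k\<in>UNIV. (if j = k then 1 else 0) * Du \<psi> x $ k)
    - (p x $ j / u x) * (\<Sum>k\<in>UNIV. (if i = k then 1 else 0) * Du \<psi> x $ k)
    + ((\<nu> x)\<^sup>2 / u x * ((if i = j then 1 else 0) - p x $ i * p x $ j)) * (\<Sum>k\<in>UNIV. p x $ k * Du \<psi> x $ k)"
    unfolding Gam_eq[OF x] sum_distrib_left sum_subtractf[symmetric] sum.distrib[symmetric]
    by (intro sum.cong refl) (simp add: algebra_simps diff_divide_distrib add_divide_distrib)
  then have "(\<Sum>k\<in>UNIV. Gam u k i j x * pd k \<psi> x) =
    - ((\<nu> x)\<^sup>2 * H x $ i $ j) * (p x \<bullet> Du \<psi> x) - (p x $ i / u x) * Du \<psi> x $ j - (p x $ j / u x) * Du \<psi> x $ i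
    + ((\<nu> x)\<^sup>2 / u x * ((if i = j then 1 else 0) - p x $ i * p x $ j)) * (p x \<bullet> Du \<psi> x)"
    by (simp only: kronecker_sum inner_vec_def inner_real_def)
  then show ?thesis unfolding covHess_def
    by (simp add: algebra_simps add_divide_distrib diff_divide_distrib)
qed

lemma covHess_form: assumes x: "x \<in> U"
  shows "\<xi> \<bullet> (covHess u \<psi> x *v \<xi>) = \<xi> \<bullet> (D2u \<psi> x *v \<xi>) + (\<nu> x)\<^sup>2 * (p x \<bullet> Du \<psi> x) * (\<xi> \<bullet> (H x *v \<xi>))
     + 2 * (Du \<psi> x \<bullet> \<xi>) * (p x \<bullet> \<xi>) / u x - (\<xi> \<bullet> \<xi> - (p x \<bullet> \<xi>)\<^sup>2) * ((\<nu> x)\<^sup>2 * (p x \<bullet> Du \<psi> x) / u x)"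
proof -
  have "\<xi> \<bullet> (covHess u \<psi> x *v \<xi>) = (\<Sum>i\<in>UNIV. \<Sum>j\<in>UNIV. \<xi> $ i * D2u \<psi> x $ i $ j * \<xi> $ j
    + (\<nu> x)\<^sup>2 * (p x \<bullet> Du \<psi> x) * (\<xi> $ i * H x $ i $ j * \<xi> $ j)
    + (1 / u x) * (\<xi> $ i * (p x $ i * Du \<psi> x $ j) * \<xi> $ j) + (1 / u x) * (\<xi> $ i * (Du \<psi> x $ i * p x $ j) * \<xi> $ j)
    - ((\<nu> x)\<^sup>2 * (p x \<bullet> Du \<psi> x) / u x) * (\<xi> $ i * (if i = j then 1 else 0) * \<xi> $ j)
    + ((\<nu> x)\<^sup>2 * (p x \<bullet> Du \<psi> x) / u x) * (\<xi> $ i * (p x $ i * p x $ j) * \<xi> $ j))"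
    unfolding matrix_form_sum[of \<xi> "covHess u \<psi> x"] covHess_nth[OF x]
    by (intro sum.cong refl) (simp add: algebra_simps add_divide_distrib diff_divide_distrib del: Du_nth D2u_nth)
  also have "\<dots> = \<xi> \<bullet> (D2u \<psi> x *v \<xi>) + (\<nu> x)\<^sup>2 * (p x \<bullet> Du \<psi> x) * (\<xi> \<bullet> (H x *v \<xi>))
    + (1 / u x) * ((p x \<bullet> \<xi>) * (Du \<psi> x \<bullet> \<xi>)) + (1 / u x) * ((Du \<psi> x \<bullet> \<xi>) * (p x \<bullet> \<xi>))
    - ((\<nu> x)\<^sup>2 * (p x \<bullet> Du \<psi> x) / u x) * (\<xi> \<bullet> \<xi>) + ((\<nu> x)\<^sup>2 * (p x \<bullet> Du \<psi> x) / u x) * ((p x \<bullet> \<xi>) * (p x \<bullet> \<xi>))"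
    unfolding sum.distrib sum_subtractf sum_distrib_left[symmetric] outer_form_sum kronecker_form_sum
      matrix_form_sum[symmetric] ..
  finally show ?thesis by (simp add: algebra_simps power2_eq_square diff_divide_distrib)
qed

lemma covHess_transpose:
  assumes x: "x \<in> U" and \<psi>: "C2_on V \<psi>" "x \<in> V"
  shows "transpose (covHess u \<psi> x) = covHess u \<psi> x"
proof -
  have "covHess u \<psi> x $ j $ i = covHess u \<psi> x $ i $ j" for i j
    unfolding covHess_nth[OF x] using pd_commute[OF \<psi>, of i j] H_sym[OF x, of i j] by (simp add: mult.commute add.commute)
  then show ?thesis by (simp add: transpose_def vec_eq_iff)
qed

text \<open>The eigenvalue equation solved for the Hessian of u: in a principal direction it acts as
  \<tau> times the graph metric.\<close>

lemma frame_vector: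
  fixes a :: 'n
  assumes x: "x \<in> U" and fr: "frame x P \<kappa>"
  defines "\<tau> \<equiv> (\<nu> x - \<kappa> $ a) / (u x * \<nu> x)"
  shows "P a \<bullet> P a = (u x)\<^sup>2 + (p x \<bullet> P a)\<^sup>2" "H x *v P a = \<tau> *\<^sub>R (P a - (p x \<bullet> P a) *\<^sub>R p x)"
proof -
  have "P a \<bullet> (gdS u x *v P a) = 1" using fr unfolding eigen_frame_def by simp
  then show "P a \<bullet> P a = (u x)\<^sup>2 + (p x \<bullet> P a)\<^sup>2"
    unfolding g_form using u_pos[OF x] by (simp add: divide_eq_eq split: if_splits)
  have e: "hdS u x *v P a = \<kappa> $ a *\<^sub>R (gdS u x *v P a)" using fr unfolding eigen_frame_def by simp
  define z where "z = P a - (p x \<bullet> P a) *\<^sub>R p x"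
  have "(\<nu> x / (u x)\<^sup>2) *\<^sub>R z - (\<nu> x / u x) *\<^sub>R (H x *v P a) = \<kappa> $ a *\<^sub>R (1 / (u x)\<^sup>2) *\<^sub>R z"
    using e unfolding h_mult g_mult z_def .
  then have "(\<nu> x / u x) *\<^sub>R (H x *v P a) = ((\<nu> x - \<kappa> $ a) / (u x)\<^sup>2) *\<^sub>R z"
    by (simp add: diff_divide_distrib scaleR_diff_left algebra_simps)
  then have "(u x / \<nu> x) *\<^sub>R (\<nu> x / u x) *\<^sub>R (H x *v P a) = (u x / \<nu> x) *\<^sub>R ((\<nu> x - \<kappa> $ a) / (u x)\<^sup>2) *\<^sub>R z" by simp
  then show "H x *v P a = \<tau> *\<^sub>R z"
    using u_pos[OF x] nu_pos[OF x] by (simp add: \<tau>_def power2_eq_square mult.commute)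
qed

text \<open>Quadratic form of the derivative of \<open>gdS\<close> in the direction Du;
  \<open>dh_form\<close> is its counterpart for \<open>hdS\<close>. Both meet again in the
  differentiated equation.\<close>

definition dg_form :: "real^'n \<Rightarrow> real^'n \<Rightarrow> real" where
  "dg_form x \<xi> = - 2 * (p x \<bullet> p x) / (u x) ^ 3 * (\<xi> \<bullet> \<xi> - (p x \<bullet> \<xi>)\<^sup>2) - 2 * (q x \<bullet> \<xi>) * (p x \<bullet> \<xi>) / (u x)\<^sup>2"

definition dh_form :: "real^'n \<Rightarrow> real^'n \<Rightarrow> real" where
  "dh_form x \<xi> = ((\<nu> x) ^ 3 * (q x \<bullet> p x) / (u x)\<^sup>2 - 2 * \<nu> x * (p x \<bullet> p x) / (u x) ^ 3) * (\<xi> \<bullet> \<xi> - (p x \<bullet> \<xi>)\<^sup>2)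
     - \<nu> x / (u x)\<^sup>2 * (2 * (q x \<bullet> \<xi>) * (p x \<bullet> \<xi>))
     - ((\<nu> x) ^ 3 * (q x \<bullet> p x) / u x - \<nu> x * (p x \<bullet> p x) / (u x)\<^sup>2) * (\<xi> \<bullet> (H x *v \<xi>)) - \<nu> x / u x * T3 x \<xi>"

text \<open>\<open>dh_form\<close> minus \<kappa> times \<open>dg_form\<close> is the first-order
  change of the curvature along Du. It carries all third derivatives and drops out after summation
  against f_i.\<close>

lemma frame_identity:
  assumes x: "x \<in> U" and fr: "frame x P \<kappa>"
  shows "P a \<bullet> (covHess u (phi \<sigma>) x *v P a) = \<sigma> / u x * (\<nu> x * \<kappa> $ a - 1) + (\<kappa> $ a - \<nu> x * (\<kappa> $ a)\<^sup>2) / u x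
     + (\<nu> x)\<^sup>2 * (dh_form x (P a) - \<kappa> $ a * dg_form x (P a))"
proof -
  define \<xi> where "\<xi> = P a"
  define \<tau> where "\<tau> = (\<nu> x - \<kappa> $ a) / (u x * \<nu> x)"
  define X where "X = p x \<bullet> \<xi>"
  define m where "m = p x \<bullet> p x"
  have u: "u x > 0" and n: "\<nu> x > 0" using u_pos[OF x] nu_pos[OF x] .
  have m: "m = 1 - 1 / (\<nu> x)\<^sup>2" using nu_norm[OF x] n by (simp add: m_def field_simps)
  have xx: "\<xi> \<bullet> \<xi> = (u x)\<^sup>2 + X\<^sup>2" and Hx: "H x *v \<xi> = \<tau> *\<^sub>R (\<xi> - X *\<^sub>R p x)"
    using frame_vector[OF x fr, of a] by (simp_all add: \<xi>_def X_def \<tau>_def)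
  have k: "\<kappa> $ a = \<nu> x - u x * \<nu> x * \<tau>" using u n by (simp add: \<tau>_def)
  have Y: "q x \<bullet> \<xi> = \<tau> * X / (\<nu> x)\<^sup>2"
  proof -
    have "q x \<bullet> \<xi> = \<tau> * (X - X * m)" unfolding q_inner[OF x] Hx by (simp add: inner_diff_right X_def m_def)
    then show ?thesis unfolding m by (simp add: algebra_simps)
  qed
  have px: "\<xi> \<bullet> p x = X" by (simp add: X_def inner_commute)
  have HH: "\<xi> \<bullet> (H x *v \<xi>) = \<tau> * (u x)\<^sup>2"
    unfolding Hx using xx by (simp add: inner_diff_right px power2_eq_square)
  have S: "(H x *v \<xi>) \<bullet> (H x *v \<xi>) = \<tau>\<^sup>2 * ((u x)\<^sup>2 - X\<^sup>2 / (\<nu> x)\<^sup>2)"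
  proof -
    have "(H x *v \<xi>) \<bullet> (H x *v \<xi>) = \<tau>\<^sup>2 * (\<xi> \<bullet> \<xi> - 2 * X\<^sup>2 + X\<^sup>2 * m)"
      unfolding Hx by (simp add: inner_diff_right inner_diff_left px X_def[symmetric] m_def[symmetric] power2_eq_square algebra_simps)
    then show ?thesis unfolding xx m by (simp add: algebra_simps)
  qed
  have lhs: "\<xi> \<bullet> (covHess u (phi \<sigma>) x *v \<xi>) =
      - (3 * (\<nu> x) ^ 5 * (q x \<bullet> \<xi>)\<^sup>2 + (\<nu> x) ^ 3 * (T3 x \<xi> + (H x *v \<xi>) \<bullet> (H x *v \<xi>))) / u x
      + 2 * (\<nu> x) ^ 3 * (q x \<bullet> \<xi>) * X / (u x)\<^sup>2
      - (\<sigma> - \<nu> x) * (\<xi> \<bullet> (H x *v \<xi>)) / (u x)\<^sup>2 + 2 * (\<sigma> - \<nu> x) * X\<^sup>2 / (u x) ^ 3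
      + (\<nu> x)\<^sup>2 * (Du (phi \<sigma>) x \<bullet> p x) * (\<xi> \<bullet> (H x *v \<xi>)) + 2 * (Du (phi \<sigma>) x \<bullet> \<xi>) * X / u x
      - (u x)\<^sup>2 * ((\<nu> x)\<^sup>2 * (Du (phi \<sigma>) x \<bullet> p x) / u x)"
    unfolding covHess_form[OF x] D2_phi_form[OF x] X_def[symmetric] inner_commute[of "p x" "Du (phi \<sigma>) x"] xx by simp
  have "\<xi> \<bullet> (covHess u (phi \<sigma>) x *v \<xi>) = \<sigma> / u x * (\<nu> x * \<kappa> $ a - 1) + (\<kappa> $ a - \<nu> x * (\<kappa> $ a)\<^sup>2) / u x
     + (\<nu> x)\<^sup>2 * (dh_form x \<xi> - \<kappa> $ a * dg_form x \<xi>)"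
    unfolding lhs
    by (rule frame_identity_real[OF u n m k Y HH S, where s = "q x \<bullet> p x"])
      (simp_all add: Du_phi[OF x] dh_form_def dg_form_def m_def[symmetric] X_def[symmetric] xx)
  then show ?thesis by (simp add: \<xi>_def)
qed

text \<open>Base point \<open>y\<close> and form \<open>S\<close> may both vary with t. This covers
  the two curves of interest: h perturbed at a fixed point in \<open>Fop_eq\<close>, and the point
  moved along Du in \<open>differentiated_equation\<close>. Eigenframes of the pairs serve as
  bounded diagonalizers.\<close>

lemma Fmat_curve_derivative:
  fixes A :: "real \<Rightarrow> real^'n^'n"
  assumes sym: "\<forall>p q. p permutes (UNIV::'n set) \<longrightarrow> q \<in> posK \<longrightarrow> f (\<chi> i. q$(p i)) = f q"
    and f: "f differentiable (at \<kappa>)" and x: "x \<in> U" and \<kappa>: "\<kappa> \<in> posK" and fr: "frame x P \<kappa>"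
    and A0: "A 0 = Amat u x" and dA: "\<And>i j. ((\<lambda>t. A t $ i $ j) has_real_derivative B $ i $ j) (at 0)"
    and curve: "\<forall>\<^sub>F t in at 0. \<exists>y S. y \<in> U \<and> transpose S = S \<and> A t = ginv y ** S \<and> u y * \<nu> y \<le> C \<and> 2 * \<nu> y / u y \<le> C"
  shows "((\<lambda>t. Fmat f (A t)) has_real_derivative (\<Sum>a\<in>UNIV. pd a f \<kappa> * (P a \<bullet> ((gdS u x ** B) *v P a)))) (at 0)"
proof -
  note m = eigen_frame_matrices[OF fr g_transpose ginv_g[OF x]]
  have AP: "A 0 ** (\<chi> i a. P a $ i) = (\<chi> i a. P a $ i) ** diagm \<kappa>"
    unfolding A0 Amat_eq[OF x] by (rule m(1))
  have diag: "\<forall>\<^sub>F t in at 0. \<exists>(Q::real^'n^'n) (S::real^'n^'n) \<mu>. A t ** Q = Q ** diagm \<mu> \<and> Q ** S = mat 1 \<and>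
        (\<forall>i j. \<bar>Q $ i $ j\<bar> \<le> C) \<and> (\<forall>i j. \<bar>S $ i $ j\<bar> \<le> C)"
    using curve
  proof eventually_elim
    case (elim t)
    then obtain y S where y: "y \<in> U" "transpose S = S" "A t = ginv y ** S" "u y * \<nu> y \<le> C" "2 * \<nu> y / u y \<le> C" by blast
    obtain Q \<mu> where fr': "eigen_frame (gdS u y) S Q \<mu>" using pair_frame_exists[OF y(1,2)] by metis
    note m' = eigen_frame_matrices(1,2)[OF fr' g_transpose ginv_g[OF y(1)]]
    have 1: "\<bar>(\<chi> i a. Q a $ i) $ i $ j\<bar> \<le> C" for i j
      using component_le_norm_cart[of "Q j" i] eigen_frame_bound(1)[OF y(1) fr', of j] y(4) by simp
    have 2: "\<bar>(\<chi> a i. (gdS u y *v Q a) $ i) $ i $ j\<bar> \<le> C" for i j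
      using component_le_norm_cart[of "gdS u y *v Q i" j] eigen_frame_bound(2)[OF y(1) fr', of i] y(5) by simp
    show ?case
      by (intro exI conjI allI) (rule m'(1)[folded y(3)], rule m'(2), rule 1, rule 2)
  qed
  have "((\<lambda>t. Fmat f (A t)) has_real_derivative (\<Sum>a\<in>UNIV. pd a f \<kappa> *
     ((\<chi> a i. (gdS u x *v P a) $ i) ** B ** (\<chi> i a. P a $ i)) $ a $ a)) (at 0)"
    by (rule Fmat_has_derivative[OF sym \<kappa> f AP m(2) dA diag])
  then show ?thesis unfolding m(4) .
qed

text \<open>A + t g^-1 B = g^-1 (h + t B) for the covariant Hessian B, so the curve comes from a
  line of symmetric forms over one metric and its derivative can be read off in an
  eigenframe.\<close>

lemma Fop_eq:
  assumes sym: "\<forall>p q. p permutes (UNIV::'n set) \<longrightarrow> q \<in> posK \<longrightarrow> f (\<chi> i. q$(p i)) = f q"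
    and f: "f differentiable (at \<kappa>)" and x: "x \<in> U" and \<kappa>: "\<kappa> \<in> posK" and fr: "frame x P \<kappa>"
    and \<psi>: "C2_on V \<psi>" "x \<in> V"
  shows "Fop f u \<psi> x = (\<Sum>a\<in>UNIV. pd a f \<kappa> * (P a \<bullet> (covHess u \<psi> x *v P a)))"
proof -
  define B where "B = ginv x ** covHess u \<psi> x"
  define A where "A t = Amat u x + t *\<^sub>R B" for t :: real
  define C where "C = max (u x * \<nu> x) (2 * \<nu> x / u x)"
  have gB: "gdS u x ** B = covHess u \<psi> x"
    unfolding B_def matrix_mul_assoc
    using ginv_g[OF x] matrix_left_right_inverse[of "ginv x" "gdS u x"] by simp
  have "((\<lambda>t. Fmat f (A t)) has_real_derivative (\<Sum>a\<in>UNIV. pd a f \<kappa> * (P a \<bullet> ((gdS u x ** B) *v P a)))) (at 0)"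
  proof (rule Fmat_curve_derivative[OF sym f x \<kappa> fr])
    show "A 0 = Amat u x" by (simp add: A_def)
    show "((\<lambda>t. A t $ i $ j) has_real_derivative B $ i $ j) (at 0)" for i j
      unfolding A_def by (auto intro!: derivative_eq_intros)
    have "A t = ginv x ** (hdS u x + t *\<^sub>R covHess u \<psi> x)" for t
    proof -
      have "ginv x ** (t *\<^sub>R covHess u \<psi> x) = t *\<^sub>R B"
        by (simp add: B_def vec_eq_iff matrix_matrix_mult_def sum_distrib_left mult_ac)
      then show ?thesis by (simp add: A_def Amat_eq[OF x] matrix_add_ldistrib)
    qed
    moreover have "transpose (hdS u x + t *\<^sub>R covHess u \<psi> x) = hdS u x + t *\<^sub>R covHess u \<psi> x" for t
      using h_transpose[OF x] covHess_transpose[OF x \<psi>] by (simp add: transpose_def vec_eq_iff)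
    ultimately show "\<forall>\<^sub>F t in at 0. \<exists>y S. y \<in> U \<and> transpose S = S \<and> A t = ginv y ** S \<and> u y * \<nu> y \<le> C \<and> 2 * \<nu> y / u y \<le> C"
      using x by (intro always_eventually allI exI conjI) (auto simp: C_def)
  qed
  then have "deriv (\<lambda>t. Fmat f (A t)) 0 = (\<Sum>a\<in>UNIV. pd a f \<kappa> * (P a \<bullet> (covHess u \<psi> x *v P a)))"
    unfolding gB by (rule DERIV_imp_deriv)
  then show ?thesis by (simp add: Fop_def A_def B_def matrix_inv_g[OF x])
qed

text \<open>F(A) is constant near x, so its derivative along Du vanishes. From g A = h follows g A'
  = h' - g' A, and on a frame vector A acts as multiplication by its curvature.\<close>

lemma differentiated_equation:
  assumes sym: "\<forall>p q. p permutes (UNIV::'n set) \<longrightarrow> q \<in> posK \<longrightarrow> f (\<chi> i. q$(p i)) = f q"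
    and f: "f differentiable (at \<kappa>)" and x: "x \<in> U" and \<kappa>: "\<kappa> \<in> posK" and fr: "frame x P \<kappa>"
    and V: "open V" "x \<in> V" and const: "\<And>y. y \<in> V \<Longrightarrow> f (kappa u y) = \<sigma>"
  shows "(\<Sum>a\<in>UNIV. pd a f \<kappa> * (dh_form x (P a) - \<kappa> $ a * dg_form x (P a))) = 0"
proof -
  define v where "v = p x"
  define Dg where "Dg = (\<lambda>i j v. - 2 * (p x \<bullet> v) / (u x) ^ 3 * ((if i = j then 1 else 0) - p x $ i * p x $ j)
     - ((H x *v v) $ i * p x $ j + p x $ i * (H x *v v) $ j) / (u x)\<^sup>2)"
  define Dh where "Dh = (\<lambda>i j v. ((\<nu> x) ^ 3 * (q x \<bullet> v) / (u x)\<^sup>2 - 2 * \<nu> x * (p x \<bullet> v) / (u x) ^ 3) * ((if i = j then 1 else 0) - p x $ i * p x $ j)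
     - \<nu> x / (u x)\<^sup>2 * ((H x *v v) $ i * p x $ j + p x $ i * (H x *v v) $ j)
     - ((\<nu> x) ^ 3 * (q x \<bullet> v) / u x - \<nu> x * (p x \<bullet> v) / (u x)\<^sup>2) * H x $ i $ j
     - \<nu> x / u x * (Du (pd i (pd j u)) x \<bullet> v))"
  have dg': "((\<lambda>y. gdS u y $ i $ j) has_derivative Dg i j) (at x)" for i j
    unfolding Dg_def by (rule dg[OF x])
  have dh': "((\<lambda>y. hdS u y $ i $ j) has_derivative Dh i j) (at x)" for i j
    unfolding Dh_def by (rule dh[OF x])
  \<comment> \<open>Existence of the derivative is established here; its value is found by
    differentiating g A = h, which spares the derivative of the inverse metric.\<close>
  have "\<exists>D. ((\<lambda>y. Amat u y $ i $ j) has_derivative D) (at x)" for i j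
  proof -
    have "(\<lambda>y. ginv y $ i $ k) differentiable (at x)" for k
    proof -
      have "(\<lambda>y. (u y)\<^sup>2 * ((if i = k then 1 else 0) + (\<nu> y)\<^sup>2 * pd i u y * pd k u y)) differentiable (at x)"
        unfolding power2_eq_square using du[OF x] dnu[OF x] dpk[OF x]
        by (intro differentiable_mult differentiable_add differentiable_const) (auto simp: differentiable_def)
      then show ?thesis by (simp add: ginv_def)
    qed
    then have "(\<lambda>y. \<Sum>k\<in>UNIV. ginv y $ i $ k * hdS u y $ k $ j) differentiable (at x)"
      using dh' by (intro differentiable_sum differentiable_mult ballI) (auto simp: differentiable_def)
    then obtain D where D: "((\<lambda>y. \<Sum>k\<in>UNIV. ginv y $ i $ k * hdS u y $ k $ j) has_derivative D) (at x)"
      unfolding differentiable_def ..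
    have "((\<lambda>y. Amat u y $ i $ j) has_derivative D) (at x)"
      by (rule has_derivative_transform_within_open[OF D open_U x]) (simp add: Amat_eq matrix_matrix_mult_def)
    then show ?thesis by blast
  qed
  then obtain DA where DA: "\<And>i j. ((\<lambda>y. Amat u y $ i $ j) has_derivative DA i j) (at x)" by metis
  define B where "B = (\<chi> i j. DA i j v)"
  define g' where "g' = (\<chi> i j. Dg i j v)"
  define h' where "h' = (\<chi> i j. Dh i j v)"
  have gA: "gdS u y ** Amat u y = hdS u y" if "y \<in> U" for y
    unfolding Amat_eq[OF that] matrix_mul_assoc
    using ginv_g[OF that] matrix_left_right_inverse[of "ginv y" "gdS u y"] by simp
  have "Dh i j v = (\<Sum>k\<in>UNIV. gdS u x $ i $ k * DA k j v + Dg i k v * Amat u x $ k $ j)" for i j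
  proof -
    have "((\<lambda>y. \<Sum>k\<in>UNIV. gdS u y $ i $ k * Amat u y $ k $ j) has_derivative
       (\<lambda>v. \<Sum>k\<in>UNIV. gdS u x $ i $ k * DA k j v + Dg i k v * Amat u x $ k $ j)) (at x)"
      by (intro has_derivative_sum has_derivative_mult dg' DA)
    then have "((\<lambda>y. hdS u y $ i $ j) has_derivative
       (\<lambda>v. \<Sum>k\<in>UNIV. gdS u x $ i $ k * DA k j v + Dg i k v * Amat u x $ k $ j)) (at x)"
      by (rule has_derivative_transform_within_open[OF _ open_U x])
        (simp add: gA[symmetric] matrix_matrix_mult_def)
    from has_derivative_unique[OF dh' this] show ?thesis by (rule fun_cong)
  qed
  then have gB: "gdS u x ** B = h' - g' ** Amat u x"
    by (simp add: vec_eq_iff matrix_matrix_mult_def h'_def g'_def B_def sum.distrib)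
  have "((\<lambda>t. Fmat f (Amat u (x + t *\<^sub>R v))) has_real_derivative (\<Sum>a\<in>UNIV. pd a f \<kappa> * (P a \<bullet> ((gdS u x ** B) *v P a)))) (at 0)"
  proof (rule Fmat_curve_derivative[OF sym f x \<kappa> fr])
    show "((\<lambda>t. Amat u (x + t *\<^sub>R v) $ i $ j) has_real_derivative B $ i $ j) (at 0)" for i j
      using has_derivative_line[OF DA] by (simp add: B_def)
    \<comment> \<open>The extra 1 makes both bounds strict at x, hence valid nearby.\<close>
    define C where "C = max (u x * \<nu> x) (2 * \<nu> x / u x) + 1"
    have cu: "(u \<longlongrightarrow> u x) (nhds x)" and cn: "(\<nu> \<longlongrightarrow> \<nu> x) (nhds x)"
      using has_derivative_continuous[OF du[OF x]] has_derivative_continuous[OF dnu[OF x]]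
      by (simp_all add: continuous_at tendsto_at_iff_tendsto_nhds)
    have "((\<lambda>y. u y * \<nu> y) \<longlongrightarrow> u x * \<nu> x) (nhds x)" by (intro tendsto_mult cu cn)
    then have e1: "\<forall>\<^sub>F y in nhds x. u y * \<nu> y < C" by (rule order_tendstoD) (simp add: C_def)
    have "((\<lambda>y. 2 * \<nu> y / u y) \<longlongrightarrow> 2 * \<nu> x / u x) (nhds x)"
      using u_pos[OF x] by (intro tendsto_intros cu cn) simp
    then have e2: "\<forall>\<^sub>F y in nhds x. 2 * \<nu> y / u y < C" by (rule order_tendstoD) (simp add: C_def)
    have "\<forall>\<^sub>F y in nhds x. y \<in> U" using open_U x by (rule eventually_nhds_in_open)
    with e1 e2 have e: "\<forall>\<^sub>F y in nhds x. y \<in> U \<and> u y * \<nu> y \<le> C \<and> 2 * \<nu> y / u y \<le> C"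
      by eventually_elim auto
    have "((\<lambda>t. x + t *\<^sub>R v) \<longlongrightarrow> x + 0 *\<^sub>R v) (at (0::real))" by (intro tendsto_intros)
    then have "filterlim (\<lambda>t. x + t *\<^sub>R v) (nhds x) (at (0::real))" by simp
    from eventually_compose_filterlim[OF e this]
    have "\<forall>\<^sub>F t in at 0. x + t *\<^sub>R v \<in> U \<and> u (x + t *\<^sub>R v) * \<nu> (x + t *\<^sub>R v) \<le> C \<and> 2 * \<nu> (x + t *\<^sub>R v) / u (x + t *\<^sub>R v) \<le> C" .
    then show "\<forall>\<^sub>F t in at 0. \<exists>y S. y \<in> U \<and> transpose S = S \<and> Amat u (x + t *\<^sub>R v) = ginv y ** S \<and> u y * \<nu> y \<le> C \<and> 2 * \<nu> y / u y \<le> C"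
    proof eventually_elim
      case (elim t)
      then show ?case
        by (intro exI[of _ "x + t *\<^sub>R v"] exI[of _ "hdS u (x + t *\<^sub>R v)"]) (simp add: h_transpose Amat_eq)
    qed
  qed simp
  moreover have "((\<lambda>t. Fmat f (Amat u (x + t *\<^sub>R v))) has_real_derivative 0) (at 0)"
  proof -
    have "((\<lambda>t. x + t *\<^sub>R v) \<longlongrightarrow> x + 0 *\<^sub>R v) (nhds (0::real))" by (intro tendsto_intros filterlim_ident)
    then have "\<forall>\<^sub>F t in nhds (0::real). x + t *\<^sub>R v \<in> V"
      by (rule topological_tendstoD) (use V in auto)
    then have ev: "\<forall>\<^sub>F t in nhds (0::real). Fmat f (Amat u (x + t *\<^sub>R v)) = \<sigma>"
      by eventually_elim (use const in \<open>simp add: Fmat_def kappa_def\<close>)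
    have "((\<lambda>t::real. \<sigma>) has_real_derivative 0) (at 0)" by simp
    then show ?thesis using DERIV_cong_ev[OF refl ev refl] by blast
  qed
  ultimately have "(\<Sum>a\<in>UNIV. pd a f \<kappa> * (P a \<bullet> ((gdS u x ** B) *v P a))) = 0" by (rule DERIV_unique)
  moreover have "P a \<bullet> ((gdS u x ** B) *v P a) = dh_form x (P a) - \<kappa> $ a * dg_form x (P a)" for a
  proof -
    have "Amat u x *v P a = ginv x *v (\<kappa> $ a *\<^sub>R (gdS u x *v P a))"
      using fr unfolding Amat_eq[OF x] matrix_vector_mul_assoc[symmetric] eigen_frame_def by simp
    also have "\<dots> = \<kappa> $ a *\<^sub>R P a"
      by (simp add: matrix_vector_mult_scaleR matrix_vector_mul_assoc ginv_g[OF x])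
    finally have AP: "Amat u x *v P a = \<kappa> $ a *\<^sub>R P a" .
    have "(gdS u x ** B) *v P a = h' *v P a - g' *v (Amat u x *v P a)"
      unfolding gB by (simp add: matrix_vector_mult_diff_rdistrib matrix_vector_mul_assoc)
    then have e: "P a \<bullet> ((gdS u x ** B) *v P a) = P a \<bullet> (h' *v P a) - \<kappa> $ a * (P a \<bullet> (g' *v P a))"
      by (simp add: AP inner_diff_right matrix_vector_mult_scaleR)
    define \<xi> where "\<xi> = P a"
    have G: "\<xi> \<bullet> (g' *v \<xi>) = dg_form x \<xi>"
    proof -
      have "\<xi> \<bullet> (g' *v \<xi>) = (\<Sum>i\<in>UNIV. \<Sum>j\<in>UNIV.
          (- 2 * (p x \<bullet> p x) / (u x) ^ 3) * (\<xi> $ i * (if i = j then 1 else 0) * \<xi> $ j)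
          - (- 2 * (p x \<bullet> p x) / (u x) ^ 3) * (\<xi> $ i * (p x $ i * p x $ j) * \<xi> $ j)
          - (1 / (u x)\<^sup>2) * (\<xi> $ i * (q x $ i * p x $ j) * \<xi> $ j) - (1 / (u x)\<^sup>2) * (\<xi> $ i * (p x $ i * q x $ j) * \<xi> $ j))"
        unfolding matrix_form_sum g'_def vec_lambda_beta Dg_def v_def
        by (intro sum.cong refl) (simp add: algebra_simps add_divide_distrib diff_divide_distrib del: Du_nth)
      also have "\<dots> = (- 2 * (p x \<bullet> p x) / (u x) ^ 3) * (\<xi> \<bullet> \<xi>) - (- 2 * (p x \<bullet> p x) / (u x) ^ 3) * ((p x \<bullet> \<xi>) * (p x \<bullet> \<xi>))
          - (1 / (u x)\<^sup>2) * ((q x \<bullet> \<xi>) * (p x \<bullet> \<xi>)) - (1 / (u x)\<^sup>2) * ((p x \<bullet> \<xi>) * (q x \<bullet> \<xi>))"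
        unfolding sum.distrib sum_subtractf sum_distrib_left[symmetric] outer_form_sum kronecker_form_sum ..
      finally show ?thesis unfolding dg_form_def by (simp add: algebra_simps power2_eq_square diff_divide_distrib)
    qed
    have "\<xi> \<bullet> (h' *v \<xi>) = dh_form x \<xi>"
    proof -
      define c where "c = (\<nu> x) ^ 3 * (q x \<bullet> p x) / (u x)\<^sup>2 - 2 * \<nu> x * (p x \<bullet> p x) / (u x) ^ 3"
      define d where "d = (\<nu> x) ^ 3 * (q x \<bullet> p x) / u x - \<nu> x * (p x \<bullet> p x) / (u x)\<^sup>2"
      have "\<xi> \<bullet> (h' *v \<xi>) = (\<Sum>i\<in>UNIV. \<Sum>j\<in>UNIV.
          c * (\<xi> $ i * (if i = j then 1 else 0) * \<xi> $ j)
          - c * (\<xi> $ i * (p x $ i * p x $ j) * \<xi> $ j)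
          - (\<nu> x / (u x)\<^sup>2) * (\<xi> $ i * (q x $ i * p x $ j) * \<xi> $ j) - (\<nu> x / (u x)\<^sup>2) * (\<xi> $ i * (p x $ i * q x $ j) * \<xi> $ j)
          - d * (\<xi> $ i * H x $ i $ j * \<xi> $ j) - (\<nu> x / u x) * (\<xi> $ i * (Du (pd i (pd j u)) x \<bullet> p x) * \<xi> $ j))"
        unfolding matrix_form_sum h'_def vec_lambda_beta Dh_def v_def c_def[symmetric] d_def[symmetric]
        by (intro sum.cong refl) (simp add: algebra_simps del: Du_nth D2u_nth)
      also have "\<dots> = c * (\<xi> \<bullet> \<xi>) - c * ((p x \<bullet> \<xi>) * (p x \<bullet> \<xi>))
          - (\<nu> x / (u x)\<^sup>2) * ((q x \<bullet> \<xi>) * (p x \<bullet> \<xi>)) - (\<nu> x / (u x)\<^sup>2) * ((p x \<bullet> \<xi>) * (q x \<bullet> \<xi>))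
          - d * (\<xi> \<bullet> (H x *v \<xi>)) - (\<nu> x / u x) * T3 x \<xi>"
        unfolding sum.distrib sum_subtractf sum_distrib_left[symmetric] outer_form_sum kronecker_form_sum
          matrix_form_sum[symmetric] T3_def[symmetric] ..
      finally show ?thesis unfolding dh_form_def c_def[symmetric] d_def[symmetric] by (simp add: algebra_simps power2_eq_square)
    qed
    with e G show ?thesis by (simp add: \<xi>_def)
  qed
  ultimately show ?thesis by simp
qed

end

section \<open>Consequences of the conditions on f\<close>

lemma f_cond_sym: "f_conditions f \<Longrightarrow> \<forall>p q. p permutes (UNIV::'n::finite set) \<longrightarrow> q \<in> posK \<longrightarrow> f (\<chi> i. q$(p i)) = f q"
  for f :: "real^'n \<Rightarrow> real"
  unfolding f_conditions_def by (elim conjE)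

lemma f_cond_smooth: "f_conditions f \<Longrightarrow> smooth_on posK f"
  unfolding f_conditions_def by (elim conjE)

lemma f_cond_differentiable: "f_conditions f \<Longrightarrow> q \<in> posK \<Longrightarrow> f differentiable (at q)"
  by (rule smooth_on_differentiable[OF f_cond_smooth])

lemma f_cond_pd_pos: "f_conditions f \<Longrightarrow> q \<in> posK \<Longrightarrow> pd i f q > 0"
  unfolding f_conditions_def by blast

lemma f_cond_concave: "f_conditions f \<Longrightarrow> concave_on posK f"
  unfolding f_conditions_def by (elim conjE)

lemma f_cond_dual_concave: "f_conditions f \<Longrightarrow> concave_on posK (\<lambda>q. 1 / f (\<chi> i. 1 / q$i))"
  unfolding f_conditions_def by (elim conjE)

lemma f_cond_pos: "f_conditions f \<Longrightarrow> q \<in> posK \<Longrightarrow> f q > 0"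
  unfolding f_conditions_def by blast

lemma f_cond_boundary: "f_conditions f \<Longrightarrow> continuous_on (closure posK) f" "f_conditions f \<Longrightarrow> q \<in> frontier posK \<Longrightarrow> f q = 0"
  unfolding f_conditions_def by blast+

lemma f_cond_one: "f_conditions f \<Longrightarrow> f onevec = 1"
  unfolding f_conditions_def by (elim conjE)

lemma f_cond_homogeneous: "f_conditions f \<Longrightarrow> q \<in> posK \<Longrightarrow> t > 0 \<Longrightarrow> f (t *\<^sub>R q) = t * f q"
  unfolding f_conditions_def by blast

lemma onevec_posK: "onevec \<in> posK"
  by (simp add: onevec_def posK_def)

lemma scaleR_posK: "t > 0 \<Longrightarrow> q \<in> posK \<Longrightarrow> t *\<^sub>R q \<in> posK"
  by (simp add: posK_def)

lemma f_cond_scaled_one: "f_conditions f \<Longrightarrow> t > 0 \<Longrightarrow> f (t *\<^sub>R onevec) = t"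
  by (simp add: f_cond_homogeneous[OF _ onevec_posK] f_cond_one)

lemma f_cond_Euler:
  assumes f: "f_conditions f" and q: "q \<in> posK"
  shows "Du f q \<bullet> q = f q"
proof -
  have "((\<lambda>t. f (q + t *\<^sub>R q)) has_real_derivative Du f q \<bullet> q) (at 0)"
    by (rule has_derivative_line[OF has_derivative_Du[OF f_cond_differentiable[OF f q]]])
  moreover have "((\<lambda>t. (1 + t) * f q) has_real_derivative f q) (at 0)"
    by (auto intro!: derivative_eq_intros)
  then have "((\<lambda>t. f (q + t *\<^sub>R q)) has_real_derivative f q) (at 0)"
  proof (rule has_field_derivative_transform_within_open[of _ _ _ "{-1<..}"])
    fix t :: real assume "t \<in> {-1<..}"
    then have "f ((1 + t) *\<^sub>R q) = (1 + t) * f q" by (intro f_cond_homogeneous[OF f q]) simp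
    then show "(1 + t) * f q = f (q + t *\<^sub>R q)" by (simp add: scaleR_add_left)
  qed auto
  ultimately show ?thesis by (rule DERIV_unique)
qed

lemma concave_derivative_ge_chord:
  fixes G :: "real \<Rightarrow> real"
  assumes "(G has_real_derivative D) (at 0)"
    and conc: "\<And>s. 0 < s \<Longrightarrow> s < 1 \<Longrightarrow> (1 - s) * G 0 + s * G 1 \<le> G s"
  shows "D \<ge> G 1 - G 0"
proof (rule ccontr)
  assume "\<not> ?thesis"
  then have neg: "D - (G 1 - G 0) < 0" by simp
  have "((\<lambda>s. G s - s * (G 1 - G 0)) has_real_derivative D - (G 1 - G 0)) (at 0)"
    using assms(1) by (auto intro!: derivative_eq_intros)
  from DERIV_neg_dec_right[OF this neg] obtain d where d: "d > 0"
    "\<And>h. 0 < h \<Longrightarrow> h < d \<Longrightarrow> G (0 + h) - (0 + h) * (G 1 - G 0) < G 0 - 0 * (G 1 - G 0)" by blast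
  define s where "s = min d 1 / 2"
  have s: "0 < s" "s < d" "s < 1" using d by (auto simp: s_def)
  show False using d(2)[OF s(1,2)] conc[OF s(1,3)] by (simp add: algebra_simps)
qed

lemma f_cond_tangent:
  assumes f: "f_conditions f" and q: "q \<in> posK" and r: "r \<in> posK"
  shows "f r \<le> f q + Du f q \<bullet> (r - q)"
proof -
  define G where "G s = f (q + s *\<^sub>R (r - q))" for s
  have "(G has_real_derivative Du f q \<bullet> (r - q)) (at 0)"
    unfolding G_def by (rule has_derivative_line[OF has_derivative_Du[OF f_cond_differentiable[OF f q]]])
  moreover have "(1 - s) * G 0 + s * G 1 \<le> G s" if "0 < s" "s < 1" for s
  proof -
    have "(1 - s) * f q + s * f r \<le> f ((1 - s) *\<^sub>R q + s *\<^sub>R r)"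
      using f_cond_concave[OF f] q r that unfolding concave_on_iff by auto
    moreover have "(1 - s) *\<^sub>R q + s *\<^sub>R r = q + s *\<^sub>R (r - q)" by (simp add: algebra_simps)
    ultimately show ?thesis by (simp add: G_def)
  qed
  ultimately have "Du f q \<bullet> (r - q) \<ge> G 1 - G 0" by (rule concave_derivative_ge_chord)
  then show ?thesis by (simp add: G_def)
qed

text \<open>A concave function lies below its tangent plane at the larger point r, and the gradient
  there is positive.\<close>

lemma f_cond_mono:
  assumes f: "f_conditions f" and q: "q \<in> posK" and r: "r \<in> posK" and le: "\<And>i. q $ i \<le> r $ i"
  shows "f q \<le> f r"
proof -
  have "Du f r \<bullet> (q - r) \<le> 0"
    unfolding inner_vec_def using f_cond_pd_pos[OF f r] le
    by (intro sum_nonpos) (simp add: mult_nonneg_nonpos less_imp_le)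
  then show ?thesis using f_cond_tangent[OF f r q] by simp
qed

lemma f_cond_strict_mono:
  assumes f: "f_conditions f" and q: "q \<in> posK" and r: "r \<in> posK" and le: "\<And>i. q $ i \<le> r $ i"
    and k: "q $ k < r $ k"
  shows "f q < f r"
proof -
  have "(\<Sum>i\<in>UNIV. pd i f r * (r $ i - q $ i)) > 0"
  proof (rule sum_pos2[of _ k])
    show "0 < pd k f r * (r $ k - q $ k)" using f_cond_pd_pos[OF f r] k by simp
    show "0 \<le> pd i f r * (r $ i - q $ i)" for i using f_cond_pd_pos[OF f r, of i] le[of i] by simp
  qed auto
  moreover have "Du f r \<bullet> (q - r) = - (\<Sum>i\<in>UNIV. pd i f r * (r $ i - q $ i))"
    unfolding inner_vec_def sum_negf[symmetric] by (intro sum.cong refl) (simp add: algebra_simps)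
  ultimately show ?thesis using f_cond_tangent[OF f r q] by simp
qed

text \<open>The tangent plane at q, evaluated at (1,...,1), reads 1 \<le> f q + \<Sum> f_i - f q by
  Euler's relation.\<close>

lemma f_cond_sum_ge_one:
  assumes f: "f_conditions f" and q: "q \<in> posK"
  shows "(\<Sum>i\<in>UNIV. pd i f q) \<ge> 1"
proof -
  have "Du f q \<bullet> onevec = (\<Sum>i\<in>UNIV. pd i f q)" by (simp add: inner_vec_def onevec_def)
  then show ?thesis
    using f_cond_tangent[OF f q onevec_posK] f_cond_one[OF f] f_cond_Euler[OF f q] by (simp add: inner_diff_right)
qed

text \<open>Concavity of \<open>g(q) = 1 / f(1/q)\<close> along the segment from \<open>1/\<kappa>\<close> to \<open>(1,\<dots>,1)\<close>.\<close>
lemma f_cond_sum_squares: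
  fixes f :: "real^'n::finite \<Rightarrow> real"
  assumes f: "f_conditions f" and q: "q \<in> posK"
  shows "(\<Sum>i\<in>UNIV. pd i f q * (q $ i)\<^sup>2) \<ge> (f q)\<^sup>2"
proof -
  have qi: "q $ i > 0" for i using q by (simp add: posK_def)
  define r where "r = (\<chi> i. 1 / q $ i)"
  have r: "r \<in> posK" using qi by (simp add: r_def posK_def)
  \<comment> \<open>Componentwise reciprocal of the segment from 1/q to (1,...,1). It starts at q
    with velocity q_i - q_i^2, the vector \<open>v\<close> below.\<close>
  define c where "c s = (\<chi> i. 1 / (r $ i + s * (1 - r $ i)))" for s
  have c0: "c 0 = q" by (simp add: c_def r_def vec_eq_iff)
  have c1: "c 1 = onevec" by (simp add: c_def onevec_def)
  define G where "G s = 1 / f (c s)" for s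
  define v where "v = (\<chi> i. q $ i - (q $ i)\<^sup>2)"
  have "((\<lambda>s. c s $ i) has_real_derivative v $ i) (at 0)" for i
  proof -
    have "((\<lambda>s. 1 / (r $ i + s * (1 - r $ i))) has_real_derivative - (1 - r $ i) / (r $ i * r $ i)) (at 0)"
      using r[unfolded posK_def, simplified, THEN spec, of i] by (auto intro!: derivative_eq_intros)
    moreover have "- (1 - r $ i) / (r $ i * r $ i) = v $ i"
      using qi[of i] by (simp add: r_def v_def power2_eq_square field_simps)
    ultimately show ?thesis by (simp add: c_def)
  qed
  then have "(c has_derivative (\<lambda>s. s *\<^sub>R v)) (at 0)"
    unfolding has_derivative_componentwise_within[of c] Basis_vec_def
    by (auto simp: inner_axis has_field_derivative_def mult.commute[of _ "_ $ _"])
  then have "((\<lambda>s. f (c s)) has_derivative (\<lambda>s. Du f q \<bullet> (s *\<^sub>R v))) (at 0)"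
    by (rule has_derivative_compose[where g = f]) (simp add: c0 has_derivative_Du[OF f_cond_differentiable[OF f q]])
  then have fc: "((\<lambda>s. f (c s)) has_real_derivative Du f q \<bullet> v) (at 0)"
    by (rule has_derivative_imp_has_field_derivative) simp
  have fq: "f q > 0" using f_cond_pos[OF f q] .
  have "(G has_real_derivative - (Du f q \<bullet> v) / (f q)\<^sup>2) (at 0)"
    unfolding G_def using fc fq by (auto intro!: derivative_eq_intros simp: c0 power2_eq_square)
  moreover have "(1 - s) * G 0 + s * G 1 \<le> G s" if "0 < s" "s < 1" for s
  proof -
    have "(1 - s) * (1 / f (\<chi> i. 1 / r $ i)) + s * (1 / f (\<chi> i. 1 / onevec $ i))
       \<le> 1 / f (\<chi> i. 1 / ((1 - s) *\<^sub>R r + s *\<^sub>R onevec) $ i)"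
      by (rule concave_onD[OF f_cond_dual_concave[OF f] _ _ r onevec_posK]) (use that in auto)
    moreover have "(\<chi> i. 1 / r $ i) = c 0" "(\<chi> i. 1 / onevec $ i) = c 1"
      "(\<chi> i. 1 / ((1 - s) *\<^sub>R r + s *\<^sub>R onevec) $ i) = c s"
      by (simp_all add: c_def onevec_def algebra_simps)
    ultimately show ?thesis by (simp add: G_def)
  qed
  ultimately have "- (Du f q \<bullet> v) / (f q)\<^sup>2 \<ge> G 1 - G 0" by (rule concave_derivative_ge_chord)
  moreover have "G 1 - G 0 = 1 - 1 / f q" by (simp add: G_def c0 c1 f_cond_one[OF f])
  moreover have "Du f q \<bullet> v = f q - (\<Sum>i\<in>UNIV. pd i f q * (q $ i)\<^sup>2)"
    unfolding f_cond_Euler[OF f q, symmetric] by (simp add: inner_vec_def v_def right_diff_distrib sum_subtractf)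
  ultimately have "((\<Sum>i\<in>UNIV. pd i f q * (q $ i)\<^sup>2) - f q) / (f q)\<^sup>2 \<ge> 1 - 1 / f q" by simp
  then have "(\<Sum>i\<in>UNIV. pd i f q * (q $ i)\<^sup>2) - f q \<ge> (1 - 1 / f q) * (f q)\<^sup>2"
    using fq by (simp add: le_divide_eq)
  moreover have "(1 - 1 / f q) * (f q)\<^sup>2 = (f q)\<^sup>2 - f q" using fq by (simp add: power2_eq_square algebra_simps)
  ultimately show ?thesis by simp
qed

text \<open>A level set of \<open>f\<close> stays away from the boundary of the cone, where \<open>f\<close> vanishes.\<close>
lemma f_cond_pd_bounds:
  fixes f :: "real^'n::finite \<Rightarrow> real"
  assumes f: "f_conditions f" and "\<sigma> > 0"
  obtains c M where "c > 0" "\<And>q i. q \<in> posK \<Longrightarrow> f q = \<sigma> \<Longrightarrow> norm q \<le> C \<Longrightarrow> c \<le> pd i f q \<and> pd i f q \<le> M"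
proof -
  define S where "S = {q \<in> closure posK. f q = \<sigma>} \<inter> cball (0::real^'n) C"
  have "closed {q \<in> closure posK. f q = \<sigma>}"
    by (rule continuous_closed_preimage_constant[OF f_cond_boundary(1)[OF f]]) simp
  then have "compact S" unfolding S_def by (intro closed_Int_compact) auto
  have op: "open (posK :: (real^'n) set)" using f_cond_smooth[OF f] by (simp add: smooth_on_def)
  have "S \<subseteq> posK"
  proof
    fix q assume q: "q \<in> S"
    show "q \<in> posK"
    proof (rule ccontr)
      assume "q \<notin> posK"
      then have "q \<in> frontier posK" using q op by (simp add: S_def frontier_def interior_open)
      then show False using f_cond_boundary(2)[OF f] q \<open>\<sigma> > 0\<close> by (simp add: S_def)
    qed
  qed
  have cont: "continuous_on S (pd i f)" for i
    by (rule continuous_on_subset[OF smooth_on_continuous_on[OF smooth_on_pd[OF f_cond_smooth[OF f]]] \<open>S \<subseteq> posK\<close>])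
  have inS: "q \<in> S" if "q \<in> posK" "f q = \<sigma>" "norm q \<le> C" for q
    using that closure_subset by (auto simp: S_def)
  show ?thesis
  proof (cases "S = {}")
    case True
    then show ?thesis using inS by (intro that[of 1 0]) auto
  next
    case False
    have "\<exists>c>0. \<exists>M. \<forall>q\<in>S. c \<le> pd i f q \<and> pd i f q \<le> M" for i
    proof -
      obtain a where a: "a \<in> S" "\<forall>q\<in>S. pd i f a \<le> pd i f q" using continuous_attains_inf[OF \<open>compact S\<close> False cont] by blast
      obtain b where b: "b \<in> S" "\<forall>q\<in>S. pd i f q \<le> pd i f b" using continuous_attains_sup[OF \<open>compact S\<close> False cont] by blast
      have "pd i f a > 0" using f_cond_pd_pos[OF f] a(1) \<open>S \<subseteq> posK\<close> by blast
      then show ?thesis using a b by blast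
    qed
    then obtain c M where cM: "\<And>i. c i > 0" "\<And>i q. q \<in> S \<Longrightarrow> c i \<le> pd i f q \<and> pd i f q \<le> M i" by metis
    show ?thesis
    proof (rule that[of "Min (range c)" "Max (range M)"])
      show "Min (range c) > 0" using cM(1) by (subst Min_gr_iff) auto
      fix q i assume "q \<in> posK" "f q = \<sigma>" "norm q \<le> C"
      then have "q \<in> S" by (rule inS)
      moreover have "Min (range c) \<le> c i" "M i \<le> Max (range M)" by auto
      ultimately show "Min (range c) \<le> pd i f q \<and> pd i f q \<le> Max (range M)" using cM(2)[of q i] by linarith
    qed
  qed
qed

lemma abs_matrix_form_le:
  fixes M :: "real^'n::finite^'n"
  shows "\<bar>\<xi> \<bullet> (M *v \<xi>)\<bar> \<le> (\<Sum>i\<in>UNIV. \<Sum>j\<in>UNIV. \<bar>M $ i $ j\<bar>) * (norm \<xi>)\<^sup>2"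
proof -
  have "\<bar>\<xi> \<bullet> (M *v \<xi>)\<bar> \<le> (\<Sum>i\<in>UNIV. \<Sum>j\<in>UNIV. \<bar>\<xi> $ i * M $ i $ j * \<xi> $ j\<bar>)"
    unfolding matrix_form_sum by (intro order_trans[OF sum_abs] sum_mono sum_abs)
  also have "\<dots> \<le> (\<Sum>i\<in>UNIV. \<Sum>j\<in>UNIV. \<bar>M $ i $ j\<bar> * (norm \<xi>)\<^sup>2)"
  proof (intro sum_mono)
    fix i j
    have "\<bar>\<xi> $ i\<bar> * \<bar>\<xi> $ j\<bar> \<le> norm \<xi> * norm \<xi>" by (intro mult_mono component_le_norm_cart) auto
    then have "\<bar>M $ i $ j\<bar> * (\<bar>\<xi> $ i\<bar> * \<bar>\<xi> $ j\<bar>) \<le> \<bar>M $ i $ j\<bar> * (norm \<xi> * norm \<xi>)" by (intro mult_left_mono) auto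
    then show "\<bar>\<xi> $ i * M $ i $ j * \<xi> $ j\<bar> \<le> \<bar>M $ i $ j\<bar> * (norm \<xi>)\<^sup>2"
      by (simp add: abs_mult power2_eq_square mult_ac)
  qed
  finally show ?thesis by (simp add: sum_distrib_right)
qed

section \<open>The linearized operator on a convex graph: formula, sign and uniform
  ellipticity\<close>

locale convex_graph = spacelike_graph u U for u :: "real^'n::finite \<Rightarrow> real" and U +
  fixes \<Omega> :: "(real^'n) set" and f :: "real^'n \<Rightarrow> real" and \<sigma> :: real
  assumes f: "f_conditions f" and sigma: "\<sigma> > 1"
    and open_\<Omega>: "open \<Omega>" and bounded_\<Omega>: "bounded \<Omega>" and closure_\<Omega>: "closure \<Omega> \<subseteq> U"
    and kappa_pos: "\<And>x. x \<in> \<Omega> \<Longrightarrow> kappa u x \<in> posK"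
    and kappa_eq: "\<And>x. x \<in> \<Omega> \<Longrightarrow> f (kappa u x) = \<sigma>"
begin

lemma \<Omega>_U: "x \<in> \<Omega> \<Longrightarrow> x \<in> U"
  using closure_\<Omega> closure_subset by blast

text \<open>\<open>frame_identity\<close> summed against f_i: the \<nu>^2 terms cancel by the
  differentiated equation, and Euler's relation replaces the sum of f_i \<kappa>_i by \<sigma> in
  both places where it occurs.\<close>

lemma Fop_phi:
  assumes x: "x \<in> \<Omega>"
  shows "Fop f u (phi \<sigma>) x = \<sigma> / u x * (1 - (\<Sum>i\<in>UNIV. pd i f (kappa u x)))
              + \<nu> x / u x * (\<sigma>\<^sup>2 - (\<Sum>i\<in>UNIV. pd i f (kappa u x) * (kappa u x $ i)\<^sup>2))"
proof -
  define \<kappa> where "\<kappa> = kappa u x"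
  have xU: "x \<in> U" by (rule \<Omega>_U[OF x])
  have \<kappa>: "\<kappa> \<in> posK" "f \<kappa> = \<sigma>" using kappa_pos[OF x] kappa_eq[OF x] by (auto simp: \<kappa>_def)
  obtain P where fr: "frame x P \<kappa>" using frame_exists[OF xU] unfolding \<kappa>_def by blast
  note sym = f_cond_sym[OF f] and diff = f_cond_differentiable[OF f \<kappa>(1)]
  have eq0: "(\<Sum>a\<in>UNIV. pd a f \<kappa> * (dh_form x (P a) - \<kappa> $ a * dg_form x (P a))) = 0"
    by (rule differentiated_equation[OF sym diff xU \<kappa>(1) fr open_\<Omega> x kappa_eq])
  have Euler: "(\<Sum>a\<in>UNIV. pd a f \<kappa> * \<kappa> $ a) = \<sigma>"
    using f_cond_Euler[OF f \<kappa>(1)] \<kappa>(2) by (simp add: inner_vec_def)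
  have "Fop f u (phi \<sigma>) x = (\<Sum>a\<in>UNIV. pd a f \<kappa> * (P a \<bullet> (covHess u (phi \<sigma>) x *v P a)))"
    by (rule Fop_eq[OF sym diff xU \<kappa>(1) fr C2_phi xU])
  also have "\<dots> = (\<Sum>a\<in>UNIV. (\<sigma> * \<nu> x / u x) * (pd a f \<kappa> * \<kappa> $ a) - (\<sigma> / u x) * pd a f \<kappa> + (1 / u x) * (pd a f \<kappa> * \<kappa> $ a)
     - (\<nu> x / u x) * (pd a f \<kappa> * (\<kappa> $ a)\<^sup>2) + (\<nu> x)\<^sup>2 * (pd a f \<kappa> * (dh_form x (P a) - \<kappa> $ a * dg_form x (P a))))"
    unfolding frame_identity[OF xU fr]
    by (intro sum.cong refl) (simp add: algebra_simps add_divide_distrib diff_divide_distrib)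
  also have "\<dots> = (\<sigma> * \<nu> x / u x) * \<sigma> - (\<sigma> / u x) * (\<Sum>a\<in>UNIV. pd a f \<kappa>) + (1 / u x) * \<sigma>
     - (\<nu> x / u x) * (\<Sum>a\<in>UNIV. pd a f \<kappa> * (\<kappa> $ a)\<^sup>2)"
    unfolding sum.distrib sum_subtractf sum_distrib_left[symmetric] eq0 Euler by simp
  finally show ?thesis unfolding \<kappa>_def by (simp add: algebra_simps power2_eq_square)
qed

lemma Fop_phi_nonpos:
  assumes x: "x \<in> \<Omega>" shows "Fop f u (phi \<sigma>) x \<le> 0"
proof -
  have "\<sigma> / u x * (1 - (\<Sum>i\<in>UNIV. pd i f (kappa u x))) \<le> 0"
    using f_cond_sum_ge_one[OF f kappa_pos[OF x]] sigma u_pos[OF \<Omega>_U[OF x]]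
    by (intro mult_nonneg_nonpos) auto
  moreover have "\<nu> x / u x * (\<sigma>\<^sup>2 - (\<Sum>i\<in>UNIV. pd i f (kappa u x) * (kappa u x $ i)\<^sup>2)) \<le> 0"
    using f_cond_sum_squares[OF f kappa_pos[OF x]] kappa_eq[OF x] nu_pos[OF \<Omega>_U[OF x]] u_pos[OF \<Omega>_U[OF x]]
    by (intro mult_nonneg_nonpos) (simp_all add: less_imp_le)
  ultimately show ?thesis unfolding Fop_phi[OF x] by simp
qed

definition pframe :: "real^'n \<Rightarrow> 'n \<Rightarrow> real^'n" where
  "pframe x = (SOME P. frame x P (kappa u x))"

lemma pframe:
  assumes "x \<in> U" shows "frame x (pframe x) (kappa u x)"
proof -
  obtain P where "frame x P (kappa u x)" by (rule frame_exists[OF assms])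
  then show ?thesis unfolding pframe_def by (rule someI[where P = "\<lambda>P. frame x P (kappa u x)"])
qed

text \<open>Scaling by the square root of f_a makes these vectors a factorization of the
  coefficients F^ij.\<close>

definition wframe :: "real^'n \<Rightarrow> 'n \<Rightarrow> real^'n" where
  "wframe x a = sqrt (pd a f (kappa u x)) *\<^sub>R pframe x a"

text \<open>First-order part of the covariant Hessian on the frame, written as a vector paired with
  the gradient. The summand - u \<nu>^2 stems from |\<xi>|^2 - (p \<bullet> \<xi>)^2 = u^2 on frame
  vectors.\<close>

definition drift :: "real^'n \<Rightarrow> real^'n" where
  "drift x = (\<Sum>a\<in>UNIV. pd a f (kappa u x) *\<^sub>R
     (((\<nu> x)\<^sup>2 * (pframe x a \<bullet> (H x *v pframe x a)) - u x * (\<nu> x)\<^sup>2) *\<^sub>R p x + (2 * (p x \<bullet> pframe x a) / u x) *\<^sub>R pframe x a))"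

lemma Fop_lin_op:
  assumes x: "x \<in> \<Omega>" and \<psi>: "C2_on V \<psi>" "x \<in> V"
  shows "Fop f u \<psi> x = lin_op wframe drift \<psi> x"
proof -
  have xU: "x \<in> U" by (rule \<Omega>_U[OF x])
  define \<kappa> where "\<kappa> = kappa u x"
  have \<kappa>: "\<kappa> \<in> posK" using kappa_pos[OF x] by (simp add: \<kappa>_def)
  note fr = pframe[OF xU, folded \<kappa>_def]
  have "Fop f u \<psi> x = (\<Sum>a\<in>UNIV. pd a f \<kappa> * (pframe x a \<bullet> (covHess u \<psi> x *v pframe x a)))"
    by (rule Fop_eq[OF f_cond_sym[OF f] f_cond_differentiable[OF f \<kappa>] xU \<kappa> fr \<psi>])
  also have "\<dots> = (\<Sum>a\<in>UNIV. wframe x a \<bullet> (D2u \<psi> x *v wframe x a) + (pd a f \<kappa> *\<^sub>R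
     (((\<nu> x)\<^sup>2 * (pframe x a \<bullet> (H x *v pframe x a)) - u x * (\<nu> x)\<^sup>2) *\<^sub>R p x + (2 * (p x \<bullet> pframe x a) / u x) *\<^sub>R pframe x a)) \<bullet> Du \<psi> x)"
  proof (intro sum.cong refl)
    fix a
    define \<xi> where "\<xi> = pframe x a"
    have pos: "pd a f \<kappa> \<ge> 0" using f_cond_pd_pos[OF f \<kappa>, of a] by simp
    have "\<xi> \<bullet> \<xi> - (p x \<bullet> \<xi>)\<^sup>2 = (u x)\<^sup>2" using frame_vector(1)[OF xU fr, of a] by (simp add: \<xi>_def)
    moreover have "wframe x a \<bullet> (D2u \<psi> x *v wframe x a) = pd a f \<kappa> * (\<xi> \<bullet> (D2u \<psi> x *v \<xi>))"
      using pos by (simp add: wframe_def \<kappa>_def[symmetric] \<xi>_def[symmetric] matrix_vector_mult_scaleR)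
    ultimately show "pd a f \<kappa> * (pframe x a \<bullet> (covHess u \<psi> x *v pframe x a)) = wframe x a \<bullet> (D2u \<psi> x *v wframe x a) + (pd a f \<kappa> *\<^sub>R
     (((\<nu> x)\<^sup>2 * (pframe x a \<bullet> (H x *v pframe x a)) - u x * (\<nu> x)\<^sup>2) *\<^sub>R p x + (2 * (p x \<bullet> pframe x a) / u x) *\<^sub>R pframe x a)) \<bullet> Du \<psi> x"
      unfolding \<xi>_def[symmetric] covHess_form[OF xU] using u_pos[OF xU]
      by (simp add: inner_add_left inner_commute[of "Du \<psi> x"] power2_eq_square algebra_simps)
  qed
  also have "\<dots> = lin_op wframe drift \<psi> x"
    unfolding lin_op_def drift_def inner_sum_left \<kappa>_def by (simp add: sum.distrib)
  finally show ?thesis .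
qed

lemma compact_bound:
  assumes "continuous_on U F"
  shows "\<exists>C::real. \<forall>x\<in>closure \<Omega>. F x \<le> C"
proof (cases "\<Omega> = {}")
  case False
  have "compact (closure \<Omega>)" using bounded_\<Omega> by simp
  moreover have "continuous_on (closure \<Omega>) F" using assms closure_\<Omega> by (rule continuous_on_subset)
  ultimately show ?thesis using continuous_attains_sup[of "closure \<Omega>" F] False closure_eq_empty[of \<Omega>] by blast
qed simp

lemma continuous_u: "continuous_on U u" and continuous_nu: "continuous_on U \<nu>"
  using has_derivative_continuous[OF du] has_derivative_continuous[OF dnu]
  by (auto intro!: continuous_at_imp_continuous_on)

lemma uniform_bounds:
  obtains C where "C \<ge> 1" "\<And>x. x \<in> closure \<Omega> \<Longrightarrow> 1 / u x \<le> C" "\<And>x. x \<in> closure \<Omega> \<Longrightarrow> u x \<le> C"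
    "\<And>x. x \<in> closure \<Omega> \<Longrightarrow> \<nu> x \<le> C" "\<And>x \<xi>. x \<in> closure \<Omega> \<Longrightarrow> \<bar>\<xi> \<bullet> (H x *v \<xi>)\<bar> \<le> C * (norm \<xi>)\<^sup>2"
proof -
  have "continuous_on U (\<lambda>x. 1 / u x)" using u_pos by (intro continuous_intros continuous_u) force
  from compact_bound[OF this] obtain C1 where C1: "\<And>x. x \<in> closure \<Omega> \<Longrightarrow> 1 / u x \<le> C1" by blast
  obtain C2 where C2: "\<And>x. x \<in> closure \<Omega> \<Longrightarrow> u x \<le> C2" using compact_bound[OF continuous_u] by blast
  obtain C3 where C3: "\<And>x. x \<in> closure \<Omega> \<Longrightarrow> \<nu> x \<le> C3" using compact_bound[OF continuous_nu] by blast
  have "continuous_on U (\<lambda>x. \<Sum>i\<in>UNIV. \<Sum>j\<in>UNIV. \<bar>pd i (pd j u) x\<bar>)"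
    by (intro continuous_intros smooth_on_continuous_on smooth_on_pd smooth)
  from compact_bound[OF this] obtain C4 where C4: "\<And>x. x \<in> closure \<Omega> \<Longrightarrow> (\<Sum>i\<in>UNIV. \<Sum>j\<in>UNIV. \<bar>pd i (pd j u) x\<bar>) \<le> C4" by blast
  have Hb: "\<bar>\<xi> \<bullet> (H x *v \<xi>)\<bar> \<le> (\<Sum>i\<in>UNIV. \<Sum>j\<in>UNIV. \<bar>pd i (pd j u) x\<bar>) * (norm \<xi>)\<^sup>2" for x \<xi>
    using abs_matrix_form_le[of \<xi> "H x"] by simp
  define C where "C = max 1 (max (max C1 C2) (max C3 C4))"
  show ?thesis
  proof (rule that[of C])
    show "\<bar>\<xi> \<bullet> (H x *v \<xi>)\<bar> \<le> C * (norm \<xi>)\<^sup>2" if "x \<in> closure \<Omega>" for x \<xi>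
    proof (rule order_trans[OF Hb])
      show "(\<Sum>i\<in>UNIV. \<Sum>j\<in>UNIV. \<bar>pd i (pd j u) x\<bar>) * (norm \<xi>)\<^sup>2 \<le> C * (norm \<xi>)\<^sup>2"
        using C4[OF that] by (intro mult_right_mono) (auto simp: C_def)
    qed
  qed (use C1 C2 C3 in \<open>fastforce simp: C_def\<close>)+
qed

text \<open>Bounds on u, \<nu> and the Hessian over the closure bound the frame and the curvatures,
  and then f_i lies between positive constants on the level set. The lower bound c / C^2 combines
  f_i \<ge> c with g^-1 \<ge> u^2 I and u \<ge> 1/C.\<close>

lemma elliptic: "uniformly_elliptic \<Omega> wframe drift"
proof -
  obtain C where C: "C \<ge> 1" "\<And>x. x \<in> closure \<Omega> \<Longrightarrow> 1 / u x \<le> C" "\<And>x. x \<in> closure \<Omega> \<Longrightarrow> u x \<le> C"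
    "\<And>x. x \<in> closure \<Omega> \<Longrightarrow> \<nu> x \<le> C" "\<And>x \<xi>. x \<in> closure \<Omega> \<Longrightarrow> \<bar>\<xi> \<bullet> (H x *v \<xi>)\<bar> \<le> C * (norm \<xi>)\<^sup>2"
    using uniform_bounds by blast
  have C0: "C > 0" using C(1) by simp
  define n where "n = real CARD('n)"
  have pfb: "norm (pframe x a) \<le> C\<^sup>2" if "x \<in> \<Omega>" for x a
  proof -
    have x: "x \<in> closure \<Omega>" "x \<in> U" using that closure_subset \<Omega>_U by auto
    have "norm (pframe x a) \<le> u x * \<nu> x" by (rule eigen_frame_bound(1)[OF x(2) pframe[OF x(2)]])
    also have "\<dots> \<le> C * C" using C(3,4)[OF x(1)] nu_pos[OF x(2)] C0 by (intro mult_mono) auto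
    finally show ?thesis by (simp add: power2_eq_square)
  qed
  have Hpf: "\<bar>pframe x a \<bullet> (H x *v pframe x a)\<bar> \<le> C ^ 5" if "x \<in> \<Omega>" for x a
  proof -
    have x: "x \<in> closure \<Omega>" using that closure_subset by auto
    have "\<bar>pframe x a \<bullet> (H x *v pframe x a)\<bar> \<le> C * (norm (pframe x a))\<^sup>2" by (rule C(5)[OF x])
    also have "\<dots> \<le> C * (C\<^sup>2)\<^sup>2" using pfb[OF that] C0 by (intro mult_left_mono power_mono) auto
    also have "C * (C\<^sup>2)\<^sup>2 = C ^ 5" by (simp add: eval_nat_numeral)
    finally show ?thesis .
  qed
  have kb: "norm (kappa u x) \<le> n * (C + C * C * C ^ 5)" if "x \<in> \<Omega>" for x
  proof -
    have x: "x \<in> closure \<Omega>" "x \<in> U" using that closure_subset \<Omega>_U by auto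
    have "\<bar>kappa u x $ a\<bar> \<le> C + C * C * C ^ 5" for a
    proof -
      note fr = pframe[OF x(2)]
      have "kappa u x $ a = pframe x a \<bullet> (hdS u x *v pframe x a)"
        using fr unfolding eigen_frame_def by simp
      also have "\<dots> = \<nu> x / (u x)\<^sup>2 * (pframe x a \<bullet> pframe x a - (p x \<bullet> pframe x a)\<^sup>2) - \<nu> x / u x * (pframe x a \<bullet> (H x *v pframe x a))"
        by (simp add: h_mult inner_diff_right inner_commute power2_eq_square)
      also have "\<dots> = \<nu> x - \<nu> x * (1 / u x) * (pframe x a \<bullet> (H x *v pframe x a))"
        using frame_vector(1)[OF x(2) fr, of a] u_pos[OF x(2)] by simp
      finally have "\<bar>kappa u x $ a\<bar> \<le> \<bar>\<nu> x\<bar> + \<bar>\<nu> x * (1 / u x) * (pframe x a \<bullet> (H x *v pframe x a))\<bar>" by linarith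
      also have "\<dots> = \<nu> x + \<nu> x * (1 / u x) * \<bar>pframe x a \<bullet> (H x *v pframe x a)\<bar>"
        using nu_pos[OF x(2)] u_pos[OF x(2)] by (simp add: abs_mult)
      also have "\<dots> \<le> C + C * C * C ^ 5"
        using C(2,4)[OF x(1)] nu_pos[OF x(2)] u_pos[OF x(2)] C0 Hpf[OF that]
        by (intro add_mono mult_mono) auto
      finally show ?thesis .
    qed
    then have "(\<Sum>a\<in>UNIV. \<bar>kappa u x $ a\<bar>) \<le> (\<Sum>a\<in>(UNIV::'n set). C + C * C * C ^ 5)" by (intro sum_mono) auto
    then show ?thesis using norm_le_l1_cart[of "kappa u x"] by (simp add: n_def)
  qed
  obtain c M where c: "c > 0" and cM: "\<And>q i. q \<in> posK \<Longrightarrow> f q = \<sigma> \<Longrightarrow> norm q \<le> n * (C + C * C * C ^ 5) \<Longrightarrow> c \<le> pd i f q \<and> pd i f q \<le> M"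
    using f_cond_pd_bounds[OF f, of \<sigma> "n * (C + C * C * C ^ 5)"] sigma by auto
  have fb: "c \<le> pd i f (kappa u x)" "pd i f (kappa u x) \<le> M" if "x \<in> \<Omega>" for x i
    using cM[OF kappa_pos kappa_eq kb, OF that that that] by auto
  define K where "K = C\<^sup>2 * C ^ 5 + C * C\<^sup>2 + 2 * C\<^sup>2 * C * C\<^sup>2"
  show ?thesis unfolding uniformly_elliptic_def
  proof (rule exI[of _ "c / C\<^sup>2"], intro conjI exI[of _ "max (n * (M * (C\<^sup>2)\<^sup>2)) (n * (M * K))"] ballI allI)
    show "c / C\<^sup>2 > 0" using c C0 by simp
    fix x assume x\<Omega>: "x \<in> \<Omega>"
    have x: "x \<in> closure \<Omega>" "x \<in> U" using x\<Omega> closure_subset \<Omega>_U by auto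
    note fr = pframe[OF x(2)]
    have fpos: "pd a f (kappa u x) > 0" for a using fb(1)[OF x\<Omega>, of a] c by linarith
    have M0: "M \<ge> 0" using fpos[of undefined] fb(2)[OF x\<Omega>, of undefined] by linarith
    have u0: "u x > 0" and n0: "\<nu> x > 0" using u_pos[OF x(2)] nu_pos[OF x(2)] .
    show "c / C\<^sup>2 * (norm z)\<^sup>2 \<le> (\<Sum>a\<in>UNIV. (wframe x a \<bullet> z)\<^sup>2)" for z
    proof -
      have "1 / C \<le> u x" using C(2)[OF x(1)] u0 C0 by (simp add: field_simps)
      then have "(1 / C)\<^sup>2 \<le> (u x)\<^sup>2" using C0 by (intro power_mono) auto
      then have "(1 / C)\<^sup>2 * (norm z)\<^sup>2 \<le> (u x)\<^sup>2 * (norm z)\<^sup>2" by (rule mult_right_mono) simp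
      also have "\<dots> \<le> (u x)\<^sup>2 * (z \<bullet> z + (\<nu> x)\<^sup>2 * (p x \<bullet> z)\<^sup>2)"
        unfolding power2_norm_eq_inner by (intro mult_left_mono) simp_all
      also have "\<dots> = z \<bullet> (ginv x *v z)"
        by (simp add: ginv_mult inner_add_right power2_eq_square[of "p x \<bullet> z"] inner_commute[of z "p x"])
      also have "\<dots> = (\<Sum>a\<in>UNIV. (pframe x a \<bullet> z)\<^sup>2)"
        by (rule eigen_frame_complete[OF fr g_transpose ginv_g[OF x(2)], symmetric])
      finally have "c * ((1 / C)\<^sup>2 * (norm z)\<^sup>2) \<le> c * (\<Sum>a\<in>UNIV. (pframe x a \<bullet> z)\<^sup>2)"
        using c by (intro mult_left_mono) auto
      also have "\<dots> \<le> (\<Sum>a\<in>UNIV. pd a f (kappa u x) * (pframe x a \<bullet> z)\<^sup>2)"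
        unfolding sum_distrib_left using fb(1)[OF x\<Omega>] by (intro sum_mono mult_right_mono) auto
      also have "\<dots> = (\<Sum>a\<in>UNIV. (wframe x a \<bullet> z)\<^sup>2)"
        by (intro sum.cong refl) (simp add: wframe_def power_mult_distrib less_imp_le[OF fpos])
      finally show ?thesis by (simp add: power_divide)
    qed
    have "(\<Sum>a\<in>UNIV. (norm (wframe x a))\<^sup>2) \<le> (\<Sum>a\<in>(UNIV::'n set). M * (C\<^sup>2)\<^sup>2)"
    proof (rule sum_mono)
      fix a
      have "(norm (wframe x a))\<^sup>2 = pd a f (kappa u x) * (norm (pframe x a))\<^sup>2"
        by (simp add: wframe_def power_mult_distrib less_imp_le[OF fpos])
      also have "\<dots> \<le> M * (C\<^sup>2)\<^sup>2"
        using fb(2)[OF x\<Omega>] M0 pfb[OF x\<Omega>] by (intro mult_mono power_mono) auto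
      finally show "(norm (wframe x a))\<^sup>2 \<le> M * (C\<^sup>2)\<^sup>2" .
    qed
    then show "(\<Sum>a\<in>UNIV. (norm (wframe x a))\<^sup>2) \<le> max (n * (M * (C\<^sup>2)\<^sup>2)) (n * (M * K))" by (simp add: n_def)
    have "norm (drift x) \<le> (\<Sum>a\<in>(UNIV::'n set). M * K)"
      unfolding drift_def
    proof (rule sum_norm_le)
      fix a
      define \<xi> where "\<xi> = pframe x a"
      have p1: "norm (p x) \<le> 1" using spacelike[OF x(2)] by simp
      have "norm (((\<nu> x)\<^sup>2 * (\<xi> \<bullet> (H x *v \<xi>)) - u x * (\<nu> x)\<^sup>2) *\<^sub>R p x + (2 * (p x \<bullet> \<xi>) / u x) *\<^sub>R \<xi>)
         \<le> \<bar>(\<nu> x)\<^sup>2 * (\<xi> \<bullet> (H x *v \<xi>)) - u x * (\<nu> x)\<^sup>2\<bar> * norm (p x) + \<bar>2 * (p x \<bullet> \<xi>) / u x\<bar> * norm \<xi>"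
        by (rule order_trans[OF norm_triangle_ineq]) simp
      also have "\<dots> \<le> (C\<^sup>2 * C ^ 5 + C * C\<^sup>2) * 1 + (2 * C\<^sup>2 * C) * C\<^sup>2"
      proof (intro add_mono mult_mono)
        have n2: "(\<nu> x)\<^sup>2 \<le> C\<^sup>2" using C(4)[OF x(1)] n0 by (intro power_mono) auto
        have "\<bar>(\<nu> x)\<^sup>2 * (\<xi> \<bullet> (H x *v \<xi>)) - u x * (\<nu> x)\<^sup>2\<bar> \<le> (\<nu> x)\<^sup>2 * \<bar>\<xi> \<bullet> (H x *v \<xi>)\<bar> + u x * (\<nu> x)\<^sup>2"
          using u0 by (intro order_trans[OF abs_triangle_ineq4]) (simp add: abs_mult)
        also have "\<dots> \<le> C\<^sup>2 * C ^ 5 + C * C\<^sup>2"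
          using n2 C(3)[OF x(1)] Hpf[OF x\<Omega>] C0 u0 unfolding \<xi>_def by (intro add_mono mult_mono) auto
        finally show "\<bar>(\<nu> x)\<^sup>2 * (\<xi> \<bullet> (H x *v \<xi>)) - u x * (\<nu> x)\<^sup>2\<bar> \<le> C\<^sup>2 * C ^ 5 + C * C\<^sup>2" .
        have "\<bar>p x \<bullet> \<xi>\<bar> \<le> norm (p x) * norm \<xi>" by (rule Cauchy_Schwarz_ineq2)
        also have "\<dots> \<le> 1 * C\<^sup>2" using p1 pfb[OF x\<Omega>] unfolding \<xi>_def by (intro mult_mono) auto
        finally have "2 * \<bar>p x \<bullet> \<xi>\<bar> * (1 / u x) \<le> 2 * C\<^sup>2 * C" using C(2)[OF x(1)] u0 by (intro mult_mono) auto
        then show "\<bar>2 * (p x \<bullet> \<xi>) / u x\<bar> \<le> 2 * C\<^sup>2 * C" using u0 by (simp add: abs_mult)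
        show "norm \<xi> \<le> C\<^sup>2" using pfb[OF x\<Omega>] by (simp add: \<xi>_def)
      qed (use p1 C0 in auto)
      finally have "norm (((\<nu> x)\<^sup>2 * (\<xi> \<bullet> (H x *v \<xi>)) - u x * (\<nu> x)\<^sup>2) *\<^sub>R p x + (2 * (p x \<bullet> \<xi>) / u x) *\<^sub>R \<xi>) \<le> K"
        by (simp add: K_def)
      then have "pd a f (kappa u x) * norm (((\<nu> x)\<^sup>2 * (\<xi> \<bullet> (H x *v \<xi>)) - u x * (\<nu> x)\<^sup>2) *\<^sub>R p x + (2 * (p x \<bullet> \<xi>) / u x) *\<^sub>R \<xi>) \<le> M * K"
        using fb(2)[OF x\<Omega>] M0 by (intro mult_mono) auto
      then show "norm (pd a f (kappa u x) *\<^sub>R (((\<nu> x)\<^sup>2 * (pframe x a \<bullet> (H x *v pframe x a)) - u x * (\<nu> x)\<^sup>2) *\<^sub>R p x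
          + (2 * (p x \<bullet> pframe x a) / u x) *\<^sub>R pframe x a)) \<le> M * K"
        using less_imp_le[OF fpos] by (simp add: \<xi>_def)
    qed
    then show "norm (drift x) \<le> max (n * (M * (C\<^sup>2)\<^sup>2)) (n * (M * K))" by (simp add: n_def)
  qed
qed

lemma lin_op_phi_nonpos: "x \<in> \<Omega> \<Longrightarrow> lin_op wframe drift (phi \<sigma>) x \<le> 0"
  using Fop_lin_op[OF _ C2_phi \<Omega>_U] Fop_phi_nonpos by simp

lemma continuous_phi: "continuous_on (closure \<Omega>) (phi \<sigma>)"
  using has_derivative_continuous[OF dphi] closure_\<Omega>
  by (auto intro!: continuous_at_imp_continuous_on)

lemma phi_C2_\<Omega>: "C2_on \<Omega> (phi \<sigma>)"
  using C2_on_subset[OF C2_phi _ open_\<Omega>] \<Omega>_U by blast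

end

section \<open>Touching spheres\<close>

text \<open>Taking A = \<Omega> gives interior and A = - \<Omega> exterior spheres, so attainment
  and monotonicity are proved once for both.\<close>

definition touching_radii :: "(real^'n::finite) set \<Rightarrow> (real^'n) set \<Rightarrow> real set" where
  "touching_radii A F = {r. r > 0 \<and> (\<forall>p\<in>F. \<exists>c. ball c r \<subseteq> A \<and> dist c p = r)}"

lemma int_sphere_radii_eq: "int_sphere_radii \<Omega> = touching_radii \<Omega> (frontier \<Omega>)"
  unfolding int_sphere_radii_def touching_radii_def by auto

lemma ext_sphere_radii_eq: "ext_sphere_radii \<Omega> = touching_radii (- \<Omega>) (frontier \<Omega>)"
  unfolding ext_sphere_radii_def touching_radii_def by (auto simp: disjoint_eq_subset_Compl)

text \<open>Homothety with centre p and ratio s / r.\<close>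

lemma ball_shrink:
  fixes c p :: "'a::real_normed_vector"
  assumes "dist c p = r" "0 < s" "s \<le> r"
  defines "c' \<equiv> p + (s / r) *\<^sub>R (c - p)"
  shows "ball c' s \<subseteq> ball c r" "dist c' p = s"
proof -
  have "c' - p = (s / r) *\<^sub>R (c - p)" by (simp add: c'_def)
  then have "norm (c' - p) = s / r * norm (c - p)" using assms by simp
  then show "dist c' p = s" using assms by (simp add: dist_norm)
  have "c - c' = (1 - s / r) *\<^sub>R (c - p)" by (simp add: c'_def algebra_simps)
  then have "norm (c - c') = \<bar>1 - s / r\<bar> * norm (c - p)" by (simp only: norm_scaleR)
  moreover have "\<bar>1 - s / r\<bar> = 1 - s / r" using assms(2,3) by simp
  ultimately have "dist c c' = (1 - s / r) * r" using assms(1) by (simp add: dist_norm)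
  then have "dist c c' = r - s" using assms(2,3) by (simp add: left_diff_distrib)
  show "ball c' s \<subseteq> ball c r"
  proof
    fix y assume "y \<in> ball c' s"
    then show "y \<in> ball c r" using \<open>dist c c' = r - s\<close> dist_triangle[of c y c'] by simp
  qed
qed

lemma touching_radii_downward:
  assumes "r \<in> touching_radii A F" "0 < s" "s \<le> r"
  shows "s \<in> touching_radii A F"
  unfolding touching_radii_def mem_Collect_eq
proof (intro conjI ballI)
  fix p assume "p \<in> F"
  then obtain c where "ball c r \<subseteq> A" "dist c p = r" using assms(1) unfolding touching_radii_def by blast
  then show "\<exists>c. ball c s \<subseteq> A \<and> dist c p = s"
    using ball_shrink[OF \<open>dist c p = r\<close> assms(2,3)] by blast
qed (fact assms)

text \<open>Centres of nearly maximal balls through p accumulate by compactness, and every point of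
  the limiting open ball lies in one of these balls.\<close>

lemma Sup_touching_radii:
  fixes A :: "(real^'n::finite) set"
  assumes ne: "touching_radii A F \<noteq> {}" and bdd: "bdd_above (touching_radii A F)"
  shows "Sup (touching_radii A F) \<in> touching_radii A F"
proof -
  define S where "S = touching_radii A F"
  define s where "s = Sup S"
  obtain r0 where r0: "r0 \<in> S" using ne by (auto simp: S_def)
  have "r0 \<le> s" unfolding s_def by (rule cSup_upper[OF r0]) (use bdd S_def in simp)
  moreover have "r0 > 0" using r0 by (simp add: S_def touching_radii_def)
  ultimately have s: "s > 0" by simp
  have "\<exists>c. ball c s \<subseteq> A \<and> dist c p = s" if p: "p \<in> F" for p
  proof -
    have "\<exists>r\<in>S. s - inverse (real (Suc k)) < r" for k
    proof (rule ccontr)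
      assume "\<not> ?thesis"
      then have "r \<le> s - inverse (real (Suc k))" if "r \<in> S" for r using that by force
      then have "s \<le> s - inverse (real (Suc k))" unfolding s_def using r0 by (intro cSup_least) auto
      then show False by simp
    qed
    then obtain r where r: "\<And>k. r k \<in> S" "\<And>k. s - inverse (real (Suc k)) < r k" by metis
    have rs: "r k \<le> s" for k unfolding s_def by (rule cSup_upper[OF r(1)]) (use bdd S_def in simp)
    have "\<exists>c. ball c (r k) \<subseteq> A \<and> dist c p = r k" for k using r(1)[of k] p by (simp add: S_def touching_radii_def)
    then obtain c where c: "\<And>k. ball (c k) (r k) \<subseteq> A" "\<And>k. dist (c k) p = r k" by metis
    have "\<forall>k. c k \<in> cball p s" using c(2) rs by (simp add: dist_commute)
    then obtain l \<phi> where l: "strict_mono (\<phi> :: nat \<Rightarrow> nat)" "(c \<circ> \<phi>) \<longlonglongrightarrow> l"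
      using compact_cball[of p s, unfolded compact_def] by metis
    have "r \<longlonglongrightarrow> s"
    proof (rule tendsto_sandwich)
      show "\<forall>\<^sub>F k in sequentially. s - inverse (real (Suc k)) \<le> r k" using r(2) by (simp add: less_imp_le)
      show "\<forall>\<^sub>F k in sequentially. r k \<le> s" using rs by simp
      show "(\<lambda>k. s - inverse (real (Suc k))) \<longlonglongrightarrow> s"
        using tendsto_diff[OF tendsto_const LIMSEQ_inverse_real_of_nat, of s] by simp
    qed simp
    then have rl: "(r \<circ> \<phi>) \<longlonglongrightarrow> s" using l(1) by (rule LIMSEQ_subseq_LIMSEQ)
    have "(\<lambda>k. dist ((c \<circ> \<phi>) k) p) \<longlonglongrightarrow> dist l p" by (intro tendsto_intros l(2))
    then have "(r \<circ> \<phi>) \<longlonglongrightarrow> dist l p" using c(2) by (simp add: comp_def)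
    then have 1: "dist l p = s" using rl LIMSEQ_unique by blast
    have "ball l s \<subseteq> A"
    proof
      fix y assume y: "y \<in> ball l s"
      have "(\<lambda>k. (r \<circ> \<phi>) k - dist ((c \<circ> \<phi>) k) y) \<longlonglongrightarrow> s - dist l y" by (intro tendsto_intros rl l(2))
      then have "\<forall>\<^sub>F k in sequentially. (r \<circ> \<phi>) k - dist ((c \<circ> \<phi>) k) y > 0"
        by (rule order_tendstoD) (use y in simp)
      then obtain k where "(r \<circ> \<phi>) k - dist ((c \<circ> \<phi>) k) y > 0"
        using eventually_happens'[OF sequentially_bot] by blast
      then have "y \<in> ball (c (\<phi> k)) (r (\<phi> k))" by simp
      then show "y \<in> A" using c(1) by blast
    qed
    with 1 show ?thesis by blast
  qed
  then show ?thesis using s by (simp add: touching_radii_def s_def S_def)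
qed

text \<open>Two mean value theorems; the intermediate factor s < 1 is estimated by 1, so C stands
  where Taylor's formula has C / 2.\<close>

lemma second_order_remainder:
  fixes \<psi> :: "real^'n::finite \<Rightarrow> real"
  assumes \<psi>: "C2_on U \<psi>" and seg: "\<And>t. 0 \<le> t \<Longrightarrow> t \<le> 1 \<Longrightarrow> x + t *\<^sub>R \<xi> \<in> U"
    and C: "\<And>t. 0 \<le> t \<Longrightarrow> t \<le> 1 \<Longrightarrow> \<bar>\<xi> \<bullet> (D2u \<psi> (x + t *\<^sub>R \<xi>) *v \<xi>)\<bar> \<le> C"
  shows "\<bar>\<psi> (x + \<xi>) - \<psi> x - Du \<psi> x \<bullet> \<xi>\<bar> \<le> C"
proof -
  have d: "\<psi> differentiable (at (x + t *\<^sub>R \<xi>))" "pd j \<psi> differentiable (at (x + t *\<^sub>R \<xi>))" if "0 \<le> t" "t \<le> 1" for t j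
    using \<psi> seg[OF that] by (auto simp: C2_on_def)
  obtain s where s: "0 < s" "s < 1" "\<psi> (x + 1 *\<^sub>R \<xi>) - \<psi> (x + 0 *\<^sub>R \<xi>) = (1 - 0) * (Du \<psi> (x + s *\<^sub>R \<xi>) \<bullet> \<xi>)"
    using MVT2[of 0 1 "\<lambda>t. \<psi> (x + t *\<^sub>R \<xi>)" "\<lambda>t. Du \<psi> (x + t *\<^sub>R \<xi>) \<bullet> \<xi>"] DERIV_along_line[OF d(1)] by auto
  have "\<exists>r. 0 < r \<and> r < s \<and> Du \<psi> (x + s *\<^sub>R \<xi>) \<bullet> \<xi> - Du \<psi> (x + 0 *\<^sub>R \<xi>) \<bullet> \<xi> = (s - 0) * (\<xi> \<bullet> (D2u \<psi> (x + r *\<^sub>R \<xi>) *v \<xi>))"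
    by (rule MVT2[OF s(1)]) (intro DERIV2_along_line d(2); use s in simp)
  then obtain r where r: "0 < r" "r < s" "Du \<psi> (x + s *\<^sub>R \<xi>) \<bullet> \<xi> - Du \<psi> x \<bullet> \<xi> = s * (\<xi> \<bullet> (D2u \<psi> (x + r *\<^sub>R \<xi>) *v \<xi>))" by auto
  have "\<psi> (x + \<xi>) - \<psi> x - Du \<psi> x \<bullet> \<xi> = s * (\<xi> \<bullet> (D2u \<psi> (x + r *\<^sub>R \<xi>) *v \<xi>))" using s(3) r(3) by simp
  then have "\<bar>\<psi> (x + \<xi>) - \<psi> x - Du \<psi> x \<bullet> \<xi>\<bar> \<le> 1 * \<bar>\<xi> \<bullet> (D2u \<psi> (x + r *\<^sub>R \<xi>) *v \<xi>)\<bar>"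
    using s by (simp add: abs_mult mult_left_le_one_le)
  also have "\<dots> \<le> C" using C[of r] r s by simp
  finally show ?thesis .
qed

lemma ball_expansion:
  fixes n :: "'a::real_inner"
  assumes "norm n = 1" "r > 0" "y \<in> ball (p + r *\<^sub>R n) r"
  shows "(norm (y - p))\<^sup>2 < 2 * r * (n \<bullet> (y - p))" "norm (y - p) < 2 * r"
proof -
  have 1: "norm ((y - p) - r *\<^sub>R n) < r" using assms(3) by (simp add: dist_norm norm_minus_commute algebra_simps)
  then have "(norm ((y - p) - r *\<^sub>R n))\<^sup>2 < r\<^sup>2" by (rule power_strict_mono) auto
  moreover have "(norm (z - r *\<^sub>R n))\<^sup>2 = (norm z)\<^sup>2 - 2 * r * (n \<bullet> z) + r\<^sup>2 * (norm n)\<^sup>2" for z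
    unfolding power2_norm_eq_inner
    by (simp add: inner_diff_left inner_diff_right inner_commute[of z n] power2_eq_square algebra_simps)
  ultimately show "(norm (y - p))\<^sup>2 < 2 * r * (n \<bullet> (y - p))" using assms by simp
  have "norm (y - p) \<le> norm ((y - p) - r *\<^sub>R n) + norm (r *\<^sub>R n)"
    using norm_triangle_ineq[of "(y - p) - r *\<^sub>R n" "r *\<^sub>R n"] by simp
  then show "norm (y - p) < 2 * r" using 1 assms by simp
qed

text \<open>In a ball of radius r tangent at x, |y - x|^2 is less than 2 r times the normal
  component of y - x. For small r the gradient of the defining function therefore outweighs its
  second-order remainder, and the sign of \<psi> decides on which side of the boundary the ball
  lies.\<close>

lemma local_sphere_condition:
  fixes \<Omega> :: "(real^'n::finite) set"
  assumes \<Omega>: "open \<Omega>" and p: "p \<in> frontier \<Omega>" "p \<in> U" and \<psi>: "smooth_on U \<psi>"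
    and grad: "\<And>x. x \<in> U \<Longrightarrow> \<exists>i. pd i \<psi> x \<noteq> 0" and eq: "\<Omega> \<inter> U = {x\<in>U. \<psi> x < 0}"
  shows "\<exists>\<rho>>0. \<exists>r>0. \<forall>x\<in>frontier \<Omega> \<inter> ball p \<rho>.
     (\<exists>c. ball c r \<subseteq> \<Omega> \<and> dist c x = r) \<and> (\<exists>c. ball c r \<subseteq> - \<Omega> \<and> dist c x = r)"
proof -
  have U: "open U" using \<psi> by (simp add: smooth_on_def)
  obtain R where R: "R > 0" "cball p R \<subseteq> U" using U p open_contains_cball by blast
  define \<rho> where "\<rho> = R / 2"
  have \<rho>: "\<rho> > 0" using R by (simp add: \<rho>_def)
  have "continuous_on (cball p R) (\<lambda>x. \<Sum>i\<in>UNIV. \<Sum>j\<in>UNIV. \<bar>pd i (pd j \<psi>) x\<bar>)"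
    by (intro continuous_intros continuous_on_subset[OF smooth_on_continuous_on R(2)] smooth_on_pd \<psi>)
  moreover have cne: "cball p R \<noteq> {}" using R by simp
  ultimately obtain z where z: "\<And>x. x \<in> cball p R \<Longrightarrow> (\<Sum>i\<in>UNIV. \<Sum>j\<in>UNIV. \<bar>pd i (pd j \<psi>) x\<bar>) \<le> (\<Sum>i\<in>UNIV. \<Sum>j\<in>UNIV. \<bar>pd i (pd j \<psi>) z\<bar>)"
    using continuous_attains_sup[OF compact_cball cne] by blast
  define C where "C = (\<Sum>i\<in>UNIV. \<Sum>j\<in>UNIV. \<bar>pd i (pd j \<psi>) z\<bar>) + 1"
  have C: "C > 0" unfolding C_def by (intro add_nonneg_pos sum_nonneg) auto
  have Cb: "\<bar>\<xi> \<bullet> (D2u \<psi> x *v \<xi>)\<bar> \<le> C * (norm \<xi>)\<^sup>2" if "x \<in> cball p R" for x \<xi>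
  proof -
    have "\<bar>\<xi> \<bullet> (D2u \<psi> x *v \<xi>)\<bar> \<le> (\<Sum>i\<in>UNIV. \<Sum>j\<in>UNIV. \<bar>pd i (pd j \<psi>) x\<bar>) * (norm \<xi>)\<^sup>2"
      using abs_matrix_form_le[of \<xi> "D2u \<psi> x"] by simp
    also have "\<dots> \<le> C * (norm \<xi>)\<^sup>2" using z[OF that] by (intro mult_right_mono) (auto simp: C_def)
    finally show ?thesis .
  qed
  have "continuous_on (cball p R) (\<lambda>x. \<Sum>i\<in>UNIV. (pd i \<psi> x)\<^sup>2)"
    by (intro continuous_intros continuous_on_subset[OF smooth_on_continuous_on R(2)] smooth_on_pd \<psi>)
  then obtain y0 where y0: "y0 \<in> cball p R" "\<And>x. x \<in> cball p R \<Longrightarrow> (\<Sum>i\<in>UNIV. (pd i \<psi> y0)\<^sup>2) \<le> (\<Sum>i\<in>UNIV. (pd i \<psi> x)\<^sup>2)"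
    using continuous_attains_inf[OF compact_cball cne] by blast
  have nD: "(norm (Du \<psi> x))\<^sup>2 = (\<Sum>i\<in>UNIV. (pd i \<psi> x)\<^sup>2)" for x
    unfolding power2_norm_eq_inner by (simp add: inner_vec_def power2_eq_square)
  define c where "c = norm (Du \<psi> y0)"
  have "Du \<psi> y0 \<noteq> 0" using grad[of y0] y0(1) R(2) by (auto simp: vec_eq_iff)
  then have c: "c > 0" by (simp add: c_def)
  have cb: "c \<le> norm (Du \<psi> x)" if "x \<in> cball p R" for x
    using y0(2)[OF that] unfolding nD[symmetric] c_def by (simp add: power2_le_iff_abs_le)
  \<comment> \<open>The first bound keeps both tangent balls inside \<open>cball p R\<close>, the
    second makes the gradient term dominate.\<close>
  define r where "r = min (\<rho> / 2) (c / (2 * C))"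
  have r: "r > 0" "2 * r \<le> \<rho>" "r \<le> c / (2 * C)" using \<rho> c C by (auto simp: r_def)
  have main: "(\<exists>c. ball c r \<subseteq> \<Omega> \<and> dist c x = r) \<and> (\<exists>c. ball c r \<subseteq> - \<Omega> \<and> dist c x = r)"
    if x: "x \<in> frontier \<Omega> \<inter> ball p \<rho>" for x
  proof -
    have xR: "x \<in> cball p R" "x \<in> U" using x R \<rho> by (auto simp: \<rho>_def)
    have notin: "x \<notin> \<Omega>" using x \<Omega> by (simp add: frontier_def interior_open)
    have \<psi>0: "\<psi> x = 0"
    proof (rule antisym)
      show "\<psi> x \<ge> 0" using notin eq xR by force
      show "\<psi> x \<le> 0"
      proof (rule ccontr)
        assume "\<not> \<psi> x \<le> 0"
        have "open {y \<in> U. \<psi> y \<in> {0<..}}"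
          using continuous_open_preimage[OF smooth_on_continuous_on[OF \<psi>] U, of "{0<..}"] by (simp add: vimage_def Int_def)
        moreover have "x \<in> {y \<in> U. \<psi> y \<in> {0<..}}" using xR \<open>\<not> \<psi> x \<le> 0\<close> by simp
        moreover have "x \<in> closure \<Omega>" using x by (simp add: frontier_def)
        ultimately have "\<Omega> \<inter> {y \<in> U. \<psi> y \<in> {0<..}} \<noteq> {}" using open_Int_closure_eq_empty by blast
        then obtain y where "y \<in> \<Omega> \<inter> U" "\<psi> y > 0" by auto
        then show False unfolding eq by simp
      qed
    qed
    define N where "N = norm (Du \<psi> x)"
    have N: "N \<ge> c" "N > 0" using cb[OF xR(1)] c by (auto simp: N_def)
    define n where "n = (1 / N) *\<^sub>R Du \<psi> x"
    have n: "norm n = 1" using N by (simp add: n_def N_def[symmetric])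
    have Dn: "Du \<psi> x \<bullet> v = N * (n \<bullet> v)" for v using N by (simp add: n_def)
    have taylor: "\<bar>\<psi> y - N * (n \<bullet> (y - x))\<bar> \<le> C * (norm (y - x))\<^sup>2" "y \<in> U" if "norm (y - x) < 2 * r" for y
    proof -
      have seg: "x + t *\<^sub>R (y - x) \<in> cball p R" if "0 \<le> t" "t \<le> 1" for t
      proof -
        have "dist p (x + t *\<^sub>R (y - x)) \<le> dist p x + norm (t *\<^sub>R (y - x))"
          using dist_triangle[of p "x + t *\<^sub>R (y - x)" x] by (simp add: dist_norm)
        moreover have "norm (t *\<^sub>R (y - x)) \<le> 1 * norm (y - x)" using that by (simp add: mult_left_le_one_le)
        ultimately show ?thesis using x r \<open>norm (y - x) < 2 * r\<close> by (simp add: \<rho>_def)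
      qed
      have "\<bar>\<psi> (x + (y - x)) - \<psi> x - Du \<psi> x \<bullet> (y - x)\<bar> \<le> C * (norm (y - x))\<^sup>2"
        by (rule second_order_remainder[OF smooth_on_C2_on[OF \<psi>]]) (use seg R(2) Cb in blast)+
      then show "\<bar>\<psi> y - N * (n \<bullet> (y - x))\<bar> \<le> C * (norm (y - x))\<^sup>2" by (simp add: \<psi>0 Dn)
      show "y \<in> U" using seg[of 1] R(2) by auto
    qed
    have Crq: "C * q < N * m" if "q < 2 * r * m" "q \<ge> 0" for q m :: real
    proof -
      have "0 < 2 * r * m" using that by linarith
      then have m: "m > 0" using r(1) by (simp add: zero_less_mult_iff)
      have "C * q < C * (2 * r * m)" using that C by simp
      also have "\<dots> = (2 * C * r) * m" by simp
      also have "\<dots> \<le> N * m"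
      proof (rule mult_right_mono)
        have "2 * C * r \<le> c" using r(3) C by (simp add: field_simps)
        then show "2 * C * r \<le> N" using N(1) by simp
      qed (use m in simp)
      finally show ?thesis .
    qed
    have "ball (x + r *\<^sub>R n) r \<subseteq> - \<Omega>"
    proof
      fix y assume y: "y \<in> ball (x + r *\<^sub>R n) r"
      note e = ball_expansion[OF n r(1) y]
      have "C * (norm (y - x))\<^sup>2 < N * (n \<bullet> (y - x))" by (rule Crq[OF e(1)]) simp
      then have "\<psi> y > 0" using taylor(1)[OF e(2)] by linarith
      then show "y \<in> - \<Omega>" using taylor(2)[OF e(2)] eq by force
    qed
    moreover have "dist (x + r *\<^sub>R n) x = r" "dist (x + r *\<^sub>R (- n)) x = r" using n r by (simp_all add: dist_norm)
    moreover have "ball (x + r *\<^sub>R (- n)) r \<subseteq> \<Omega>"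
    proof
      fix y assume y: "y \<in> ball (x + r *\<^sub>R (- n)) r"
      have n': "norm (- n) = 1" using n by simp
      note e = ball_expansion[OF n' r(1) y]
      have "C * (norm (y - x))\<^sup>2 < N * (- n \<bullet> (y - x))" by (rule Crq[OF e(1)]) simp
      then have "\<psi> y < 0" using taylor(1)[OF e(2)] by simp
      then show "y \<in> \<Omega>" using taylor(2)[OF e(2)] eq by force
    qed
    ultimately show ?thesis by blast
  qed
  show ?thesis using \<rho> r(1) main by blast
qed

lemma sphere_conditions:
  fixes \<Omega> :: "(real^'n::finite) set"
  assumes dom: "smooth_domain \<Omega>"
  shows "int_sphere_radii \<Omega> \<noteq> {}" "ext_sphere_radii \<Omega> \<noteq> {}"
proof -
  have \<Omega>: "open \<Omega>" "bounded \<Omega>" using dom by (auto simp: smooth_domain_def)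
  define good where "good r x \<longleftrightarrow> (\<exists>c. ball c r \<subseteq> \<Omega> \<and> dist c x = r) \<and> (\<exists>c. ball c r \<subseteq> - \<Omega> \<and> dist c x = r)" for r x
  have "\<exists>\<rho>>0. \<exists>r>0. \<forall>x\<in>frontier \<Omega> \<inter> ball p \<rho>. good r x" if p: "p \<in> frontier \<Omega>" for p
  proof -
    obtain U \<psi> where "p \<in> U" "smooth_on U \<psi>" "\<forall>x\<in>U. \<exists>i. pd i \<psi> x \<noteq> 0" "\<Omega> \<inter> U = {x\<in>U. \<psi> x < 0}"
      using dom p unfolding smooth_domain_def by blast
    then show ?thesis unfolding good_def by (intro local_sphere_condition[OF \<Omega>(1) p]) auto
  qed
  then obtain \<rho> r where \<rho>r: "\<And>p. p \<in> frontier \<Omega> \<Longrightarrow> \<rho> p > 0 \<and> r p > 0 \<and> (\<forall>x\<in>frontier \<Omega> \<inter> ball p (\<rho> p). good (r p) x)"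
    by metis
  have "compact (frontier \<Omega>)" using \<Omega> by (simp add: compact_frontier_bounded)
  moreover have "frontier \<Omega> \<subseteq> (\<Union>p\<in>frontier \<Omega>. ball p (\<rho> p))" using \<rho>r by force
  ultimately obtain S where S: "S \<subseteq> frontier \<Omega>" "finite S" "frontier \<Omega> \<subseteq> (\<Union>p\<in>S. ball p (\<rho> p))"
    using compactE_image[of "frontier \<Omega>" "frontier \<Omega>" "\<lambda>p. ball p (\<rho> p)"] by (metis open_ball)
  define s where "s = Min (insert 1 (r ` S))"
  have s: "s > 0" unfolding s_def using S \<rho>r by (subst Min_gr_iff) auto
  have "good s x" if x: "x \<in> frontier \<Omega>" for x
  proof -
    obtain p where p: "p \<in> S" "x \<in> ball p (\<rho> p)" using S(3) x by blast
    then have g: "good (r p) x" using \<rho>r S(1) x by blast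
    have le: "s \<le> r p" unfolding s_def using S(2) p(1) by (intro Min_le) auto
    show ?thesis using g ball_shrink[OF _ s le] unfolding good_def by (meson order_trans)
  qed
  then have "s \<in> int_sphere_radii \<Omega>" "s \<in> ext_sphere_radii \<Omega>"
    unfolding int_sphere_radii_eq ext_sphere_radii_eq touching_radii_def good_def using s by blast+
  then show "int_sphere_radii \<Omega> \<noteq> {}" "ext_sphere_radii \<Omega> \<noteq> {}" by blast+
qed

lemma frontier_nonempty:
  fixes \<Omega> :: "(real^'n::finite) set"
  assumes "smooth_domain \<Omega>" shows "frontier \<Omega> \<noteq> {}"
  using assms frontier_eq_empty[of \<Omega>] not_bounded_UNIV unfolding smooth_domain_def by blast

text \<open>A bounded domain contains no large balls, so the supremum is finite and attained.
  Exterior radii admit no such bound, which is the case r2 = \<infinity>.\<close>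

lemma Sup_int_sphere_radii:
  fixes \<Omega> :: "(real^'n::finite) set"
  assumes dom: "smooth_domain \<Omega>"
  shows "Sup (int_sphere_radii \<Omega>) \<in> int_sphere_radii \<Omega>"
proof -
  obtain p where p: "p \<in> frontier \<Omega>" using frontier_nonempty[OF dom] by blast
  obtain B where B: "\<And>x. x \<in> \<Omega> \<Longrightarrow> norm x \<le> B" using dom unfolding smooth_domain_def bounded_iff by blast
  have "bdd_above (int_sphere_radii \<Omega>)"
  proof (rule bdd_aboveI[of _ "4 * B"])
    fix r assume "r \<in> int_sphere_radii \<Omega>"
    then obtain c where r: "r > 0" "ball c r \<subseteq> \<Omega>" using p unfolding int_sphere_radii_eq touching_radii_def by blast
    obtain e :: "real^'n" where e: "norm e = 1" using vector_choose_size[of 1] by auto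
    have "c \<in> \<Omega>" "c + (r / 2) *\<^sub>R e \<in> \<Omega>" using r e by (auto intro!: subsetD[OF r(2)] simp: dist_norm)
    then have "norm c \<le> B" "norm (c + (r / 2) *\<^sub>R e) \<le> B" using B by auto
    moreover have "norm ((r / 2) *\<^sub>R e) \<le> norm (c + (r / 2) *\<^sub>R e) + norm c"
      using norm_triangle_ineq4[of "c + (r / 2) *\<^sub>R e" c] by simp
    ultimately show "r \<le> 4 * B" using e r by simp
  qed
  then show ?thesis
    using Sup_touching_radii sphere_conditions(1)[OF dom] unfolding int_sphere_radii_eq by blast
qed

section \<open>Comparison with umbilic hyperboloids\<close>

lemma C2_on_uminus:
  assumes "C2_on U \<phi>"
  shows "C2_on U (\<lambda>x. - \<phi> x)" and "x \<in> U \<Longrightarrow> Du (\<lambda>x. - \<phi> x) x = - Du \<phi> x"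
    and "x \<in> U \<Longrightarrow> D2u (\<lambda>x. - \<phi> x) x = - D2u \<phi> x"
proof -
  have U: "open U" and d: "\<And>y. y \<in> U \<Longrightarrow> (\<phi> has_derivative (\<lambda>v. Du \<phi> y \<bullet> v)) (at y)"
    and d2: "\<And>y j. y \<in> U \<Longrightarrow> (pd j \<phi> has_derivative (\<lambda>v. Du (pd j \<phi>) y \<bullet> v)) (at y)"
    using assms by (auto simp: C2_on_def intro: has_derivative_Du)
  have dn: "((\<lambda>x. - \<phi> x) has_derivative (\<lambda>v. - (Du \<phi> y \<bullet> v))) (at y)" if "y \<in> U" for y
    by (rule has_derivative_minus[OF d[OF that]])
  have pdn: "pd j (\<lambda>x. - \<phi> x) y = - pd j \<phi> y" if "y \<in> U" for y j
    by (simp add: pd_eqI[OF dn[OF that]] inner_axis)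
  have d2n: "(pd j (\<lambda>x. - \<phi> x) has_derivative (\<lambda>v. - (Du (pd j \<phi>) y \<bullet> v))) (at y)" if "y \<in> U" for y j
    by (rule has_derivative_transform_within_open[OF has_derivative_minus[OF d2[OF that]] U that]) (simp add: pdn)
  show "C2_on U (\<lambda>x. - \<phi> x)" unfolding C2_on_def differentiable_def using U dn d2n by blast
  show "Du (\<lambda>x. - \<phi> x) x = - Du \<phi> x" if "x \<in> U" using pdn[OF that] by (simp add: vec_eq_iff)
  show "D2u (\<lambda>x. - \<phi> x) x = - D2u \<phi> x" if "x \<in> U"
    by (simp add: vec_eq_iff pd_eqI[OF d2n[OF that]] inner_axis)
qed

lemma one_sided_min:
  assumes g: "(g has_real_derivative D) (at 0)" and "d > 0" "\<And>t. 0 < t \<Longrightarrow> t < d \<Longrightarrow> g 0 \<le> g t"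
  shows "D \<ge> 0"
proof (rule ccontr)
  assume "\<not> D \<ge> 0"
  then have "D < 0" by simp
  from DERIV_neg_dec_right[OF g this] obtain e where e: "e > 0" "\<And>h. 0 < h \<Longrightarrow> h < e \<Longrightarrow> g (0 + h) < g 0" by blast
  define t where "t = min d e / 2"
  have "0 < t" "t < d" "t < e" using e \<open>d > 0\<close> by (auto simp: t_def)
  with e(2)[of t] assms(3)[of t] show False by simp
qed

text \<open>Upper sheet of the Minkowski hyperboloid of radius R about (c, 0). The surfaces
  \<open>hyp R c\<close> - a R and a R - \<open>hyp R c\<close> are umbilic in de Sitter space with
  curvature a.\<close>

definition hyp :: "real \<Rightarrow> 'a::real_inner \<Rightarrow> 'a \<Rightarrow> real" where
  "hyp R c x = sqrt (R\<^sup>2 + (norm (x - c))\<^sup>2)"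

lemma hyp_pos: "R > 0 \<Longrightarrow> hyp R c x > 0"
  unfolding hyp_def by (simp add: add_pos_nonneg)

lemma hyp_sq: "(hyp R c x)\<^sup>2 = R\<^sup>2 + (norm (x - c))\<^sup>2"
  by (simp add: hyp_def)

lemma continuous_on_hyp: "continuous_on S (hyp R c)"
  unfolding hyp_def by (intro continuous_intros)

text \<open>The second derivative at 0 equals (|\<xi>|^2 - (D hyp \<bullet> \<xi>)^2) / hyp, a
  multiple of the sheet's own graph metric. This is the umbilicity exploited by the touching
  lemmas.\<close>

lemma hyp_line:
  fixes x c \<xi> :: "'a::real_inner"
  assumes R: "R > 0"
  defines "\<psi>' \<equiv> \<lambda>t. ((x + t *\<^sub>R \<xi> - c) \<bullet> \<xi>) / hyp R c (x + t *\<^sub>R \<xi>)"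
  shows "((\<lambda>t. hyp R c (x + t *\<^sub>R \<xi>)) has_real_derivative \<psi>' t) (at t)"
    and "(\<psi>' has_real_derivative (\<xi> \<bullet> \<xi>) / hyp R c x - ((x - c) \<bullet> \<xi>)\<^sup>2 / (hyp R c x) ^ 3) (at 0)"
proof -
  have sq: "hyp R c (x + t *\<^sub>R \<xi>) = sqrt (R\<^sup>2 + ((x - c) \<bullet> (x - c) + 2 * t * ((x - c) \<bullet> \<xi>) + t\<^sup>2 * (\<xi> \<bullet> \<xi>)))" for t
  proof -
    have e: "x + t *\<^sub>R \<xi> - c = (x - c) + t *\<^sub>R \<xi>" by simp
    have "(z + t *\<^sub>R \<xi>) \<bullet> (z + t *\<^sub>R \<xi>) = z \<bullet> z + 2 * t * (z \<bullet> \<xi>) + t\<^sup>2 * (\<xi> \<bullet> \<xi>)" for z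
      by (simp add: inner_add_left inner_add_right inner_commute[of \<xi> z] power2_eq_square algebra_simps)
    then show ?thesis unfolding hyp_def power2_norm_eq_inner e by (simp only:)
  qed
  show d1: "((\<lambda>t. hyp R c (x + t *\<^sub>R \<xi>)) has_real_derivative \<psi>' t) (at t)" for t
  proof -
    have pos: "R\<^sup>2 + ((x - c) \<bullet> (x - c) + 2 * t * ((x - c) \<bullet> \<xi>) + t\<^sup>2 * (\<xi> \<bullet> \<xi>)) > 0"
      using hyp_pos[OF R, of c "x + t *\<^sub>R \<xi>"] unfolding sq by simp
    have "((\<lambda>t. sqrt (R\<^sup>2 + ((x - c) \<bullet> (x - c) + 2 * t * ((x - c) \<bullet> \<xi>) + t\<^sup>2 * (\<xi> \<bullet> \<xi>)))) has_real_derivative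
       (2 * ((x - c) \<bullet> \<xi>) + 2 * t * (\<xi> \<bullet> \<xi>)) * (inverse (sqrt (R\<^sup>2 + ((x - c) \<bullet> (x - c) + 2 * t * ((x - c) \<bullet> \<xi>) + t\<^sup>2 * (\<xi> \<bullet> \<xi>)))) / 2)) (at t)"
      using pos by (auto intro!: derivative_eq_intros)
    moreover have "(x + t *\<^sub>R \<xi> - c) \<bullet> \<xi> = (x - c) \<bullet> \<xi> + t * (\<xi> \<bullet> \<xi>)"
      by (simp add: inner_diff_left inner_add_left)
    moreover have "(2 * a + 2 * t * b) * (inverse r / 2) = (a + t * b) / r" for a b r :: real
      by (cases "r = 0") (simp_all add: field_simps)
    ultimately show ?thesis unfolding \<psi>'_def sq[symmetric] by (simp only:)
  qed
  have h0: "hyp R c x > 0" by (rule hyp_pos[OF R])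
  have "((\<lambda>t. (x + t *\<^sub>R \<xi> - c) \<bullet> \<xi>) has_real_derivative \<xi> \<bullet> \<xi>) (at 0)"
  proof -
    have "(\<lambda>t. (x + t *\<^sub>R \<xi> - c) \<bullet> \<xi>) = (\<lambda>t. (x - c) \<bullet> \<xi> + t * (\<xi> \<bullet> \<xi>))"
      by (simp add: inner_diff_left inner_add_left algebra_simps)
    then show ?thesis by (auto intro!: derivative_eq_intros)
  qed
  from DERIV_divide[OF this d1[of 0]] h0
  have "(\<psi>' has_real_derivative ((\<xi> \<bullet> \<xi>) * hyp R c x - ((x - c) \<bullet> \<xi>) * (((x - c) \<bullet> \<xi>) / hyp R c x)) / (hyp R c x * hyp R c x)) (at 0)"
    by (simp add: \<psi>'_def)
  moreover have "((\<xi> \<bullet> \<xi>) * hyp R c x - ((x - c) \<bullet> \<xi>) * (((x - c) \<bullet> \<xi>) / hyp R c x)) / (hyp R c x * hyp R c x)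
     = (\<xi> \<bullet> \<xi>) / hyp R c x - ((x - c) \<bullet> \<xi>)\<^sup>2 / (hyp R c x) ^ 3"
    using h0 by (simp add: field_simps power2_eq_square power3_eq_cube)
  ultimately show "(\<psi>' has_real_derivative (\<xi> \<bullet> \<xi>) / hyp R c x - ((x - c) \<bullet> \<xi>)\<^sup>2 / (hyp R c x) ^ 3) (at 0)" by simp
qed

text \<open>If a had a component b orthogonal to n, it would be negative on \<delta> n - b for small
  \<delta> > 0. The lemma converts one-sided derivatives in all inward directions into the exact
  direction of Du.\<close>

lemma half_space_dual:
  fixes a n :: "'a::real_inner"
  assumes n: "n \<noteq> 0" and le: "\<And>\<xi>. \<xi> \<bullet> n > 0 \<Longrightarrow> a \<bullet> \<xi> \<ge> 0"
  obtains \<mu> where "\<mu> \<ge> 0" "a = \<mu> *\<^sub>R n"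
proof -
  define \<mu> where "\<mu> = (a \<bullet> n) / (n \<bullet> n)"
  have nn: "n \<bullet> n > 0" using n by simp
  have an: "a \<bullet> n \<ge> 0" using le[of n] nn by simp
  define b where "b = a - \<mu> *\<^sub>R n"
  have bn: "b \<bullet> n = 0" using nn by (simp add: b_def \<mu>_def inner_diff_left)
  have ab: "a \<bullet> b = b \<bullet> b"
  proof -
    have "a = b + \<mu> *\<^sub>R n" by (simp add: b_def)
    then have "a \<bullet> b = (b + \<mu> *\<^sub>R n) \<bullet> b" by simp
    then show ?thesis using bn by (simp add: inner_add_left inner_commute[of n b])
  qed
  have "b \<bullet> b \<le> 0 + e" if "e > 0" for e
  proof -
    define \<delta> where "\<delta> = e / (a \<bullet> n + 1)"
    have \<delta>: "\<delta> > 0" using that an by (simp add: \<delta>_def)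
    have "a \<bullet> (\<delta> *\<^sub>R n - b) \<ge> 0" using \<delta> nn bn by (intro le) (simp add: inner_diff_left)
    then have "b \<bullet> b \<le> \<delta> * (a \<bullet> n)" using ab by (simp add: inner_diff_right)
    also have "\<dots> \<le> \<delta> * (a \<bullet> n + 1)" using \<delta> by simp
    also have "\<dots> = e" using an by (simp add: \<delta>_def)
    finally show ?thesis by simp
  qed
  then have "b \<bullet> b \<le> 0" by (rule field_le_epsilon)
  then have "b = 0" using inner_ge_zero[of b] by (metis antisym inner_eq_zero_iff)
  show ?thesis
    by (rule that[of \<mu>]) (use an nn \<open>b = 0\<close> in \<open>auto simp: \<mu>_def b_def\<close>)
qed

context convex_graph
begin

lemma frame_kappa_form: "x \<in> U \<Longrightarrow> frame x P \<kappa> \<Longrightarrow> \<kappa> $ a = \<nu> x - \<nu> x / u x * (P a \<bullet> (H x *v P a))"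
proof -
  assume x: "x \<in> U" and fr: "frame x P \<kappa>"
  have "\<kappa> $ a = P a \<bullet> (hdS u x *v P a)" using fr unfolding eigen_frame_def by simp
  also have "\<dots> = \<nu> x / (u x)\<^sup>2 * (P a \<bullet> P a - (p x \<bullet> P a)\<^sup>2) - \<nu> x / u x * (P a \<bullet> (H x *v P a))"
    by (simp add: h_mult inner_diff_right inner_commute power2_eq_square)
  finally show ?thesis using frame_vector(1)[OF x fr, of a] u_pos[OF x] by simp
qed

text \<open>The Hessian bound puts all curvatures below M = \<nu> (1 + u m); monotonicity of f and
  f(M,...,M) = M do the rest.\<close>

lemma sigma_le:
  assumes x: "x \<in> \<Omega>" and le: "\<And>\<xi>. - (\<xi> \<bullet> (H x *v \<xi>)) \<le> m * (\<xi> \<bullet> \<xi> - (p x \<bullet> \<xi>)\<^sup>2)"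
  shows "\<sigma> \<le> \<nu> x * (1 + u x * m)"
proof -
  have xU: "x \<in> U" by (rule \<Omega>_U[OF x])
  note fr = pframe[OF xU]
  have u: "u x > 0" and n: "\<nu> x > 0" using u_pos[OF xU] nu_pos[OF xU] .
  define M where "M = \<nu> x * (1 + u x * m)"
  have k: "kappa u x $ a \<le> M" for a
  proof -
    have "- (pframe x a \<bullet> (H x *v pframe x a)) \<le> m * (u x)\<^sup>2"
      using le[of "pframe x a"] frame_vector(1)[OF xU fr, of a] by simp
    then have "\<nu> x / u x * - (pframe x a \<bullet> (H x *v pframe x a)) \<le> \<nu> x / u x * (m * (u x)\<^sup>2)"
      using u n by (intro mult_left_mono) auto
    then show ?thesis unfolding frame_kappa_form[OF xU fr, of a] M_def using u by (simp add: power2_eq_square algebra_simps)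
  qed
  have "0 < kappa u x $ undefined" using kappa_pos[OF x] by (simp add: posK_def)
  then have M: "M > 0" using k[of undefined] by linarith
  have "\<sigma> = f (kappa u x)" using kappa_eq[OF x] by simp
  also have "\<dots> \<le> f (M *\<^sub>R onevec)"
    by (rule f_cond_mono[OF f kappa_pos[OF x] scaleR_posK[OF M onevec_posK]]) (use k in \<open>simp add: onevec_def\<close>)
  also have "\<dots> = M" by (rule f_cond_scaled_one[OF f M])
  finally show ?thesis by (simp add: M_def)
qed

text \<open>Mirror image of \<open>sigma_le\<close>; positivity of M keeps the comparison point
  (M,...,M) in the cone.\<close>

lemma sigma_ge:
  assumes x: "x \<in> \<Omega>" and le: "\<And>\<xi>. m * (\<xi> \<bullet> \<xi> - (p x \<bullet> \<xi>)\<^sup>2) \<le> - (\<xi> \<bullet> (H x *v \<xi>))"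
    and pos: "\<nu> x * (1 + u x * m) > 0"
  shows "\<sigma> \<ge> \<nu> x * (1 + u x * m)"
proof -
  have xU: "x \<in> U" by (rule \<Omega>_U[OF x])
  note fr = pframe[OF xU]
  have u: "u x > 0" and n: "\<nu> x > 0" using u_pos[OF xU] nu_pos[OF xU] .
  define M where "M = \<nu> x * (1 + u x * m)"
  have k: "M \<le> kappa u x $ a" for a
  proof -
    have "m * (u x)\<^sup>2 \<le> - (pframe x a \<bullet> (H x *v pframe x a))"
      using le[of "pframe x a"] frame_vector(1)[OF xU fr, of a] by simp
    then have "\<nu> x / u x * (m * (u x)\<^sup>2) \<le> \<nu> x / u x * - (pframe x a \<bullet> (H x *v pframe x a))"
      using u n by (intro mult_left_mono) auto
    then show ?thesis unfolding frame_kappa_form[OF xU fr, of a] M_def using u by (simp add: power2_eq_square algebra_simps)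
  qed
  have M: "M > 0" using pos by (simp add: M_def)
  have "M = f (M *\<^sub>R onevec)" by (rule f_cond_scaled_one[OF f M, symmetric])
  also have "\<dots> \<le> f (kappa u x)"
    by (rule f_cond_mono[OF f scaleR_posK[OF M onevec_posK] kappa_pos[OF x]]) (use k in \<open>simp add: onevec_def\<close>)
  finally show ?thesis using kappa_eq[OF x] by (simp add: M_def)
qed

lemma nu_eqI:
  assumes x: "x \<in> U" and s: "s > 0" "R > 0" and eq: "s\<^sup>2 * (p x \<bullet> p x) = s\<^sup>2 - R\<^sup>2"
  shows "\<nu> x = s / R"
proof -
  have "(\<nu> x)\<^sup>2 * (s\<^sup>2 * (p x \<bullet> p x)) = s\<^sup>2 * ((\<nu> x)\<^sup>2 * (p x \<bullet> p x))" by simp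
  then have "(\<nu> x)\<^sup>2 * (s\<^sup>2 - R\<^sup>2) = s\<^sup>2 * ((\<nu> x)\<^sup>2 - 1)" unfolding eq nu_norm[OF x] .
  then have "(\<nu> x * R)\<^sup>2 = s\<^sup>2" by (simp add: algebra_simps power_mult_distrib)
  then have "\<nu> x * R = s" using s nu_pos[OF x] by (simp add: power2_eq_iff_nonneg)
  then show ?thesis using s by (simp add: field_simps)
qed

lemma open_ray:
  fixes \<xi> :: "'a::real_normed_vector"
  assumes "open V" "x \<in> V"
  obtains d :: real where "d > 0" "\<And>t. \<bar>t\<bar> < d \<Longrightarrow> x + t *\<^sub>R \<xi> \<in> V"
proof -
  have "((\<lambda>t. x + t *\<^sub>R \<xi>) \<longlongrightarrow> x + 0 *\<^sub>R \<xi>) (nhds (0::real))"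
    by (intro tendsto_intros filterlim_ident)
  then have "\<forall>\<^sub>F t in nhds (0::real). x + t *\<^sub>R \<xi> \<in> V"
    by (rule topological_tendstoD) (use assms in auto)
  then show ?thesis unfolding eventually_nhds_metric dist_real_def using that by auto
qed

text \<open>At the minimum a lower sheet touches the graph from below, so the Hessian of u is at
  least that of the sheet. There \<nu> = s / R, and \<open>sigma_le\<close> with m = 1 / s reads
  \<sigma> \<le> (s + u) / R.\<close>

lemma touch_below:
  assumes x: "x \<in> \<Omega>" and R: "R > 0" and min: "\<And>y. y \<in> \<Omega> \<Longrightarrow> u x + hyp R c x \<le> u y + hyp R c y"
  shows "\<sigma> * R \<le> u x + hyp R c x"
proof -
  have xU: "x \<in> U" by (rule \<Omega>_U[OF x])
  define s where "s = hyp R c x"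
  have s: "s > 0" using hyp_pos[OF R] by (simp add: s_def)
  have crit: "p x \<bullet> \<xi> = - ((x - c) \<bullet> \<xi>) / s" for \<xi>
  proof -
    have "Du u x \<bullet> \<xi> + ((x + 0 *\<^sub>R \<xi> - c) \<bullet> \<xi>) / hyp R c (x + 0 *\<^sub>R \<xi>) = 0"
      by (rule line_min_critical[OF open_\<Omega> x _ hyp_line(1)[OF R]])
        (use min smooth_on_differentiable[OF smooth xU] in auto)
    then show ?thesis by (simp add: s_def)
  qed
  have "- (\<xi> \<bullet> (H x *v \<xi>)) \<le> (1 / s) * (\<xi> \<bullet> \<xi> - (p x \<bullet> \<xi>)\<^sup>2)" for \<xi>
  proof -
    obtain d where d: "d > 0" "\<And>t. \<bar>t\<bar> < d \<Longrightarrow> x + t *\<^sub>R \<xi> \<in> \<Omega>" using open_ray[OF open_\<Omega> x, of \<xi>] by blast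
    have "\<xi> \<bullet> (H x *v \<xi>) + ((\<xi> \<bullet> \<xi>) / hyp R c x - ((x - c) \<bullet> \<xi>)\<^sup>2 / (hyp R c x) ^ 3) \<ge> 0"
    proof (rule C2_on_line_nonneg[OF C2_u xU hyp_line[OF R] d(1)])
      show "u x + hyp R c (x + 0 *\<^sub>R \<xi>) \<le> u (x + t *\<^sub>R \<xi>) + hyp R c (x + t *\<^sub>R \<xi>)" if "0 < t" "t < d" for t
        using min[OF d(2)[of t]] that by simp
      show "p x \<bullet> \<xi> + ((x + 0 *\<^sub>R \<xi> - c) \<bullet> \<xi>) / hyp R c (x + 0 *\<^sub>R \<xi>) = 0"
        using crit[of \<xi>] by (simp add: s_def)
    qed
    moreover have "((x - c) \<bullet> \<xi>)\<^sup>2 / s ^ 3 = (p x \<bullet> \<xi>)\<^sup>2 / s"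
      unfolding crit using s by (simp add: power_divide power2_eq_square power3_eq_cube)
    ultimately show ?thesis by (simp add: s_def[symmetric] diff_divide_distrib)
  qed
  then have "\<sigma> \<le> \<nu> x * (1 + u x * (1 / s))" by (rule sigma_le[OF x])
  moreover have "\<nu> x = s / R"
  proof (rule nu_eqI[OF xU s R])
    have "p x \<bullet> p x = - ((x - c) \<bullet> p x) / s" by (rule crit)
    moreover have "(x - c) \<bullet> p x = - ((x - c) \<bullet> (x - c)) / s" using crit[of "x - c"] by (simp add: inner_commute)
    ultimately have "s\<^sup>2 * (p x \<bullet> p x) = (x - c) \<bullet> (x - c)" using s by (simp add: power2_eq_square)
    moreover have "s\<^sup>2 = R\<^sup>2 + (x - c) \<bullet> (x - c)" by (simp add: s_def hyp_sq power2_norm_eq_inner)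
    ultimately show "s\<^sup>2 * (p x \<bullet> p x) = s\<^sup>2 - R\<^sup>2" by simp
  qed
  moreover have "s / R * (1 + u x * (1 / s)) = (s + u x) / R" using s R by (simp add: field_simps)
  ultimately have "\<sigma> \<le> (s + u x) / R" by (simp only:)
  then show ?thesis using R by (simp add: s_def field_simps)
qed

text \<open>The same computation with a sheet touching from above. Its curvature level (s - u) / R
  has to be positive for \<open>sigma_ge\<close> to apply.\<close>

lemma touch_above:
  assumes x: "x \<in> \<Omega>" and R: "R > 0" and max: "\<And>y. y \<in> \<Omega> \<Longrightarrow> u y - hyp R c y \<le> u x - hyp R c x"
    and pos: "u x < hyp R c x"
  shows "hyp R c x - u x \<le> \<sigma> * R"
proof -
  have xU: "x \<in> U" by (rule \<Omega>_U[OF x])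
  define s where "s = hyp R c x"
  have s: "s > 0" using hyp_pos[OF R] by (simp add: s_def)
  note neg = C2_on_uminus[OF C2_u]
  have crit: "p x \<bullet> \<xi> = ((x - c) \<bullet> \<xi>) / s" for \<xi>
  proof -
    have "Du (\<lambda>x. - u x) x \<bullet> \<xi> + ((x + 0 *\<^sub>R \<xi> - c) \<bullet> \<xi>) / hyp R c (x + 0 *\<^sub>R \<xi>) = 0"
      by (rule line_min_critical[OF open_\<Omega> x _ hyp_line(1)[OF R]])
        (use max neg(1) xU in \<open>force simp: C2_on_def\<close>)+
    then show ?thesis by (simp add: s_def neg(2)[OF xU])
  qed
  have "- (1 / s) * (\<xi> \<bullet> \<xi> - (p x \<bullet> \<xi>)\<^sup>2) \<le> - (\<xi> \<bullet> (H x *v \<xi>))" for \<xi>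
  proof -
    obtain d where d: "d > 0" "\<And>t. \<bar>t\<bar> < d \<Longrightarrow> x + t *\<^sub>R \<xi> \<in> \<Omega>" using open_ray[OF open_\<Omega> x, of \<xi>] by blast
    have "\<xi> \<bullet> (D2u (\<lambda>x. - u x) x *v \<xi>) + ((\<xi> \<bullet> \<xi>) / hyp R c x - ((x - c) \<bullet> \<xi>)\<^sup>2 / (hyp R c x) ^ 3) \<ge> 0"
    proof (rule C2_on_line_nonneg[OF neg(1) xU hyp_line[OF R] d(1)])
      show "- u x + hyp R c (x + 0 *\<^sub>R \<xi>) \<le> - u (x + t *\<^sub>R \<xi>) + hyp R c (x + t *\<^sub>R \<xi>)" if "0 < t" "t < d" for t
        using max[OF d(2)[of t]] that by simp
      show "Du (\<lambda>x. - u x) x \<bullet> \<xi> + ((x + 0 *\<^sub>R \<xi> - c) \<bullet> \<xi>) / hyp R c (x + 0 *\<^sub>R \<xi>) = 0"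
        using crit[of \<xi>] by (simp add: s_def neg(2)[OF xU])
    qed
    moreover have "\<xi> \<bullet> (D2u (\<lambda>x. - u x) x *v \<xi>) = - (\<xi> \<bullet> (H x *v \<xi>))"
      unfolding neg(3)[OF xU] by (simp add: matrix_form_sum sum_negf)
    moreover have "((x - c) \<bullet> \<xi>)\<^sup>2 / s ^ 3 = (p x \<bullet> \<xi>)\<^sup>2 / s"
      unfolding crit using s by (simp add: power_divide power2_eq_square power3_eq_cube)
    ultimately show ?thesis by (simp add: s_def[symmetric] diff_divide_distrib)
  qed
  note below = this
  have nu: "\<nu> x = s / R"
  proof (rule nu_eqI[OF xU s R])
    have "p x \<bullet> p x = ((x - c) \<bullet> p x) / s" by (rule crit)
    moreover have "(x - c) \<bullet> p x = ((x - c) \<bullet> (x - c)) / s" using crit[of "x - c"] by (simp add: inner_commute)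
    ultimately have "s\<^sup>2 * (p x \<bullet> p x) = (x - c) \<bullet> (x - c)" using s by (simp add: power2_eq_square)
    moreover have "s\<^sup>2 = R\<^sup>2 + (x - c) \<bullet> (x - c)" by (simp add: s_def hyp_sq power2_norm_eq_inner)
    ultimately show "s\<^sup>2 * (p x \<bullet> p x) = s\<^sup>2 - R\<^sup>2" by simp
  qed
  have e: "\<nu> x * (1 + u x * - (1 / s)) = (s - u x) / R" unfolding nu using s R by (simp add: field_simps)
  have "(s - u x) / R > 0" using pos R by (simp add: s_def)
  then have "(s - u x) / R \<le> \<sigma>" using sigma_ge[OF x below] unfolding e by simp
  then show ?thesis using R by (simp add: s_def field_simps)
qed

text \<open>A plane has zero Hessian and hence all curvatures equal to its \<nu>, so contact from
  above forces \<nu> \<le> \<sigma>.\<close>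

lemma touch_plane:
  assumes x: "x \<in> \<Omega>" and max: "\<And>y. y \<in> \<Omega> \<Longrightarrow> u y - b \<bullet> y \<le> u x - b \<bullet> x"
  shows "p x = b" "\<nu> x \<le> \<sigma>"
proof -
  have xU: "x \<in> U" by (rule \<Omega>_U[OF x])
  note neg = C2_on_uminus[OF C2_u]
  have lin: "((\<lambda>t. b \<bullet> (x + t *\<^sub>R \<xi>)) has_real_derivative b \<bullet> \<xi>) (at t)" for t \<xi>
  proof -
    have "((\<lambda>t. b \<bullet> x + t * (b \<bullet> \<xi>)) has_real_derivative b \<bullet> \<xi>) (at t)" by (auto intro!: derivative_eq_intros)
    then show ?thesis by (simp add: inner_add_right)
  qed
  have crit: "p x \<bullet> \<xi> = b \<bullet> \<xi>" for \<xi>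
  proof -
    have "Du (\<lambda>x. - u x) x \<bullet> \<xi> + b \<bullet> \<xi> = 0"
      by (rule line_min_critical[OF open_\<Omega> x _ lin])
        (use max neg(1) xU in \<open>force simp: C2_on_def\<close>)+
    then show ?thesis by (simp add: neg(2)[OF xU])
  qed
  then show "p x = b" by (metis inner_commute vector_eq_rdot)
  have "0 * (\<xi> \<bullet> \<xi> - (p x \<bullet> \<xi>)\<^sup>2) \<le> - (\<xi> \<bullet> (H x *v \<xi>))" for \<xi>
  proof -
    obtain d where d: "d > 0" "\<And>t. \<bar>t\<bar> < d \<Longrightarrow> x + t *\<^sub>R \<xi> \<in> \<Omega>" using open_ray[OF open_\<Omega> x, of \<xi>] by blast
    have "\<xi> \<bullet> (D2u (\<lambda>x. - u x) x *v \<xi>) + 0 \<ge> 0"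
    proof (rule C2_on_line_nonneg[OF neg(1) xU lin _ d(1)])
      show "((\<lambda>t. b \<bullet> \<xi>) has_real_derivative 0) (at 0)" by simp
      show "- u x + b \<bullet> (x + 0 *\<^sub>R \<xi>) \<le> - u (x + t *\<^sub>R \<xi>) + b \<bullet> (x + t *\<^sub>R \<xi>)" if "0 < t" "t < d" for t
        using max[OF d(2)[of t]] that by simp
      show "Du (\<lambda>x. - u x) x \<bullet> \<xi> + b \<bullet> \<xi> = 0"
        using crit[of \<xi>] by (simp add: neg(2)[OF xU])
    qed
    moreover have "\<xi> \<bullet> (D2u (\<lambda>x. - u x) x *v \<xi>) = - (\<xi> \<bullet> (H x *v \<xi>))"
      unfolding neg(3)[OF xU] by (simp add: matrix_form_sum sum_negf)
    ultimately show ?thesis by simp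
  qed
  from sigma_ge[OF x this] show "\<nu> x \<le> \<sigma>" using nu_pos[OF xU] by simp
qed

text \<open>Frames extend to the boundary by compactness; the limiting curvatures stay in the cone because
  \<open>f = \<sigma> > 0\<close> there while \<open>f\<close> vanishes on the boundary of the cone.\<close>
lemma closure_frame:
  assumes x: "x \<in> closure \<Omega>"
  obtains P \<kappa> where "frame x P \<kappa>" "\<kappa> \<in> posK" "f \<kappa> = \<sigma>"
proof -
  have xU: "x \<in> U" using x closure_\<Omega> by blast
  obtain X where X: "\<And>k. X k \<in> \<Omega>" "X \<longlonglongrightarrow> x" using x unfolding closure_sequential by blast
  obtain C where C: "C \<ge> 1" "\<And>x. x \<in> closure \<Omega> \<Longrightarrow> 1 / u x \<le> C" "\<And>x. x \<in> closure \<Omega> \<Longrightarrow> u x \<le> C"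
    "\<And>x. x \<in> closure \<Omega> \<Longrightarrow> \<nu> x \<le> C" "\<And>x \<xi>. x \<in> closure \<Omega> \<Longrightarrow> \<bar>\<xi> \<bullet> (H x *v \<xi>)\<bar> \<le> C * (norm \<xi>)\<^sup>2"
    using uniform_bounds by blast
  \<comment> \<open>The whole frame is packed into one matrix, so that a single subsequence serves
    all its vectors.\<close>
  define M :: "nat \<Rightarrow> real^'n^'n" where "M k = (\<chi> a. pframe (X k) a)" for k
  have "norm (M k) \<le> real CARD('n) * (C * C)" for k
  proof -
    have xk: "X k \<in> closure \<Omega>" "X k \<in> U" using X(1) closure_subset \<Omega>_U by auto
    have "norm (pframe (X k) a) \<le> C * C" for a
    proof -
      have "norm (pframe (X k) a) \<le> u (X k) * \<nu> (X k)" by (rule eigen_frame_bound(1)[OF xk(2) pframe[OF xk(2)]])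
      also have "\<dots> \<le> C * C" using C(1) C(3,4)[OF xk(1)] nu_pos[OF xk(2)] by (intro mult_mono) auto
      finally show ?thesis .
    qed
    then have "(\<Sum>a\<in>UNIV. norm (M k $ a)) \<le> (\<Sum>a\<in>(UNIV::'n set). C * C)" by (intro sum_mono) (simp add: M_def)
    moreover have "norm (M k) \<le> (\<Sum>a\<in>UNIV. norm (M k $ a))" unfolding norm_vec_def by (rule L2_set_le_sum) simp
    ultimately show ?thesis by simp
  qed
  then have "\<forall>k. M k \<in> cball 0 (real CARD('n) * (C * C))" by simp
  then obtain l r where l: "strict_mono (r :: nat \<Rightarrow> nat)" "(M \<circ> r) \<longlonglongrightarrow> l"
    using compact_cball[of "0::real^'n^'n" "real CARD('n) * (C * C)", unfolded compact_def] by blast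
  have Xr: "(\<lambda>k. X (r k)) \<longlonglongrightarrow> x" using LIMSEQ_subseq_LIMSEQ[OF X(2) l(1)] by (simp add: comp_def)
  have Ml: "(\<lambda>k. pframe (X (r k)) a) \<longlonglongrightarrow> l $ a" for a
    using tendsto_vec_nth[OF l(2), of a] by (simp add: comp_def M_def)
  have g: "(\<lambda>k. gdS u (X (r k)) *v pframe (X (r k)) a) \<longlonglongrightarrow> gdS u x *v (l $ a)" for a
  proof (rule vec_tendstoI)
    fix i
    have "(\<lambda>k. gdS u (X (r k)) $ i $ j) \<longlonglongrightarrow> gdS u x $ i $ j" for j
      using has_derivative_continuous[OF dg[OF xU]] by (rule isCont_tendsto_compose[OF _ Xr])
    then show "(\<lambda>k. (gdS u (X (r k)) *v pframe (X (r k)) a) $ i) \<longlonglongrightarrow> (gdS u x *v (l $ a)) $ i"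
      unfolding matrix_vector_mult_def vec_lambda_beta by (intro tendsto_sum tendsto_mult tendsto_vec_nth[OF Ml])
  qed
  have h: "(\<lambda>k. hdS u (X (r k)) *v pframe (X (r k)) a) \<longlonglongrightarrow> hdS u x *v (l $ a)" for a
  proof (rule vec_tendstoI)
    fix i
    have "(\<lambda>k. hdS u (X (r k)) $ i $ j) \<longlonglongrightarrow> hdS u x $ i $ j" for j
      using has_derivative_continuous[OF dh[OF xU]] by (rule isCont_tendsto_compose[OF _ Xr])
    then show "(\<lambda>k. (hdS u (X (r k)) *v pframe (X (r k)) a) $ i) \<longlonglongrightarrow> (hdS u x *v (l $ a)) $ i"
      unfolding matrix_vector_mult_def vec_lambda_beta by (intro tendsto_sum tendsto_mult tendsto_vec_nth[OF Ml])
  qed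
  define \<kappa> where "\<kappa> = (\<chi> a. l $ a \<bullet> (hdS u x *v (l $ a)))"
  have fr: "frame (X k) (pframe (X k)) (kappa u (X k))" for k by (rule pframe[OF \<Omega>_U[OF X(1)]])
  have kl: "(\<lambda>k. kappa u (X (r k)) $ a) \<longlonglongrightarrow> \<kappa> $ a" for a
  proof -
    have "kappa u (X k) $ a = pframe (X k) a \<bullet> (hdS u (X k) *v pframe (X k) a)" for k
      using fr[of k] unfolding eigen_frame_def by simp
    then show ?thesis unfolding \<kappa>_def by simp (intro tendsto_intros Ml h)
  qed
  have klim: "(\<lambda>k. kappa u (X (r k))) \<longlonglongrightarrow> \<kappa>" by (rule vec_tendstoI) (rule kl)
  have "frame x (\<lambda>a. l $ a) \<kappa>"
    unfolding eigen_frame_def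
  proof (intro conjI allI)
    fix a b
    have "(\<lambda>k. pframe (X (r k)) a \<bullet> (gdS u (X (r k)) *v pframe (X (r k)) b)) \<longlonglongrightarrow> l $ a \<bullet> (gdS u x *v (l $ b))"
      by (intro tendsto_intros Ml g)
    moreover have "pframe (X (r k)) a \<bullet> (gdS u (X (r k)) *v pframe (X (r k)) b) = (if a = b then 1 else 0)" for k
      using fr[of "r k"] unfolding eigen_frame_def by blast
    ultimately have "(\<lambda>k. if a = b then 1 else 0) \<longlonglongrightarrow> l $ a \<bullet> (gdS u x *v (l $ b))" by simp
    then show "l $ a \<bullet> (gdS u x *v (l $ b)) = (if a = b then 1 else 0)"
      using LIMSEQ_unique tendsto_const by blast
  next
    fix a
    have "(\<lambda>k. kappa u (X (r k)) $ a *\<^sub>R (gdS u (X (r k)) *v pframe (X (r k)) a)) \<longlonglongrightarrow> \<kappa> $ a *\<^sub>R (gdS u x *v (l $ a))"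
      by (intro tendsto_intros kl g)
    moreover have "kappa u (X (r k)) $ a *\<^sub>R (gdS u (X (r k)) *v pframe (X (r k)) a) = hdS u (X (r k)) *v pframe (X (r k)) a" for k
      using fr[of "r k"] unfolding eigen_frame_def by simp
    ultimately have "(\<lambda>k. hdS u (X (r k)) *v pframe (X (r k)) a) \<longlonglongrightarrow> \<kappa> $ a *\<^sub>R (gdS u x *v (l $ a))" by simp
    then show "hdS u x *v (l $ a) = \<kappa> $ a *\<^sub>R (gdS u x *v (l $ a))" using h LIMSEQ_unique by blast
  qed
  moreover have kc: "\<kappa> \<in> closure posK"
    unfolding closure_sequential using klim kappa_pos[OF X(1)]
    by (intro exI[of _ "\<lambda>k. kappa u (X (r k))"]) simp
  moreover have fk: "f \<kappa> = \<sigma>"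
  proof -
    have "(\<lambda>k. f (kappa u (X (r k)))) \<longlonglongrightarrow> f \<kappa>"
    proof (rule continuous_on_tendsto_compose[OF f_cond_boundary(1)[OF f] klim kc])
      show "\<forall>\<^sub>F k in sequentially. kappa u (X (r k)) \<in> closure posK"
        by (rule always_eventually) (metis X(1) kappa_pos closure_subset subsetD)
    qed
    then have "(\<lambda>k. \<sigma>) \<longlonglongrightarrow> f \<kappa>" by (simp add: kappa_eq[OF X(1)])
    from LIMSEQ_unique[OF this tendsto_const] show ?thesis .
  qed
  moreover have "\<kappa> \<in> posK"
  proof (rule ccontr)
    assume "\<kappa> \<notin> posK"
    moreover have "open (posK :: (real^'n) set)" using f_cond_smooth[OF f] by (simp add: smooth_on_def)
    ultimately have "\<kappa> \<in> frontier posK" using kc by (simp add: frontier_def interior_open)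
    then show False using f_cond_boundary(2)[OF f] fk sigma by simp
  qed
  ultimately show ?thesis using that by blast
qed

end

text \<open>S and T are the positive roots of (a - \<epsilon> S)^2 = 1 + r^2 S^2 and (a + \<epsilon>
  T)^2 = 1 + r^2 T^2, that is, the reciprocal radii of the hyperboloids of curvature a that meet
  level \<epsilon> in a sphere of radius r. Both strict estimates come from D < r sqrt (a^2 - 1) +
  \<epsilon>.\<close>

lemma barrier_roots:
  fixes a r \<epsilon> :: real
  assumes a: "a > 1" and e: "0 < \<epsilon>" "\<epsilon> < r"
  defines "D \<equiv> sqrt ((a\<^sup>2 - 1) * r\<^sup>2 + \<epsilon>\<^sup>2)"
  defines "S \<equiv> (D - a * \<epsilon>) / (r\<^sup>2 - \<epsilon>\<^sup>2)" and "T \<equiv> (D + a * \<epsilon>) / (r\<^sup>2 - \<epsilon>\<^sup>2)"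
  shows "S > 0" "(a - \<epsilon> * S)\<^sup>2 = 1 + r\<^sup>2 * S\<^sup>2" "a - \<epsilon> * S > 0"
    "S < r * sqrt (a\<^sup>2 - 1) / (r\<^sup>2 - \<epsilon>\<^sup>2) + \<epsilon> * (a - 1) / (r\<^sup>2 - \<epsilon>\<^sup>2)"
    "T > 0" "(a + \<epsilon> * T)\<^sup>2 = 1 + r\<^sup>2 * T\<^sup>2"
    "T < r * sqrt (a\<^sup>2 - 1) / (r\<^sup>2 - \<epsilon>\<^sup>2) + \<epsilon> * (1 + a) / (r\<^sup>2 - \<epsilon>\<^sup>2)"
proof -
  have r: "r > 0" using e by simp
  have d: "r\<^sup>2 - \<epsilon>\<^sup>2 > 0" using e by (simp add: power_strict_mono)
  have a2: "a\<^sup>2 - 1 > 0" using a by (simp add: one_less_power)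
  have D2: "D\<^sup>2 = (a\<^sup>2 - 1) * r\<^sup>2 + \<epsilon>\<^sup>2" using a2 by (simp add: D_def)
  have pos: "(a\<^sup>2 - 1) * r\<^sup>2 > 0" using a2 r by simp
  have Dpos: "D > 0" unfolding D_def using pos by (simp add: add_pos_nonneg)
  have "(a * \<epsilon>)\<^sup>2 < D\<^sup>2"
  proof -
    have "D\<^sup>2 - (a * \<epsilon>)\<^sup>2 = (a\<^sup>2 - 1) * (r\<^sup>2 - \<epsilon>\<^sup>2)" unfolding D2 by (simp add: power_mult_distrib algebra_simps)
    moreover have "(a\<^sup>2 - 1) * (r\<^sup>2 - \<epsilon>\<^sup>2) > 0" using a2 d by simp
    ultimately show ?thesis by simp
  qed
  then have aD: "a * \<epsilon> < D" using Dpos by (simp add: power2_less_imp_less)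
  have Sd: "S * (r\<^sup>2 - \<epsilon>\<^sup>2) = D - a * \<epsilon>" and Td: "T * (r\<^sup>2 - \<epsilon>\<^sup>2) = D + a * \<epsilon>" using d by (simp_all add: S_def T_def)
  show S: "S > 0" using aD d by (simp add: S_def)
  show T: "T > 0" using Dpos a e d by (simp add: T_def add_pos_pos)
  have prod: "(D - a * \<epsilon>) * (D + a * \<epsilon>) = (a\<^sup>2 - 1) * (r\<^sup>2 - \<epsilon>\<^sup>2)"
  proof -
    have "(D - a * \<epsilon>) * (D + a * \<epsilon>) = D\<^sup>2 - (a * \<epsilon>)\<^sup>2" by (simp add: power2_eq_square algebra_simps)
    then show ?thesis unfolding D2 by (simp add: power_mult_distrib algebra_simps)
  qed
  have SD: "S * (D + a * \<epsilon>) = a\<^sup>2 - 1" using prod d by (simp add: S_def)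
  have TD: "T * (D - a * \<epsilon>) = a\<^sup>2 - 1" using prod d by (simp add: T_def mult.commute)
  have "S * (S * (r\<^sup>2 - \<epsilon>\<^sup>2)) + 2 * (a * \<epsilon>) * S = a\<^sup>2 - 1" unfolding Sd using SD by (simp add: algebra_simps)
  then show SS: "(a - \<epsilon> * S)\<^sup>2 = 1 + r\<^sup>2 * S\<^sup>2" by (simp add: power2_eq_square algebra_simps)
  have "T * (T * (r\<^sup>2 - \<epsilon>\<^sup>2)) - 2 * (a * \<epsilon>) * T = a\<^sup>2 - 1" unfolding Td using TD by (simp add: algebra_simps)
  then show "(a + \<epsilon> * T)\<^sup>2 = 1 + r\<^sup>2 * T\<^sup>2" by (simp add: power2_eq_square algebra_simps)
  define w where "w = r * sqrt (a\<^sup>2 - 1)"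
  have w: "w > 0" using r a2 by (simp add: w_def)
  have w2: "w\<^sup>2 = (a\<^sup>2 - 1) * r\<^sup>2" using a2 by (simp add: w_def power_mult_distrib)
  have Dlt: "D < w + \<epsilon>"
  proof -
    have "D\<^sup>2 < (w + \<epsilon>)\<^sup>2" unfolding D2 w2[symmetric] using w e by (simp add: power2_sum)
    then show ?thesis using w e by (simp add: power2_less_imp_less)
  qed
  have "D - a * \<epsilon> < w + \<epsilon> * (a - 1)"
  proof -
    have "\<epsilon> * (a - 1) > 0" using a e by simp
    then have "\<epsilon> - a * \<epsilon> < \<epsilon> * (a - 1)" by (simp add: algebra_simps)
    then show ?thesis using Dlt by linarith
  qed
  then have "S < (w + \<epsilon> * (a - 1)) / (r\<^sup>2 - \<epsilon>\<^sup>2)" unfolding S_def using d by (rule divide_strict_right_mono)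
  then show "S < r * sqrt (a\<^sup>2 - 1) / (r\<^sup>2 - \<epsilon>\<^sup>2) + \<epsilon> * (a - 1) / (r\<^sup>2 - \<epsilon>\<^sup>2)" by (simp add: w_def add_divide_distrib)
  have "D + a * \<epsilon> < w + \<epsilon> * (1 + a)" using Dlt by (simp add: algebra_simps)
  then have "T < (w + \<epsilon> * (1 + a)) / (r\<^sup>2 - \<epsilon>\<^sup>2)" unfolding T_def using d by (rule divide_strict_right_mono)
  then show "T < r * sqrt (a\<^sup>2 - 1) / (r\<^sup>2 - \<epsilon>\<^sup>2) + \<epsilon> * (1 + a) / (r\<^sup>2 - \<epsilon>\<^sup>2)" by (simp add: w_def add_divide_distrib)
  show "a - \<epsilon> * S > 0"
  proof -
    have "\<epsilon>\<^sup>2 * D\<^sup>2 < (a * r\<^sup>2)\<^sup>2"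
    proof -
      have e2: "\<epsilon>\<^sup>2 < r\<^sup>2" using d by simp
      have "D\<^sup>2 < a\<^sup>2 * r\<^sup>2" unfolding D2 using e2 by (simp add: algebra_simps)
      then have "\<epsilon>\<^sup>2 * D\<^sup>2 \<le> r\<^sup>2 * D\<^sup>2" "r\<^sup>2 * D\<^sup>2 < r\<^sup>2 * (a\<^sup>2 * r\<^sup>2)" using e2 r by (auto intro: mult_right_mono)
      then show ?thesis by (simp add: power_mult_distrib power2_eq_square mult_ac)
    qed
    then have "(\<epsilon> * D)\<^sup>2 < (a * r\<^sup>2)\<^sup>2" by (simp add: power_mult_distrib)
    then have "\<epsilon> * D < a * r\<^sup>2" by (rule power2_less_imp_less) (use a in simp)
    then have "\<epsilon> * (D - a * \<epsilon>) < a * (r\<^sup>2 - \<epsilon>\<^sup>2)" by (simp add: power2_eq_square algebra_simps)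
    then have "(\<epsilon> * S) * (r\<^sup>2 - \<epsilon>\<^sup>2) < a * (r\<^sup>2 - \<epsilon>\<^sup>2)" unfolding Sd[symmetric] by (simp add: mult.assoc)
    then show ?thesis using d by simp
  qed
qed

text \<open>|c - q - t \<xi>|^2 stays below r^2 as long as t |\<xi>|^2 < 2 \<xi> \<bullet> (c - q),
  which dictates d.\<close>

lemma ray_in_ball:
  fixes c q \<xi> :: "'a::real_inner"
  assumes q: "dist c q = r" and \<xi>: "\<xi> \<bullet> (c - q) > 0"
  obtains d where "d > 0" "\<And>t. 0 < t \<Longrightarrow> t < d \<Longrightarrow> q + t *\<^sub>R \<xi> \<in> ball c r"
proof -
  have \<xi>\<xi>: "\<xi> \<bullet> \<xi> > 0" using \<xi> by (metis inner_gt_zero_iff inner_zero_left less_irrefl)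
  show ?thesis
  proof (rule that[of "2 * (\<xi> \<bullet> (c - q)) / (\<xi> \<bullet> \<xi>)"])
    show "2 * (\<xi> \<bullet> (c - q)) / (\<xi> \<bullet> \<xi>) > 0" using \<xi> \<xi>\<xi> by simp
    fix t assume t: "0 < t" "t < 2 * (\<xi> \<bullet> (c - q)) / (\<xi> \<bullet> \<xi>)"
    have "(z - t *\<^sub>R \<xi>) \<bullet> (z - t *\<^sub>R \<xi>) = z \<bullet> z - t * (2 * (\<xi> \<bullet> z) - t * (\<xi> \<bullet> \<xi>))" for z
      by (simp add: inner_diff_left inner_diff_right inner_commute[of z \<xi>] algebra_simps)
    moreover have "c - (q + t *\<^sub>R \<xi>) = (c - q) - t *\<^sub>R \<xi>" by simp
    ultimately have "(norm (c - (q + t *\<^sub>R \<xi>)))\<^sup>2 = (norm (c - q))\<^sup>2 - t * (2 * (\<xi> \<bullet> (c - q)) - t * (\<xi> \<bullet> \<xi>))"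
      unfolding power2_norm_eq_inner by (simp only:)
    moreover have "t * (2 * (\<xi> \<bullet> (c - q)) - t * (\<xi> \<bullet> \<xi>)) > 0" using t \<xi>\<xi> by (simp add: field_simps)
    ultimately have "(norm (c - (q + t *\<^sub>R \<xi>)))\<^sup>2 < (norm (c - q))\<^sup>2" by simp
    then have "norm (c - (q + t *\<^sub>R \<xi>)) < norm (c - q)" by (rule power2_less_imp_less) simp
    then show "q + t *\<^sub>R \<xi> \<in> ball c r" using q by (simp add: dist_norm)
  qed
qed

text \<open>Disjointness gives |c - c'| \<ge> r + r', so the triangle inequality through q is an
  equality and the two radius vectors are parallel.\<close>

lemma tangent_balls_aligned:
  fixes c c' q :: "'a::real_inner"
  assumes disj: "ball c r \<inter> ball c' r' = {}" and r: "r > 0" "r' > 0" and q: "dist c q = r" "dist c' q = r'"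
  shows "q - c' = (r' / r) *\<^sub>R (c - q)"
proof -
  have "r + r' \<le> norm (c - c')"
  proof (rule ccontr)
    assume lt: "\<not> ?thesis"
    define D where "D = norm (c - c')"
    \<comment> \<open>The point dividing the segment of centres in the ratio r : r'; for centres too
      close it lies in both balls.\<close>
    define x where "x = c + (r / (r + r')) *\<^sub>R (c' - c)"
    have D: "D < r + r'" "D \<ge> 0" using lt by (auto simp: D_def)
    have "norm (x - c) = r * (D / (r + r'))"
      using r by (simp add: x_def D_def norm_minus_commute)
    also have "\<dots> < r * 1" using r D by (intro mult_strict_left_mono) auto
    finally have 1: "x \<in> ball c r" by (simp add: dist_norm norm_minus_commute)
    have "1 - r / (r + r') = r' / (r + r')" using r by (simp add: field_simps)
    moreover have "x - c' = (1 - r / (r + r')) *\<^sub>R (c - c')" by (simp add: x_def algebra_simps)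
    ultimately have "x - c' = (r' / (r + r')) *\<^sub>R (c - c')" by simp
    then have "norm (x - c') = r' * (D / (r + r'))" using r by (simp add: D_def)
    also have "\<dots> < r' * 1" using r D by (intro mult_strict_left_mono) auto
    finally have 2: "x \<in> ball c' r'" by (simp add: dist_norm norm_minus_commute)
    show False using 1 2 disj by blast
  qed
  moreover have "norm (c - q) = r" "norm (q - c') = r'" using q by (simp_all add: dist_norm norm_minus_commute)
  moreover have "norm ((c - q) + (q - c')) \<le> norm (c - q) + norm (q - c')" by (rule norm_triangle_ineq)
  ultimately have "norm ((c - q) + (q - c')) = norm (c - q) + norm (q - c')" by simp
  then have "norm (c - q) *\<^sub>R (q - c') = norm (q - c') *\<^sub>R (c - q)" unfolding norm_triangle_eq .
  then have "r *\<^sub>R (q - c') = r' *\<^sub>R (c - q)" using \<open>norm (c - q) = r\<close> \<open>norm (q - c') = r'\<close> by simp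
  then have "(1 / r) *\<^sub>R (r *\<^sub>R (q - c')) = (1 / r) *\<^sub>R (r' *\<^sub>R (c - q))" by simp
  then show ?thesis using r by simp
qed

section \<open>Boundary gradient estimates for graphs with constant boundary value\<close>

locale level_graph = convex_graph +
  fixes \<epsilon> :: real
  assumes eps: "\<epsilon> > 0" and boundary: "\<And>x. x \<in> frontier \<Omega> \<Longrightarrow> u x = \<epsilon>"
    and conn: "connected \<Omega>"
begin

lemma compact_closure: "compact (closure \<Omega>)"
  using bounded_\<Omega> by simp

lemma closure_cases: "x \<in> closure \<Omega> \<Longrightarrow> x \<in> \<Omega> \<or> x \<in> frontier \<Omega>"
  using open_\<Omega> by (simp add: frontier_def interior_open)

lemma frontier_closure: "x \<in> frontier \<Omega> \<Longrightarrow> x \<in> closure \<Omega>"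
  by (simp add: frontier_def)

lemma continuous_u_closure: "continuous_on (closure \<Omega>) u"
  by (rule continuous_on_subset[OF continuous_u closure_\<Omega>])

lemma closure_min:
  assumes "continuous_on (closure \<Omega>) F" "x \<in> closure \<Omega>"
  shows "\<exists>z\<in>closure \<Omega>. \<forall>y\<in>closure \<Omega>. F z \<le> (F y :: real)"
proof -
  have "closure \<Omega> \<noteq> {}" using assms(2) by auto
  from continuous_attains_inf[OF compact_closure this assms(1)] show ?thesis .
qed

lemma p_line: "x \<in> closure \<Omega> \<Longrightarrow> ((\<lambda>t. u (x + t *\<^sub>R \<xi>)) has_real_derivative p x \<bullet> \<xi>) (at 0)"
  using has_derivative_line[OF du] closure_\<Omega> by blast

lemma nu_le_iff:
  assumes x: "x \<in> U" and s: "s > 0" "R > 0"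
  shows "\<nu> x \<le> s / R \<longleftrightarrow> s\<^sup>2 * (p x \<bullet> p x) \<le> s\<^sup>2 - R\<^sup>2"
proof -
  have n: "\<nu> x > 0" by (rule nu_pos[OF x])
  have n2: "(\<nu> x)\<^sup>2 * (1 - p x \<bullet> p x) = 1" using nu_norm[OF x] by (simp add: algebra_simps)
  have "\<nu> x \<le> s / R \<longleftrightarrow> \<nu> x * R \<le> s" using s by (simp add: field_simps)
  also have "\<dots> \<longleftrightarrow> (\<nu> x * R)\<^sup>2 \<le> s\<^sup>2" using s n by (simp add: power2_le_iff_abs_le abs_mult)
  also have "\<dots> \<longleftrightarrow> (\<nu> x)\<^sup>2 * R\<^sup>2 \<le> (\<nu> x)\<^sup>2 * (s\<^sup>2 * (1 - p x \<bullet> p x))"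
  proof -
    have "(\<nu> x)\<^sup>2 * (s\<^sup>2 * (1 - p x \<bullet> p x)) = s\<^sup>2" using n2 by (metis mult.left_commute mult.right_neutral)
    then show ?thesis unfolding power_mult_distrib by (simp only:)
  qed
  also have "\<dots> \<longleftrightarrow> R\<^sup>2 \<le> s\<^sup>2 * (1 - p x \<bullet> p x)" using n by simp
  finally show ?thesis by (simp add: algebra_simps)
qed

lemma nu_ge_iff:
  assumes x: "x \<in> U" and s: "s > 0" "R > 0"
  shows "s / R \<le> \<nu> x \<longleftrightarrow> s\<^sup>2 - R\<^sup>2 \<le> s\<^sup>2 * (p x \<bullet> p x)"
proof -
  have n: "\<nu> x > 0" by (rule nu_pos[OF x])
  have n2: "(\<nu> x)\<^sup>2 * (1 - p x \<bullet> p x) = 1" using nu_norm[OF x] by (simp add: algebra_simps)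
  have "s / R \<le> \<nu> x \<longleftrightarrow> s \<le> \<nu> x * R" using s by (simp add: field_simps)
  also have "\<dots> \<longleftrightarrow> s\<^sup>2 \<le> (\<nu> x * R)\<^sup>2" using s n by (simp add: abs_le_square_iff[symmetric] abs_mult)
  also have "\<dots> \<longleftrightarrow> (\<nu> x)\<^sup>2 * (s\<^sup>2 * (1 - p x \<bullet> p x)) \<le> (\<nu> x)\<^sup>2 * R\<^sup>2"
  proof -
    have "(\<nu> x)\<^sup>2 * (s\<^sup>2 * (1 - p x \<bullet> p x)) = s\<^sup>2" using n2 by (metis mult.left_commute mult.right_neutral)
    then show ?thesis unfolding power_mult_distrib by (simp only:)
  qed
  also have "\<dots> \<longleftrightarrow> s\<^sup>2 * (1 - p x \<bullet> p x) \<le> R\<^sup>2" using n by simp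
  finally show ?thesis by (simp add: algebra_simps)
qed

text \<open>The graph lies above the cap \<sigma> R - \<open>hyp R c\<close>: at an interior minimum
  of u + hyp this is \<open>touch_below\<close>, and on the frontier hyp \<ge> s because the ball
  lies in \<Omega>. Cap and graph meet at y0, so comparing inward derivatives there fixes the
  direction of Du and bounds its length from below.\<close>

lemma interior_sphere:
  assumes y0: "y0 \<in> frontier \<Omega>" and ball: "ball c r \<subseteq> \<Omega>" "dist c y0 = r" and r: "r > 0"
    and R: "R > 0" "\<sigma> * R - \<epsilon> > 0" "(\<sigma> * R - \<epsilon>)\<^sup>2 = R\<^sup>2 + r\<^sup>2"
  obtains \<mu> where "\<mu> > 0" "p y0 = \<mu> *\<^sub>R (c - y0)" "phi \<sigma> y0 \<le> 1 / R"
proof -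
  define s where "s = \<sigma> * R - \<epsilon>"
  have s: "s > 0" "s\<^sup>2 = R\<^sup>2 + r\<^sup>2" using R by (auto simp: s_def)
  have qc: "y0 \<in> closure \<Omega>" "y0 \<in> U" using y0 frontier_closure closure_\<Omega> by auto
  have hq: "hyp R c y0 = s" unfolding hyp_def using ball(2) s by (simp add: dist_norm norm_minus_commute s(2)[symmetric])
  have low: "\<sigma> * R \<le> u x + hyp R c x" if x: "x \<in> closure \<Omega>" for x
  proof -
    have "continuous_on (closure \<Omega>) (\<lambda>x. u x + hyp R c x)"
      by (intro continuous_on_add continuous_u_closure continuous_on_hyp)
    from closure_min[OF this x] obtain z where z: "z \<in> closure \<Omega>" "\<And>y. y \<in> closure \<Omega> \<Longrightarrow> u z + hyp R c z \<le> u y + hyp R c y"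
    by blast
    have "\<sigma> * R \<le> u z + hyp R c z"
    proof (cases "z \<in> \<Omega>")
      case True
      show ?thesis by (rule touch_below[OF True R(1)]) (use z(2) closure_subset in blast)
    next
      case False
      then have zf: "z \<in> frontier \<Omega>" using closure_cases z by blast
      have "z \<notin> ball c r" using False ball(1) by blast
      then have "r \<le> norm (z - c)" by (simp add: dist_norm norm_minus_commute)
      then have "r\<^sup>2 \<le> (norm (z - c))\<^sup>2" using r by (intro power_mono) auto
      then have "s \<le> hyp R c z" unfolding hyp_def using s by (intro real_le_rsqrt) simp
      then show ?thesis using boundary[OF zf] by (simp add: s_def)
    qed
    then show ?thesis using z(2)[OF x] by simp
  qed
  \<comment> \<open>Every direction entering the ball gives a one-sided inequality at y0; together
    they are the premise of \<open>half_space_dual\<close>.\<close>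
  have "(p y0 - (1 / s) *\<^sub>R (c - y0)) \<bullet> \<xi> \<ge> 0" if \<xi>: "\<xi> \<bullet> (c - y0) > 0" for \<xi>
  proof -
    obtain d where d: "d > 0" "\<And>t. 0 < t \<Longrightarrow> t < d \<Longrightarrow> y0 + t *\<^sub>R \<xi> \<in> ball c r" using ray_in_ball[OF ball(2) \<xi>] by blast
    have "p y0 \<bullet> \<xi> + ((y0 + 0 *\<^sub>R \<xi> - c) \<bullet> \<xi>) / hyp R c (y0 + 0 *\<^sub>R \<xi>) \<ge> 0"
    proof (rule one_sided_min[OF DERIV_add[OF p_line[OF qc(1)] hyp_line(1)[OF R(1)]] d(1)])
      fix t assume "0 < t" "t < d"
      then have "y0 + t *\<^sub>R \<xi> \<in> closure \<Omega>" using d(2) ball(1) closure_subset by blast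
      from low[OF this] show "u (y0 + 0 *\<^sub>R \<xi>) + hyp R c (y0 + 0 *\<^sub>R \<xi>) \<le> u (y0 + t *\<^sub>R \<xi>) + hyp R c (y0 + t *\<^sub>R \<xi>)"
        using boundary[OF y0] hq by (simp add: s_def)
    qed
    then have ge: "p y0 \<bullet> \<xi> + ((y0 - c) \<bullet> \<xi>) / s \<ge> 0" using hq by simp
    define w where "w = (c - y0) \<bullet> \<xi>"
    have "(y0 - c) \<bullet> \<xi> = - w" by (simp add: w_def inner_diff_left)
    then have "p y0 \<bullet> \<xi> - (1 / s) * w \<ge> 0" using ge by simp
    then show ?thesis unfolding inner_diff_left[of "p y0" "(1 / s) *\<^sub>R (c - y0)"] inner_scaleR_left w_def .
  qed
  moreover have cq: "c - y0 \<noteq> 0" using ball(2) r by auto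
  ultimately obtain m where m: "m \<ge> 0" "p y0 - (1 / s) *\<^sub>R (c - y0) = m *\<^sub>R (c - y0)" using half_space_dual by metis
  have pq: "p y0 = (m + 1 / s) *\<^sub>R (c - y0)"
  proof -
    have "p y0 = m *\<^sub>R (c - y0) + (1 / s) *\<^sub>R (c - y0)" using m(2) by (metis diff_add_cancel)
    then show ?thesis by (simp only: scaleR_add_left)
  qed
  have "(c - y0) \<bullet> (c - y0) = r\<^sup>2" using ball(2) by (simp add: power2_norm_eq_inner[symmetric] dist_norm)
  then have pp: "p y0 \<bullet> p y0 = (m + 1 / s)\<^sup>2 * r\<^sup>2" unfolding pq by (simp add: power2_eq_square)
  have "s\<^sup>2 - R\<^sup>2 \<le> s\<^sup>2 * (p y0 \<bullet> p y0)"
  proof -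
    have "(1 / s)\<^sup>2 \<le> (m + 1 / s)\<^sup>2" using m s by (intro power_mono) auto
    then have "s\<^sup>2 * ((1 / s)\<^sup>2 * r\<^sup>2) \<le> s\<^sup>2 * ((m + 1 / s)\<^sup>2 * r\<^sup>2)" by (intro mult_left_mono mult_right_mono) auto
    moreover have "s\<^sup>2 * ((1 / s)\<^sup>2 * r\<^sup>2) = s\<^sup>2 - R\<^sup>2" using s by (simp add: power_divide)
    ultimately show ?thesis unfolding pp by (simp only:)
  qed
  then have "s / R \<le> \<nu> y0" using nu_ge_iff[OF qc(2) s(1) R(1)] by simp
  then have "\<sigma> - \<nu> y0 \<le> \<epsilon> / R" using R(1) by (simp add: s_def field_simps)
  then have "phi \<sigma> y0 \<le> (\<epsilon> / R) / \<epsilon>" unfolding phi_def boundary[OF y0] using eps by (intro divide_right_mono) auto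
  then have "phi \<sigma> y0 \<le> 1 / R" using eps by simp
  moreover have "m + 1 / s > 0" using m s by (simp add: add_nonneg_pos)
  ultimately show ?thesis using that pq by blast
qed

lemma exterior_ball_dist:
  assumes ball: "ball c r \<subseteq> - \<Omega>" and x: "x \<in> closure \<Omega>"
  shows "r \<le> norm (x - c)"
proof (rule ccontr)
  assume "\<not> ?thesis"
  then have "x \<in> ball c r" by (simp add: dist_norm norm_minus_commute)
  then have "ball c r \<inter> \<Omega> \<noteq> {}" using x open_Int_closure_eq_empty[OF open_ball] by blast
  then show False using ball by blast
qed

text \<open>|Du| < 1 excludes an interior minimum of |x - c| - u, and on the frontier |x - c| \<ge>
  r > \<epsilon> = u. The graph is thus spacelike separated from (c, 0), which makes the parameter
  of the homothetic family positive on it.\<close>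

lemma u_less_dist:
  assumes ball: "ball c r \<subseteq> - \<Omega>" and r: "\<epsilon> < r" and x: "x \<in> closure \<Omega>"
  shows "u x < norm (x - c)"
proof -
  have "continuous_on (closure \<Omega>) (\<lambda>x. norm (x - c) - u x)"
    by (intro continuous_intros continuous_u_closure)
  from closure_min[OF this x] obtain z where z: "z \<in> closure \<Omega>" "\<And>y. y \<in> closure \<Omega> \<Longrightarrow> norm (z - c) - u z \<le> norm (y - c) - u y"
    by blast
  have zd: "norm (z - c) \<ge> r" by (rule exterior_ball_dist[OF ball z(1)])
  have "z \<notin> \<Omega>"
  proof
    assume z\<Omega>: "z \<in> \<Omega>"
    define v where "v = z - c"
    have v: "norm v > 0" unfolding v_def using zd r eps by linarith
    obtain d where d: "d > 0" "\<And>t. \<bar>t\<bar> < d \<Longrightarrow> z + t *\<^sub>R (- v) \<in> \<Omega>" using open_ray[OF open_\<Omega> z\<Omega>, of "- v"] by blast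
    have "((\<lambda>t. (1 - t) * norm v - u (z + t *\<^sub>R (- v))) has_real_derivative (- norm v - p z \<bullet> (- v))) (at 0)"
    proof (rule DERIV_diff)
      show "((\<lambda>t. (1 - t) * norm v) has_real_derivative - norm v) (at 0)" by (auto intro!: derivative_eq_intros)
    qed (rule p_line[OF z(1)])
    then have "- norm v - p z \<bullet> (- v) \<ge> 0"
    proof (rule one_sided_min)
      show "min d 1 > 0" using d by simp
      fix t assume t: "0 < t" "t < min d 1"
      have "z + t *\<^sub>R (- v) - c = (1 - t) *\<^sub>R v" by (simp add: v_def algebra_simps)
      then have "norm (z + t *\<^sub>R (- v) - c) = (1 - t) * norm v" using t by simp
      moreover have "z + t *\<^sub>R (- v) \<in> closure \<Omega>" using d(2)[of t] t closure_subset by auto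
      ultimately show "(1 - 0) * norm v - u (z + 0 *\<^sub>R (- v)) \<le> (1 - t) * norm v - u (z + t *\<^sub>R (- v))"
        using z(2)[of "z + t *\<^sub>R (- v)"] by (simp add: v_def)
    qed
    then have "norm v \<le> p z \<bullet> v" by simp
    also have "\<dots> \<le> norm (p z) * norm v" by (rule norm_cauchy_schwarz)
    also have "\<dots> < 1 * norm v" using spacelike[OF \<Omega>_U[OF z\<Omega>]] v by (intro mult_strict_right_mono)
    finally show False by simp
  qed
  then have "u z = \<epsilon>" using closure_cases[OF z(1)] boundary by blast
  then have "norm (z - c) - u z > 0" using zd r by simp
  then show ?thesis using z(2)[OF x] by simp
qed

text \<open>\<open>\<Lambda> x\<close> is the parameter for which the homothetic hyperboloid of curvature \<open>a\<close> centred at \<open>(c, -a \<Lambda>)\<close>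
  passes through \<open>(x, u x)\<close>; since \<open>a > \<sigma>\<close>, it cannot be minimal at an interior point.\<close>
lemma exterior_barrier:
  assumes ball: "ball c r \<subseteq> - \<Omega>" and r: "\<epsilon> < r" and a: "a > \<sigma>"
    and lam: "l0 > 0" "(a * l0 + \<epsilon>)\<^sup>2 = l0\<^sup>2 + r\<^sup>2" and x: "x \<in> closure \<Omega>"
  shows "u x \<le> hyp l0 c x - a * l0"
proof -
  have a1: "a > 1" using a sigma by simp
  then have a2: "a\<^sup>2 - 1 > 0" by (simp add: one_less_power)
  \<comment> \<open>\<Lambda> y is the positive root l of (u + a l)^2 = l^2 + |y - c|^2; in terms of
    Q the equation says Q y l = |y - c|^2 - u^2.\<close>
  define Disc where "Disc y = sqrt ((a * u y)\<^sup>2 + (a\<^sup>2 - 1) * ((norm (y - c))\<^sup>2 - (u y)\<^sup>2))" for y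
  define \<Lambda> where "\<Lambda> y = (Disc y - a * u y) / (a\<^sup>2 - 1)" for y
  define Q where "Q y l = (a\<^sup>2 - 1) * l\<^sup>2 + 2 * a * u y * l" for y l
  have up: "u y > 0" if "y \<in> closure \<Omega>" for y using that u_pos closure_\<Omega> by blast
  have pos: "\<Lambda> y > 0" and root: "Q y (\<Lambda> y) = (norm (y - c))\<^sup>2 - (u y)\<^sup>2" if y: "y \<in> closure \<Omega>" for y
  proof -
    have "(u y)\<^sup>2 < (norm (y - c))\<^sup>2" using u_less_dist[OF ball r y] up[OF y] by (intro power_strict_mono) auto
    then have gt: "(a\<^sup>2 - 1) * ((norm (y - c))\<^sup>2 - (u y)\<^sup>2) > 0" using a2 by simp
    have D2: "(Disc y)\<^sup>2 = (a * u y)\<^sup>2 + (a\<^sup>2 - 1) * ((norm (y - c))\<^sup>2 - (u y)\<^sup>2)"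
      unfolding Disc_def using gt by (intro real_sqrt_pow2) (simp add: add_nonneg_nonneg)
    have "a * u y < Disc y" unfolding Disc_def using gt by (intro real_less_rsqrt) simp
    then show "\<Lambda> y > 0" using a2 by (simp add: \<Lambda>_def)
    have L: "(a\<^sup>2 - 1) * \<Lambda> y = Disc y - a * u y" using a2 by (simp add: \<Lambda>_def)
    have "(a\<^sup>2 - 1) * Q y (\<Lambda> y) = ((a\<^sup>2 - 1) * \<Lambda> y)\<^sup>2 + 2 * a * u y * ((a\<^sup>2 - 1) * \<Lambda> y)"
      by (simp add: Q_def power2_eq_square algebra_simps)
    also have "\<dots> = (Disc y)\<^sup>2 - (a * u y)\<^sup>2" unfolding L by (simp add: power2_eq_square algebra_simps)
    also have "\<dots> = (a\<^sup>2 - 1) * ((norm (y - c))\<^sup>2 - (u y)\<^sup>2)" unfolding D2 by simp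
    finally show "Q y (\<Lambda> y) = (norm (y - c))\<^sup>2 - (u y)\<^sup>2" using a2 by simp
  qed
  have Qmono: "Q y l \<le> Q y m" if "y \<in> closure \<Omega>" "0 \<le> l" "l \<le> m" for y l m
  proof -
    have "l\<^sup>2 \<le> m\<^sup>2" using that by (intro power_mono) auto
    then show ?thesis unfolding Q_def using that a1 a2 up[OF that(1)] by (intro add_mono mult_left_mono) auto
  qed
  have Qstrict: "Q y l < Q y m" if "y \<in> closure \<Omega>" "0 \<le> l" "l < m" for y l m
  proof -
    have "l\<^sup>2 < m\<^sup>2" using that by (intro power_strict_mono) auto
    then show ?thesis unfolding Q_def using that a1 a2 up[OF that(1)]
      by (intro add_strict_mono mult_strict_left_mono) auto
  qed
  have expand: "(u y + a * l)\<^sup>2 = (u y)\<^sup>2 + Q y l + l\<^sup>2" for y l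
    by (simp add: Q_def power2_eq_square algebra_simps)
  have below: "u y + a * l \<le> hyp l c y" if "y \<in> closure \<Omega>" "0 \<le> l" "l \<le> \<Lambda> y" for y l
    unfolding hyp_def using Qmono[OF that] root[OF that(1)] by (intro real_le_rsqrt) (simp add: expand)
  have "continuous_on (closure \<Omega>) \<Lambda>"
    unfolding \<Lambda>_def Disc_def using a2 by (intro continuous_intros continuous_u_closure) simp
  from closure_min[OF this x] obtain z where z: "z \<in> closure \<Omega>" "\<And>y. y \<in> closure \<Omega> \<Longrightarrow> \<Lambda> z \<le> \<Lambda> y"
    by blast
  have hz: "hyp (\<Lambda> z) c z = u z + a * \<Lambda> z"
    unfolding hyp_def
  proof (rule real_sqrt_unique)
    show "(u z + a * \<Lambda> z)\<^sup>2 = (\<Lambda> z)\<^sup>2 + (norm (z - c))\<^sup>2" unfolding expand root[OF z(1)] by simp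
    show "0 \<le> u z + a * \<Lambda> z" using up[OF z(1)] pos[OF z(1)] a1 by simp
  qed
  \<comment> \<open>At an interior minimum of \<Lambda> the hyperboloid with parameter \<Lambda> z
    touches the graph from above, and \<open>touch_above\<close> would give a \<le>
    \<sigma>.\<close>
  have "z \<notin> \<Omega>"
  proof
    assume z\<Omega>: "z \<in> \<Omega>"
    have "a * \<Lambda> z > 0" using a1 pos[OF z(1)] by simp
    then have lt: "u z < hyp (\<Lambda> z) c z" using hz by simp
    have "hyp (\<Lambda> z) c z - u z \<le> \<sigma> * \<Lambda> z"
    proof (rule touch_above[OF z\<Omega> pos[OF z(1)] _ lt])
      fix y assume "y \<in> \<Omega>"
      then have y: "y \<in> closure \<Omega>" using closure_subset by blast
      show "u y - hyp (\<Lambda> z) c y \<le> u z - hyp (\<Lambda> z) c z"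
        using below[OF y less_imp_le[OF pos[OF z(1)]] z(2)[OF y]] hz by simp
    qed
    then have "a * \<Lambda> z \<le> \<sigma> * \<Lambda> z" using hz by simp
    then show False using a pos[OF z(1)] by simp
  qed
  then have uz: "u z = \<epsilon>" using closure_cases[OF z(1)] boundary by blast
  \<comment> \<open>At height \<epsilon> and distance at least r from c the root is at least l0,
    since Q increases with l.\<close>
  have "l0 \<le> \<Lambda> z"
  proof (rule ccontr)
    assume "\<not> l0 \<le> \<Lambda> z"
    then have "Q z (\<Lambda> z) < Q z l0" using pos[OF z(1)] by (intro Qstrict[OF z(1)]) auto
    moreover have "r\<^sup>2 \<le> (norm (z - c))\<^sup>2" using exterior_ball_dist[OF ball z(1)] r eps by (intro power_mono) auto
    moreover have "\<epsilon>\<^sup>2 + Q z l0 + l0\<^sup>2 = l0\<^sup>2 + r\<^sup>2" using lam(2) expand[of z l0] uz by (simp add: add.commute)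
    ultimately show False using root[OF z(1)] uz by simp
  qed
  then have "l0 \<le> \<Lambda> x" using z(2)[OF x] by simp
  then show ?thesis using below[OF x less_imp_le[OF lam(1)]] by simp
qed

text \<open>The barrier of curvature a > \<sigma> meets the graph at y0 and lies above it, which
  bounds the inward slope of u. Since Du at y0 is already known to point along the inner radius,
  this bounds |Du| and gives \<nu> \<le> a + \<epsilon> T a; then a tends to \<sigma>.\<close>

lemma exterior_sphere:
  assumes y0: "y0 \<in> frontier \<Omega>" and inner: "ball c r \<subseteq> \<Omega>" "dist c y0 = r" "r > 0" "\<mu> > 0" "p y0 = \<mu> *\<^sub>R (c - y0)"
    and ball: "ball c' r' \<subseteq> - \<Omega>" "dist c' y0 = r'" and r': "\<epsilon> < r'"
  shows "phi \<sigma> y0 \<ge> - ((sqrt ((\<sigma>\<^sup>2 - 1) * r'\<^sup>2 + \<epsilon>\<^sup>2) + \<sigma> * \<epsilon>) / (r'\<^sup>2 - \<epsilon>\<^sup>2))"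
proof -
  define T where "T a = (sqrt ((a\<^sup>2 - 1) * r'\<^sup>2 + \<epsilon>\<^sup>2) + a * \<epsilon>) / (r'\<^sup>2 - \<epsilon>\<^sup>2)" for a
  have qc: "y0 \<in> closure \<Omega>" "y0 \<in> U" using y0 frontier_closure closure_\<Omega> by auto
  have bound: "\<nu> y0 \<le> a + \<epsilon> * T a" if a: "a > \<sigma>" for a
  proof -
    have a1: "a > 1" using a sigma by simp
    note T = barrier_roots(5,6)[OF a1 eps r', folded T_def]
    \<comment> \<open>Radius of the hyperboloid of curvature a that meets level \<epsilon> in the
      exterior sphere of radius r'.\<close>
    define l where "l = 1 / T a"
    have l: "l > 0" using T by (simp add: l_def)
    have Tl: "T a = 1 / l" by (simp add: l_def)
    define s where "s = a * l + \<epsilon>"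
    have s: "s > 0" using a1 l eps by (simp add: s_def add_pos_pos)
    have "(a + \<epsilon> * T a) * l = s" using l by (simp add: Tl s_def field_simps)
    then have "s\<^sup>2 = (a + \<epsilon> * T a)\<^sup>2 * l\<^sup>2" by (metis power_mult_distrib)
    also have "\<dots> = l\<^sup>2 + r'\<^sup>2" unfolding T(2) using l by (simp add: Tl power_divide field_simps)
    finally have s2: "s\<^sup>2 = l\<^sup>2 + r'\<^sup>2" .
    have hq: "hyp l c' y0 = s" unfolding hyp_def using ball(2) s by (simp add: dist_norm norm_minus_commute s2[symmetric])
    define v where "v = c - y0"
    have vv: "v \<bullet> v = r\<^sup>2" using inner(2) by (simp add: v_def power2_norm_eq_inner[symmetric] dist_norm)
    have "v \<bullet> (c - y0) > 0" using vv inner(3) by (simp add: v_def)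
    then obtain d where d: "d > 0" "\<And>t. 0 < t \<Longrightarrow> t < d \<Longrightarrow> y0 + t *\<^sub>R v \<in> ball c r" using ray_in_ball[OF inner(2)] by blast
    have "((y0 + 0 *\<^sub>R v - c') \<bullet> v) / hyp l c' (y0 + 0 *\<^sub>R v) - p y0 \<bullet> v \<ge> 0"
    proof (rule one_sided_min[OF DERIV_diff[OF hyp_line(1)[OF l] p_line[OF qc(1)]] d(1)])
      fix t assume "0 < t" "t < d"
      then have "y0 + t *\<^sub>R v \<in> closure \<Omega>" using d(2) inner(1) closure_subset by blast
      from exterior_barrier[OF ball(1) r' a l s2[unfolded s_def] this]
      show "hyp l c' (y0 + 0 *\<^sub>R v) - u (y0 + 0 *\<^sub>R v) \<le> hyp l c' (y0 + t *\<^sub>R v) - u (y0 + t *\<^sub>R v)"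
        using boundary[OF y0] hq by (simp add: s_def)
    qed
    then have "p y0 \<bullet> v \<le> ((y0 - c') \<bullet> v) / s" using hq by simp
    also have "\<dots> \<le> (r' * r) / s"
    proof (rule divide_right_mono)
      have "(y0 - c') \<bullet> v \<le> norm (y0 - c') * norm v" by (rule norm_cauchy_schwarz)
      also have "\<dots> = r' * r" using ball(2) inner(2) by (simp add: v_def dist_norm norm_minus_commute)
      finally show "(y0 - c') \<bullet> v \<le> r' * r" .
    qed (use s in simp)
    finally have "\<mu> * r\<^sup>2 \<le> r' * r / s" unfolding inner(5) v_def[symmetric] by (simp add: vv)
    then have "(\<mu> * r) * r \<le> (r' / s) * r" by (simp add: power2_eq_square mult_ac)
    then have mr: "\<mu> * r \<le> r' / s" by (rule mult_right_le_imp_le) (rule inner(3))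
    have "p y0 \<bullet> p y0 = (\<mu> * r)\<^sup>2" unfolding inner(5) v_def[symmetric] using vv by (simp add: power2_eq_square)
    also have "\<dots> \<le> (r' / s)\<^sup>2" using mr inner by (intro power_mono) auto
    finally have "s\<^sup>2 * (p y0 \<bullet> p y0) \<le> s\<^sup>2 * (r' / s)\<^sup>2" by (intro mult_left_mono) auto
    also have "s\<^sup>2 * (r' / s)\<^sup>2 = s\<^sup>2 - l\<^sup>2" using s s2 by (simp add: power_divide)
    finally have "\<nu> y0 \<le> s / l" using nu_le_iff[OF qc(2) s l] by simp
    moreover have "s / l = a + \<epsilon> * T a" using l by (simp add: s_def Tl field_simps)
    ultimately show ?thesis by simp
  qed
  have d: "r'\<^sup>2 - \<epsilon>\<^sup>2 \<noteq> 0" using r' eps power_strict_mono[of \<epsilon> r' 2] by simp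
  have "((\<lambda>a. a + \<epsilon> * T a) \<longlongrightarrow> \<sigma> + \<epsilon> * T \<sigma>) (at_right \<sigma>)"
    unfolding T_def by (intro tendsto_intros d)
  moreover have "\<forall>\<^sub>F a in at_right \<sigma>. \<nu> y0 \<le> a + \<epsilon> * T a"
    using bound unfolding eventually_at_filter by (auto intro: always_eventually)
  ultimately have "\<nu> y0 \<le> \<sigma> + \<epsilon> * T \<sigma>" by (rule tendsto_lowerbound) simp
  then have "- T \<sigma> * \<epsilon> \<le> \<sigma> - \<nu> y0" by (simp add: mult.commute)
  then have "- T \<sigma> \<le> (\<sigma> - \<nu> y0) / \<epsilon>" using eps by (simp add: le_divide_eq)
  then show ?thesis by (simp add: phi_def boundary[OF y0] T_def)
qed

end

section \<open>Strict positivity on the boundary when exterior spheres are arbitrarily large\<close>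

context level_graph
begin

text \<open>Disjointness from the interior ball centres every exterior ball touching at y0 on the
  ray opposite to c - y0; as their radii grow they exhaust the open half-space behind y0.\<close>

lemma half_space:
  assumes inner: "ball c r \<subseteq> \<Omega>" "dist c y0 = r" "r > 0" and y0: "y0 \<in> frontier \<Omega>"
    and ext: "\<And>\<rho>. \<rho> > 0 \<Longrightarrow> \<rho> \<in> touching_radii (- \<Omega>) (frontier \<Omega>)" and x: "x \<in> closure \<Omega>"
  shows "(c - y0) \<bullet> (x - y0) \<ge> 0"
proof -
  define v where "v = c - y0"
  have vv: "v \<bullet> v = r\<^sup>2" using inner(2) by (simp add: v_def power2_norm_eq_inner[symmetric] dist_norm)
  have "v \<bullet> (x - y0) \<ge> 0" if x: "x \<in> \<Omega>" for x
  proof (rule ccontr)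
    define z where "z = x - y0"
    assume "\<not> v \<bullet> (x - y0) \<ge> 0"
    then have neg: "v \<bullet> z < 0" by (simp add: z_def)
    \<comment> \<open>Larger than r |z|^2 / (- 2 v \<bullet> z), the radius beyond which the
      exterior ball contains x.\<close>
    define \<rho> where "\<rho> = r * ((z \<bullet> z) / (- (v \<bullet> z)) + 1)"
    have zz: "(z \<bullet> z) / (- (v \<bullet> z)) \<ge> 0" using neg by (intro divide_nonneg_nonneg) auto
    then have \<rho>: "\<rho> > 0" using inner(3) by (simp add: \<rho>_def add_nonneg_pos)
    obtain c' where c': "ball c' \<rho> \<subseteq> - \<Omega>" "dist c' y0 = \<rho>" using ext[OF \<rho>] y0 unfolding touching_radii_def by blast
    have "ball c r \<inter> ball c' \<rho> = {}" using inner(1) c'(1) by blast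
    from tangent_balls_aligned[OF this inner(3) \<rho> inner(2) c'(2)]
    have al: "y0 - c' = (\<rho> / r) *\<^sub>R v" by (simp add: v_def)
    have "x - c' = z + (\<rho> / r) *\<^sub>R v" using al by (simp add: z_def algebra_simps)
    then have "(norm (x - c'))\<^sup>2 = (z + (\<rho> / r) *\<^sub>R v) \<bullet> (z + (\<rho> / r) *\<^sub>R v)" by (simp add: power2_norm_eq_inner)
    also have "\<dots> = z \<bullet> z + 2 * (\<rho> / r) * (v \<bullet> z) + (\<rho> / r)\<^sup>2 * (v \<bullet> v)"
      by (simp add: inner_add_left inner_add_right inner_commute[of z v] power2_eq_square algebra_simps)
    also have "(\<rho> / r)\<^sup>2 * (v \<bullet> v) = \<rho>\<^sup>2" unfolding vv using inner(3) by (simp add: power_divide)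
    also have "\<rho> / r = (z \<bullet> z) / (- (v \<bullet> z)) + 1" using inner(3) by (simp add: \<rho>_def)
    also have "2 * ((z \<bullet> z) / (- (v \<bullet> z)) + 1) * (v \<bullet> z) = - 2 * (z \<bullet> z) + 2 * (v \<bullet> z)" using neg by (simp add: field_simps)
    finally have "(norm (x - c'))\<^sup>2 < \<rho>\<^sup>2" using neg inner_ge_zero[of z] by linarith
    then have "norm (x - c') < \<rho>" by (rule power2_less_imp_less) (use \<rho> in simp)
    then have "x \<in> ball c' \<rho>" by (simp add: dist_norm norm_minus_commute)
    then show False using c'(1) x by blast
  qed
  then have "\<Omega> \<subseteq> {x. v \<bullet> (x - y0) \<ge> 0}" by blast
  moreover have "closed {x. v \<bullet> (x - y0) \<ge> 0}" by (intro closed_Collect_le continuous_intros)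
  ultimately have "closure \<Omega> \<subseteq> {x. v \<bullet> (x - y0) \<ge> 0}" by (rule closure_minimal)
  then show ?thesis using x by (auto simp: v_def)
qed

text \<open>A plane of slope sqrt (1 - 1/a^2) has \<nu> = a and hence curvature a. For a > \<sigma>
  \<open>touch_plane\<close> rules out interior contact, while over the frontier the half-space
  condition keeps the plane at height \<epsilon> or more; then a tends to \<sigma>.\<close>

lemma plane_barrier:
  assumes y0: "y0 \<in> frontier \<Omega>" and half: "\<And>x. x \<in> closure \<Omega> \<Longrightarrow> v \<bullet> (x - y0) \<ge> 0" and v: "norm v = r" "r > 0"
    and x: "x \<in> closure \<Omega>"
  shows "u x \<le> \<epsilon> + sqrt (1 - 1 / \<sigma>\<^sup>2) / r * (v \<bullet> (x - y0))"
proof -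
  have bound: "u x \<le> \<epsilon> + sqrt (1 - 1 / a\<^sup>2) / r * (v \<bullet> (x - y0))" if a: "a > \<sigma>" for a
  proof -
    have a1: "a > 1" using a sigma by simp
    define \<beta> where "\<beta> = sqrt (1 - 1 / a\<^sup>2)"
    have "1 / a\<^sup>2 < 1" using a1 by (simp add: one_less_power)
    then have \<beta>: "\<beta> \<ge> 0" "\<beta>\<^sup>2 = 1 - 1 / a\<^sup>2" by (simp_all add: \<beta>_def)
    define b where "b = (\<beta> / r) *\<^sub>R v"
    have bb: "b \<bullet> b = \<beta>\<^sup>2"
    proof -
      have "b \<bullet> b = (\<beta> / r)\<^sup>2 * (norm v)\<^sup>2" by (simp add: b_def power2_eq_square power2_norm_eq_inner[symmetric])
      then show ?thesis using v by (simp add: power_divide)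
    qed
    have "continuous_on (closure \<Omega>) (\<lambda>x. b \<bullet> x - u x)" by (intro continuous_intros continuous_u_closure)
    from closure_min[OF this x] obtain z where z: "z \<in> closure \<Omega>" "\<And>y. y \<in> closure \<Omega> \<Longrightarrow> b \<bullet> z - u z \<le> b \<bullet> y - u y"
      by blast
    have "z \<notin> \<Omega>"
    proof
      assume z\<Omega>: "z \<in> \<Omega>"
      have max: "u y - b \<bullet> y \<le> u z - b \<bullet> z" if "y \<in> \<Omega>" for y
        using z(2)[of y] that closure_subset[of \<Omega>] by force
      have pz: "p z = b" and nz: "\<nu> z \<le> \<sigma>" using touch_plane[OF z\<Omega> max] by auto
      have "(\<nu> z)\<^sup>2 * (1 - \<beta>\<^sup>2) = 1" using nu_norm[OF \<Omega>_U[OF z\<Omega>]] unfolding pz bb by (simp add: algebra_simps)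
      moreover have "1 - \<beta>\<^sup>2 = 1 / a\<^sup>2" using \<beta>(2) by simp
      ultimately have "(\<nu> z)\<^sup>2 * (1 / a\<^sup>2) = 1" by (simp only:)
      then have "(\<nu> z)\<^sup>2 / a\<^sup>2 = 1" by (simp only: times_divide_eq_right mult_1_right)
      then have "(\<nu> z)\<^sup>2 = a\<^sup>2" by (simp only: divide_eq_1_iff)
      then have "\<nu> z = a" using nu_pos[OF \<Omega>_U[OF z\<Omega>]] a1 by (simp add: power2_eq_iff_nonneg)
      then show False using nz a by simp
    qed
    then have "u z = \<epsilon>" using closure_cases[OF z(1)] boundary by blast
    moreover have "b \<bullet> (z - y0) \<ge> 0" using half[OF z(1)] \<beta> v by (simp add: b_def)
    ultimately have "b \<bullet> y0 - \<epsilon> \<le> b \<bullet> x - u x" using z(2)[OF x] by (simp add: inner_diff_right)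
    then show ?thesis by (simp add: b_def \<beta>_def[symmetric] inner_diff_right algebra_simps diff_divide_distrib)
  qed
  have "((\<lambda>a. \<epsilon> + sqrt (1 - 1 / a\<^sup>2) / r * (v \<bullet> (x - y0))) \<longlongrightarrow> \<epsilon> + sqrt (1 - 1 / \<sigma>\<^sup>2) / r * (v \<bullet> (x - y0))) (at_right \<sigma>)"
    using sigma v by (intro tendsto_intros) auto
  moreover have "\<forall>\<^sub>F a in at_right \<sigma>. u x \<le> \<epsilon> + sqrt (1 - 1 / a\<^sup>2) / r * (v \<bullet> (x - y0))"
    using bound unfolding eventually_at_filter by (auto intro: always_eventually)
  ultimately show ?thesis by (rule tendsto_lowerbound) simp
qed

text \<open>The cap of \<open>interior_sphere\<close> exists with R = 1 / S, S the root from
  \<open>barrier_roots\<close>, and S carries the strict bound.\<close>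

lemma interior_sphere_at:
  assumes y0: "y0 \<in> frontier \<Omega>" and ball: "ball c r \<subseteq> \<Omega>" "dist c y0 = r" and r: "\<epsilon> < r"
  obtains \<mu> where "\<mu> > 0" "p y0 = \<mu> *\<^sub>R (c - y0)"
    "phi \<sigma> y0 < r * sqrt (\<sigma>\<^sup>2 - 1) / (r\<^sup>2 - \<epsilon>\<^sup>2) + \<epsilon> * (\<sigma> - 1) / (r\<^sup>2 - \<epsilon>\<^sup>2)"
proof -
  define S where "S = (sqrt ((\<sigma>\<^sup>2 - 1) * r\<^sup>2 + \<epsilon>\<^sup>2) - \<sigma> * \<epsilon>) / (r\<^sup>2 - \<epsilon>\<^sup>2)"
  note S = barrier_roots(1-4)[OF sigma eps r, folded S_def]
  define R where "R = 1 / S"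
  have R: "R > 0" "S = 1 / R" using S by (simp_all add: R_def)
  have e: "\<sigma> * R - \<epsilon> = (\<sigma> - \<epsilon> * S) * R" using R by (simp add: field_simps)
  have "\<sigma> * R - \<epsilon> > 0" unfolding e using S(3) R(1) by simp
  moreover have "(\<sigma> * R - \<epsilon>)\<^sup>2 = R\<^sup>2 + r\<^sup>2"
  proof -
    have "S * R = 1" using R by simp
    moreover have "(1 + r\<^sup>2 * S\<^sup>2) * R\<^sup>2 = R\<^sup>2 + r\<^sup>2 * (S * R)\<^sup>2" by (simp add: power_mult_distrib algebra_simps)
    ultimately show ?thesis unfolding e power_mult_distrib[of "\<sigma> - \<epsilon> * S"] S(2) by simp
  qed
  ultimately obtain \<mu> where "\<mu> > 0" "p y0 = \<mu> *\<^sub>R (c - y0)" "phi \<sigma> y0 \<le> 1 / R"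
    using interior_sphere[OF y0 ball _ R(1)] r eps by (metis less_trans)
  then show ?thesis using that S(4) R(2) by simp
qed

text \<open>If \<open>\<nu> = \<sigma>\<close> at a boundary point, comparison with the supporting tilted plane forces \<open>D\<^sup>2u = 0\<close> there,
  which contradicts the Hopf lemma for the nonnegative supersolution \<open>(\<sigma> - \<nu>)/u\<close>.\<close>
lemma phi_pos_convex:
  assumes y0: "y0 \<in> frontier \<Omega>" and r: "\<epsilon> < r" and int: "r \<in> touching_radii \<Omega> (frontier \<Omega>)"
    and ext: "\<And>\<rho>. \<rho> > 0 \<Longrightarrow> \<rho> \<in> touching_radii (- \<Omega>) (frontier \<Omega>)"
  shows "phi \<sigma> y0 > 0"
proof -
  define \<beta> where "\<beta> = sqrt (1 - 1 / \<sigma>\<^sup>2)"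
  have "1 / \<sigma>\<^sup>2 < 1" using sigma by (simp add: one_less_power)
  then have \<beta>: "\<beta> > 0" "\<sigma>\<^sup>2 * \<beta>\<^sup>2 = \<sigma>\<^sup>2 - 1" using sigma by (simp_all add: \<beta>_def right_diff_distrib)
  have r0: "r > 0" using r eps by simp
  \<comment> \<open>At each boundary point the supporting plane limits the normal slope to \<beta>,
    the slope at which \<nu> = \<sigma>.\<close>
  have slope: "\<exists>c \<mu>. ball c r \<subseteq> \<Omega> \<and> dist c y = r \<and> \<mu> > 0 \<and> p y = \<mu> *\<^sub>R (c - y) \<and> \<mu> * r \<le> \<beta>
      \<and> (\<forall>x\<in>closure \<Omega>. u x \<le> \<epsilon> + \<beta> / r * ((c - y) \<bullet> (x - y)))" if y: "y \<in> frontier \<Omega>" for y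
  proof -
    obtain c where c: "ball c r \<subseteq> \<Omega>" "dist c y = r" using int y unfolding touching_radii_def by blast
    obtain \<mu> where \<mu>: "\<mu> > 0" "p y = \<mu> *\<^sub>R (c - y)" using interior_sphere_at[OF y c r] by blast
    define v where "v = c - y"
    have nv: "norm v = r" using c(2) by (simp add: v_def dist_norm)
    have vv: "v \<bullet> v = r\<^sup>2" using nv by (simp add: power2_norm_eq_inner[symmetric])
    have half: "v \<bullet> (x - y) \<ge> 0" if "x \<in> closure \<Omega>" for x
      unfolding v_def by (rule half_space[OF c r0 y ext that])
    have plane: "u x \<le> \<epsilon> + \<beta> / r * (v \<bullet> (x - y))" if "x \<in> closure \<Omega>" for x
      unfolding \<beta>_def by (rule plane_barrier[OF y half nv r0 that])
    have "v \<bullet> (c - y) > 0" using vv r0 by (simp add: v_def)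
    then obtain d where d: "d > 0" "\<And>t. 0 < t \<Longrightarrow> t < d \<Longrightarrow> y + t *\<^sub>R v \<in> ball c r" using ray_in_ball[OF c(2)] by blast
    have "((\<lambda>t. \<beta> / r * (t * r\<^sup>2) - u (y + t *\<^sub>R v)) has_real_derivative \<beta> / r * (1 * r\<^sup>2) - p y \<bullet> v) (at 0)"
    proof (rule DERIV_diff)
      show "((\<lambda>t. \<beta> / r * (t * r\<^sup>2)) has_real_derivative \<beta> / r * (1 * r\<^sup>2)) (at 0)"
        by (intro DERIV_cmult DERIV_cmult_right DERIV_ident)
    qed (rule p_line[OF frontier_closure[OF y]])
    then have "\<beta> / r * (1 * r\<^sup>2) - p y \<bullet> v \<ge> 0"
    proof (rule one_sided_min[OF _ d(1)])
      fix t assume "0 < t" "t < d"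
      then have "y + t *\<^sub>R v \<in> closure \<Omega>" using d(2) c(1) closure_subset by blast
      from plane[OF this] show "\<beta> / r * (0 * r\<^sup>2) - u (y + 0 *\<^sub>R v) \<le> \<beta> / r * (t * r\<^sup>2) - u (y + t *\<^sub>R v)"
        using boundary[OF y] by (simp add: vv)
    qed
    moreover have "p y \<bullet> v = (\<mu> * r) * r" unfolding \<mu>(2) v_def[symmetric] by (simp add: vv power2_eq_square)
    moreover have "\<beta> / r * (1 * r\<^sup>2) = \<beta> * r" using r0 by (simp add: power2_eq_square)
    ultimately have "(\<mu> * r) * r \<le> \<beta> * r" by simp
    then have "\<mu> * r \<le> \<beta>" by (rule mult_right_le_imp_le) (rule r0)
    then show ?thesis using c \<mu> plane unfolding v_def by blast
  qed
  have pp: "p y \<bullet> p y = (\<mu> * r)\<^sup>2" if "p y = \<mu> *\<^sub>R (c - y)" "dist c y = r" for y c \<mu>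
  proof -
    have "(c - y) \<bullet> (c - y) = r\<^sup>2" using that(2) by (simp add: power2_norm_eq_inner[symmetric] dist_norm)
    then show ?thesis unfolding that(1) by (simp add: power2_eq_square)
  qed
  have nonneg_frontier: "phi \<sigma> y \<ge> 0" if y: "y \<in> frontier \<Omega>" for y
  proof -
    obtain c \<mu> where c: "dist c y = r" "\<mu> > 0" "p y = \<mu> *\<^sub>R (c - y)" "\<mu> * r \<le> \<beta>" using slope[OF y] by blast
    have yU: "y \<in> U" using frontier_closure[OF y] closure_\<Omega> by blast
    have "(\<mu> * r)\<^sup>2 \<le> \<beta>\<^sup>2" using c r0 by (intro power_mono) auto
    then have "\<sigma>\<^sup>2 * (p y \<bullet> p y) \<le> \<sigma>\<^sup>2 * \<beta>\<^sup>2" unfolding pp[OF c(3,1)] by (intro mult_left_mono) auto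
    then have "\<nu> y \<le> \<sigma> / 1" using nu_le_iff[OF yU, of \<sigma> 1] sigma \<beta>(2) by simp
    then show ?thesis using eps by (simp add: phi_def boundary[OF y])
  qed
  have nonneg: "phi \<sigma> x \<ge> 0" if "x \<in> closure \<Omega>" for x
    using closure_cases[OF that]
  proof
    assume "x \<in> \<Omega>"
    from minimum_principle[OF elliptic phi_C2_\<Omega> conn bounded_\<Omega> lin_op_phi_nonpos continuous_phi this]
    show ?thesis using nonneg_frontier by force
  qed (rule nonneg_frontier)
  obtain c \<mu> where c: "ball c r \<subseteq> \<Omega>" "dist c y0 = r" "\<mu> > 0" "p y0 = \<mu> *\<^sub>R (c - y0)" "\<mu> * r \<le> \<beta>"
    and plane: "\<And>x. x \<in> closure \<Omega> \<Longrightarrow> u x \<le> \<epsilon> + \<beta> / r * ((c - y0) \<bullet> (x - y0))" using slope[OF y0] by blast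
  define v where "v = c - y0"
  have vv: "v \<bullet> v = r\<^sup>2" using c(2) by (simp add: v_def power2_norm_eq_inner[symmetric] dist_norm)
  have y0c: "y0 \<in> closure \<Omega>" "y0 \<in> U" using frontier_closure[OF y0] closure_\<Omega> by auto
  \<comment> \<open>u increases inward from y0, so its maximum lies in \<Omega>, and there \<nu> = 1
    < \<sigma>. Hence (\<sigma> - \<nu>)/u is not identically zero.\<close>
  have "\<exists>x\<in>\<Omega>. phi \<sigma> x > 0"
  proof -
    have "continuous_on (closure \<Omega>) (\<lambda>x. - u x)" by (intro continuous_intros continuous_u_closure)
    from closure_min[OF this y0c(1)] obtain z where z: "z \<in> closure \<Omega>" "\<And>y. y \<in> closure \<Omega> \<Longrightarrow> u y \<le> u z" by auto
    have "p y0 \<bullet> v > 0" unfolding c(4) v_def[symmetric] using vv c(3) r0 by simp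
    from DERIV_pos_inc_right[OF p_line[OF y0c(1)] this] obtain e where e: "e > 0" "\<And>h. 0 < h \<Longrightarrow> h < e \<Longrightarrow> u (y0 + 0 *\<^sub>R v) < u (y0 + (0 + h) *\<^sub>R v)" by blast
    have "v \<bullet> (c - y0) > 0" using vv r0 by (simp add: v_def)
    then obtain d where d: "d > 0" "\<And>t. 0 < t \<Longrightarrow> t < d \<Longrightarrow> y0 + t *\<^sub>R v \<in> ball c r" using ray_in_ball[OF c(2)] by blast
    define t where "t = min d e / 2"
    have t: "0 < t" "t < d" "t < e" using d e by (auto simp: t_def)
    have "y0 + t *\<^sub>R v \<in> closure \<Omega>" using d(2)[OF t(1,2)] c(1) closure_subset by blast
    then have "\<epsilon> < u z" using z(2) e(2)[OF t(1,3)] boundary[OF y0] by force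
    then have z\<Omega>: "z \<in> \<Omega>" using closure_cases[OF z(1)] boundary by force
    have "p z = 0" by (rule touch_plane(1)[OF z\<Omega>]) (use z(2) closure_subset in force)
    then have "\<nu> z = 1" by (simp add: nu_last_def wfun_def)
    then have "phi \<sigma> z > 0" using sigma u_pos[OF \<Omega>_U[OF z\<Omega>]] by (simp add: phi_def)
    then show ?thesis using z\<Omega> by blast
  qed
  then obtain x1 where x1: "x1 \<in> \<Omega>" "phi \<sigma> x1 > 0" by blast
  have pos: "phi \<sigma> x > 0" if x: "x \<in> \<Omega>" for x
  proof (rule ccontr)
    assume "\<not> phi \<sigma> x > 0"
    then have "phi \<sigma> x = 0" using nonneg[of x] x closure_subset by force
    from strong_minimum_principle[OF elliptic phi_C2_\<Omega> conn lin_op_phi_nonpos _ x this x1(1)]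
    have "phi \<sigma> x1 = 0" using nonneg closure_subset by blast
    then show False using x1(2) by simp
  qed
  show ?thesis
  proof (rule ccontr)
    assume "\<not> phi \<sigma> y0 > 0"
    then have phi0: "phi \<sigma> y0 = 0" using nonneg[OF y0c(1)] by simp
    then have nu0: "\<nu> y0 = \<sigma>" using eps by (simp add: phi_def boundary[OF y0])
    have cb: "cball c r \<subseteq> closure \<Omega>"
      using closure_mono[OF c(1)] closure_ball[of r c] r0 by simp
    have diff: "phi \<sigma> differentiable (at y0)" using dphi[OF y0c(2)] unfolding differentiable_def by blast
    have "Du (phi \<sigma>) y0 \<bullet> (c - y0) > 0"
      by (rule Hopf_boundary_point[OF elliptic phi_C2_\<Omega> lin_op_phi_nonpos r0 c(1) continuous_on_subset[OF continuous_phi cb] c(2) phi0 _ _ diff])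
        (use cb nonneg pos c(1) in blast)+
    \<comment> \<open>With \<nu> = \<sigma> at y0, the gradient of \<open>phi \<sigma>\<close>
      reduces to a negative multiple of \<open>q\<close>.\<close>
    then have Hneg: "q y0 \<bullet> v < 0"
      unfolding Du_phi[OF y0c(2)] v_def[symmetric] using nu0 sigma boundary[OF y0] eps
      by (simp add: divide_less_0_iff mult_less_0_iff)
    have mr: "\<mu> * r = \<beta>"
    proof (rule antisym[OF c(5)])
      have "\<sigma>\<^sup>2 * \<beta>\<^sup>2 \<le> \<sigma>\<^sup>2 * (\<mu> * r)\<^sup>2"
        using nu_ge_iff[OF y0c(2), of \<sigma> 1] nu0 sigma \<beta>(2) by (simp add: pp[OF c(4,2)])
      then have "\<beta>\<^sup>2 \<le> (\<mu> * r)\<^sup>2" using sigma by simp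
      then show "\<beta> \<le> \<mu> * r" by (rule power2_le_imp_le) (use c(3) r0 in simp)
    qed
    then have \<mu>: "\<mu> = \<beta> / r" using r0 by (simp add: field_simps)
    note neg = C2_on_uminus[OF C2_u]
    \<comment> \<open>By \<open>mr\<close> the supporting plane agrees with u to first order at y0
      and lies above it, so second derivatives in directions entering the ball are
      nonpositive.\<close>
    have semi: "\<xi> \<bullet> (H y0 *v \<xi>) \<le> 0" if \<xi>: "\<xi> \<bullet> (c - y0) > 0" for \<xi>
    proof -
      obtain d where d: "d > 0" "\<And>t. 0 < t \<Longrightarrow> t < d \<Longrightarrow> y0 + t *\<^sub>R \<xi> \<in> ball c r" using ray_in_ball[OF c(2) \<xi>] by blast
      have "\<xi> \<bullet> (D2u (\<lambda>x. - u x) y0 *v \<xi>) + 0 \<ge> 0"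
      proof (rule C2_on_line_nonneg[OF neg(1) y0c(2) _ _ d(1)])
        show "((\<lambda>t. t * (p y0 \<bullet> \<xi>)) has_real_derivative p y0 \<bullet> \<xi>) (at t)" for t
          by (auto intro!: derivative_eq_intros)
        show "((\<lambda>t. p y0 \<bullet> \<xi>) has_real_derivative 0) (at 0)" by simp
        fix t assume "0 < t" "t < d"
        then have "y0 + t *\<^sub>R \<xi> \<in> closure \<Omega>" using d(2) c(1) closure_subset by blast
        from plane[OF this] show "- u y0 + 0 * (p y0 \<bullet> \<xi>) \<le> - u (y0 + t *\<^sub>R \<xi>) + t * (p y0 \<bullet> \<xi>)"
          unfolding c(4) \<mu> by (simp add: boundary[OF y0] mult_ac)
      next
        show "Du (\<lambda>x. - u x) y0 \<bullet> \<xi> + p y0 \<bullet> \<xi> = 0" by (simp add: neg(2)[OF y0c(2)])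
      qed
      moreover have "\<xi> \<bullet> (D2u (\<lambda>x. - u x) y0 *v \<xi>) = - (\<xi> \<bullet> (H y0 *v \<xi>))"
        unfolding neg(3)[OF y0c(2)] by (simp add: matrix_form_sum sum_negf)
      ultimately show ?thesis by simp
    qed
    have semi_all: "\<xi> \<bullet> (H y0 *v \<xi>) \<le> 0" for \<xi>
    proof -
      consider "\<xi> \<bullet> v > 0" | "(- \<xi>) \<bullet> v > 0" | "\<xi> \<bullet> v = 0" by (metis inner_minus_left linorder_neqE_linordered_idom neg_0_less_iff_less)
      then show ?thesis
      proof cases
        case 1
        then show ?thesis using semi[of \<xi>] by (simp add: v_def)
      next
        case 2
        then have "(- \<xi>) \<bullet> (H y0 *v (- \<xi>)) \<le> 0" using semi[of "- \<xi>"] by (simp only: v_def)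
        then show ?thesis by (simp add: matrix_form_sum)
      next
        case 3
        \<comment> \<open>A tangential direction is a limit of directions tilted inward.\<close>
        have "((\<lambda>\<delta>. (\<xi> + \<delta> *\<^sub>R v) \<bullet> (H y0 *v (\<xi> + \<delta> *\<^sub>R v))) \<longlongrightarrow> (\<xi> + 0 *\<^sub>R v) \<bullet> (H y0 *v (\<xi> + 0 *\<^sub>R v))) (at_right 0)"
          unfolding matrix_form_sum by (intro tendsto_intros)
        moreover have "\<forall>\<^sub>F \<delta> in at_right 0. (\<xi> + \<delta> *\<^sub>R v) \<bullet> (H y0 *v (\<xi> + \<delta> *\<^sub>R v)) \<le> 0"
          unfolding eventually_at_filter
        proof (intro always_eventually allI impI)
          fix \<delta> :: real assume "\<delta> \<in> {0<..}"
          then have "(\<xi> + \<delta> *\<^sub>R v) \<bullet> v > 0" using 3 vv r0 by (simp add: inner_add_left)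
          then show "(\<xi> + \<delta> *\<^sub>R v) \<bullet> (H y0 *v (\<xi> + \<delta> *\<^sub>R v)) \<le> 0" using semi[of "\<xi> + \<delta> *\<^sub>R v"] by (simp add: v_def)
        qed
        ultimately have "(\<xi> + 0 *\<^sub>R v) \<bullet> (H y0 *v (\<xi> + 0 *\<^sub>R v)) \<le> 0" by (rule tendsto_upperbound) simp
        then show ?thesis by simp
      qed
    qed
    obtain P \<kappa> where fr: "frame y0 P \<kappa>" and \<kappa>: "\<kappa> \<in> posK" "f \<kappa> = \<sigma>" by (rule closure_frame[OF y0c(1)])
    have s0: "\<sigma> > 0" using sigma by simp
    \<comment> \<open>A nonpositive Hessian puts every curvature at least at \<nu> = \<sigma>. As
      f(\<kappa>) = \<sigma> = f(\<sigma>,...,\<sigma>), strict monotonicity leaves only \<kappa>_a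
      = \<sigma>, and then the Hessian vanishes on the frame.\<close>
    have ge: "\<sigma> \<le> \<kappa> $ a" for a
    proof -
      have "\<sigma> / u y0 * (P a \<bullet> (H y0 *v P a)) \<le> 0"
        using semi_all[of "P a"] s0 u_pos[OF y0c(2)] by (intro mult_nonneg_nonpos) auto
      then show ?thesis unfolding frame_kappa_form[OF y0c(2) fr, of a] nu0 by simp
    qed
    have eq: "\<kappa> $ a = \<sigma>" for a
    proof (rule ccontr)
      assume "\<kappa> $ a \<noteq> \<sigma>"
      then have "\<sigma> < \<kappa> $ a" using ge[of a] by simp
      then have "f (\<sigma> *\<^sub>R onevec) < f \<kappa>"
        by (intro f_cond_strict_mono[OF f scaleR_posK[OF s0 onevec_posK] \<kappa>(1), of a]) (use ge in \<open>simp_all add: onevec_def\<close>)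
      then show False using f_cond_scaled_one[OF f s0] \<kappa>(2) by simp
    qed
    have HP: "H y0 *v P a = 0" for a
      using frame_vector(2)[OF y0c(2) fr, of a] by (simp add: eq nu0)
    define z where "z = H y0 *v v"
    have "P a \<bullet> z = 0" for a unfolding z_def inner_symmetric_matrix[OF H_transpose[OF y0c(2)]] HP by simp
    then have "z \<bullet> (ginv y0 *v z) = 0"
      using eigen_frame_complete[OF fr g_transpose ginv_g[OF y0c(2)], of z] by simp
    then have "(u y0)\<^sup>2 * (z \<bullet> z + (\<nu> y0)\<^sup>2 * (p y0 \<bullet> z)\<^sup>2) = 0"
      by (simp add: ginv_mult inner_add_right power2_eq_square[of "p y0 \<bullet> z"] inner_commute[of z "p y0"] mult.assoc)
    then have "z \<bullet> z + (\<nu> y0)\<^sup>2 * (p y0 \<bullet> z)\<^sup>2 = 0" using u_pos[OF y0c(2)] by simp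
    then have "z = 0" by (simp add: add_nonneg_eq_0_iff)
    then have "q y0 \<bullet> v = 0" unfolding q_inner[OF y0c(2)] z_def by simp
    then show False using Hneg by simp
  qed
qed

end

text \<open>Positivity of u and |Du| < 1 are given on the closure of \<Omega>. Being open
  conditions, they persist on a neighbourhood U, so that derivatives at boundary points can be
  treated like interior ones.\<close>

lemma admissible_graph_locale:
  assumes dom: "smooth_domain \<Omega>" and \<sigma>: "\<sigma> > 1" and f: "f_conditions f" and adm: "admissible_graph \<Omega> \<sigma> f u"
  obtains U where "convex_graph u U \<Omega> f \<sigma>"
proof -
  obtain V where V: "closure \<Omega> \<subseteq> V" "smooth_on V u" using adm unfolding admissible_graph_def by blast
  have "open V" using V(2) by (simp add: smooth_on_def)
  define U where "U = {x \<in> V. u x \<in> {0<..}} \<inter> {x \<in> V. norm (Du u x) \<in> {..<1}}"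
  have "open U"
  proof -
    have "continuous_on V (\<lambda>x. Du u x)"
      unfolding Du_def by (intro continuous_on_vec_lambda smooth_on_continuous_on smooth_on_pd V)
    then have "continuous_on V (\<lambda>x. norm (Du u x))" by (rule continuous_on_norm)
    from continuous_open_preimage[OF this \<open>open V\<close>, of "{..<1}"]
    have "open {x \<in> V. norm (Du u x) \<in> {..<1}}"
      by (simp add: vimage_def Int_def)
    moreover have "open {x \<in> V. u x \<in> {0<..}}"
      using continuous_open_preimage[OF smooth_on_continuous_on[OF V(2)] \<open>open V\<close>, of "{0<..}"] by (simp add: vimage_def Int_def)
    ultimately show ?thesis unfolding U_def by (intro open_Int)
  qed
  have "smooth_on U u"
    unfolding smooth_on_def
  proof (intro conjI allI)
    fix "is"
    have "pds is u differentiable_on V" using V(2) unfolding smooth_on_def by blast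
    then show "pds is u differentiable_on U" by (rule differentiable_on_subset) (auto simp: U_def)
  qed fact
  then have "spacelike_graph u U" by unfold_locales (auto simp: U_def)
  moreover have "convex_graph_axioms u U \<Omega> f \<sigma>" if "spacelike_graph u U"
  proof -
    show ?thesis
      using dom \<sigma> f adm V(1) unfolding smooth_domain_def admissible_graph_def
      by unfold_locales (auto simp: U_def)
  qed
  ultimately show ?thesis using that[of U] unfolding convex_graph_def by blast
qed

theorem theorem4p2:
  fixes \<Omega> :: "(real^'n::finite) set"
  assumes "smooth_domain \<Omega>"
  shows "\<exists>\<epsilon>0>0. \<forall>\<sigma> f u \<epsilon>.
     \<sigma> > 1 \<and> f_conditions f \<and> admissible_graph \<Omega> \<sigma> f u \<longrightarrow>
     (let \<phi> = (\<lambda>x. (\<sigma> - nu_last u x) / u x);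
          r1 = Sup (int_sphere_radii \<Omega>);
          r2 = Sup (ext_sphere_radii \<Omega>)
      in (\<forall>x\<in>\<Omega>.
            Fop f u \<phi> x =
              \<sigma> / u x * (1 - (\<Sum>i\<in>UNIV. pd i f (kappa u x)))
              + nu_last u x / u x * (\<sigma>\<^sup>2 - (\<Sum>i\<in>UNIV. pd i f (kappa u x) * (kappa u x $ i)\<^sup>2))
          \<and> Fop f u \<phi> x \<le> 0)
       \<and> (\<forall>x\<in>\<Omega>. \<phi> x \<ge> Inf (\<phi> ` frontier \<Omega>))
       \<and> ((0 < \<epsilon> \<and> \<epsilon> \<le> \<epsilon>0 \<and> (\<forall>x\<in>frontier \<Omega>. u x = \<epsilon>)) \<longrightarrow>
           (\<forall>x\<in>frontier \<Omega>.
              r1 * sqrt (\<sigma>\<^sup>2 - 1) / (r1\<^sup>2 - \<epsilon>\<^sup>2) + \<epsilon> * (\<sigma> - 1) / (r1\<^sup>2 - \<epsilon>\<^sup>2) > \<phi> x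
            \<and> \<phi> x > (if bdd_above (ext_sphere_radii \<Omega>)
                      then - (r2 * sqrt (\<sigma>\<^sup>2 - 1) / (r2\<^sup>2 - \<epsilon>\<^sup>2)) - \<epsilon> * (1 + \<sigma>) / (r2\<^sup>2 - \<epsilon>\<^sup>2)
                      else 0))))"
proof -
  define r1 where "r1 = Sup (int_sphere_radii \<Omega>)"
  define r2 where "r2 = Sup (ext_sphere_radii \<Omega>)"
  have int: "r1 \<in> touching_radii \<Omega> (frontier \<Omega>)"
    using Sup_int_sphere_radii[OF assms] by (simp add: r1_def int_sphere_radii_eq)
  then have r1: "r1 > 0" by (simp add: touching_radii_def)
  have ext: "r2 \<in> touching_radii (- \<Omega>) (frontier \<Omega>)" if "bdd_above (ext_sphere_radii \<Omega>)"
    using Sup_touching_radii sphere_conditions(2)[OF assms] that unfolding r2_def ext_sphere_radii_eq by blast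
  then have r2: "r2 > 0" if "bdd_above (ext_sphere_radii \<Omega>)" using that by (simp add: touching_radii_def)
  \<comment> \<open>Half of each maximal radius keeps \<epsilon> below r1 and r2, so that the
    barriers exist and the denominators are positive; 1 is a neutral value for r2 = \<infinity>.
    Only \<Omega> enters.\<close>
  define \<epsilon>0 where "\<epsilon>0 = min (r1 / 2) (if bdd_above (ext_sphere_radii \<Omega>) then r2 / 2 else 1)"
  have conn: "connected \<Omega>" and bd: "bounded \<Omega>" using assms by (auto simp: smooth_domain_def)
  have main: "(\<forall>x\<in>\<Omega>.
            Fop f u (\<lambda>x. (\<sigma> - nu_last u x) / u x) x =
              \<sigma> / u x * (1 - (\<Sum>i\<in>UNIV. pd i f (kappa u x)))
              + nu_last u x / u x * (\<sigma>\<^sup>2 - (\<Sum>i\<in>UNIV. pd i f (kappa u x) * (kappa u x $ i)\<^sup>2))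
          \<and> Fop f u (\<lambda>x. (\<sigma> - nu_last u x) / u x) x \<le> 0)
       \<and> (\<forall>x\<in>\<Omega>. (\<sigma> - nu_last u x) / u x \<ge> Inf ((\<lambda>x. (\<sigma> - nu_last u x) / u x) ` frontier \<Omega>))
       \<and> ((0 < \<epsilon> \<and> \<epsilon> \<le> \<epsilon>0 \<and> (\<forall>x\<in>frontier \<Omega>. u x = \<epsilon>)) \<longrightarrow>
           (\<forall>x\<in>frontier \<Omega>.
              r1 * sqrt (\<sigma>\<^sup>2 - 1) / (r1\<^sup>2 - \<epsilon>\<^sup>2) + \<epsilon> * (\<sigma> - 1) / (r1\<^sup>2 - \<epsilon>\<^sup>2) > (\<sigma> - nu_last u x) / u x
            \<and> (\<sigma> - nu_last u x) / u x > (if bdd_above (ext_sphere_radii \<Omega>)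
                      then - (r2 * sqrt (\<sigma>\<^sup>2 - 1) / (r2\<^sup>2 - \<epsilon>\<^sup>2)) - \<epsilon> * (1 + \<sigma>) / (r2\<^sup>2 - \<epsilon>\<^sup>2)
                      else 0)))"
    if H: "\<sigma> > 1" "f_conditions f" "admissible_graph \<Omega> \<sigma> f u" for \<sigma> f u \<epsilon>
  proof -
    obtain U where cg: "convex_graph u U \<Omega> f \<sigma>" using admissible_graph_locale[OF assms H] .
    interpret convex_graph u U \<Omega> f \<sigma> by (rule cg)
    have phi_eq: "(\<lambda>x. (\<sigma> - nu_last u x) / u x) = phi \<sigma>" by (simp add: phi_def)
    have phi_x: "(\<sigma> - nu_last u x) / u x = phi \<sigma> x" for x by (simp add: phi_def)
    show ?thesis unfolding phi_x
    proof (intro conjI ballI impI)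
      fix x assume x: "x \<in> \<Omega>"
      show "Fop f u (phi \<sigma>) x = \<sigma> / u x * (1 - (\<Sum>i\<in>UNIV. pd i f (kappa u x)))
              + nu_last u x / u x * (\<sigma>\<^sup>2 - (\<Sum>i\<in>UNIV. pd i f (kappa u x) * (kappa u x $ i)\<^sup>2))"
        by (rule Fop_phi[OF x])
      show "Fop f u (phi \<sigma>) x \<le> 0" by (rule Fop_phi_nonpos[OF x])
      obtain z where z: "z \<in> frontier \<Omega>" "phi \<sigma> z \<le> phi \<sigma> x"
        using minimum_principle[OF elliptic phi_C2_\<Omega> conn bd lin_op_phi_nonpos continuous_phi x] by blast
      \<comment> \<open>\<open>Inf\<close> is a genuine lower bound only for a set bounded below,
        which compactness of the frontier provides.\<close>
      have "compact (frontier \<Omega>)" using bd by (simp add: compact_frontier_bounded)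
      moreover have "continuous_on (frontier \<Omega>) (phi \<sigma>)"
        by (rule continuous_on_subset[OF continuous_phi]) (simp add: frontier_def)
      ultimately have "bdd_below (phi \<sigma> ` frontier \<Omega>)"
        by (intro bounded_imp_bdd_below compact_imp_bounded compact_continuous_image)
      then have "Inf (phi \<sigma> ` frontier \<Omega>) \<le> phi \<sigma> z" using z(1) by (intro cInf_lower) auto
      then show "Inf (phi \<sigma> ` frontier \<Omega>) \<le> phi \<sigma> x" using z(2) by simp
    next
      fix x assume E: "0 < \<epsilon> \<and> \<epsilon> \<le> \<epsilon>0 \<and> (\<forall>x\<in>frontier \<Omega>. u x = \<epsilon>)" and x: "x \<in> frontier \<Omega>"
      interpret level_graph u U \<Omega> f \<sigma> \<epsilon> by unfold_locales (use E conn in auto)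
      have e1: "\<epsilon> < r1" using E r1 by (auto simp: \<epsilon>0_def)
      obtain c where c: "ball c r1 \<subseteq> \<Omega>" "dist c x = r1" using int x unfolding touching_radii_def by blast
      obtain \<mu> where \<mu>: "\<mu> > 0" "Du u x = \<mu> *\<^sub>R (c - x)"
        and upper: "phi \<sigma> x < r1 * sqrt (\<sigma>\<^sup>2 - 1) / (r1\<^sup>2 - \<epsilon>\<^sup>2) + \<epsilon> * (\<sigma> - 1) / (r1\<^sup>2 - \<epsilon>\<^sup>2)"
        by (rule interior_sphere_at[OF x c e1])
      show "phi \<sigma> x < r1 * sqrt (\<sigma>\<^sup>2 - 1) / (r1\<^sup>2 - \<epsilon>\<^sup>2) + \<epsilon> * (\<sigma> - 1) / (r1\<^sup>2 - \<epsilon>\<^sup>2)" by (rule upper)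
      show "(if bdd_above (ext_sphere_radii \<Omega>)
                      then - (r2 * sqrt (\<sigma>\<^sup>2 - 1) / (r2\<^sup>2 - \<epsilon>\<^sup>2)) - \<epsilon> * (1 + \<sigma>) / (r2\<^sup>2 - \<epsilon>\<^sup>2)
                      else 0) < phi \<sigma> x"
      proof (cases "bdd_above (ext_sphere_radii \<Omega>)")
        case True
        have e2: "\<epsilon> < r2" using E r2[OF True] True by (auto simp: \<epsilon>0_def)
        obtain c' where c': "ball c' r2 \<subseteq> - \<Omega>" "dist c' x = r2" using ext[OF True] x unfolding touching_radii_def by blast
        have "- ((sqrt ((\<sigma>\<^sup>2 - 1) * r2\<^sup>2 + \<epsilon>\<^sup>2) + \<sigma> * \<epsilon>) / (r2\<^sup>2 - \<epsilon>\<^sup>2)) \<le> phi \<sigma> x"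
          by (rule exterior_sphere[OF x c r1 \<mu> c' e2])
        moreover have "(sqrt ((\<sigma>\<^sup>2 - 1) * r2\<^sup>2 + \<epsilon>\<^sup>2) + \<sigma> * \<epsilon>) / (r2\<^sup>2 - \<epsilon>\<^sup>2)
            < r2 * sqrt (\<sigma>\<^sup>2 - 1) / (r2\<^sup>2 - \<epsilon>\<^sup>2) + \<epsilon> * (1 + \<sigma>) / (r2\<^sup>2 - \<epsilon>\<^sup>2)"
          by (rule barrier_roots(7)[OF sigma eps e2])
        ultimately show ?thesis using True by simp
      next
        case False
        \<comment> \<open>Touching balls can be shrunk, so unbounded exterior radii mean that every
          positive radius occurs.\<close>
        have "\<rho> \<in> touching_radii (- \<Omega>) (frontier \<Omega>)" if "\<rho> > 0" for \<rho>
        proof -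
          obtain r where "r \<in> ext_sphere_radii \<Omega>" "\<not> r \<le> \<rho>" using False unfolding bdd_above_def by blast
          then show ?thesis using touching_radii_downward[of r _ _ \<rho>] that unfolding ext_sphere_radii_eq by (simp add: less_imp_le)
        qed
        then have "phi \<sigma> x > 0" by (rule phi_pos_convex[OF x e1 int])
        then show ?thesis using False by simp
      qed
    qed
  qed
  have "\<epsilon>0 > 0" using r1 r2 by (simp add: \<epsilon>0_def)
  then show ?thesis unfolding Let_def r1_def[symmetric] r2_def[symmetric] using main by blast
qed

end
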